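(* Let $T>0$ and let $L$ be a linear operator on $\mathbb{R}^m$. Consider the system $\frac{du}{dt}=Lu+V(u,t)$, $t\in\mathbb{R}$, $u(t)\in\mathbb{R}^m$, where $V$ is $T$-periodic in $t$ and satisfies $V(0,\cdot)=0$, $D_uV(0,\cdot)=0$. Assume the following. 1. There exist a neighborhood $\Omega$ of the origin in $\mathbb{R}^m$ and an integer $\ell\ge1$ such that $V\in\mathcal{A}(\Omega,H^\ell(\mathbb{R}/T\mathbb{Z},\mathbb{R}^m))$, with associated constants $c,\rho>0$. 2. $L$ is diagonalizable. 3. There exist two positive constants $\gamma$ and $\tau$ such that, denoting by $\lambda_1,\dots,\lambda_m\in\mathbb{C}$ the eigenvalues of $L$, for all $a\in\mathbb{N}^m$, all $k\in\mathbb{Z}$ and all $j$ with $1\le j\le m$, $$\Big|\langle a,\lambda\rangle+ik\tfrac{2\pi}{T}-\lambda_j\Big|\ge\frac{\gamma}{(|a|+|k|)^\tau}.$$ 4. $\tau\le\ell$. Then for all $\delta>0$ there exist an integer $p_\delta$ with $p_\delta=O(\delta^{-b})$ as $\delta\to0$, and a function $\Phi_\delta\in\mathcal{P}_{p_\delta}(\mathbb{R}^m,H^{\ell+1}(\mathbb{R}/T\mathbb{Z},\mathbb{R}^m))$ with $\Phi_\delta(0,\cdot)=0$, $D_u\Phi_\delta(0,\cdot)=0$, such that the change of variables $u=y+\Phi_\delta(y,t)$ transforms the system into the normal form $$\frac{dy}{dt}=Ly+\mathcal{N}(y,t)+R(y,t),$$ where $\mathcal{N}\in\mathcal{P}_{p_\delta}(\mathbb{R}^m,H^\ell(\mathbb{R}/T\mathbb{Z},\mathbb{R}^m))$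 satisfies $\mathcal{N}(0,\cdot)=0$, $D_u\mathcal{N}(0,\cdot)=0$ (derivative with respect to the first variable) and the normal form criterion $$e^{-tL^*}\mathcal{N}(e^{tL^*}y,t)=\mathcal{N}(y,0)\quad\text{for all }y\in\mathbb{R}^m\text{ and all }t\in\mathbb{R},$$ and where the remainder $R$ is analytic and satisfies $$\sup_{|y|\le\delta}|R(y,\cdot)|_{H^\ell}\le M'\delta^2e^{-\omega/\delta^b},$$ with $M'$ and $\omega$ depending only on $T,m,c,\rho,L,\ell$ and $\tau$, and $$b=\frac{1}{\ell+\tau+1}.$$
   Context: $H^\ell(\mathbb{R}/T\mathbb{Z},\mathbb{R}^m)$ is the Sobolev space of functions $f$ from $\mathbb{R}/T\mathbb{Z}$ to $\mathbb{R}^m$ whose Fourier coefficients $f^{(k)}$ (with respect to $e^{ik\frac{2\pi}{T}t}$) satisfy $|f|_{H^\ell}^2:=\sum_{k\in\mathbb{Z}}(1+k^2)^\ell|f^{(k)}|^2<\infty$. For a neighborhood $\Omega$ of the origin in $\mathbb{R}^m$, $\mathcal{A}(\Omega,H^\ell(\mathbb{R}/T\mathbb{Z},\mathbb{R}^m))$ is the space of maps $V$ for which there exist a family of $q$-linear symmetric maps $V_q(t)$ on $(\mathbb{R}^m)^q$, $q\ge0$, a radius of convergence $\rho$ and a positive constant $c$ such that $V(u,t)=\sum_{q\ge0}V_q(t)[u,\dots,u]$ and $|V_q(\cdot)[u_1,\dots,u_q]|_{H^\ell}\le\frac{c}{\rho^q}|u_1|\cdots|u_q|$ for all $u_1,\dots,u_q\in\mathbb{R}^m$.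 These are the constants $c,\rho$ associated with $V$. $\mathcal{P}_p(\mathbb{R}^m,H^{\ell}(\mathbb{R}/T\mathbb{Z},\mathbb{R}^m))$ is the space of polynomials $P(x_1,\dots,x_m,t)=\sum_{|\alpha|\le p}P_\alpha(t)x_1^{\alpha_1}\cdots x_m^{\alpha_m}$ with $\alpha\in\mathbb{N}^m$ and coefficients $P_\alpha\in H^\ell(\mathbb{R}/T\mathbb{Z},\mathbb{R}^m)$ (similarly with $\ell+1$ in place of $\ell$). For a multi-index $a\in\mathbb{N}^m$, $|a|=\sum_ia_i$ and $\langle a,\lambda\rangle=\sum_ia_i\lambda_i$. $L^*$ is the adjoint of $L$.
   Formalization: Assumption 3 is required only for multi-indices a with |a| ≥ 2; as printed, for all a, it is contradictory (a = e_j, k = 0 gives 0 ≥ γ), and a = 0, k = 0 has an undefined bound. *)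

theory Defs
  imports "HOL-Analysis.Analysis" "HOL-Library.Landau_Symbols"
begin

definition fourier_coeff :: "real \<Rightarrow> (real \<Rightarrow> real ^ 'm) \<Rightarrow> int \<Rightarrow> complex ^ 'm" where
  "fourier_coeff T f k =
     (\<chi> j. complex_of_real (1 / T) *
        integral {0..T} (\<lambda>t. complex_of_real (f t $ j) * cis (- (of_int k * (2 * pi / T) * t))))"

(* Elements are continuous functions instead of classes modulo null sets: for l >= 1, the only
   case in which the space is used, each class of H^l has exactly one continuous representative,
   and point values of its elements refer to that representative. *)
definition sobolev :: "real \<Rightarrow> nat \<Rightarrow> (real \<Rightarrow> real ^ 'm) set" where
  "sobolev T l = {f. continuous_on UNIV f \<and> (\<forall>t. f (t + T) = f t) \<and>
     (\<lambda>k::int. (1 + (of_int k)\<^sup>2) ^ l * (norm (fourier_coeff T f k))\<^sup>2) summable_on UNIV}"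

definition sobolev_norm :: "real \<Rightarrow> nat \<Rightarrow> (real \<Rightarrow> real ^ 'm) \<Rightarrow> real" where
  "sobolev_norm T l f =
     sqrt (\<Sum>\<^sub>\<infinity>k\<in>(UNIV :: int set). (1 + (of_int k)\<^sup>2) ^ l * (norm (fourier_coeff T f k))\<^sup>2)"

(* A q-linear map on (R^m)^q takes its arguments as a list of length q; its values on lists of
   other lengths are irrelevant. *)
definition sym_multilinear :: "nat \<Rightarrow> ((real ^ 'm) list \<Rightarrow> real ^ 'm) \<Rightarrow> bool" where
  "sym_multilinear q F \<longleftrightarrow>
     (\<forall>us i. length us = q \<and> i < q \<longrightarrow> linear (\<lambda>x. F (us[i := x]))) \<and>
     (\<forall>us vs. length us = q \<and> mset us = mset vs \<longrightarrow> F us = F vs)"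

(* V belongs to A(Omega, H^l(R/TZ, R^m)) with associated constants c and rho. *)
definition analytic_class ::
  "(real ^ 'm) set \<Rightarrow> real \<Rightarrow> nat \<Rightarrow> real \<Rightarrow> real \<Rightarrow> (real ^ 'm \<Rightarrow> real \<Rightarrow> real ^ 'm) \<Rightarrow> bool" where
  "analytic_class \<Omega> T l c \<rho> V \<longleftrightarrow> 0 < c \<and> 0 < \<rho> \<and>
     (\<exists>W :: nat \<Rightarrow> real \<Rightarrow> (real ^ 'm) list \<Rightarrow> real ^ 'm.
        (\<forall>q t. sym_multilinear q (W q t)) \<and>
        (\<forall>u\<in>\<Omega>. \<forall>t. (\<lambda>q. W q t (replicate q u)) sums V u t) \<and>
        (\<forall>q us. length us = q \<longrightarrow>
           (\<lambda>t. W q t us) \<in> sobolev T l \<and>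
           sobolev_norm T l (\<lambda>t. W q t us) \<le> c / \<rho> ^ q * prod_list (map norm us)))"

(* Analyticity of y |-> R(y, .) as a map into H^l on a neighbourhood of S: around each point of S,
   R has a power series expansion in the above sense, with its own domain and constants. *)
definition sobolev_analytic_on ::
  "real \<Rightarrow> nat \<Rightarrow> (real ^ 'm \<Rightarrow> real \<Rightarrow> real ^ 'm) \<Rightarrow> (real ^ 'm) set \<Rightarrow> bool" where
  "sobolev_analytic_on T l R S \<longleftrightarrow>
     (\<forall>y\<in>S. \<exists>U c \<rho>. 0 \<in> interior U \<and> analytic_class U T l c \<rho> (\<lambda>h. R (y + h)))"

definition sobolev_polys :: "nat \<Rightarrow> real \<Rightarrow> nat \<Rightarrow> (real ^ 'm \<Rightarrow> real \<Rightarrow> real ^ 'm) set" where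
  "sobolev_polys p T l = {P. \<exists>C :: ('m \<Rightarrow> nat) \<Rightarrow> real \<Rightarrow> real ^ 'm.
     (\<forall>\<alpha>. C \<alpha> \<in> sobolev T l) \<and>
     (\<forall>x t. P x t = (\<Sum>\<alpha> | (\<Sum>i\<in>UNIV. \<alpha> i) \<le> p. (\<Prod>i\<in>UNIV. (x $ i) ^ \<alpha> i) *\<^sub>R C \<alpha> t))}"

definition vanishes_to_second_order :: "(real ^ 'm \<Rightarrow> real \<Rightarrow> real ^ 'm) \<Rightarrow> bool" where
  "vanishes_to_second_order F \<longleftrightarrow>
     (\<forall>t. F 0 t = 0 \<and> ((\<lambda>u. F u t) has_derivative (\<lambda>_. 0)) (at 0))"

definition complex_matrix :: "(real ^ 'm \<Rightarrow> real ^ 'm) \<Rightarrow> complex ^ 'm ^ 'm" where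
  "complex_matrix L = (\<chi> i j. complex_of_real (matrix L $ i $ j))"

(* Diagonalizable over the complex numbers: the eigenvalues of L are allowed to be non-real. *)
definition diagonalizable :: "(real ^ 'm \<Rightarrow> real ^ 'm) \<Rightarrow> bool" where
  "diagonalizable L \<longleftrightarrow> (\<exists>(P :: complex ^ 'm ^ 'm) (d :: 'm \<Rightarrow> complex).
     invertible P \<and> complex_matrix L = P ** (\<chi> i j. if i = j then d i else 0) ** matrix_inv P)"

(* The eigenvalues of L with multiplicity, read off the characteristic polynomial. *)
definition eigenvalues_of :: "(real ^ 'm \<Rightarrow> real ^ 'm) \<Rightarrow> ('m \<Rightarrow> complex) \<Rightarrow> bool" where
  "eigenvalues_of L ev \<longleftrightarrow> (\<forall>z. det (mat z - complex_matrix L) = (\<Prod>j\<in>UNIV. z - ev j))"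

definition op_exp :: "(real ^ 'm \<Rightarrow> real ^ 'm) \<Rightarrow> real ^ 'm \<Rightarrow> real ^ 'm" where
  "op_exp A y = (\<Sum>n. (1 / fact n) *\<^sub>R (A ^^ n) y)"

definition solves_on :: "(real ^ 'm \<Rightarrow> real \<Rightarrow> real ^ 'm) \<Rightarrow> real set \<Rightarrow> (real \<Rightarrow> real ^ 'm) \<Rightarrow> bool" where
  "solves_on F J u \<longleftrightarrow> (\<forall>t\<in>J. (u has_vector_derivative F (u t) t) (at t within J))"

(* The substitution u = y + Phi(y,t) transforms u' = F(u,t), posed on Omega, into y' = G(y,t) as
   long as y stays in S. *)
definition transforms_into ::
  "(real ^ 'm \<Rightarrow> real \<Rightarrow> real ^ 'm) \<Rightarrow> (real ^ 'm) set \<Rightarrow> (real ^ 'm \<Rightarrow> real \<Rightarrow> real ^ 'm) \<Rightarrow>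
   (real ^ 'm \<Rightarrow> real \<Rightarrow> real ^ 'm) \<Rightarrow> (real ^ 'm) set \<Rightarrow> bool" where
  "transforms_into F \<Omega> \<Phi> G S \<longleftrightarrow>
     (\<forall>J y. is_interval J \<and> y differentiable_on J \<and>
        (\<forall>t\<in>J. y t \<in> S \<and> y t + \<Phi> (y t) t \<in> \<Omega>) \<longrightarrow>
        (solves_on F J (\<lambda>t. y t + \<Phi> (y t) t) \<longleftrightarrow> solves_on G J y))"

end

theory Submission
  imports Defs
begin

text \<open>The Diophantine inequality holds for every frequency \<open>k\<close>, every index \<open>j\<close> and every multi-index
of degree at least two, so no monomial is resonant: all of them can be removed up to degree \<open>p\<close>, and
the theorem holds with \<open>\<N> = 0\<close>, for which the normal form criterion is trivial. What has to be shown is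
that removing the monomials of degree \<open>2, \<dots>, p\<close> leaves an exponentially small remainder when \<open>p\<close> is
chosen in terms of \<open>\<delta>\<close>.

The change of variables \<open>y \<mapsto> y + \<Phi>(y,t)\<close> with \<open>\<Phi> = F\<^sub>2 + \<dots> + F\<^sub>p\<close> transforms the equation
into \<open>y' = L y + R\<close>, where \<open>(1 + D\<^sub>y\<Phi>) R = V(y + \<Phi>, t) + L \<Phi> - D\<^sub>y\<Phi> L y - \<partial>\<^sub>t\<Phi>\<close>. The terms of degree
\<open>n \<le> p\<close> on the right vanish if \<open>D F\<^sub>n (L y, 1) - L F\<^sub>n\<close>, with \<open>D\<close> the derivative in
\<open>(y,t)\<close>, is the homogeneous part of degree \<open>n\<close> of \<open>V(y + \<Phi>, t)\<close>, which depends only on \<open>F\<^sub>2, \<dots>, F\<^sub>n\<^sub>-\<^sub>1\<close>. As \<open>L\<close> is diagonalizable, this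
homological equation splits into scalar equations \<open>a' + \<mu> a = v\<close> for \<open>T\<close>-periodic functions, one for each
monomial in the eigenforms of \<open>L\<close> (\<open>pol_homological\<close>). The Diophantine inequality gives
\<open>\<bar>\<mu> + 2 \<pi> i k / T\<bar> \<ge> \<kappa> (n + 1)\<^sup>-\<^sup>\<tau>\<^sup>-\<^sup>1 (1 + \<bar>k\<bar>)\<close> (\<open>small_divisor_bound\<close>): at the price of one more
power of \<open>n\<close>, the solution operator gains a derivative, from \<open>H\<^sup>l\<close> to \<open>H\<^sup>l\<^sup>+\<^sup>1\<close>
(\<open>periodic_solution\<close>). This gain closes the estimates: functions in \<open>H\<^sup>l\<^sup>+\<^sup>1\<close> act on \<open>H\<^sup>l\<close> by
multiplication (\<open>sob_le_mult_le\<close>), and the operator norm of a multiplier is submultiplicative, so that the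
products of arbitrarily many components of \<open>\<Phi>\<close> that occur in \<open>V(y + \<Phi>, t)\<close> cost no constants.

The bounds \<open>\<phi>\<^sub>n\<close> of the \<open>F\<^sub>n\<close> satisfy a scalar majorant recursion in which every step with \<open>n \<le> p\<close>
costs at most a factor of order \<open>(p + 1)\<^sup>\<tau>\<^sup>+\<^sup>1\<close>. Hence \<open>\<Sum>\<^sub>n\<^sub>\<le>\<^sub>p \<phi>\<^sub>n s\<^sup>n\<close> stays bounded by a multiple of \<open>s\<close> for some \<open>s\<close> of
order \<open>(p + 1)\<^sup>-\<^sup>\<tau>\<^sup>-\<^sup>1\<close> (\<open>majorant_bound\<close>). On the ball of radius \<open>\<delta>\<close> the terms of degree above \<open>p\<close> are then
smaller than they are at scale \<open>s\<close> by a factor \<open>q\<^sup>p\<^sup>+\<^sup>1\<close>, where \<open>q\<close> is a constant multiple of \<open>\<delta> / s\<close>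
(\<open>normal_form_near_zero\<close>). For \<open>p\<close> of order \<open>\<delta>\<^sup>-\<^sup>b\<close> with \<open>b (\<tau> + 1) \<le> 1\<close> the quotient \<open>q\<close> can be kept
below \<open>1/e\<close>, and \<open>q\<^sup>p\<close> is exponentially small in \<open>\<delta>\<^sup>-\<^sup>b\<close> (\<open>exponentially_small_remainder\<close>).

For \<open>\<delta>\<close> above a fixed \<open>\<delta>\<^sub>0\<close> the exponential is bounded below, and a remainder of order \<open>\<delta>\<close> is enough.
The difficulty there is that the ball of radius \<open>\<delta>\<close> need not be contained in the domain of convergence of \<open>V\<close>;
a polynomial diffeomorphism that is tangent to the identity at the origin and maps the ball into a small
cube resolves it (\<open>normal_form_by_squashing\<close>).

Analyticity with values in \<open>H\<^sup>l\<close> is carried through all constructions by the relation \<open>series_le\<close>, a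
power series with absolutely summable coefficient bounds. It is closed under sums, products, substitution
and Neumann series, and \<open>analytic_class_of_series\<close> turns such a series into symmetric multilinear forms.\<close>

section \<open>Fourier series of continuous periodic functions\<close>

locale periodic =
  fixes T :: real
  assumes T_pos: "T > 0"
begin

definition mode :: "int \<Rightarrow> real \<Rightarrow> complex" where
  "mode k t = cis (of_int k * (2 * pi / T) * t)"

definition fcoeff :: "(real \<Rightarrow> complex) \<Rightarrow> int \<Rightarrow> complex" where
  "fcoeff f k = complex_of_real (1 / T) *
     integral {0..T} (\<lambda>t. f t * cis (- (of_int k * (2 * pi / T) * t)))"

definition percont :: "(real \<Rightarrow> complex) \<Rightarrow> bool" where
  "percont f \<longleftrightarrow> continuous_on UNIV f \<and> (\<forall>t. f (t + T) = f t)"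

lemma mode_add: "mode (j + k) t = mode j t * mode k t"
  by (simp add: mode_def cis_mult distrib_right add_divide_distrib)

lemma mode_0 [simp]: "mode 0 t = 1"
  by (simp add: mode_def)

lemma mode_neg: "mode (- k) t = cnj (mode k t)"
  by (simp add: mode_def cis_cnj)

lemma norm_mode [simp]: "cmod (mode k t) = 1"
  by (simp add: mode_def)

lemma continuous_mode: "continuous_on A (mode k)"
  unfolding mode_def by (intro continuous_intros)

lemma mode_period: "mode k (t + T) = mode k t"
proof -
  have "of_int k * (2 * pi / T) * (t + T) = of_int k * (2 * pi / T) * t + 2 * pi * of_int k"
    using T_pos by (simp add: field_simps)
  then show ?thesis
    unfolding mode_def by (metis cis_mult cis_multiple_2pi Ints_of_int mult.right_neutral)
qed

lemma percont_mode: "percont (mode k)"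
  by (simp add: percont_def continuous_mode mode_period)

lemma fcoeff_alt: "fcoeff f k = complex_of_real (1 / T) * integral {0..T} (\<lambda>t. f t * mode (- k) t)"
  by (simp add: fcoeff_def mode_def)

lemma percont_const: "percont (\<lambda>_. c)"
  by (simp add: percont_def)

lemma percont_add: "percont f \<Longrightarrow> percont g \<Longrightarrow> percont (\<lambda>t. f t + g t)"
  by (auto simp: percont_def intro!: continuous_intros)

lemma percont_mult: "percont f \<Longrightarrow> percont g \<Longrightarrow> percont (\<lambda>t. f t * g t)"
  by (auto simp: percont_def intro!: continuous_intros)

lemma percont_cnj: "percont f \<Longrightarrow> percont (\<lambda>t. cnj (f t))"
  by (auto simp: percont_def intro!: continuous_intros)

lemma percont_diff: "percont f \<Longrightarrow> percont g \<Longrightarrow> percont (\<lambda>t. f t - g t)"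
  by (auto simp: percont_def intro!: continuous_intros)

lemma percont_sum: "(\<And>i. i \<in> I \<Longrightarrow> percont (f i)) \<Longrightarrow> percont (\<lambda>t. \<Sum>i\<in>I. f i t)"
  by (auto simp: percont_def intro!: continuous_intros sum.cong)

lemma percont_integrable:
  assumes "percont f" shows "f integrable_on {a..b}"
  using assms integrable_continuous_interval continuous_on_subset unfolding percont_def by blast

lemma percont_integrable_mode:
  assumes "percont f" shows "(\<lambda>t. f t * mode k t) integrable_on {a..b}"
  using percont_integrable[OF percont_mult[OF assms percont_mode]] .

lemma fcoeff_add:
  assumes "percont f" "percont g"
  shows "fcoeff (\<lambda>t. f t + g t) k = fcoeff f k + fcoeff g k"
  using assms by (simp add: fcoeff_alt distrib_right integral_add percont_integrable_mode distrib_left)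

lemma fcoeff_cmult: "fcoeff (\<lambda>t. c * f t) k = c * fcoeff f k"
  by (simp add: fcoeff_alt mult.assoc mult.left_commute)

lemma fcoeff_diff:
  assumes "percont f" "percont g"
  shows "fcoeff (\<lambda>t. f t - g t) k = fcoeff f k - fcoeff g k"
  using assms by (simp add: fcoeff_alt left_diff_distrib integral_diff percont_integrable_mode right_diff_distrib)

lemma fcoeff_sum:
  assumes "finite I" "\<And>i. i \<in> I \<Longrightarrow> percont (f i)"
  shows "fcoeff (\<lambda>t. \<Sum>i\<in>I. f i t) k = (\<Sum>i\<in>I. fcoeff (f i) k)"
  using assms
proof (induction I rule: finite_induct)
  case empty then show ?case by (simp add: fcoeff_alt)
next
  case (insert x F) then show ?case by (simp add: fcoeff_add percont_sum)
qed

lemma fcoeff_cnj: "fcoeff (\<lambda>t. cnj (f t)) k = cnj (fcoeff f (- k))"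
  by (simp add: fcoeff_alt mode_neg flip: integral_cnj complex_cnj_mult)

lemma fcoeff_shift: "fcoeff (\<lambda>t. mode j t * f t) k = fcoeff f (k - j)"
proof -
  have "mode (- (k - j)) t = mode j t * mode (- k) t" for t
    using mode_add[of j "-k" t] by simp
  then show ?thesis by (simp add: fcoeff_alt mult_ac)
qed

lemma has_vector_derivative_exp_linear:
  fixes c :: complex
  shows "((\<lambda>t. exp (c * of_real t)) has_vector_derivative c * exp (c * of_real t)) (at t within A)"
proof -
  have "((\<lambda>z. exp (c * z)) has_field_derivative c * exp (c * of_real t)) (at (of_real t))"
    by (auto intro!: derivative_eq_intros)
  then show ?thesis by (rule has_vector_derivative_real_field)
qed

lemma mode_exp: "mode k t = exp (\<i> * of_int k * (2 * pi / T) * of_real t)"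
  by (simp add: mode_def cis_conv_exp mult_ac)

lemma integral_mode: "integral {0..T} (mode k) = (if k = 0 then of_real T else 0)"
proof (cases "k = 0")
  case True
  then have "mode k = (\<lambda>_. 1)" by auto
  then show ?thesis using T_pos True by (simp add: scaleR_conv_of_real)
next
  case False
  define w where "w = of_int k * (2 * pi / T)"
  have w: "w \<noteq> 0" using False T_pos by (simp add: w_def)
  have "(mode k has_integral (mode k T / (\<i> * w) - mode k 0 / (\<i> * w))) {0..T}"
  proof (rule fundamental_theorem_of_calculus)
    fix t
    have "((\<lambda>t. exp ((\<i> * w) * of_real t)) has_vector_derivative (\<i> * w) * exp ((\<i> * w) * of_real t)) (at t within {0..T})"
      by (rule has_vector_derivative_exp_linear)
    moreover have "exp ((\<i> * w) * of_real t) = mode k t" for t by (simp add: mode_exp w_def mult.assoc)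
    ultimately have "(mode k has_vector_derivative (\<i> * w) * mode k t) (at t within {0..T})" by simp
    then have "((\<lambda>t. mode k t / (\<i> * w)) has_vector_derivative (\<i> * w) * mode k t / (\<i> * w)) (at t within {0..T})"
      by (rule has_vector_derivative_divide)
    then show "((\<lambda>t. mode k t / (\<i> * w)) has_vector_derivative mode k t) (at t within {0..T})"
      using w by simp
  qed (use T_pos in simp)
  moreover have "mode k T = mode k 0" using mode_period[of k 0] by simp
  ultimately show ?thesis using False by (simp add: integral_unique)
qed

lemma fcoeff_mode: "fcoeff (mode j) k = (if k = j then 1 else 0)"
proof -
  have "(\<lambda>t. mode j t * mode (- k) t) = mode (j - k)"
    by (rule ext) (simp flip: mode_add)
  then show ?thesis using T_pos by (simp add: fcoeff_alt integral_mode)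
qed

lemma fcoeff_const: "fcoeff (\<lambda>_. c) k = (if k = 0 then c else 0)"
proof -
  have "mode 0 = (\<lambda>_. 1)" by auto
  then show ?thesis using fcoeff_cmult[of c "mode 0" k] fcoeff_mode[of 0 k] by simp
qed

lemma percont_uniform_limit:
  assumes "uniform_limit UNIV f g F" "F \<noteq> bot" "\<And>n. percont (f n)"
  shows "percont g"
  unfolding percont_def
proof (intro conjI allI)
  show "continuous_on UNIV g"
    using assms by (intro uniform_limit_theorem[OF _ assms(1)]) (auto simp: percont_def)
next
  fix t
  have 1: "((\<lambda>n. f n t) \<longlongrightarrow> g t) F" by (rule tendsto_uniform_limitI[OF assms(1)]) simp
  have "((\<lambda>n. f n (t + T)) \<longlongrightarrow> g (t + T)) F" by (rule tendsto_uniform_limitI[OF assms(1)]) simp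
  moreover have "f n (t + T) = f n t" for n using assms(3) by (auto simp: percont_def)
  ultimately show "g (t + T) = g t"
    using 1 tendsto_unique[OF assms(2)] by simp
qed

lemma fcoeff_uniform_limit:
  assumes "uniform_limit UNIV f g F" "F \<noteq> bot" "\<And>n. percont (f n)"
  shows "((\<lambda>n. fcoeff (f n) k) \<longlongrightarrow> fcoeff g k) F"
proof -
  have u: "uniform_limit {0..T} (\<lambda>n t. f n t * mode (- k) t) (\<lambda>t. g t * mode (- k) t) F"
  proof -
    have "uniform_limit {0..T} f g F" using assms(1) by (rule uniform_limit_on_subset) simp
    moreover have "bounded (g ` {0..T})"
      using percont_uniform_limit[OF assms] unfolding percont_def
      by (intro compact_imp_bounded compact_continuous_image) (auto intro: continuous_on_subset)
    ultimately show ?thesis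
      by (intro uniform_lim_mult uniform_limit_const) (auto intro!: boundedI[where B=1])
  qed
  have "continuous_on {0..T} (\<lambda>t. f n t * mode (- k) t)" for n
    using percont_mult[OF assms(3) percont_mode] continuous_on_subset unfolding percont_def by blast
  then obtain I J where I: "\<And>n. ((\<lambda>t. f n t * mode (- k) t) has_integral I n) {0..T}"
    and J: "((\<lambda>t. g t * mode (- k) t) has_integral J) {0..T}" and lim: "(I \<longlongrightarrow> J) F"
    using uniform_limit_integral[OF u _ assms(2)] by auto
  have "integral {0..T} (\<lambda>t. f n t * mode (- k) t) = I n" for n using I by (rule integral_unique)
  moreover have "integral {0..T} (\<lambda>t. g t * mode (- k) t) = J" using J by (rule integral_unique)
  ultimately show ?thesis
    unfolding fcoeff_alt using lim by (auto intro!: tendsto_intros simp: divide_inverse)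
qed

definition trig_sum :: "(real \<Rightarrow> complex) \<Rightarrow> bool" where
  "trig_sum q \<longleftrightarrow> (\<exists>K c. finite K \<and> q = (\<lambda>t. \<Sum>k\<in>K. c k * mode k t))"

lemma trig_sum_mode: "trig_sum (\<lambda>t. c * mode k t)"
  unfolding trig_sum_def by (rule exI[of _ "{k}"], rule exI[of _ "\<lambda>_. c"]) simp

lemma trig_sum_add:
  assumes "trig_sum p" "trig_sum q" shows "trig_sum (\<lambda>t. p t + q t)"
proof -
  obtain K c where K: "finite K" "p = (\<lambda>t. \<Sum>k\<in>K. c k * mode k t)"
    using assms(1) unfolding trig_sum_def by auto
  obtain J d where J: "finite J" "q = (\<lambda>t. \<Sum>k\<in>J. d k * mode k t)"
    using assms(2) unfolding trig_sum_def by auto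
  have "p t + q t = (\<Sum>k\<in>K \<union> J. ((if k \<in> K then c k else 0) + (if k \<in> J then d k else 0)) * mode k t)" for t
  proof -
    have 1: "(\<Sum>k\<in>K. c k * mode k t) = (\<Sum>k\<in>K\<union>J. (if k \<in> K then c k else 0) * mode k t)"
      using K(1) J(1) by (intro sum.mono_neutral_cong_left) auto
    have 2: "(\<Sum>k\<in>J. d k * mode k t) = (\<Sum>k\<in>K\<union>J. (if k \<in> J then d k else 0) * mode k t)"
      using K(1) J(1) by (intro sum.mono_neutral_cong_left) auto
    show ?thesis by (simp only: K(2) J(2) 1 2 distrib_right sum.distrib)
  qed
  then show ?thesis
    unfolding trig_sum_def using K(1) J(1)
    by (intro exI[of _ "K \<union> J"] exI[of _ "\<lambda>k. (if k \<in> K then c k else 0) + (if k \<in> J then d k else 0)"]) auto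
qed

lemma trig_sum_sum: "finite I \<Longrightarrow> (\<And>i. i \<in> I \<Longrightarrow> trig_sum (f i)) \<Longrightarrow> trig_sum (\<lambda>t. \<Sum>i\<in>I. f i t)"
proof (induction I rule: finite_induct)
  case empty
  show ?case unfolding trig_sum_def by (rule exI[of _ "{}"]) simp
next
  case (insert x F) then show ?case by (simp add: trig_sum_add)
qed

lemma trig_sum_mult:
  assumes "trig_sum p" "trig_sum q" shows "trig_sum (\<lambda>t. p t * q t)"
proof -
  obtain K c where K: "finite K" "p = (\<lambda>t. \<Sum>k\<in>K. c k * mode k t)"
    using assms(1) unfolding trig_sum_def by auto
  obtain J d where J: "finite J" "q = (\<lambda>t. \<Sum>k\<in>J. d k * mode k t)"
    using assms(2) unfolding trig_sum_def by auto
  have "(\<lambda>t. p t * q t) = (\<lambda>t. \<Sum>k\<in>K. \<Sum>j\<in>J. (c k * d j) * mode (k + j) t)"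
    unfolding K(2) J(2) by (rule ext) (simp add: sum_product mode_add mult_ac)
  then show ?thesis
    using K(1) J(1) by (auto intro!: trig_sum_sum trig_sum_mode)
qed

text \<open>Orthogonality to all modes extends to trigonometric sums, which are the functions supplied by the
Weierstrass approximation on the unit circle.\<close>

lemma trig_sum_orthogonal:
  assumes "percont f" "\<And>k. fcoeff f k = 0" "trig_sum q"
  shows "integral {0..T} (\<lambda>t. f t * q t) = 0"
proof -
  obtain K c where K: "finite K" "q = (\<lambda>t. \<Sum>k\<in>K. c k * mode k t)"
    using assms(3) unfolding trig_sum_def by auto
  have z: "integral {0..T} (\<lambda>t. f t * mode k t) = 0" for k
    using assms(2)[of "-k"] T_pos by (simp add: fcoeff_alt)
  have "integral {0..T} (\<lambda>t. f t * q t) = integral {0..T} (\<lambda>t. \<Sum>k\<in>K. c k * (f t * mode k t))"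
    unfolding K(2) by (simp add: sum_distrib_left mult_ac)
  also have "\<dots> = (\<Sum>k\<in>K. integral {0..T} (\<lambda>t. c k * (f t * mode k t)))"
    using K(1) assms(1) by (intro integral_sum integrable_on_mult_right percont_integrable_mode)
  finally show ?thesis by (simp add: z)
qed

lemma trig_sum_polynomial:
  fixes g :: "complex \<Rightarrow> real"
  assumes "real_polynomial_function g"
  shows "trig_sum (\<lambda>t. of_real (g (mode 1 t)))"
  using assms
proof (induction rule: real_polynomial_function.induct)
  case (linear f)
  interpret bounded_linear f by fact
  have *: "of_real (f (mode 1 t)) =
     ((of_real (f 1) - \<i> * of_real (f \<i>)) / 2) * mode 1 t + ((of_real (f 1) + \<i> * of_real (f \<i>)) / 2) * mode (-1) t" for t
  proof -
    have "mode 1 t = Re (mode 1 t) *\<^sub>R 1 + Im (mode 1 t) *\<^sub>R \<i>" by (simp add: complex_eq_iff)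
    then have "f (mode 1 t) = Re (mode 1 t) * f 1 + Im (mode 1 t) * f \<i>"
      by (metis add scaleR real_scaleR_def)
    then show ?thesis by (simp add: mode_neg complex_eq_iff algebra_simps flip: add_divide_distrib)
  qed
  show ?case unfolding * by (intro trig_sum_add trig_sum_mode)
next
  case (const c)
  show ?case using trig_sum_mode[of "of_real c" 0] by simp
qed (auto intro: trig_sum_add trig_sum_mult)

text \<open>A periodic function is a function on the circle, where polynomial approximation is available. Continuity
of the lift needs care only at the branch cut of the logarithm; around each point of the circle it is
checked with the logarithm rotated to that point.\<close>

lemma percont_on_circle:
  assumes "percont f"
  obtains F where "continuous_on (sphere 0 1) F" "\<And>t. F (mode 1 t) = f t"
proof -
  define F where "F z = f (T / (2 * pi) * Im (Ln z))" for z
  have per: "f (t + of_int k * T) = f t" for t k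
  proof -
    have nat: "f (t + of_nat n * T) = f t" for n t
    proof (induction n)
      case (Suc n)
      have "f (t + of_nat (Suc n) * T) = f ((t + of_nat n * T) + T)" by (simp add: algebra_simps)
      also have "\<dots> = f t" using assms Suc unfolding percont_def by metis
      finally show ?case .
    qed simp
    show ?thesis
    proof (cases "k \<ge> 0")
      case True then show ?thesis using nat[of t "nat k"] by simp
    next
      case False
      then show ?thesis using nat[of "t + of_int k * T" "nat (- k)"] by (simp add: algebra_simps)
    qed
  qed
  have eq: "f s = f t" if st: "mode 1 s = mode 1 t" for s t
  proof -
    have "exp (\<i> * (2 * pi / T * s)) = exp (\<i> * (2 * pi / T * t))" using st by (simp add: mode_exp mult_ac)
    then obtain n :: int where n: "\<i> * (2 * pi / T * s) = \<i> * (2 * pi / T * t) + (of_int (2 * n) * pi) * \<i>"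
      using exp_eq by blast
    then have "2 * pi / T * s = 2 * pi / T * t + of_int (2 * n) * pi"
      by (simp add: complex_eq_iff)
    then have "(2 * pi) * s = (2 * pi) * (t + of_int n * T)" using T_pos by (simp add: field_simps)
    then have "s = t + of_int n * T" unfolding mult_cancel_left by simp
    then show ?thesis using per by simp
  qed
  have rep: "mode 1 (T / (2 * pi) * Im (Ln z)) = z" if "cmod z = 1" for z
  proof -
    have z0: "z \<noteq> 0" using that by auto
    have "Ln z = \<i> * of_real (Im (Ln z))" using that z0 by (simp add: complex_eq_iff)
    then have "exp (\<i> * of_real (Im (Ln z))) = z" using exp_Ln[OF z0] by simp
    then show ?thesis using T_pos by (simp add: mode_exp field_simps)
  qed
  have F: "F (mode 1 t) = f t" for t
    unfolding F_def by (rule eq, rule rep) simp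
  have "continuous_on (sphere 0 1) F"
    unfolding continuous_on_eq_continuous_within
  proof
    fix z0 :: complex assume z0: "z0 \<in> sphere 0 1"
    define t0 where "t0 = T / (2 * pi) * Im (Ln z0)"
    have z0': "z0 = mode 1 t0" "cmod z0 = 1" "z0 \<noteq> 0" using rep z0 by (auto simp: t0_def)
    have loc: "F z = f (t0 + T / (2 * pi) * Im (Ln (z / z0)))" if "z \<in> sphere 0 1" for z
    proof -
      have "cmod (z / z0) = 1" using that z0' by (simp add: norm_divide)
      then have "mode 1 (T / (2 * pi) * Im (Ln (z / z0))) = z / z0" by (rule rep)
      then have "mode 1 (t0 + T / (2 * pi) * Im (Ln (z / z0))) = z"
        using z0' unfolding mode_def by (simp add: distrib_left flip: cis_mult)
      then show ?thesis using F by metis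
    qed
    have "isCont f s" for s
      using assms by (simp add: percont_def continuous_on_eq_continuous_at)
    moreover have "isCont (\<lambda>z. t0 + T / (2 * pi) * Im (Ln (z / z0))) z0"
      using z0'(3) by (intro continuous_intros) (auto simp: complex_nonpos_Reals_iff)
    ultimately have "isCont (\<lambda>z. f (t0 + T / (2 * pi) * Im (Ln (z / z0)))) z0"
      using isCont_o2 by blast
    then have "continuous (at z0 within sphere 0 1) (\<lambda>z. f (t0 + T / (2 * pi) * Im (Ln (z / z0))))"
      by (rule continuous_at_imp_continuous_at_within)
    then show "continuous (at z0 within sphere 0 1) F"
      by (rule continuous_transform_within[OF _ zero_less_one z0]) (use loc in auto)
  qed
  then show thesis using F that by blast
qed

text \<open>Uniqueness of Fourier coefficients: \<open>f\<close> is orthogonal to every trigonometric sum and a uniform limit of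
such sums, hence orthogonal to itself.\<close>

lemma fcoeff_zero_imp_zero_real:
  fixes f :: "real \<Rightarrow> real"
  assumes pc: "percont (\<lambda>t. of_real (f t))" and z: "\<And>k. fcoeff (\<lambda>t. of_real (f t)) k = 0"
  shows "f t = 0"
proof -
  let ?f = "\<lambda>t. complex_of_real (f t)"
  obtain F where F: "continuous_on (sphere 0 1) F" "\<And>t. F (mode 1 t) = ?f t"
    using percont_on_circle[OF pc] by blast
  have cf: "continuous_on A f" for A
  proof -
    have "continuous_on UNIV (\<lambda>t. Re (?f t))" using pc unfolding percont_def by (intro continuous_intros) auto
    then show ?thesis using continuous_on_subset by auto
  qed
  obtain B where B: "\<And>t. t \<in> {0..T} \<Longrightarrow> \<bar>f t\<bar> \<le> B"
    using compact_imp_bounded[OF compact_continuous_image[OF cf compact_Icc[of 0 T]]]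
    by (force simp: bounded_iff)
  have small: "integral {0..T} (\<lambda>t. f t * f t) \<le> e * (B * T)" if e: "e > 0" for e
  proof -
    have "continuous_on (sphere 0 1) (\<lambda>z. Re (F z))" using F(1) by (intro continuous_intros)
    then obtain g where g: "real_polynomial_function g" "\<And>z. z \<in> sphere 0 1 \<Longrightarrow> \<bar>Re (F z) - g z\<bar> < e"
      using Stone_Weierstrass_real_polynomial_function[OF compact_sphere _ e] by metis
    define q where "q t = g (mode 1 t)" for t
    have q: "\<bar>f t - q t\<bar> < e" for t
      using g(2)[of "mode 1 t"] F(2)[of t] by (simp add: q_def)
    have cq: "continuous_on A q" for A
      unfolding q_def
      using g(1) continuous_on_compose2[OF continuous_on_polymonial_function[of g UNIV] continuous_mode]
      by (auto simp: real_polynomial_function_eq)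
    have "integral {0..T} (\<lambda>t. ?f t * of_real (q t)) = 0"
      unfolding q_def by (rule trig_sum_orthogonal[OF pc z trig_sum_polynomial[OF g(1)]])
    moreover have "((\<lambda>t. complex_of_real (f t * q t)) has_integral of_real (integral {0..T} (\<lambda>t. f t * q t))) {0..T}"
      by (intro has_integral_of_real integrable_integral integrable_continuous_interval continuous_intros cf cq)
    ultimately have qz: "integral {0..T} (\<lambda>t. f t * q t) = 0"
      by (simp add: integral_unique)
    have "integral {0..T} (\<lambda>t. f t * f t) = integral {0..T} (\<lambda>t. f t * f t) - integral {0..T} (\<lambda>t. f t * q t)"
      by (simp add: qz)
    also have "\<dots> = integral {0..T} (\<lambda>t. f t * (f t - q t))"
      by (subst integral_diff[symmetric])
        (auto intro!: integrable_continuous_interval continuous_intros cf cq simp: algebra_simps)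
    also have "\<dots> \<le> integral {0..T} (\<lambda>t. B * e)"
    proof (rule integral_le)
      fix t assume t: "t \<in> {0..T}"
      have "f t * (f t - q t) \<le> \<bar>f t\<bar> * \<bar>f t - q t\<bar>" by (metis abs_ge_self abs_mult)
      also have "\<dots> \<le> B * e" using B[OF t] q[of t] by (intro mult_mono) auto
      finally show "f t * (f t - q t) \<le> B * e" .
    qed (auto intro!: integrable_continuous_interval continuous_intros cf cq)
    also have "\<dots> = e * (B * T)" using T_pos by simp
    finally show ?thesis .
  qed
  have nn: "0 \<le> integral {0..T} (\<lambda>t. f t * f t)"
    by (intro integral_nonneg integrable_continuous_interval continuous_intros cf) auto
  have "integral {0..T} (\<lambda>t. f t * f t) \<le> 0 + x" if "x > 0" for x
  proof -
    have BT: "B * T \<ge> 0" using B[of 0] T_pos by (intro mult_nonneg_nonneg) auto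
    have "integral {0..T} (\<lambda>t. f t * f t) \<le> x / (B * T + 1) * (B * T)"
      using that BT by (intro small) auto
    also have "\<dots> \<le> x" using that BT by (simp add: field_simps)
    finally show ?thesis by simp
  qed
  then have "integral {0..T} (\<lambda>t. f t * f t) \<le> 0" by (rule field_le_epsilon)
  then have int0: "integral {0..T} (\<lambda>t. f t * f t) = 0" using nn by (rule antisym)
  then have *: "f s = 0" if "s \<in> {0..T}" for s
  proof -
    have "\<forall>x\<in>{0..T}. f x * f x = 0"
      using integral_eq_0_iff[of 0 T "\<lambda>t. f t * f t"] T_pos int0 continuous_on_mult[OF cf cf] by simp
    then show ?thesis using that by simp
  qed
  obtain s where s: "s \<in> {0..T}" "mode 1 s = mode 1 t"
  proof -
    define s where "s = t - of_int \<lfloor>t / T\<rfloor> * T"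
    have "of_int \<lfloor>t / T\<rfloor> * T \<le> t" "t \<le> (of_int \<lfloor>t / T\<rfloor> + 1) * T"
      using T_pos of_int_floor_le[of "t / T"] real_of_int_floor_add_one_ge[of "t / T"]
      by (simp_all only: pos_le_divide_eq pos_divide_le_eq)
    then have "s \<in> {0..T}" by (simp add: s_def algebra_simps)
    moreover have "mode 1 s = mode 1 t"
    proof -
      have "2 * pi / T * s = 2 * pi / T * t + 2 * pi * of_int (- \<lfloor>t / T\<rfloor>)"
        using T_pos by (simp add: s_def field_simps)
      then show ?thesis unfolding mode_def
        by (metis cis_mult cis_multiple_2pi Ints_of_int mult.right_neutral mult_1 of_int_1)
    qed
    ultimately show thesis by (rule that)
  qed
  show "f t = 0" using *[OF s(1)] F(2)[of s] F(2)[of t] s(2) by simp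
qed

lemma fcoeff_zero_imp_zero:
  assumes pc: "percont f" and z: "\<And>k. fcoeff f k = 0"
  shows "f t = 0"
proof -
  have re: "(\<lambda>t. complex_of_real (Re (f t))) = (\<lambda>t. (1/2) * (f t + cnj (f t)))"
    by (auto simp: complex_eq_iff)
  have im: "(\<lambda>t. complex_of_real (Im (f t))) = (\<lambda>t. (-\<i>/2) * (f t - cnj (f t)))"
    by (auto simp: complex_eq_iff)
  have cz: "fcoeff (\<lambda>t. cnj (f t)) k = 0" for k by (simp add: fcoeff_cnj z)
  have "Re (f t) = 0"
  proof (rule fcoeff_zero_imp_zero_real, unfold re)
    show "percont (\<lambda>t. (1/2) * (f t + cnj (f t)))"
      by (intro percont_mult percont_const percont_add percont_cnj pc)
    show "fcoeff (\<lambda>t. (1/2) * (f t + cnj (f t))) k = 0" for k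
      by (simp only: fcoeff_cmult fcoeff_add pc percont_cnj z cz) simp
  qed
  moreover have "Im (f t) = 0"
  proof (rule fcoeff_zero_imp_zero_real, unfold im)
    show "percont (\<lambda>t. (-\<i>/2) * (f t - cnj (f t)))"
      by (intro percont_mult percont_const percont_diff percont_cnj pc)
    show "fcoeff (\<lambda>t. (-\<i>/2) * (f t - cnj (f t))) k = 0" for k
      by (simp only: fcoeff_cmult fcoeff_diff pc percont_cnj z cz) simp
  qed
  ultimately show ?thesis by (simp add: complex_eq_iff)
qed

text \<open>The Fourier series converges uniformly by the Weierstrass test; its sum has the same coefficients as \<open>f\<close>
and therefore equals \<open>f\<close>.\<close>

lemma fourier_inversion:
  assumes pc: "percont f" and s: "(\<lambda>k. cmod (fcoeff f k)) summable_on UNIV"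
  shows "uniform_limit UNIV (\<lambda>K t. \<Sum>k\<in>K. fcoeff f k * mode k t) f (finite_subsets_at_top UNIV)"
proof -
  define g where "g t = (\<Sum>\<^sub>\<infinity>k\<in>UNIV. fcoeff f k * mode k t)" for t
  have u: "uniform_limit UNIV (\<lambda>K t. \<Sum>k\<in>K. fcoeff f k * mode k t) g (finite_subsets_at_top UNIV)"
    unfolding g_def by (rule Weierstrass_m_test_general[OF _ s]) (simp add: norm_mult)
  have pcs: "percont (\<lambda>t. \<Sum>k\<in>K. fcoeff f k * mode k t)" for K
    by (intro percont_sum percont_mult percont_const percont_mode)
  have pg: "percont g" by (rule percont_uniform_limit[OF u _ pcs]) simp
  have "fcoeff g j = fcoeff f j" for j
  proof (rule tendsto_unique)
    show "((\<lambda>K. fcoeff (\<lambda>t. \<Sum>k\<in>K. fcoeff f k * mode k t) j) \<longlongrightarrow> fcoeff g j) (finite_subsets_at_top UNIV)"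
      by (rule fcoeff_uniform_limit[OF u _ pcs]) simp
    have "\<forall>\<^sub>F K in finite_subsets_at_top UNIV. finite K \<and> {j} \<subseteq> K"
      using eventually_finite_subsets_at_top_weakI[of UNIV "\<lambda>K. True"]
      by (auto simp: eventually_finite_subsets_at_top intro!: exI[of _ "{j}"])
    then have "\<forall>\<^sub>F K in finite_subsets_at_top UNIV. fcoeff (\<lambda>t. \<Sum>k\<in>K. fcoeff f k * mode k t) j = fcoeff f j"
    proof eventually_elim
      case (elim K)
      have "fcoeff (\<lambda>t. \<Sum>k\<in>K. fcoeff f k * mode k t) j = (\<Sum>k\<in>K. fcoeff f k * fcoeff (mode k) j)"
        using elim by (subst fcoeff_sum) (auto intro!: percont_mult percont_const percont_mode simp: fcoeff_cmult)
      also have "\<dots> = fcoeff f j" using elim by (simp add: fcoeff_mode if_distrib[of "\<lambda>x. _ * x"] sum.delta cong: if_cong)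
      finally show ?case .
    qed
    then show "((\<lambda>K. fcoeff (\<lambda>t. \<Sum>k\<in>K. fcoeff f k * mode k t) j) \<longlongrightarrow> fcoeff f j) (finite_subsets_at_top UNIV)"
      by (rule tendsto_eventually)
  qed simp
  then have "fcoeff (\<lambda>t. g t - f t) j = 0" for j using pg pc by (simp add: fcoeff_diff)
  then have "g t = f t" for t
    using fcoeff_zero_imp_zero[of "\<lambda>t. g t - f t" t] percont_diff[OF pg pc] by simp
  then have "g = f" by auto
  then show ?thesis using u by simp
qed

end

section \<open>Sobolev bounds and multipliers\<close>

context periodic
begin

definition sweight :: "nat \<Rightarrow> int \<Rightarrow> real" where
  "sweight l k = sqrt ((1 + (of_int k)\<^sup>2) ^ l)"

text \<open>The bound is stated on finite sets of frequencies, which makes it stable under uniform limits without any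
discussion of summability.\<close>

definition sob_le :: "nat \<Rightarrow> (real \<Rightarrow> complex) \<Rightarrow> real \<Rightarrow> bool" where
  "sob_le l f M \<longleftrightarrow> percont f \<and>
     (\<forall>K. finite K \<longrightarrow> L2_set (\<lambda>k. sweight l k * cmod (fcoeff f k)) K \<le> M)"

text \<open>\<open>M\<close> bounds the norm of multiplication by \<open>a\<close> on \<open>H\<^sup>l\<close>. Unlike the \<open>H\<^sup>l\<close>-norm, this norm is submultiplicative
with constant one, which matters for products with an unbounded number of factors.\<close>

definition mult_le :: "nat \<Rightarrow> (real \<Rightarrow> complex) \<Rightarrow> real \<Rightarrow> bool" where
  "mult_le l a M \<longleftrightarrow> 0 \<le> M \<and> (\<forall>f N. sob_le l f N \<longrightarrow> sob_le l (\<lambda>t. a t * f t) (M * N))"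

lemma sweight_pos: "sweight l k > 0"
proof -
  have "1 + (real_of_int k)\<^sup>2 > 0" by (simp add: add_pos_nonneg)
  then show ?thesis by (simp add: sweight_def)
qed

lemma sob_leD: "sob_le l f M \<Longrightarrow> percont f" "sob_le l f M \<Longrightarrow> 0 \<le> M"
  unfolding sob_le_def by (auto dest: spec[of _ "{}"])

lemma sob_le_mono: "sob_le l f M \<Longrightarrow> M \<le> M' \<Longrightarrow> sob_le l f M'"
  unfolding sob_le_def by (meson order_trans)

lemma sob_le_0: "sob_le l (\<lambda>_. 0) 0"
  by (simp add: sob_le_def percont_const fcoeff_const L2_set_0')

lemma sob_le_1: "sob_le l (\<lambda>_. 1) 1"
proof -
  have "L2_set (\<lambda>k. sweight l k * cmod (fcoeff (\<lambda>_. 1) k)) K \<le> 1" if "finite K" for K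
  proof -
    have "L2_set (\<lambda>k. sweight l k * cmod (fcoeff (\<lambda>_. 1) k)) K = L2_set (\<lambda>k. if k = 0 then 1 else 0) K"
      by (intro L2_set_cong) (auto simp: fcoeff_const sweight_def)
    also have "\<dots> \<le> (\<Sum>k\<in>K. if k = (0::int) then 1 else 0)"
      by (rule L2_set_le_sum) auto
    also have "\<dots> \<le> 1" using that by simp
    finally show ?thesis .
  qed
  then show ?thesis by (simp add: sob_le_def percont_const)
qed

lemma sob_le_add:
  assumes "sob_le l f M" "sob_le l g N" shows "sob_le l (\<lambda>t. f t + g t) (M + N)"
  unfolding sob_le_def
proof (intro conjI allI impI)
  show "percont (\<lambda>t. f t + g t)" using assms by (auto intro: percont_add sob_leD)
  fix K :: "int set" assume K: "finite K"
  have "L2_set (\<lambda>k. sweight l k * cmod (fcoeff (\<lambda>t. f t + g t) k)) K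
     \<le> L2_set (\<lambda>k. sweight l k * cmod (fcoeff f k) + sweight l k * cmod (fcoeff g k)) K"
    using assms sweight_pos
    by (intro L2_set_mono) (auto simp: fcoeff_add sob_leD less_imp_le norm_triangle_ineq simp flip: distrib_left)
  also have "\<dots> \<le> L2_set (\<lambda>k. sweight l k * cmod (fcoeff f k)) K + L2_set (\<lambda>k. sweight l k * cmod (fcoeff g k)) K"
    by (rule L2_set_triangle_ineq)
  also have "\<dots> \<le> M + N" using assms K unfolding sob_le_def by (intro add_mono) auto
  finally show "L2_set (\<lambda>k. sweight l k * cmod (fcoeff (\<lambda>t. f t + g t) k)) K \<le> M + N" .
qed

lemma sob_le_sum:
  assumes "finite I" "\<And>i. i \<in> I \<Longrightarrow> sob_le l (f i) (M i)"
  shows "sob_le l (\<lambda>t. \<Sum>i\<in>I. f i t) (\<Sum>i\<in>I. M i)"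
  using assms by (induction I rule: finite_induct) (auto intro: sob_le_0 sob_le_add)

lemma sob_le_cmult:
  assumes "sob_le l f M" shows "sob_le l (\<lambda>t. c * f t) (cmod c * M)"
  unfolding sob_le_def
proof (intro conjI allI impI)
  show "percont (\<lambda>t. c * f t)" using assms by (auto intro: percont_mult percont_const sob_leD)
  fix K :: "int set" assume K: "finite K"
  have "L2_set (\<lambda>k. sweight l k * cmod (fcoeff (\<lambda>t. c * f t) k)) K
      = L2_set (\<lambda>k. cmod c * (sweight l k * cmod (fcoeff f k))) K"
    by (simp add: fcoeff_cmult norm_mult mult_ac)
  also have "\<dots> = cmod c * L2_set (\<lambda>k. sweight l k * cmod (fcoeff f k)) K"
    by (simp add: L2_set_right_distrib)
  also have "\<dots> \<le> cmod c * M" using assms K unfolding sob_le_def by (intro mult_left_mono) auto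
  finally show "L2_set (\<lambda>k. sweight l k * cmod (fcoeff (\<lambda>t. c * f t) k)) K \<le> cmod c * M" .
qed

lemma L2_set_reindex: "inj_on h K \<Longrightarrow> L2_set (\<lambda>k. g (h k)) K = L2_set g (h ` K)"
  by (simp add: L2_set_def sum.reindex)

lemma sob_le_cnj:
  assumes "sob_le l f M" shows "sob_le l (\<lambda>t. cnj (f t)) M"
  unfolding sob_le_def
proof (intro conjI allI impI)
  show "percont (\<lambda>t. cnj (f t))" using assms by (auto intro: percont_cnj sob_leD)
  fix K :: "int set" assume K: "finite K"
  have "L2_set (\<lambda>k. sweight l k * cmod (fcoeff (\<lambda>t. cnj (f t)) k)) K
     = L2_set (\<lambda>k. (\<lambda>k. sweight l k * cmod (fcoeff f k)) (- k)) K"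
    by (simp add: fcoeff_cnj sweight_def)
  also have "\<dots> = L2_set (\<lambda>k. sweight l k * cmod (fcoeff f k)) (uminus ` K)"
    by (rule L2_set_reindex) simp
  also have "\<dots> \<le> M" using assms K unfolding sob_le_def by auto
  finally show "L2_set (\<lambda>k. sweight l k * cmod (fcoeff (\<lambda>t. cnj (f t)) k)) K \<le> M" .
qed

lemma sweight_shift: "sweight l (j + k) \<le> sqrt 2 ^ l * sweight l j * sweight l k"
proof -
  have "1 + (of_int (j + k))\<^sup>2 \<le> 2 * (1 + (of_int j)\<^sup>2) * (1 + (real_of_int k)\<^sup>2)"
  proof -
    have "0 \<le> (real_of_int j - real_of_int k)\<^sup>2 + 2 * (real_of_int j * real_of_int k)\<^sup>2 + 1" by simp
    then show ?thesis by (simp add: power2_eq_square algebra_simps)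
  qed
  then have "(1 + (of_int (j + k))\<^sup>2) ^ l \<le> (2 * (1 + (of_int j)\<^sup>2) * (1 + (real_of_int k)\<^sup>2)) ^ l"
    by (intro power_mono) auto
  then have "sweight l (j + k) \<le> sqrt ((2 * (1 + (of_int j)\<^sup>2) * (1 + (real_of_int k)\<^sup>2)) ^ l)"
    unfolding sweight_def by (rule real_sqrt_le_mono)
  also have "\<dots> = sqrt 2 ^ l * sweight l j * sweight l k"
    by (simp only: sweight_def power_mult_distrib real_sqrt_mult real_sqrt_power)
  finally show ?thesis .
qed

text \<open>Multiplication by a mode shifts the coefficients, at the cost of the weight of that mode.\<close>

lemma sob_le_shift:
  assumes "sob_le l f M"
  shows "sob_le l (\<lambda>t. mode j t * f t) (sqrt 2 ^ l * sweight l j * M)"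
  unfolding sob_le_def
proof (intro conjI allI impI)
  show "percont (\<lambda>t. mode j t * f t)" using assms by (auto intro: percont_mult percont_mode sob_leD)
  fix K :: "int set" assume K: "finite K"
  let ?c = "sqrt 2 ^ l * sweight l j"
  have "L2_set (\<lambda>k. sweight l k * cmod (fcoeff (\<lambda>t. mode j t * f t) k)) K
     \<le> L2_set (\<lambda>k. ?c * (sweight l (k - j) * cmod (fcoeff f (k - j)))) K"
  proof (intro L2_set_mono)
    fix k
    have "sweight l k \<le> ?c * sweight l (k - j)" using sweight_shift[of l j "k - j"] by simp
    then have "sweight l k * cmod (fcoeff f (k - j)) \<le> ?c * sweight l (k - j) * cmod (fcoeff f (k - j))"
      by (rule mult_right_mono) simp
    then show "sweight l k * cmod (fcoeff (\<lambda>t. mode j t * f t) k) \<le> ?c * (sweight l (k - j) * cmod (fcoeff f (k - j)))"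
      by (simp add: fcoeff_shift mult.assoc)
  qed (use sweight_pos in \<open>auto simp: less_imp_le\<close>)
  also have "\<dots> = ?c * L2_set (\<lambda>k. (\<lambda>k. sweight l k * cmod (fcoeff f k)) (k - j)) K"
    using sweight_pos[of l j] by (simp add: L2_set_right_distrib)
  also have "\<dots> = ?c * L2_set (\<lambda>k. sweight l k * cmod (fcoeff f k)) ((\<lambda>k. k - j) ` K)"
    by (subst L2_set_reindex) (auto simp: inj_on_def)
  also have "\<dots> \<le> ?c * M"
    using assms K sweight_pos[of l j] unfolding sob_le_def by (intro mult_left_mono) auto
  finally show "L2_set (\<lambda>k. sweight l k * cmod (fcoeff (\<lambda>t. mode j t * f t) k)) K \<le> ?c * M" .
qed

text \<open>Uniform convergence implies convergence of each Fourier coefficient, hence of every finite sum in the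
definition of the bound.\<close>

lemma sob_le_uniform_limit:
  assumes u0: "uniform_limit UNIV f0 g F" and F: "F \<noteq> bot" and b0: "\<forall>\<^sub>F n in F. sob_le l (f0 n) M"
  shows "sob_le l g M"
proof -
  obtain n0 where n0: "sob_le l (f0 n0) M" using eventually_happens'[OF F b0] by blast
  \<comment> \<open>The bound is made to hold for all indices, not only eventually.\<close>
  define f where "f n = (if sob_le l (f0 n) M then f0 n else f0 n0)" for n
  have b: "sob_le l (f n) M" for n using n0 by (simp add: f_def)
  have u: "uniform_limit UNIV f g F"
    unfolding uniform_limit_iff
  proof (intro allI impI)
    fix e :: real assume "e > 0"
    then have "\<forall>\<^sub>F n in F. \<forall>x\<in>UNIV. dist (f0 n x) (g x) < e" using u0 by (simp add: uniform_limit_iff)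
    with b0 show "\<forall>\<^sub>F n in F. \<forall>x\<in>UNIV. dist (f n x) (g x) < e"
      by eventually_elim (simp add: f_def)
  qed
  show ?thesis
  unfolding sob_le_def
proof (intro conjI allI impI)
  show "percont g" using percont_uniform_limit[OF u F] b sob_leD by blast
  fix K :: "int set" assume K: "finite K"
  have "((\<lambda>n. L2_set (\<lambda>k. sweight l k * cmod (fcoeff (f n) k)) K) \<longlongrightarrow> L2_set (\<lambda>k. sweight l k * cmod (fcoeff g k)) K) F"
    unfolding L2_set_def by (intro tendsto_intros fcoeff_uniform_limit[OF u F] sob_leD[OF b])
  then show "L2_set (\<lambda>k. sweight l k * cmod (fcoeff g k)) K \<le> M"
    using b K F unfolding sob_le_def by (intro tendsto_upperbound) auto
qed
qed

lemma summable_on_int: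
  fixes f :: "int \<Rightarrow> real"
  assumes "\<And>k. 0 \<le> f k" "summable (\<lambda>n. f (int n))" "summable (\<lambda>n. f (- int n))"
  shows "f summable_on UNIV"
proof -
  have "(\<lambda>n. f (int n)) summable_on UNIV" "(\<lambda>n. f (- int n)) summable_on UNIV"
    using assms by (auto intro!: summable_nonneg_imp_summable_on)
  then have "f summable_on range int" "f summable_on range (\<lambda>n. - int n)"
    by (auto simp: summable_on_reindex inj_on_def o_def)
  moreover have "UNIV = range int \<union> range (\<lambda>n. - int n)"
    by (auto, metis int_cases2 rangeI)
  ultimately show ?thesis by (metis summable_on_union)
qed

lemma summable_on_inverse_squares: "(\<lambda>k::int. 1 / (1 + (real_of_int k)\<^sup>2)) summable_on UNIV"
proof -
  have "summable (\<lambda>n. 1 / (1 + (real n)\<^sup>2))"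
  proof (rule summable_comparison_test')
    show "summable (\<lambda>n. inverse ((real n)\<^sup>2))" using inverse_power_summable[of 2, where 'a=real] by simp
    show "norm (1 / (1 + (real n)\<^sup>2)) \<le> inverse ((real n)\<^sup>2)" if "n \<ge> 1" for n
      using that by (simp add: field_simps add_pos_nonneg)
  qed
  then show ?thesis by (intro summable_on_int) auto
qed

text \<open>The constant of the embedding of \<open>H\<^sup>1\<close> into the functions with absolutely convergent Fourier series,
enlarged by one so that it is at least one.\<close>

definition sob_const :: real where
  "sob_const = 1 + sqrt (\<Sum>\<^sub>\<infinity>k::int. 1 / (1 + (real_of_int k)\<^sup>2))"

lemma sob_const_ge_1: "sob_const \<ge> 1"
  unfolding sob_const_def by (simp add: infsum_nonneg)

text \<open>The Cauchy--Schwarz inequality against the square-summable sequence \<open>(1 + k\<^sup>2)\<^sup>-\<^sup>1\<^sup>/\<^sup>2\<close>.\<close>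

lemma sum_fcoeff_le:
  assumes b: "sob_le (Suc l) f M" and K: "finite K"
  shows "(\<Sum>k\<in>K. sweight l k * cmod (fcoeff f k)) \<le> sob_const * M"
proof -
  have pos: "1 + (real_of_int k)\<^sup>2 > 0" for k by (simp add: add_pos_nonneg)
  have "(\<Sum>k\<in>K. sweight l k * cmod (fcoeff f k))
      = (\<Sum>k\<in>K. \<bar>1 / sqrt (1 + (of_int k)\<^sup>2)\<bar> * \<bar>sweight (Suc l) k * cmod (fcoeff f k)\<bar>)"
    using pos by (intro sum.cong) (auto simp: sweight_def real_sqrt_mult abs_mult less_imp_neq[THEN not_sym])
  also have "\<dots> \<le> L2_set (\<lambda>k. 1 / sqrt (1 + (of_int k)\<^sup>2)) K * L2_set (\<lambda>k. sweight (Suc l) k * cmod (fcoeff f k)) K"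
    by (rule L2_set_mult_ineq)
  also have "\<dots> \<le> sob_const * M"
  proof (rule mult_mono)
    have "L2_set (\<lambda>k. 1 / sqrt (1 + (of_int k)\<^sup>2)) K = sqrt (\<Sum>k\<in>K. 1 / (1 + (real_of_int k)\<^sup>2))"
      unfolding L2_set_def using pos by (simp add: power_divide less_imp_le)
    also have "\<dots> \<le> sqrt (\<Sum>\<^sub>\<infinity>k::int. 1 / (1 + (real_of_int k)\<^sup>2))"
      using K by (intro real_sqrt_le_mono finite_sum_le_infsum summable_on_inverse_squares) auto
    also have "\<dots> \<le> sob_const" by (simp add: sob_const_def)
    finally show "L2_set (\<lambda>k. 1 / sqrt (1 + (of_int k)\<^sup>2)) K \<le> sob_const" .
  qed (use b K sob_const_ge_1 in \<open>auto simp: sob_le_def\<close>)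
  finally show ?thesis .
qed

lemma sob_le_decrease:
  assumes "sob_le (Suc l) f M" shows "sob_le l f M"
  unfolding sob_le_def
proof (intro conjI allI impI)
  show "percont f" using assms by (rule sob_leD)
  fix K :: "int set" assume K: "finite K"
  have "sweight l k \<le> sweight (Suc l) k" for k
    unfolding sweight_def by (intro real_sqrt_le_mono power_increasing) auto
  then have "L2_set (\<lambda>k. sweight l k * cmod (fcoeff f k)) K \<le> L2_set (\<lambda>k. sweight (Suc l) k * cmod (fcoeff f k)) K"
    using sweight_pos by (intro L2_set_mono mult_right_mono) (auto simp: less_imp_le)
  also have "\<dots> \<le> M" using assms K by (auto simp: sob_le_def)
  finally show "L2_set (\<lambda>k. sweight l k * cmod (fcoeff f k)) K \<le> M" .
qed

lemma sob_le_summable: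
  assumes "sob_le (Suc l) f M"
  shows "(\<lambda>k. cmod (fcoeff f k)) summable_on UNIV"
proof -
  have "sob_le (Suc 0) f M" using assms by (induction l) (auto dest: sob_le_decrease)
  from sum_fcoeff_le[OF this]
  have "(\<Sum>k\<in>K. cmod (fcoeff f k)) \<le> sob_const * M" if "finite K" for K using that by (simp add: sweight_def)
  then show ?thesis
    by (intro nonneg_bdd_above_summable_on bdd_aboveI[where M = "sob_const * M"]) auto
qed

lemma sob_le_sup:
  assumes "sob_le (Suc l) f M" shows "cmod (f t) \<le> sob_const * M"
proof -
  have b: "sob_le (Suc 0) f M" using assms by (induction l) (auto dest: sob_le_decrease)
  have "((\<lambda>K. \<Sum>k\<in>K. fcoeff f k * mode k t) \<longlongrightarrow> f t) (finite_subsets_at_top UNIV)"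
    using fourier_inversion[OF sob_leD(1)[OF assms] sob_le_summable[OF assms]]
    by (rule tendsto_uniform_limitI) simp
  then have "((\<lambda>K. cmod (\<Sum>k\<in>K. fcoeff f k * mode k t)) \<longlongrightarrow> cmod (f t)) (finite_subsets_at_top UNIV)"
    by (rule tendsto_norm)
  moreover have "\<forall>\<^sub>F K in finite_subsets_at_top UNIV. cmod (\<Sum>k\<in>K. fcoeff f k * mode k t) \<le> sob_const * M"
  proof (rule eventually_finite_subsets_at_top_weakI)
    fix K :: "int set" assume K: "finite K"
    have "cmod (\<Sum>k\<in>K. fcoeff f k * mode k t) \<le> (\<Sum>k\<in>K. cmod (fcoeff f k))"
      by (rule order_trans[OF norm_sum]) (simp add: norm_mult)
    then show "cmod (\<Sum>k\<in>K. fcoeff f k * mode k t) \<le> sob_const * M"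
      using sum_fcoeff_le[OF b K] by (simp add: sweight_def)
  qed
  ultimately show ?thesis by (rule tendsto_upperbound) simp
qed

text \<open>The product of a trigonometric sum \<open>\<Sum>\<^sub>k a\<^sub>k e\<^sub>k\<close> with \<open>f\<close> is a sum of shifts of \<open>f\<close> with total cost
\<open>\<Sum>\<^sub>k \<bar>a\<^sub>k\<bar> (1 + k\<^sup>2)\<^sup>l\<^sup>/\<^sup>2\<close>, which one additional derivative of \<open>a\<close> makes finite. The general case is a
uniform limit.\<close>

lemma sob_le_mult_le:
  assumes "sob_le (Suc l) a M" "l \<ge> 1"
  shows "mult_le l a (sqrt 2 ^ l * sob_const * M)"
  unfolding mult_le_def
proof (intro conjI allI impI)
  show "0 \<le> sqrt 2 ^ l * sob_const * M"
    using sob_const_ge_1 sob_leD(2)[OF assms(1)] by simp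
  fix f N assume f: "sob_le l f N"
  obtain l' where l': "l = Suc l'" using assms(2) by (cases l) auto
  let ?p = "\<lambda>K t. \<Sum>k\<in>K. fcoeff a k * mode k t"
  have u: "uniform_limit UNIV ?p a (finite_subsets_at_top UNIV)"
    by (rule fourier_inversion[OF sob_leD(1)[OF assms(1)] sob_le_summable[OF assms(1)]])
  have ba: "cmod (a t) \<le> sob_const * M" for t by (rule sob_le_sup[OF assms(1)])
  have bf: "cmod (f t) \<le> sob_const * N" for t using sob_le_sup f l' by blast
  have u2: "uniform_limit UNIV (\<lambda>K t. ?p K t * f t) (\<lambda>t. a t * f t) (finite_subsets_at_top UNIV)"
    using ba bf by (intro uniform_lim_mult u uniform_limit_const) (auto intro!: boundedI)
  have b: "sob_le l (\<lambda>t. ?p K t * f t) (sqrt 2 ^ l * sob_const * M * N)" if K: "finite K" for K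
  proof -
    have "sob_le l (\<lambda>t. \<Sum>k\<in>K. fcoeff a k * (mode k t * f t))
        (\<Sum>k\<in>K. cmod (fcoeff a k) * (sqrt 2 ^ l * sweight l k * N))"
      using K f by (intro sob_le_sum sob_le_cmult sob_le_shift)
    moreover have "(\<lambda>t. \<Sum>k\<in>K. fcoeff a k * (mode k t * f t)) = (\<lambda>t. ?p K t * f t)"
      by (simp add: sum_distrib_right mult.assoc)
    ultimately have "sob_le l (\<lambda>t. ?p K t * f t) (\<Sum>k\<in>K. cmod (fcoeff a k) * (sqrt 2 ^ l * sweight l k * N))"
      by simp
    then show ?thesis
    proof (rule sob_le_mono)
      have "(\<Sum>k\<in>K. cmod (fcoeff a k) * (sqrt 2 ^ l * sweight l k * N))
          = sqrt 2 ^ l * N * (\<Sum>k\<in>K. sweight l k * cmod (fcoeff a k))"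
        by (simp add: sum_distrib_left mult_ac)
      also have "\<dots> \<le> sqrt 2 ^ l * N * (sob_const * M)"
        using sob_leD(2)[OF f] by (intro mult_left_mono sum_fcoeff_le assms K) auto
      finally show "(\<Sum>k\<in>K. cmod (fcoeff a k) * (sqrt 2 ^ l * sweight l k * N)) \<le> sqrt 2 ^ l * sob_const * M * N"
        by (simp add: mult_ac)
    qed
  qed
  show "sob_le l (\<lambda>t. a t * f t) (sqrt 2 ^ l * sob_const * M * N)"
    by (rule sob_le_uniform_limit[OF u2]) (simp, intro eventually_finite_subsets_at_top_weakI b)
qed

text \<open>The supremum is dominated by the \<open>H\<^sup>l\<close>-bound, so a series with summable bounds converges uniformly.\<close>

lemma sob_le_has_sum:
  assumes l: "l \<ge> 1" and b: "\<And>i. i \<in> I \<Longrightarrow> sob_le l (f i) (N i)" and N: "N summable_on I"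
    and g: "\<And>t. ((\<lambda>i. f i t) has_sum g t) I"
  shows "sob_le l g (infsum N I)"
proof -
  obtain l' where l': "l = Suc l'" using l by (cases l) auto
  have bf: "cmod (f i t) \<le> sob_const * N i" if "i \<in> I" for i t using sob_le_sup b that l' by blast
  have u: "uniform_limit UNIV (\<lambda>K t. \<Sum>i\<in>K. f i t) g (finite_subsets_at_top I)"
    by (rule Weierstrass_m_test_general'[OF bf g]) (auto intro: summable_on_cmult_right N)
  have bb: "sob_le l (\<lambda>t. \<Sum>i\<in>K. f i t) (infsum N I)" if K: "finite K" "K \<subseteq> I" for K
  proof (rule sob_le_mono[OF sob_le_sum[OF K(1), of l f N]])
    show "sum N K \<le> infsum N I"
      using K N sob_leD(2)[OF b] by (intro finite_sum_le_infsum) auto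
  qed (use K b in auto)
  show ?thesis
    by (rule sob_le_uniform_limit[OF u]) (simp, intro eventually_finite_subsets_at_top_weakI bb)
qed

lemma mult_le_mono: "mult_le l a M \<Longrightarrow> M \<le> M' \<Longrightarrow> mult_le l a M'"
  unfolding mult_le_def by (meson sob_le_mono mult_right_mono order_trans sob_leD(2))

lemma mult_le_const: "mult_le l (\<lambda>_. c) (cmod c)"
  by (simp add: mult_le_def sob_le_cmult)

lemma mult_le_mult:
  assumes "mult_le l a M" "mult_le l b N" shows "mult_le l (\<lambda>t. a t * b t) (M * N)"
  using assms unfolding mult_le_def by (auto simp: mult.assoc)

lemma mult_le_sob_le: "mult_le l a M \<Longrightarrow> sob_le l f N \<Longrightarrow> sob_le l (\<lambda>t. a t * f t) (M * N)"
  by (simp add: mult_le_def)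

lemma mult_le_imp_sob_le:
  assumes "mult_le l a M" shows "sob_le l a M"
  using mult_le_sob_le[OF assms sob_le_1] by simp

end

section \<open>Periodic linear equations\<close>

context periodic
begin

lemma fourier_coeff_nth: "fourier_coeff T f k $ j = fcoeff (\<lambda>t. of_real (f t $ j)) k"
  by (simp add: fourier_coeff_def fcoeff_def)

lemma sob_le_of_sobolev:
  assumes f: "f \<in> sobolev T l" and M: "sobolev_norm T l f \<le> M"
  shows "sob_le l (\<lambda>t. of_real (f t $ j)) M"
  unfolding sob_le_def
proof (intro conjI allI impI)
  show "percont (\<lambda>t. complex_of_real (f t $ j))"
    using f unfolding sobolev_def percont_def by (auto intro!: continuous_intros)
  fix K :: "int set" assume K: "finite K"
  have nn: "0 \<le> (1 + (real_of_int k)\<^sup>2) ^ l" for k by simp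
  have "L2_set (\<lambda>k. sweight l k * cmod (fcoeff (\<lambda>t. of_real (f t $ j)) k)) K
      = sqrt (\<Sum>k\<in>K. (1 + (of_int k)\<^sup>2) ^ l * (cmod (fourier_coeff T f k $ j))\<^sup>2)"
    unfolding L2_set_def by (simp add: power_mult_distrib sweight_def fourier_coeff_nth)
  also have "\<dots> \<le> sqrt (\<Sum>k\<in>K. (1 + (of_int k)\<^sup>2) ^ l * (norm (fourier_coeff T f k))\<^sup>2)"
    by (intro real_sqrt_le_mono sum_mono mult_left_mono power_mono Finite_Cartesian_Product.norm_nth_le nn) auto
  also have "\<dots> \<le> sobolev_norm T l f"
    unfolding sobolev_norm_def using f K
    by (intro real_sqrt_le_mono finite_sum_le_infsum) (auto simp: sobolev_def)
  finally show "L2_set (\<lambda>k. sweight l k * cmod (fcoeff (\<lambda>t. of_real (f t $ j)) k)) K \<le> M"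
    using M by simp
qed

text \<open>The squares of the bounds of the components add up, and a sum of squares is at most the square of the sum.\<close>

lemma sobolev_of_sob_le:
  fixes f :: "real \<Rightarrow> real ^ 'm"
  assumes b: "\<And>j. sob_le l (\<lambda>t. of_real (f t $ j)) (M j)"
  shows "f \<in> sobolev T l" "sobolev_norm T l f \<le> (\<Sum>j\<in>UNIV. M j)"
proof -
  let ?g = "\<lambda>k::int. (1 + (of_int k)\<^sup>2) ^ l * (norm (fourier_coeff T f k))\<^sup>2"
  have Mnn: "0 \<le> M j" for j using sob_leD(2)[OF b] .
  have fin: "sum ?g K \<le> (\<Sum>j\<in>UNIV. M j)\<^sup>2" if K: "finite K" for K
  proof -
    have "?g k = (\<Sum>j\<in>UNIV. (sweight l k * cmod (fcoeff (\<lambda>t. of_real (f t $ j)) k))\<^sup>2)" for k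
      by (simp add: norm_vec_def L2_set_def sum_nonneg fourier_coeff_nth power_mult_distrib sweight_def sum_distrib_left)
    then have "sum ?g K = (\<Sum>k\<in>K. \<Sum>j\<in>UNIV. (sweight l k * cmod (fcoeff (\<lambda>t. of_real (f t $ j)) k))\<^sup>2)"
      by simp
    also have "\<dots> = (\<Sum>j\<in>UNIV. \<Sum>k\<in>K. (sweight l k * cmod (fcoeff (\<lambda>t. of_real (f t $ j)) k))\<^sup>2)"
      by (rule sum.swap)
    also have "\<dots> = (\<Sum>j\<in>UNIV. (L2_set (\<lambda>k. sweight l k * cmod (fcoeff (\<lambda>t. of_real (f t $ j)) k)) K)\<^sup>2)"
      by (simp add: L2_set_def sum_nonneg)
    also have "\<dots> \<le> (\<Sum>j\<in>UNIV. (M j)\<^sup>2)"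
      using b K unfolding sob_le_def by (intro sum_mono power_mono) auto
    also have "\<dots> = (L2_set M UNIV)\<^sup>2" by (simp add: L2_set_def sum_nonneg)
    also have "\<dots> \<le> (\<Sum>j\<in>UNIV. M j)\<^sup>2"
      using Mnn by (intro power_mono L2_set_le_sum) auto
    finally show ?thesis .
  qed
  have s: "?g summable_on UNIV"
    using fin by (intro nonneg_bdd_above_summable_on bdd_aboveI[where M="(\<Sum>j\<in>UNIV. M j)\<^sup>2"]) auto
  have pc: "percont (\<lambda>t. complex_of_real (f t $ j))" for j using sob_leD(1)[OF b] .
  have "continuous_on UNIV (\<lambda>t. f t $ j)" for j
  proof -
    have "continuous_on UNIV (\<lambda>t. Re (complex_of_real (f t $ j)))"
      by (intro continuous_on_Re) (use pc[of j] in \<open>simp add: percont_def\<close>)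
    then show ?thesis by simp
  qed
  then have "continuous_on UNIV (\<lambda>t. \<chi> j. f t $ j)" by (rule continuous_on_vec_lambda)
  moreover have "f (t + T) = f t" for t
    using pc unfolding percont_def by (simp add: vec_eq_iff)
  ultimately show "f \<in> sobolev T l" using s by (simp add: sobolev_def)
  have "infsum ?g UNIV \<le> (\<Sum>j\<in>UNIV. M j)\<^sup>2"
    using fin s by (intro infsum_le_finite_sums) auto
  then show "sobolev_norm T l f \<le> (\<Sum>j\<in>UNIV. M j)"
    unfolding sobolev_norm_def by (intro real_le_lsqrt) (auto intro: sum_nonneg Mnn)
qed

text \<open>Elements of \<open>H\<^sup>l\<^sup>+\<^sup>1\<close> with \<open>l \<ge> 1\<close> are differentiable in the classical sense. Recording this as part of the
bound avoids differentiating Fourier series.\<close>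

definition smooth_le :: "nat \<Rightarrow> (real \<Rightarrow> complex) \<Rightarrow> real \<Rightarrow> bool" where
  "smooth_le l a M \<longleftrightarrow> sob_le (Suc l) a M \<and>
     (\<exists>a'. \<forall>t. (a has_vector_derivative a' t) (at t))"

lemma antiderivative_on_line:
  fixes f :: "real \<Rightarrow> complex"
  assumes "continuous_on UNIV f"
  obtains G where "\<And>t. (G has_vector_derivative f t) (at t)" "G 0 = 0"
proof -
  define G where "G u = interval_lebesgue_integral lborel (ereal 0) (ereal u) f" for u
  have "(G has_vector_derivative f x) (at x)" for x
  proof -
    define B where "B = \<bar>x\<bar> + 1"
    have "(G has_vector_derivative f x) (at x within {-B..B})"
      unfolding G_def using assms
      by (intro interval_integral_FTC2) (auto simp: B_def intro: continuous_on_subset)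
    then have "(G has_vector_derivative f x) (at x within {-B<..<B})"
      by (rule has_vector_derivative_within_subset) auto
    then show ?thesis
      by (subst (asm) has_vector_derivative_within_open) (auto simp: B_def)
  qed
  moreover have "G 0 = 0" by (simp add: G_def)
  ultimately show thesis using that by blast
qed

lemma has_vector_derivative_zero_const:
  fixes g :: "real \<Rightarrow> complex"
  assumes "\<And>t. (g has_vector_derivative 0) (at t)"
  shows "g s = g t"
proof -
  obtain c where "\<And>x. x \<in> UNIV \<Longrightarrow> g x = c"
    using has_vector_derivative_zero_constant[OF convex_UNIV, of g] assms by auto
  then show ?thesis by simp
qed

lemma has_vector_derivative_shift:
  assumes "(g has_vector_derivative g') (at (t + c))"
  shows "((\<lambda>s. g (s + c)) has_vector_derivative g') (at t)"
proof -
  have "((g \<circ> (\<lambda>s. s + c)) has_vector_derivative 1 *\<^sub>R g') (at t)"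
    using assms by (intro vector_diff_chain_at derivative_eq_intros refl) auto
  then show ?thesis by (simp add: o_def)
qed

text \<open>Variation of constants gives a solution on the line, and the initial value is adjusted to make it
periodic; this is possible because \<open>e\<^sup>\<mu>\<^sup>T \<noteq> 1\<close>. Its Fourier coefficients are those of \<open>v\<close> divided by
\<open>\<mu> + 2 \<pi> i k / T\<close>, and the factor \<open>1 + \<bar>k\<bar>\<close> in the lower bound of the divisors is the gained derivative.\<close>

lemma periodic_solution:
  assumes v: "sob_le l v M" and \<kappa>: "\<kappa> > 0"
    and div: "\<And>k::int. \<kappa> * (1 + \<bar>of_int k\<bar>) \<le> cmod (\<mu> + \<i> * of_int k * of_real (2 * pi / T))"
  obtains a a' where "sob_le (Suc l) a (M / \<kappa>)" "\<And>t. (a has_vector_derivative a' t) (at t)"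
    "\<And>t. a' t + \<mu> * a t = v t"
proof -
  have pv: "percont v" using sob_leD(1)[OF v] .
  have div0: "\<mu> + \<i> * of_int k * of_real (2 * pi / T) \<noteq> 0" for k
    using div[of k] \<kappa> by (smt (verit) mult_pos_pos norm_zero of_int_abs)
  have e: "exp (\<mu> * of_real T) \<noteq> 1"
  proof
    assume "exp (\<mu> * of_real T) = 1"
    then obtain n where n: "Re (\<mu> * of_real T) = 0" "Im (\<mu> * of_real T) = of_int (2 * n) * pi"
      unfolding exp_eq_1 by blast
    have "\<mu> + \<i> * of_int (- n) * of_real (2 * pi / T) = 0"
      using n T_pos by (simp add: complex_eq_iff field_simps)
    then show False using div0 by blast
  qed
  have "continuous_on UNIV (\<lambda>s. exp (\<mu> * of_real s) * v s)"
    using pv unfolding percont_def by (intro continuous_intros) auto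
  then obtain G where G: "\<And>t. (G has_vector_derivative exp (\<mu> * of_real t) * v t) (at t)" and G0: "G 0 = 0"
    using antiderivative_on_line by blast
  \<comment> \<open>The initial value for which \<open>a T = a 0\<close>.\<close>
  define C where "C = G T / (exp (\<mu> * of_real T) - 1)"
  define a where "a t = exp ((- \<mu>) * of_real t) * (C + G t)" for t
  define a' where "a' t = v t - \<mu> * a t" for t
  have ex: "exp ((- \<mu>) * of_real t) * exp (\<mu> * of_real t) = 1" for t
    by (simp flip: exp_add)
  have da: "(a has_vector_derivative a' t) (at t)" for t
  proof -
    have "(a has_vector_derivative exp ((- \<mu>) * of_real t) * (exp (\<mu> * of_real t) * v t)
       + ((- \<mu>) * exp ((- \<mu>) * of_real t)) * (C + G t)) (at t)"
      unfolding a_def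
      by (intro has_vector_derivative_mult has_vector_derivative_exp_linear)
        (use has_vector_derivative_add[OF has_vector_derivative_const G] in auto)
    also have "exp ((- \<mu>) * of_real t) * (exp (\<mu> * of_real t) * v t) + ((- \<mu>) * exp ((- \<mu>) * of_real t)) * (C + G t) = a' t"
      using ex[of t] by (simp add: a'_def a_def mult.assoc[symmetric])
    finally show ?thesis .
  qed
  have aT: "a T = a 0"
  proof -
    have "C * (exp (\<mu> * of_real T) - 1) = G T" using e by (simp add: C_def)
    then have "C + G T = C * exp (\<mu> * of_real T)" by (simp add: algebra_simps)
    then have "a T = C * (exp ((- \<mu>) * of_real T) * exp (\<mu> * of_real T))" by (simp only: a_def mult_ac)
    then show ?thesis by (simp only: ex) (simp add: a_def G0)
  qed
  have per: "a (t + T) = a t" for t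
  proof -
    \<comment> \<open>The difference \<open>a (t + T) - a t\<close> solves the homogeneous equation and vanishes at zero.\<close>
    define b where "b t = exp (\<mu> * of_real t) * (a (t + T) - a t)" for t
    have "(b has_vector_derivative exp (\<mu> * of_real t) * (a' (t + T) - a' t) + (\<mu> * exp (\<mu> * of_real t)) * (a (t + T) - a t)) (at t)" for t
      unfolding b_def
      by (intro has_vector_derivative_mult has_vector_derivative_exp_linear has_vector_derivative_diff has_vector_derivative_shift da)
    moreover have "exp (\<mu> * of_real t) * (a' (t + T) - a' t) + (\<mu> * exp (\<mu> * of_real t)) * (a (t + T) - a t) = 0" for t
    proof -
      have "v (t + T) = v t" using pv by (simp add: percont_def)
      then show ?thesis by (simp add: a'_def right_diff_distrib)
    qed
    ultimately have "b t = b 0" by (intro has_vector_derivative_zero_const) simp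
    then show ?thesis using aT by (simp add: b_def)
  qed
  have ca: "continuous_on A a" for A
    using da by (meson continuous_at_imp_continuous_on has_vector_derivative_continuous)
  have pa: "percont a" using per ca by (simp add: percont_def)
  have fc: "fcoeff v k = (\<mu> + \<i> * of_int k * of_real (2 * pi / T)) * fcoeff a k" for k
  proof -
    let ?w = "\<i> * of_int (- k) * (2 * pi / T)"
    have dm: "(mode (- k) has_vector_derivative ?w * mode (- k) t) (at t within A)" for t A
      using has_vector_derivative_exp_linear[of ?w t A] unfolding mode_exp[abs_def] by simp
    have "((\<lambda>t. a t * (?w * mode (- k) t) + a' t * mode (- k) t) has_integral
        (a T * mode (- k) T - a 0 * mode (- k) 0)) {0..T}"
      by (intro fundamental_theorem_of_calculus has_vector_derivative_mult dm
            has_vector_derivative_at_within[OF da]) (use T_pos in auto)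
    then have "integral {0..T} (\<lambda>t. a t * (?w * mode (- k) t) + a' t * mode (- k) t) = 0"
      using aT mode_period[of "-k" 0] by (simp add: integral_unique)
    moreover have "a t * (?w * mode (- k) t) + a' t * mode (- k) t
        = v t * mode (- k) t - (\<mu> - ?w) * (a t * mode (- k) t)" for t
      by (simp add: a'_def algebra_simps)
    ultimately have "integral {0..T} (\<lambda>t. v t * mode (- k) t) - (\<mu> - ?w) * integral {0..T} (\<lambda>t. a t * mode (- k) t) = 0"
      using pa pv by (simp add: integral_diff percont_integrable_mode integrable_on_mult_right del: of_int_minus)
    then show ?thesis by (simp add: fcoeff_alt)
  qed
  have "sob_le (Suc l) a (M / \<kappa>)"
    unfolding sob_le_def
  proof (intro conjI allI impI pa)
    fix K :: "int set" assume K: "finite K"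
    have "sweight (Suc l) k * cmod (fcoeff a k) \<le> 1 / \<kappa> * (sweight l k * cmod (fcoeff v k))" for k
    proof -
      have "(1::real) + (of_int k)\<^sup>2 \<le> (1 + \<bar>of_int k\<bar>)\<^sup>2" by (simp add: power2_eq_square algebra_simps)
      then have s: "sqrt (1 + (of_int k)\<^sup>2) \<le> 1 + \<bar>real_of_int k\<bar>" by (intro real_le_lsqrt) auto
      have "\<kappa> * (sqrt (1 + (of_int k)\<^sup>2) * cmod (fcoeff a k)) \<le> \<kappa> * ((1 + \<bar>real_of_int k\<bar>) * cmod (fcoeff a k))"
        using s \<kappa> by (intro mult_left_mono mult_right_mono) auto
      also have "\<dots> \<le> cmod (\<mu> + \<i> * of_int k * of_real (2 * pi / T)) * cmod (fcoeff a k)"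
        using div[of k] by (simp add: mult_right_mono flip: mult.assoc)
      also have "\<dots> = cmod (fcoeff v k)" by (simp only: fc norm_mult)
      finally have "sqrt (1 + (of_int k)\<^sup>2) * cmod (fcoeff a k) \<le> 1 / \<kappa> * cmod (fcoeff v k)"
        using \<kappa> by (simp add: field_simps)
      then have "sweight l k * (sqrt (1 + (of_int k)\<^sup>2) * cmod (fcoeff a k)) \<le> sweight l k * (1 / \<kappa> * cmod (fcoeff v k))"
        using sweight_pos[of l k] by (intro mult_left_mono) auto
      then show ?thesis by (simp add: sweight_def real_sqrt_mult mult_ac)
    qed
    then have "L2_set (\<lambda>k. sweight (Suc l) k * cmod (fcoeff a k)) K \<le> L2_set (\<lambda>k. 1 / \<kappa> * (sweight l k * cmod (fcoeff v k))) K"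
      using sweight_pos by (intro L2_set_mono) (auto simp: less_imp_le)
    also have "\<dots> = 1 / \<kappa> * L2_set (\<lambda>k. sweight l k * cmod (fcoeff v k)) K"
      using \<kappa> by (subst L2_set_right_distrib) auto
    also have "\<dots> \<le> 1 / \<kappa> * M"
      using v K \<kappa> by (intro mult_left_mono) (auto simp: sob_le_def)
    finally show "L2_set (\<lambda>k. sweight (Suc l) k * cmod (fcoeff a k)) K \<le> M / \<kappa>" by simp
  qed
  then show thesis using that[of a a'] da by (simp add: a'_def)
qed

end

section \<open>Normally convergent power series\<close>

lemma has_sum_Sigma_nonneg:
  fixes f :: "'i \<times> 'k \<Rightarrow> real"
  assumes f: "\<And>x. x \<in> A \<Longrightarrow> ((\<lambda>y. f (x, y)) has_sum g x) (B x)"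
    and g: "g summable_on A" and nn: "\<And>x y. x \<in> A \<Longrightarrow> y \<in> B x \<Longrightarrow> 0 \<le> f (x, y)"
  shows "(f has_sum infsum g A) (Sigma A B)"
proof (rule has_sum_SigmaI[OF f])
  show "(g has_sum infsum g A) A" using g by (rule has_sum_infsum)
  have 1: "(\<lambda>y. norm (f (x, y))) summable_on B x" if "x \<in> A" for x
    using f[OF that] nn[OF that] by (simp add: has_sum_imp_summable cong: summable_on_cong)
  have 2: "infsum (\<lambda>y. norm (f (x, y))) (B x) = g x" if "x \<in> A" for x
    using f[OF that] nn[OF that] by (simp add: infsumI cong: infsum_cong)
  have 3: "0 \<le> g x" if "x \<in> A" for x
    using f[OF that] nn[OF that] by (rule has_sum_nonneg)
  have "(\<lambda>x. norm (infsum (\<lambda>y. norm (f (x, y))) (B x))) summable_on A"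
    using g 2 3 by (simp cong: summable_on_cong)
  then have "(\<lambda>x. norm (f x)) summable_on Sigma A B"
    using 1 by (subst Infinite_Sum.abs_summable_on_Sigma_iff) blast
  then show "f summable_on Sigma A B" by (rule Infinite_Sum.abs_summable_summable)
qed

lemma has_sum_to_nat_on:
  fixes F :: "'i \<Rightarrow> 'b :: {topological_comm_monoid_add,t2_space}"
  assumes I: "countable I" and F: "(F has_sum S) I"
    and eq: "\<And>i. i \<in> I \<Longrightarrow> F' (to_nat_on I i) = F i" and z: "\<And>n. n \<notin> to_nat_on I ` I \<Longrightarrow> F' n = 0"
  shows "(F' has_sum S) UNIV"
proof -
  have "((\<lambda>i. F' (to_nat_on I i)) has_sum S) I" using F eq by (simp cong: has_sum_cong)
  then have "(F' has_sum S) (to_nat_on I ` I)"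
    using has_sum_reindex[OF inj_on_to_nat_on[OF I], of F' S] by (simp add: o_def)
  then show ?thesis
    by (rule has_sum_cong_neutral[THEN iffD1, rotated -1]) (use z in auto)
qed

text \<open>Monomials are indexed by words in the coordinates rather than by multi-indices, so that the product of two
monomials belongs to the concatenated word.\<close>

definition vmono :: "'m list \<Rightarrow> real ^ 'm \<Rightarrow> complex" where
  "vmono w h = (\<Prod>j\<leftarrow>w. complex_of_real (h $ j))"

lemma vmono_append: "vmono (u @ w) h = vmono u h * vmono w h"
  by (simp add: vmono_def)

lemma vmono_Nil [simp]: "vmono [] h = 1"
  by (simp add: vmono_def)

lemma vmono_Cons: "vmono (j # w) h = of_real (h $ j) * vmono w h"
  by (simp add: vmono_def)

lemma norm_vmono_le:
  assumes "\<And>j. \<bar>h $ j\<bar> \<le> r" shows "cmod (vmono w h) \<le> r ^ length w"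
proof (induction w)
  case (Cons j w)
  have "0 \<le> r" using assms[of undefined] by linarith
  then show ?case using Cons assms[of j] by (auto simp: vmono_Cons norm_mult intro: mult_mono)
qed simp

text \<open>A power series in \<open>h\<close> that converges normally on the polydisc \<open>\<bar>h\<^sub>j\<bar> \<le> r\<close>: the \<open>i\<close>-th term is
\<open>v i t\<close> times the monomial of the word \<open>w i\<close>. Words may be repeated, so sums and products of series only
require a reenumeration of their terms and never a collection of equal monomials. The predicate \<open>nb\<close>
measures the coefficients; it is instantiated with \<open>sob_le\<close> for functions with values in \<open>H\<^sup>l\<close> and with
\<open>mult_le\<close> for multipliers.\<close>

definition series_rep where
  "series_rep nb r f M (v :: nat \<Rightarrow> real \<Rightarrow> complex) (w :: nat \<Rightarrow> 'm::finite list) N \<longleftrightarrow>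
      (\<forall>i. nb (v i) (N i)) \<and>
      (\<lambda>i. N i * r ^ length (w i)) summable_on UNIV \<and> (\<Sum>\<^sub>\<infinity>i. N i * r ^ length (w i)) \<le> M \<and>
      (\<forall>h t. (\<forall>j. \<bar>h $ j\<bar> \<le> r) \<longrightarrow> ((\<lambda>i. v i t * vmono (w i) h) has_sum f h t) UNIV)"

definition series_le ::
  "((real \<Rightarrow> complex) \<Rightarrow> real \<Rightarrow> bool) \<Rightarrow> real \<Rightarrow> (real ^ 'm \<Rightarrow> real \<Rightarrow> complex) \<Rightarrow> real \<Rightarrow> bool" where
  "series_le nb r f M \<longleftrightarrow> (\<exists>v w N. series_rep nb r f M v w N)"

lemma series_repD:
  assumes "series_rep nb r f M v w N"
  shows "nb (v i) (N i)" "(\<lambda>i. N i * r ^ length (w i)) summable_on UNIV" "(\<Sum>\<^sub>\<infinity>i. N i * r ^ length (w i)) \<le> M"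
    "(\<And>j. \<bar>h $ j\<bar> \<le> r) \<Longrightarrow> ((\<lambda>i. v i t * vmono (w i) h) has_sum f h t) UNIV"
  using assms unfolding series_rep_def by blast+

locale coeff_bound =
  fixes nb :: "(real \<Rightarrow> complex) \<Rightarrow> real \<Rightarrow> bool" and C :: real
  assumes nb_zero: "nb (\<lambda>_. 0) 0"
    and nb_nonneg: "nb v N \<Longrightarrow> 0 \<le> N"
    and nb_sup: "nb v N \<Longrightarrow> cmod (v t) \<le> C * N"
    and C_pos: "0 < C"
begin

text \<open>Any countable index set will do: it is enumerated by natural numbers and the missing indices are filled
with zero coefficients.\<close>

lemma series_leI:
  assumes I: "countable I" and b: "\<And>i. i \<in> I \<Longrightarrow> nb (v i) (N i)"
    and s: "((\<lambda>i. N i * r ^ length (w i)) has_sum M) I"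
    and f: "\<And>h t. (\<And>j. \<bar>h $ j\<bar> \<le> r) \<Longrightarrow> ((\<lambda>i. v i t * vmono (w i) h) has_sum f h t) I"
  shows "series_le nb r f M"
proof -
  define e where "e = to_nat_on I"
  define d where "d = from_nat_into I"
  have inj: "inj_on e I" using I by (simp add: e_def inj_on_to_nat_on)
  have de: "d (e i) = i" if "i \<in> I" for i using that I by (simp add: e_def d_def)
  define v' where "v' n = (if n \<in> e ` I then v (d n) else (\<lambda>_. 0))" for n
  define N' where "N' n = (if n \<in> e ` I then N (d n) else 0)" for n
  define w' where "w' n = w (d n)" for n
  note tr = has_sum_to_nat_on[OF I, folded e_def]
  have "nb (v' n) (N' n)" for n
    using b de by (auto simp: v'_def N'_def nb_zero)
  moreover have "((\<lambda>n. N' n * r ^ length (w' n)) has_sum M) UNIV"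
    by (rule tr[OF s]) (auto simp: N'_def w'_def de)
  moreover have "((\<lambda>n. v' n t * vmono (w' n) h) has_sum f h t) UNIV" if "\<And>j. \<bar>h $ j\<bar> \<le> r" for h t
    by (rule tr[OF f[OF that]]) (auto simp: v'_def w'_def de)
  ultimately show ?thesis
    unfolding series_le_def series_rep_def by (intro exI[of _ v'] exI[of _ w'] exI[of _ N']) (auto simp: has_sum_iff)
qed

lemma series_le_mono: "series_le nb r f M \<Longrightarrow> M \<le> M' \<Longrightarrow> series_le nb r f M'"
proof -
  assume "series_le nb r f M" and M: "M \<le> M'"
  then obtain v w N where "series_rep nb r f M v w N" unfolding series_le_def by blast
  then have "series_rep nb r f M' v w N" using M unfolding series_rep_def by simp
  then show "series_le nb r f M'" unfolding series_le_def by blast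
qed

lemma series_le_cong:
  "series_le nb r f M \<Longrightarrow> (\<And>h t. (\<And>j. \<bar>h $ j\<bar> \<le> r) \<Longrightarrow> f h t = g h t) \<Longrightarrow> series_le nb r g M"
proof -
  assume "series_le nb r f M" and eq: "\<And>h t. (\<And>j. \<bar>h $ j\<bar> \<le> r) \<Longrightarrow> f h t = g h t"
  then obtain v w N where "series_rep nb r f M v w N" unfolding series_le_def by blast
  then have "series_rep nb r g M v w N" using eq unfolding series_rep_def by simp
  then show "series_le nb r g M" unfolding series_le_def by blast
qed

lemma series_le_const: "nb v N \<Longrightarrow> series_le nb r (\<lambda>h. v) N"
  by (rule series_leI[of "{()}" "\<lambda>_. v" "\<lambda>_. N" r "\<lambda>_. []"]) (auto intro!: has_sum_finiteI)

text \<open>The terms of all the series together form one absolutely summable family.\<close>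

lemma series_le_has_sum:
  fixes f :: "'i \<Rightarrow> real ^ 'm \<Rightarrow> real \<Rightarrow> complex"
  assumes r: "0 \<le> r" and I: "countable I" and b: "\<And>i. i \<in> I \<Longrightarrow> series_le nb r (f i) (M i)" and M: "M summable_on I"
    and F: "\<And>h t. (\<And>j. \<bar>h $ j\<bar> \<le> r) \<Longrightarrow> ((\<lambda>i. f i h t) has_sum F h t) I"
  shows "series_le nb r F (infsum M I)"
proof -
  have "\<forall>i\<in>I. \<exists>v w N. series_rep nb r (f i) (M i) v w N"
    using b by (simp add: series_le_def)
  then obtain v w N where rep: "\<And>i. i \<in> I \<Longrightarrow> series_rep nb r (f i) (M i) (v i) (w i) (N i)" by metis
  note nb = series_repD(1)[OF rep] and s = series_repD(2)[OF rep] and le = series_repD(3)[OF rep]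
    and f = series_repD(4)[OF rep]
  define S where "S i = (\<Sum>\<^sub>\<infinity>k. N i k * r ^ length (w i k))" for i
  have nn: "0 \<le> N i k * r ^ length (w i k)" if "i \<in> I" for i k
    using nb_nonneg[OF nb[OF that]] r by simp
  have S: "S summable_on I"
    by (rule summable_on_comparison_test[OF M]) (use le nn in \<open>auto simp: S_def intro: infsum_nonneg\<close>)
  have tot: "((\<lambda>(i, k). N i k * r ^ length (w i k)) has_sum infsum S I) (I \<times> UNIV)"
  proof (rule has_sum_Sigma_nonneg[OF _ S])
    fix i assume i: "i \<in> I"
    show "((\<lambda>y. case (i, y) of (i, k) \<Rightarrow> N i k * r ^ length (w i k)) has_sum S i) UNIV"
      using s[OF i] unfolding S_def by simp
  qed (use nn in auto)
  have "series_le nb r F (infsum S I)"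
  proof (rule series_leI[of "I \<times> UNIV" "\<lambda>(i,k). v i k" "\<lambda>(i,k). N i k" r "\<lambda>(i,k). w i k"])
    show "countable (I \<times> (UNIV::nat set))" using I by simp
    show "((\<lambda>i. (case i of (i, k) \<Rightarrow> N i k) * r ^ length (case i of (i, k) \<Rightarrow> w i k)) has_sum infsum S I) (I \<times> UNIV)"
      using tot by (simp add: case_prod_unfold)
    fix h :: "real ^ 'm" and t assume h: "\<And>j. \<bar>h $ j\<bar> \<le> r"
    let ?T = "\<lambda>(i, k). v i k t * vmono (w i k) h"
    have "(\<lambda>p. norm (?T p)) summable_on (I \<times> UNIV)"
    proof (rule Infinite_Sum.abs_summable_on_comparison_test)
      show "(\<lambda>p. norm (case p of (i, k) \<Rightarrow> C * (N i k * r ^ length (w i k)))) summable_on (I \<times> UNIV)"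
      proof -
        have "(\<lambda>p. C * (case p of (i, k) \<Rightarrow> N i k * r ^ length (w i k))) summable_on (I \<times> UNIV)"
          by (intro summable_on_cmult_right has_sum_imp_summable[OF tot])
        moreover have "norm (case p of (i, k) \<Rightarrow> C * (N i k * r ^ length (w i k)))
            = C * (case p of (i, k) \<Rightarrow> N i k * r ^ length (w i k))" if "p \<in> I \<times> UNIV" for p
          using that nn C_pos by (auto simp: abs_of_nonneg simp del: abs_mult)
        ultimately show ?thesis by (simp cong: summable_on_cong)
      qed
      show "norm (?T p) \<le> norm (case p of (i, k) \<Rightarrow> C * (N i k * r ^ length (w i k)))" if pI: "p \<in> I \<times> UNIV" for p
      proof -
        obtain i k where p: "p = (i, k)" "i \<in> I" using pI by auto
        have "cmod (v i k t * vmono (w i k) h) \<le> (C * N i k) * r ^ length (w i k)"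
          unfolding norm_mult using nb_sup[OF nb[OF p(2)]] norm_vmono_le[OF h] nb_nonneg[OF nb[OF p(2)]] C_pos
          by (intro mult_mono) auto
        also have "\<dots> \<le> \<bar>C * (N i k * r ^ length (w i k))\<bar>" by (simp add: mult.assoc)
        finally show ?thesis by (simp add: p(1))
      qed
    qed
    then have "?T summable_on (I \<times> UNIV)" by (rule Infinite_Sum.abs_summable_summable)
    then have "(?T has_sum F h t) (I \<times> UNIV)"
      by (intro has_sum_SigmaI[OF _ F[OF h]]) (use f[OF _ h] in auto)
    then show "((\<lambda>i. (case i of (i, k) \<Rightarrow> v i k) t * vmono (case i of (i, k) \<Rightarrow> w i k) h) has_sum F h t) (I \<times> UNIV)"
      by (simp add: case_prod_unfold)
  qed (use nb in auto)
  moreover have "infsum S I \<le> infsum M I"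
    using S M le by (intro infsum_mono) (auto simp: S_def)
  ultimately show ?thesis by (rule series_le_mono)
qed

lemma series_le_sum:
  fixes f :: "'i \<Rightarrow> real ^ 'm \<Rightarrow> real \<Rightarrow> complex"
  assumes "0 \<le> r" "finite I" "\<And>i. i \<in> I \<Longrightarrow> series_le nb r (f i) (M i)"
  shows "series_le nb r (\<lambda>h t. \<Sum>i\<in>I. f i h t) (\<Sum>i\<in>I. M i)"
  using series_le_has_sum[of r I f M "\<lambda>h t. \<Sum>i\<in>I. f i h t"] assms
  by (simp add: countable_finite has_sum_finite)

lemma series_le_add:
  assumes "0 \<le> r" "series_le nb r f M" "series_le nb r g N"
  shows "series_le nb r (\<lambda>h t. f h t + g h t) (M + N)"
  using series_le_sum[of r "UNIV :: bool set" "\<lambda>b. if b then f else g" "\<lambda>b. if b then M else N"] assms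
  by (simp add: UNIV_bool add.commute)

lemma series_le_nonneg:
  assumes "0 \<le> r" "series_le nb r f M" shows "0 \<le> M"
proof -
  from assms(2) obtain v w N where rep: "series_rep nb r f M v w N" unfolding series_le_def by blast
  note nb = series_repD(1)[OF rep] and le = series_repD(3)[OF rep]
  have "0 \<le> (\<Sum>\<^sub>\<infinity>k. N k * r ^ length (w k))"
    using nb_nonneg[OF nb] assms(1) by (intro infsum_nonneg) simp
  with le show ?thesis by simp
qed

lemma series_le_sup:
  assumes "0 \<le> r" "series_le nb r f M" "\<And>j. \<bar>h $ j\<bar> \<le> r"
  shows "cmod (f h t) \<le> C * M"
proof -
  from assms(2) obtain v w N where rep: "series_rep nb r f M v w N" unfolding series_le_def by blast
  note nb = series_repD(1)[OF rep] and s = series_repD(2)[OF rep] and le = series_repD(3)[OF rep]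
    and f = series_repD(4)[OF rep assms(3)]
  have "cmod (f h t) \<le> (\<Sum>\<^sub>\<infinity>k. C * (N k * r ^ length (w k)))"
  proof (rule norm_infsum_le[OF f])
    show "((\<lambda>k. C * (N k * r ^ length (w k))) has_sum (\<Sum>\<^sub>\<infinity>k. C * (N k * r ^ length (w k)))) UNIV"
      by (intro has_sum_infsum summable_on_cmult_right s)
    fix k
    have "cmod (v k t * vmono (w k) h) \<le> (C * N k) * r ^ length (w k)"
      unfolding norm_mult using nb_sup[OF nb] norm_vmono_le[OF assms(3)] nb_nonneg[OF nb] C_pos
      by (intro mult_mono) auto
    then show "cmod (v k t * vmono (w k) h) \<le> C * (N k * r ^ length (w k))" by (simp add: mult.assoc)
  qed
  also have "\<dots> = C * (\<Sum>\<^sub>\<infinity>k. N k * r ^ length (w k))" by (rule infsum_cmult_right) (use s in simp)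
  also have "\<dots> \<le> C * M" using le C_pos by simp
  finally show ?thesis .
qed

text \<open>Apart from its value at the origin, a power series tends to zero with the radius, since every remaining
word has positive length. The radius is made uniform over all smaller radii in order to allow a common
choice for finitely many series.\<close>

lemma series_le_shrink:
  fixes f :: "real ^ 'm \<Rightarrow> real \<Rightarrow> complex"
  assumes r0: "0 < r0" and f: "series_le nb r0 f M" and f0: "nb (f 0) M0" and e: "\<epsilon> > 0"
  shows "\<exists>r>0. r \<le> r0 \<and> (\<forall>r'>0. r' \<le> r \<longrightarrow> series_le nb r' f (M0 + \<epsilon>))"
proof -
  from f obtain v w N where rep: "series_rep nb r0 f M v w N" unfolding series_le_def by blast
  note nb = series_repD(1)[OF rep] and s = series_repD(2)[OF rep] and le = series_repD(3)[OF rep]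
    and fs = series_repD(4)[OF rep]
  have Mnn: "0 \<le> M" using series_le_nonneg[OF less_imp_le[OF r0] f] .
  \<comment> \<open>Each term with a nonempty word shrinks at least by the factor \<open>r / r0\<close>.\<close>
  define r where "r = r0 * min 1 (\<epsilon> / (M + 1))"
  have r: "0 < r" "r \<le> r0" using r0 e Mnn by (auto simp: r_def mult_le_cancel_left1 min_def)
  have "series_le nb r' f (M0 + \<epsilon>)" if r': "0 < r'" "r' \<le> r" for r'
  proof -
    define I where "I = {k. w k \<noteq> []}"
    have nn: "0 \<le> N k * r0 ^ length (w k)" for k using nb_nonneg[OF nb] r0 by simp
    have small: "N k * r' ^ length (w k) \<le> r / r0 * (N k * r0 ^ length (w k))" if "k \<in> I" for k
    proof -
      have "w k \<noteq> []" using that by (simp add: I_def)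
      then obtain n where n: "length (w k) = Suc n" by (cases "w k") auto
      have "r' ^ Suc n \<le> r * r0 ^ n"
        using r' r by (auto intro!: mult_mono power_mono)
      also have "\<dots> = r / r0 * r0 ^ Suc n" using r0 by simp
      finally have "N k * r' ^ Suc n \<le> N k * (r / r0 * r0 ^ Suc n)"
        using nb_nonneg[OF nb] by (intro mult_left_mono)
      then show ?thesis using n r0 by (simp add: mult_ac)
    qed
    have sI: "(\<lambda>k. N k * r0 ^ length (w k)) summable_on I" using s by (rule summable_on_subset) simp
    have sI': "(\<lambda>k. N k * r' ^ length (w k)) summable_on I"
      by (rule summable_on_comparison_test[OF summable_on_cmult_right[OF sI, of "r / r0"]])
        (use small nb_nonneg[OF nb] r' in auto)
    have hle: "\<bar>h $ j\<bar> \<le> r0" if "\<And>j. \<bar>h $ j\<bar> \<le> r'" for h :: "real ^ 'm" and j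
      using that[of j] r' r by linarith
    have zero: "((\<lambda>k. v k t * vmono (w k) h) has_sum f 0 t) (- I)" for t and h :: "real ^ 'm"
    proof -
      have "((\<lambda>k. v k t * vmono (w k) 0) has_sum f 0 t) UNIV" by (rule fs) (use r0 in simp)
      then have "((\<lambda>k. v k t * vmono (w k) 0) has_sum f 0 t) (- I)"
        by (rule has_sum_cong_neutral[THEN iffD1, rotated -1]) (auto simp: I_def neq_Nil_conv vmono_Cons)
      then show ?thesis by (rule has_sum_cong[THEN iffD1, rotated]) (auto simp: I_def)
    qed
    have "series_le nb r' (\<lambda>h t. f h t - f 0 t) (\<Sum>\<^sub>\<infinity>k\<in>I. N k * r' ^ length (w k))"
    proof (rule series_leI[of I v N r' w])
      show "((\<lambda>k. N k * r' ^ length (w k)) has_sum (\<Sum>\<^sub>\<infinity>k\<in>I. N k * r' ^ length (w k))) I"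
        using sI' by (rule has_sum_infsum)
      fix h :: "real ^ 'm" and t assume h: "\<And>j. \<bar>h $ j\<bar> \<le> r'"
      have "((\<lambda>k. v k t * vmono (w k) h) has_sum (f h t - f 0 t)) (UNIV - (- I))"
        by (rule has_sum_Diff[OF fs[OF hle[OF h]] zero]) simp
      moreover have "UNIV - (- I) = I" by auto
      ultimately show "((\<lambda>k. v k t * vmono (w k) h) has_sum (f h t - f 0 t)) I" by simp
    qed (auto intro: nb)
    moreover have "(\<Sum>\<^sub>\<infinity>k\<in>I. N k * r' ^ length (w k)) \<le> \<epsilon>"
    proof -
      have "(\<Sum>\<^sub>\<infinity>k\<in>I. N k * r' ^ length (w k)) \<le> (\<Sum>\<^sub>\<infinity>k\<in>I. r / r0 * (N k * r0 ^ length (w k)))"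
        using small by (intro infsum_mono sI' summable_on_cmult_right sI)
      also have "\<dots> = r / r0 * (\<Sum>\<^sub>\<infinity>k\<in>I. N k * r0 ^ length (w k))"
        by (rule infsum_cmult_right) (use sI in simp)
      also have "\<dots> \<le> r / r0 * M"
      proof -
        have "(\<Sum>\<^sub>\<infinity>k\<in>I. N k * r0 ^ length (w k)) \<le> (\<Sum>\<^sub>\<infinity>k. N k * r0 ^ length (w k))"
          using nn by (intro infsum_mono2 sI s) auto
        then show ?thesis using le r r0 by (intro mult_left_mono) auto
      qed
      also have "\<dots> \<le> \<epsilon> / (M + 1) * M"
        using r0 Mnn by (intro mult_right_mono) (auto simp: r_def)
      also have "\<dots> \<le> \<epsilon>" using e Mnn by (simp add: field_simps)
      finally show ?thesis .
    qed
    ultimately have "series_le nb r' (\<lambda>h t. f h t - f 0 t) \<epsilon>" by (rule series_le_mono)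
    from series_le_add[OF _ series_le_const[OF f0] this] r'(1) show ?thesis by simp
  qed
  then show ?thesis using r by blast
qed

end

locale sobolev_multipliers = periodic +
  fixes l :: nat
  assumes l_pos: "l \<ge> 1"
begin

abbreviation "H \<equiv> sob_le l"
abbreviation "A \<equiv> mult_le l"

lemma sup_H: "H v N \<Longrightarrow> cmod (v t) \<le> sob_const * N"
  using l_pos sob_le_sup by (cases l) auto

sublocale H: coeff_bound H sob_const
proof
  show "H (\<lambda>_. 0) 0" by (rule sob_le_0)
  show "0 < sob_const" using sob_const_ge_1 by simp
qed (fact sob_leD(2) sup_H)+

sublocale A: coeff_bound A sob_const
proof
  show "A (\<lambda>_. 0) 0" using mult_le_const[of l 0] by simp
  show "0 < sob_const" using sob_const_ge_1 by simp
  show "0 \<le> N" if "A v N" for v N using that by (simp add: mult_le_def)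
  show "cmod (v t) \<le> sob_const * N" if "A v N" for v N t
    using sup_H[OF mult_le_imp_sob_le[OF that]] .
qed

lemma series_le_coord: 
  assumes "0 \<le> r" shows "series_le A r (\<lambda>(h :: real ^ 'm) t. of_real (h $ j)) r"
proof (rule A.series_leI[of "{()}" "\<lambda>_ _. 1" "\<lambda>_. 1" r "\<lambda>_. [j]"])
  show "A (\<lambda>_. 1) 1" using mult_le_const[of l 1] by simp
  show "((\<lambda>i. 1 * r ^ length [j]) has_sum r) {()}" by (rule has_sum_finiteI) auto
  show "((\<lambda>i. 1 * vmono [j] h) has_sum complex_of_real (h $ j)) {()}" for h :: "real ^ 'm"
    by (rule has_sum_finiteI) (auto simp: vmono_Cons)
qed simp

text \<open>Each term of \<open>f\<close> multiplies the series of \<open>g\<close>, and the resulting series are summed. Multiplicativity of the coefficient bounds is a hypothesis, so that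
one proof covers multipliers times multipliers and multipliers times functions in \<open>H\<^sup>l\<close>.\<close>

lemma series_le_product:
  fixes f g :: "real ^ 'm \<Rightarrow> real \<Rightarrow> complex"
  assumes r: "0 \<le> r" and cb: "coeff_bound nb C" and mult: "\<And>a v M N. A a M \<Longrightarrow> nb v N \<Longrightarrow> nb (\<lambda>t. a t * v t) (M * N)"
    and f: "series_le A r f M" and g: "series_le nb r g N"
  shows "series_le nb r (\<lambda>h t. f h t * g h t) (M * N)"
proof -
  interpret B: coeff_bound nb C by fact
  from f obtain a u P where rep: "series_rep A r f M a u P" unfolding series_le_def by blast
  note nA = series_repD(1)[OF rep] and sA = series_repD(2)[OF rep] and leA = series_repD(3)[OF rep]
    and fA = series_repD(4)[OF rep]
  have ga: "series_le nb r (\<lambda>h t. (a k t * vmono (u k) h) * g h t) ((P k * r ^ length (u k)) * N)" for k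
  proof -
    from g obtain v w Q where rep: "series_rep nb r g N v w Q" unfolding series_le_def by blast
    note nB = series_repD(1)[OF rep] and sB = series_repD(2)[OF rep] and leB = series_repD(3)[OF rep]
      and fB = series_repD(4)[OF rep]
    have "series_le nb r (\<lambda>h t. (a k t * vmono (u k) h) * g h t) ((P k * r ^ length (u k)) * (\<Sum>\<^sub>\<infinity>k. Q k * r ^ length (w k)))"
    proof (rule B.series_leI[of UNIV "\<lambda>i t. a k t * v i t" "\<lambda>i. P k * Q i" r "\<lambda>i. u k @ w i"])
      show "nb (\<lambda>t. a k t * v i t) (P k * Q i)" for i using mult nA nB by blast
      have "((\<lambda>i. (P k * r ^ length (u k)) * (Q i * r ^ length (w i))) has_sum
          ((P k * r ^ length (u k)) * (\<Sum>\<^sub>\<infinity>k. Q k * r ^ length (w k)))) UNIV"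
        by (intro has_sum_cmult_right has_sum_infsum sB)
      then show "((\<lambda>i. P k * Q i * r ^ length (u k @ w i)) has_sum
          ((P k * r ^ length (u k)) * (\<Sum>\<^sub>\<infinity>k. Q k * r ^ length (w k)))) UNIV"
        by (simp add: power_add mult_ac)
      fix h :: "real ^ 'm" and t assume h: "\<And>j. \<bar>h $ j\<bar> \<le> r"
      have "((\<lambda>i. (a k t * vmono (u k) h) * (v i t * vmono (w i) h)) has_sum ((a k t * vmono (u k) h) * g h t)) UNIV"
        by (intro has_sum_cmult_right fB h)
      then show "((\<lambda>i. a k t * v i t * vmono (u k @ w i) h) has_sum ((a k t * vmono (u k) h) * g h t)) UNIV"
        by (simp add: vmono_append mult_ac)
    qed simp
    moreover have "0 \<le> P k * r ^ length (u k)" using A.nb_nonneg[OF nA] r by simp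
    ultimately show ?thesis
      using mult_left_mono[OF leB] B.series_le_mono by blast
  qed
  have Nnn: "0 \<le> N" by (rule B.series_le_nonneg[OF r g])
  have 1: "series_le nb r (\<lambda>h t. f h t * g h t) (\<Sum>\<^sub>\<infinity>k. (P k * r ^ length (u k)) * N)"
  proof (rule B.series_le_has_sum[OF r _ ga])
    show "(\<lambda>k. P k * r ^ length (u k) * N) summable_on UNIV"
      by (intro summable_on_cmult_left sA)
    show "((\<lambda>k. a k t * vmono (u k) h * g h t) has_sum f h t * g h t) UNIV" if "\<And>j. \<bar>h $ j\<bar> \<le> r" for h t
      by (intro has_sum_cmult_left fA that)
  qed simp
  have "(\<Sum>\<^sub>\<infinity>k. (P k * r ^ length (u k)) * N) = (\<Sum>\<^sub>\<infinity>k. P k * r ^ length (u k)) * N"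
    by (rule infsum_cmult_left) (use sA in simp)
  also have "\<dots> \<le> M * N" using leA Nnn by (intro mult_right_mono)
  finally show ?thesis using 1 by (rule B.series_le_mono[rotated])
qed

lemma series_le_mult_H:
  "0 \<le> r \<Longrightarrow> series_le A r f M \<Longrightarrow> series_le H r g N \<Longrightarrow> series_le H r (\<lambda>h t. f h t * g h t) (M * N)"
  by (rule series_le_product[OF _ H.coeff_bound_axioms mult_le_sob_le])

lemma series_le_mult_A:
  "0 \<le> r \<Longrightarrow> series_le A r f M \<Longrightarrow> series_le A r g N \<Longrightarrow> series_le A r (\<lambda>h t. f h t * g h t) (M * N)"
  by (rule series_le_product[OF _ A.coeff_bound_axioms mult_le_mult])

lemma series_le_cmult_A:
  "0 \<le> r \<Longrightarrow> series_le A r g N \<Longrightarrow> series_le A r (\<lambda>h t. c * g h t) (cmod c * N)"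
  using series_le_mult_A[OF _ A.series_le_const[OF mult_le_const]] .

lemma series_le_cmult_H:
  "0 \<le> r \<Longrightarrow> series_le H r g N \<Longrightarrow> series_le H r (\<lambda>h t. c * g h t) (cmod c * N)"
  using series_le_mult_H[OF _ A.series_le_const[OF mult_le_const]] .

lemma series_le_A_imp_H:
  assumes "series_le A r f M" shows "series_le H r f M"
proof -
  from assms obtain v w N where rep: "series_rep A r f M v w N" unfolding series_le_def by blast
  have "H (v i) (N i)" for i by (rule mult_le_imp_sob_le[OF series_repD(1)[OF rep]])
  then have "series_rep H r f M v w N" using rep unfolding series_rep_def by simp
  then show ?thesis unfolding series_le_def by blast
qed

lemma series_le_eval:
  assumes r: "0 \<le> r" and f: "series_le H r f M" and h: "\<And>j. \<bar>h $ j\<bar> \<le> r"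
  shows "H (f h) M"
proof -
  from f obtain v w N where rep: "series_rep H r f M v w N" unfolding series_le_def by blast
  note nb = series_repD(1)[OF rep] and s = series_repD(2)[OF rep] and le = series_repD(3)[OF rep]
    and fs = series_repD(4)[OF rep h]
  have "H (f h) (\<Sum>\<^sub>\<infinity>k. N k * r ^ length (w k))"
  proof (rule sob_le_has_sum[where f = "\<lambda>k t. v k t * vmono (w k) h", OF l_pos])
    show "(\<lambda>k. N k * r ^ length (w k)) summable_on UNIV" by (rule s)
    show "((\<lambda>k. v k t * vmono (w k) h) has_sum f h t) UNIV" for t by (rule fs)
    fix k
    have "H (\<lambda>t. vmono (w k) h * v k t) (cmod (vmono (w k) h) * N k)" by (rule sob_le_cmult[OF nb])
    moreover have "cmod (vmono (w k) h) * N k \<le> N k * r ^ length (w k)"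
      using norm_vmono_le[OF h, of "w k"] H.nb_nonneg[OF nb, of k] by (simp add: mult.commute mult_left_mono)
    ultimately show "H (\<lambda>t. v k t * vmono (w k) h) (N k * r ^ length (w k))"
      using sob_le_mono[of l "\<lambda>t. vmono (w k) h * v k t"] by (simp add: mult.commute)
  qed
  then show ?thesis using le by (rule sob_le_mono)
qed

text \<open>The solution of \<open>R = g + E R\<close> is the Neumann series \<open>\<Sum>\<^sub>n E\<^sup>n g\<close>, all of whose terms are normally convergent
power series with geometrically decreasing bounds. Pointwise it converges to the given \<open>R\<close> because \<open>E\<close> is
a pointwise contraction; this is where the factor \<open>sob_const\<close> in the smallness condition enters.\<close>

lemma series_le_fixed_point:
  fixes R g :: "'m::finite \<Rightarrow> real ^ 'n \<Rightarrow> real \<Rightarrow> complex"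
  assumes r: "0 \<le> r"
    and E: "\<And>i j. series_le A r (E i j) \<theta>" and \<theta>: "sob_const * real CARD('m) * \<theta> \<le> 1 / 2"
    and g: "\<And>i. series_le H r (g i) M"
    and R: "\<And>i h t. (\<And>j. \<bar>h $ j\<bar> \<le> r) \<Longrightarrow> R i h t = g i h t + (\<Sum>j\<in>UNIV. E i j h t * R j h t)"
  shows "series_le H r (R i) (2 * M)"
proof -
  have \<theta>nn: "0 \<le> \<theta>" using A.series_le_nonneg[OF r E] .
  have \<theta>': "real CARD('m) * \<theta> \<le> 1 / 2"
  proof -
    have "1 * (real CARD('m) * \<theta>) \<le> sob_const * (real CARD('m) * \<theta>)"
      using sob_const_ge_1 \<theta>nn by (intro mult_right_mono) auto
    then show ?thesis using \<theta> unfolding mult.assoc mult_1 by (rule order_trans)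
  qed
  have Mnn: "0 \<le> M" using H.series_le_nonneg[OF r g] .
  define G where "G = rec_nat g (\<lambda>_ G i h t. \<Sum>j\<in>UNIV. E i j h t * G j h t)"
  have G0: "G 0 = g" and GS: "G (Suc n) = (\<lambda>i h t. \<Sum>j\<in>UNIV. E i j h t * G n j h t)" for n
    by (simp_all add: G_def)
  have bG: "series_le H r (G n i) (M * (1 / 2) ^ n)" for n i
  proof (induction n arbitrary: i)
    case 0 then show ?case using g G0 by simp
  next
    case (Suc n)
    have "series_le H r (\<lambda>h t. \<Sum>j\<in>UNIV. E i j h t * G n j h t) (\<Sum>j\<in>(UNIV::'m set). \<theta> * (M * (1 / 2) ^ n))"
      using r E Suc by (intro H.series_le_sum series_le_mult_H) auto
    moreover have "(\<Sum>j\<in>(UNIV::'m set). \<theta> * (M * (1 / 2) ^ n)) \<le> M * (1 / 2) ^ Suc n"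
      using mult_right_mono[OF \<theta>', of "M * (1/2)^n"] Mnn by (simp add: mult_ac)
    ultimately show ?case unfolding GS by (rule H.series_le_mono)
  qed
  have conv: "((\<lambda>n. G n i h t) has_sum R i h t) UNIV" if h: "\<And>j. \<bar>h $ j\<bar> \<le> r" for h t i
  proof (rule norm_summable_imp_has_sum)
    have bnd: "cmod (G n i h t) \<le> sob_const * M * (1 / 2) ^ n" for n i
      using H.series_le_sup[OF r bG h] by (simp add: mult.assoc)
    show "summable (\<lambda>n. cmod (G n i h t))"
      by (rule summable_comparison_test'[where g = "\<lambda>n. sob_const * M * (1/2)^n" and N = 0])
        (use bnd in \<open>auto intro!: summable_mult summable_geometric\<close>)
    define B where "B = (\<Sum>j\<in>UNIV. cmod (R j h t))"
    have D: "cmod (R i h t - (\<Sum>k<n. G k i h t)) \<le> B * (1 / 2) ^ n" for n i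
    proof (induction n arbitrary: i)
      case 0 show ?case using member_le_sum[of i UNIV "\<lambda>j. cmod (R j h t)"] by (simp add: B_def)
    next
      case (Suc n)
      have "R i h t - (\<Sum>k<Suc n. G k i h t) = (\<Sum>j\<in>UNIV. E i j h t * (R j h t - (\<Sum>k<n. G k j h t)))"
      proof -
        have "(\<Sum>k<n. G (Suc k) i h t) = (\<Sum>j\<in>UNIV. E i j h t * (\<Sum>k<n. G k j h t))"
          unfolding GS by (subst sum.swap) (simp add: sum_distrib_left)
        then show ?thesis
          using R[OF h, where i=i and t=t] unfolding sum.lessThan_Suc_shift
          by (simp add: G0 right_diff_distrib sum_subtractf)
      qed
      also have "cmod \<dots> \<le> (\<Sum>j\<in>(UNIV::'m set). (sob_const * \<theta>) * (B * (1 / 2) ^ n))"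
        using A.series_le_sup[OF r E h] Suc sob_const_ge_1 \<theta>nn
        by (intro order_trans[OF norm_sum] sum_mono) (auto simp: norm_mult intro!: mult_mono)
      also have "\<dots> = (sob_const * real CARD('m) * \<theta>) * (B * (1 / 2) ^ n)" by simp
      also have "\<dots> \<le> 1 / 2 * (B * (1 / 2) ^ n)"
        using \<theta> by (intro mult_right_mono) (auto simp: B_def intro!: mult_nonneg_nonneg sum_nonneg)
      finally show ?case by simp
    qed
    have "(\<lambda>n. B * (1 / 2) ^ n) \<longlonglongrightarrow> B * 0"
      by (intro tendsto_intros) auto
    then have "(\<lambda>n. B * (1 / 2) ^ n) \<longlonglongrightarrow> 0" by simp
    then have "(\<lambda>n. R i h t - (\<Sum>k<n. G k i h t)) \<longlonglongrightarrow> 0"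
      by (rule Lim_null_comparison[rotated]) (use D in auto)
    then have "(\<lambda>n. R i h t - (R i h t - (\<Sum>k<n. G k i h t))) \<longlonglongrightarrow> R i h t - 0"
      by (intro tendsto_diff tendsto_const)
    then show "(\<lambda>n. G n i h t) sums R i h t" by (simp add: sums_def)
  qed
  have geo: "((\<lambda>n. M * (1 / 2) ^ n) has_sum 2 * M) UNIV"
  proof (rule norm_summable_imp_has_sum)
    show "(\<lambda>n. M * (1 / 2) ^ n) sums (2 * M)"
      using sums_mult[OF geometric_sums[of "1/2 :: real"], of M] by (simp add: mult.commute)
    then show "summable (\<lambda>n. norm (M * (1 / 2) ^ n))" using Mnn by (simp add: sums_iff)
  qed
  have "series_le H r (R i) (\<Sum>\<^sub>\<infinity>n. M * (1 / 2) ^ n)"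
    by (rule H.series_le_has_sum[OF r _ bG _ conv]) (use geo in \<open>auto simp: has_sum_iff\<close>)
  then show ?thesis using geo by (simp add: has_sum_iff)
qed

end

section \<open>Symmetric forms of a power series\<close>

lemma prod_nth_list: "(\<Prod>k<length xs. f (xs ! k)) = prod_list (map f xs)"
  by (induction xs) (auto simp: prod.lessThan_Suc_shift simp del: prod.lessThan_Suc)

text \<open>The symmetrization of \<open>(u\<^sub>1, \<dots>, u\<^sub>q) \<mapsto> \<Prod>\<^sub>k (u\<^sub>k)\<^sub>j\<^sub>k\<close>, where \<open>w = [j\<^sub>1, \<dots>, j\<^sub>q]\<close>, that is, the
polarization of the monomial of \<open>w\<close>.\<close>

definition sym_form :: "'m list \<Rightarrow> (real ^ 'm) list \<Rightarrow> real" where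
  "sym_form w us = (\<Sum>p | p permutes {..<length w}. \<Prod>k<length w. us ! p k $ (w ! k)) / fact (length w)"

lemma sym_form_linear:
  assumes "length us = length w" "i < length w"
  shows "linear (\<lambda>x. sym_form w (us[i := x]))"
proof -
  have "linear (\<lambda>x. \<Prod>k<length w. us[i := x] ! p k $ (w ! k))" if p: "p permutes {..<length w}" for p
  proof -
    define k0 where "k0 = inv p i"
    have k0: "p k0 = i" "k0 < length w"
      using permutes_inverses(1)[OF p, of i] permutes_in_image[OF permutes_inv[OF p], of i] assms
      by (simp_all add: k0_def)
    have other: "p k \<noteq> i" if "k \<noteq> k0" for k
      using that k0 permutes_inj[OF p] by (metis injD)
    have "(\<Prod>k<length w. us[i := x] ! p k $ (w ! k)) = (\<Prod>k\<in>{..<length w} - {k0}. us ! p k $ (w ! k)) * x $ (w ! k0)" for x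
    proof -
      have "(\<Prod>k<length w. us[i := x] ! p k $ (w ! k)) = us[i := x] ! p k0 $ (w ! k0) * (\<Prod>k\<in>{..<length w} - {k0}. us[i := x] ! p k $ (w ! k))"
        using k0 by (intro prod.remove) auto
      also have "(\<Prod>k\<in>{..<length w} - {k0}. us[i := x] ! p k $ (w ! k)) = (\<Prod>k\<in>{..<length w} - {k0}. us ! p k $ (w ! k))"
      proof (rule prod.cong)
        fix k assume "k \<in> {..<length w} - {k0}"
        then have "i \<noteq> p k" using other[of k] by auto
        then show "us[i := x] ! p k $ (w ! k) = us ! p k $ (w ! k)" by simp
      qed simp
      finally show ?thesis using k0 assms by simp
    qed
    then show ?thesis by (simp add: linear_iff algebra_simps)
  qed
  then have "linear (\<lambda>x. \<Sum>p | p permutes {..<length w}. \<Prod>k<length w. us[i := x] ! p k $ (w ! k))"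
    by (intro linear_compose_sum) auto
  then show ?thesis unfolding sym_form_def
    by (simp add: linear_iff add_divide_distrib)
qed

lemma sym_form_mset:
  assumes "length us = length w" "mset us = mset vs"
  shows "sym_form w us = sym_form w vs"
proof -
  have len: "length vs = length w" using assms by (metis mset_eq_length)
  obtain q where q: "q permutes {..<length vs}" "permute_list q vs = us"
    using mset_eq_permutation[OF assms(2)] .
  have "(\<Prod>k<length w. us ! p k $ (w ! k)) = (\<Prod>k<length w. vs ! (q \<circ> p) k $ (w ! k))"
    if p: "p permutes {..<length w}" for p
  proof (rule prod.cong)
    fix k assume "k \<in> {..<length w}"
    then have "p k < length vs" using permutes_in_image[OF p, of k] len by simp
    then show "us ! p k $ (w ! k) = vs ! (q \<circ> p) k $ (w ! k)"
      using permute_list_nth[OF q(1), of "p k"] q(2) by simp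
  qed simp
  then have "(\<Sum>p | p permutes {..<length w}. \<Prod>k<length w. us ! p k $ (w ! k))
      = (\<Sum>p | p permutes {..<length w}. \<Prod>k<length w. vs ! (q \<circ> p) k $ (w ! k))"
    by (intro sum.cong) auto
  also have "\<dots> = (\<Sum>p | p permutes {..<length w}. \<Prod>k<length w. vs ! p k $ (w ! k))"
    using setum_permutations_compose_left[of q "{..<length w}" "\<lambda>p. \<Prod>k<length w. vs ! p k $ (w ! k)"] q(1) len by simp
  finally show ?thesis by (simp add: sym_form_def)
qed

lemma sym_form_replicate: "of_real (sym_form w (replicate (length w) h)) = vmono w h"
proof -
  have "(\<Prod>k<length w. replicate (length w) h ! p k $ (w ! k)) = (\<Prod>j\<leftarrow>w. h $ j)"
    if p: "p permutes {..<length w}" for p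
  proof -
    have "(\<Prod>k<length w. replicate (length w) h ! p k $ (w ! k)) = (\<Prod>k<length w. h $ (w ! k))"
      using permutes_in_image[OF p] by (intro prod.cong) auto
    also have "\<dots> = (\<Prod>j\<leftarrow>w. h $ j)"
      by (rule prod_nth_list)
    finally show ?thesis .
  qed
  then have "sym_form w (replicate (length w) h) = (\<Prod>j\<leftarrow>w. h $ j)"
    by (simp add: sym_form_def card_permutations)
  moreover have "complex_of_real (\<Prod>j\<leftarrow>w. h $ j) = vmono w h" by (induction w) (simp_all add: vmono_Cons)
  ultimately show ?thesis by simp
qed

lemma abs_sym_form_le:
  assumes "length us = length w"
  shows "\<bar>sym_form w us\<bar> \<le> prod_list (map norm us)"
proof -
  have "\<bar>\<Prod>k<length w. us ! p k $ (w ! k)\<bar> \<le> prod_list (map norm us)" if p: "p permutes {..<length w}" for p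
  proof -
    have "\<bar>\<Prod>k<length w. us ! p k $ (w ! k)\<bar> \<le> (\<Prod>k<length w. norm (us ! p k))"
      unfolding abs_prod by (intro prod_mono) (simp add: component_le_norm_cart)
    also have "\<dots> = (\<Prod>k<length w. norm (us ! k))"
      using prod.permute[OF p, of "\<lambda>k. norm (us ! k)"] by (simp add: o_def)
    also have "\<dots> = prod_list (map norm us)"
      unfolding assms[symmetric] by (rule prod_nth_list)
    finally show ?thesis .
  qed
  then have "\<bar>\<Sum>p | p permutes {..<length w}. \<Prod>k<length w. us ! p k $ (w ! k)\<bar>
      \<le> (\<Sum>p | p permutes {..<length w}. prod_list (map norm us))"
    by (intro order_trans[OF sum_abs] sum_mono) auto
  then show ?thesis by (simp add: sym_form_def card_permutations divide_simps mult.commute)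
qed

lemma linear_has_sum:
  fixes G :: "'i \<Rightarrow> 'a::real_vector \<Rightarrow> real"
  assumes "\<And>i. i \<in> I \<Longrightarrow> linear (G i)" "\<And>x. (\<lambda>i. G i x) summable_on I"
  shows "linear (\<lambda>x. infsum (\<lambda>i. G i x) I)"
proof (rule linearI)
  fix x y :: 'a and c :: real
  have "infsum (\<lambda>i. G i (x + y)) I = infsum (\<lambda>i. G i x + G i y) I"
    using assms(1) by (intro infsum_cong) (simp add: linear_add)
  then show "infsum (\<lambda>i. G i (x + y)) I = infsum (\<lambda>i. G i x) I + infsum (\<lambda>i. G i y) I"
    using assms(2) by (simp add: infsum_add)
  have "infsum (\<lambda>i. G i (c *\<^sub>R x)) I = infsum (\<lambda>i. c * G i x) I"
    using assms(1) by (intro infsum_cong) (simp add: linear_scale)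
  then show "infsum (\<lambda>i. G i (c *\<^sub>R x)) I = c *\<^sub>R infsum (\<lambda>i. G i x) I"
    using infsum_cmult_right[of c "\<lambda>i. G i x" I] assms(2)[of x] by simp
qed

context periodic
begin

lemma sob_le_Re:
  assumes "sob_le l f M" shows "sob_le l (\<lambda>t. of_real (Re (f t))) M"
proof -
  have "sob_le l (\<lambda>t. (1/2) * (f t + cnj (f t))) (cmod (1/2) * (M + M))"
    by (intro sob_le_cmult sob_le_add sob_le_cnj assms)
  moreover have "(\<lambda>t. (1/2) * (f t + cnj (f t))) = (\<lambda>t. of_real (Re (f t)))"
    by (auto simp: complex_eq_iff)
  ultimately show ?thesis by simp
qed

end

context sobolev_multipliers
begin

text \<open>The form of degree \<open>q\<close> collects the polarized monomials of all words of length \<open>q\<close>. Its bound is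
that of the monomials, because polarization does not increase the norm of a monomial.\<close>

lemma symmetric_forms_of_series:
  fixes f :: "real ^ 'm \<Rightarrow> real \<Rightarrow> real"
  assumes r: "0 < r" and f: "series_le H r (\<lambda>h t. of_real (f h t)) M"
  obtains Z :: "nat \<Rightarrow> real \<Rightarrow> (real ^ 'm) list \<Rightarrow> real" where
    "\<And>q t us i. length us = q \<Longrightarrow> i < q \<Longrightarrow> linear (\<lambda>x. Z q t (us[i := x]))"
    "\<And>q t us vs. length us = q \<Longrightarrow> mset us = mset vs \<Longrightarrow> Z q t us = Z q t vs"
    "\<And>q us. length us = q \<Longrightarrow> H (\<lambda>t. of_real (Z q t us)) (M / r ^ q * prod_list (map norm us))"
    "\<And>h t. (\<And>j. \<bar>h $ j\<bar> \<le> r) \<Longrightarrow> (\<lambda>q. Z q t (replicate q h)) sums f h t"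
proof -
  from f obtain v w N where rep: "series_rep H r (\<lambda>h t. of_real (f h t)) M v w N"
    unfolding series_le_def by blast
  note nb = series_repD(1)[OF rep] and s = series_repD(2)[OF rep] and le = series_repD(3)[OF rep]
    and fs = series_repD(4)[OF rep]
  have N0: "0 \<le> N i" for i by (rule H.nb_nonneg[OF nb])
  define I where "I q = {i. length (w i) = q}" for q
  define Z where "Z q t us = (\<Sum>\<^sub>\<infinity>i\<in>I q. Re (v i t) * sym_form (w i) us)" for q t us
  have sN: "N summable_on I q" for q
  proof -
    have "(\<lambda>i. N i * r ^ length (w i)) summable_on I q" using s by (rule summable_on_subset) simp
    then have "(\<lambda>i. N i * r ^ q) summable_on I q"
      by (rule summable_on_cong[THEN iffD1, rotated]) (simp add: I_def)
    then have "(\<lambda>i. N i * r ^ q * inverse (r ^ q)) summable_on I q" by (rule summable_on_cmult_left)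
    then show ?thesis using r by (simp add: mult.assoc)
  qed
  have leN: "infsum N (I q) \<le> M / r ^ q" for q
  proof -
    have "infsum N (I q) * r ^ q = (\<Sum>\<^sub>\<infinity>i\<in>I q. N i * r ^ q)"
      by (rule infsum_cmult_left[symmetric]) (use sN in simp)
    also have "\<dots> = (\<Sum>\<^sub>\<infinity>i\<in>I q. N i * r ^ length (w i))"
      by (rule infsum_cong) (simp add: I_def)
    also have "\<dots> \<le> (\<Sum>\<^sub>\<infinity>i. N i * r ^ length (w i))"
      using N0 r by (intro infsum_mono2 s summable_on_subset[OF s]) auto
    also have "\<dots> \<le> M" by (rule le)
    finally show ?thesis using r by (simp add: field_simps)
  qed
  have bnd: "\<bar>Re (v i t) * sym_form (w i) us\<bar> \<le> sob_const * prod_list (map norm us) * N i"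
    if "i \<in> I q" "length us = q" for i q t us
  proof -
    have "\<bar>Re (v i t) * sym_form (w i) us\<bar> \<le> (sob_const * N i) * prod_list (map norm us)"
      unfolding abs_mult
      using order_trans[OF abs_Re_le_cmod sup_H[OF nb]] abs_sym_form_le[of us "w i"] that sob_const_ge_1 N0[of i]
      by (intro mult_mono) (auto simp: I_def)
    then show ?thesis by (simp add: mult_ac)
  qed
  have sZ: "(\<lambda>i. Re (v i t) * sym_form (w i) us) summable_on I q" if "length us = q" for q t us
  proof -
    have "(\<lambda>i. norm (Re (v i t) * sym_form (w i) us)) summable_on I q"
      by (rule summable_on_comparison_test[OF summable_on_cmult_right[OF sN, of "sob_const * prod_list (map norm us)"]])
        (use bnd that in auto)
    then show ?thesis by (rule Infinite_Sum.abs_summable_summable)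
  qed
  show thesis
  proof (rule that)
    show "linear (\<lambda>x. Z q t (us[i := x]))" if "length us = q" "i < q" for q t us i
      unfolding Z_def
    proof (rule linear_has_sum)
      show "linear (\<lambda>x. Re (v k t) * sym_form (w k) (us[i := x]))" if "k \<in> I q" for k
        using sym_form_linear[of us "w k" i] that \<open>length us = q\<close> \<open>i < q\<close>
        by (simp add: I_def linear_iff algebra_simps)
    qed (use sZ that in simp)
    show "Z q t us = Z q t vs" if "length us = q" "mset us = mset vs" for q t us vs
      unfolding Z_def using that by (intro infsum_cong) (metis (mono_tags) I_def mem_Collect_eq sym_form_mset)
    show "H (\<lambda>t. of_real (Z q t us)) (M / r ^ q * prod_list (map norm us))" if us: "length us = q" for q us
    proof -
      let ?P = "prod_list (map norm us)"
      have P0: "0 \<le> ?P" by (rule prod_list_nonneg) auto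
      have "H (\<lambda>t. of_real (Z q t us)) (\<Sum>\<^sub>\<infinity>i\<in>I q. ?P * N i)"
      proof (rule sob_le_has_sum[where f = "\<lambda>i t. of_real (Re (v i t) * sym_form (w i) us)", OF l_pos])
        show "(\<lambda>i. ?P * N i) summable_on I q" by (rule summable_on_cmult_right[OF sN])
        show "((\<lambda>i. complex_of_real (Re (v i t) * sym_form (w i) us)) has_sum of_real (Z q t us)) (I q)" for t
          unfolding Z_def by (intro has_sum_of_real has_sum_infsum sZ us)
        fix i assume i: "i \<in> I q"
        have "H (\<lambda>t. of_real (sym_form (w i) us) * of_real (Re (v i t))) (cmod (of_real (sym_form (w i) us)) * N i)"
          by (intro sob_le_cmult sob_le_Re nb)
        moreover have "cmod (of_real (sym_form (w i) us)) * N i \<le> ?P * N i"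
          using abs_sym_form_le[of us "w i"] i us N0 by (intro mult_right_mono) (auto simp: I_def)
        ultimately have "H (\<lambda>t. of_real (sym_form (w i) us) * of_real (Re (v i t))) (?P * N i)"
          by (rule sob_le_mono)
        then show "H (\<lambda>t. complex_of_real (Re (v i t) * sym_form (w i) us)) (?P * N i)"
          by (simp add: mult.commute)
      qed
      moreover have "(\<Sum>\<^sub>\<infinity>i\<in>I q. ?P * N i) = ?P * infsum N (I q)"
        by (rule infsum_cmult_right) (use sN in simp)
      moreover have "?P * infsum N (I q) \<le> M / r ^ q * ?P"
        using mult_left_mono[OF leN P0, of q] by (simp add: mult.commute)
      ultimately show ?thesis using sob_le_mono by simp
    qed
    show "(\<lambda>q. Z q t (replicate q h)) sums f h t" if h: "\<And>j. \<bar>h $ j\<bar> \<le> r" for h t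
    proof -
      let ?F = "\<lambda>i. Re (v i t) * sym_form (w i) (replicate (length (w i)) h)"
      have "((\<lambda>i. Re (v i t * vmono (w i) h)) has_sum Re (of_real (f h t))) UNIV"
        by (rule has_sum_Re[OF fs[OF h]])
      moreover have "Re (v i t * vmono (w i) h) = ?F i" for i
        by (simp flip: sym_form_replicate)
      ultimately have "(?F has_sum f h t) UNIV" by simp
      moreover have "bij_betw snd (Sigma UNIV I) UNIV"
        by (rule bij_betw_byWitness[where f' = "\<lambda>i. (length (w i), i)"]) (auto simp: I_def)
      ultimately have "((\<lambda>p. ?F (snd p)) has_sum f h t) (Sigma UNIV I)"
        by (subst has_sum_reindex_bij_betw)
      then have "((\<lambda>q. Z q t (replicate q h)) has_sum f h t) UNIV"
      proof (rule has_sum_SigmaD)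
        fix q :: nat
        have "((\<lambda>i. Re (v i t) * sym_form (w i) (replicate q h)) has_sum Z q t (replicate q h)) (I q)"
          unfolding Z_def by (intro has_sum_infsum sZ) simp
        then show "((\<lambda>y. ?F (snd (q, y))) has_sum Z q t (replicate q h)) (I q)"
          by (rule has_sum_cong[THEN iffD1, rotated]) (simp add: I_def)
      qed
      then show ?thesis by (rule has_sum_imp_sums)
    qed
  qed
qed

lemma analytic_class_of_series:
  fixes F :: "real ^ 'm \<Rightarrow> real \<Rightarrow> real ^ 'm"
  assumes r: "0 < r" and F: "\<And>j. series_le H r (\<lambda>h t. of_real (F h t $ j)) M"
  shows "analytic_class (cball 0 r) T l (real CARD('m) * M + 1) r F"
proof -
  have M0: "0 \<le> M" by (rule H.series_le_nonneg[OF less_imp_le[OF r] F])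
  define P where "P j Z \<longleftrightarrow> (\<forall>q t us i. length us = q \<longrightarrow> i < q \<longrightarrow> linear (\<lambda>x. Z q t (us[i := x]))) \<and>
    (\<forall>q t us vs. length us = q \<longrightarrow> mset us = mset vs \<longrightarrow> Z q t us = (Z q t vs :: real)) \<and>
    (\<forall>q us. length us = q \<longrightarrow> H (\<lambda>t. of_real (Z q t us)) (M / r ^ q * prod_list (map norm us))) \<and>
    (\<forall>h t. (\<forall>j. \<bar>h $ j\<bar> \<le> r) \<longrightarrow> (\<lambda>q. Z q t (replicate q h)) sums (F h t $ j))" for j Z
  have "\<exists>Z. P j Z" for j
    unfolding P_def by (rule symmetric_forms_of_series[OF r F[of j]]) blast
  then obtain Z where Z: "\<And>j. P j (Z j)" by metis
  note ZD = Z[unfolded P_def]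
  note Z1 = ZD[THEN conjunct1, rule_format] and Z2 = ZD[THEN conjunct2, THEN conjunct1, rule_format]
    and Z3 = ZD[THEN conjunct2, THEN conjunct2, THEN conjunct1, rule_format]
    and Z4 = ZD[THEN conjunct2, THEN conjunct2, THEN conjunct2, rule_format]
  define W where "W q t us = (\<chi> j. Z j q t us)" for q t us
  show ?thesis
    unfolding analytic_class_def
  proof (intro conjI exI[of _ W] allI ballI impI r)
    show "0 < real CARD('m) * M + 1" using M0 by (simp add: add_nonneg_pos)
    show "sym_multilinear q (W q t)" for q t
      unfolding sym_multilinear_def
    proof (intro conjI allI impI)
      fix us :: "(real ^ 'm) list" and i assume "length us = q \<and> i < q"
      then have "linear (\<lambda>x. Z j q t (us[i := x]))" for j using Z1 by simp
      then show "linear (\<lambda>x. W q t (us[i := x]))"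
        by (simp add: W_def linear_iff vec_eq_iff)
    next
      fix us vs :: "(real ^ 'm) list" assume "length us = q \<and> mset us = mset vs"
      then have "Z j q t us = Z j q t vs" for j using Z2 by blast
      then show "W q t us = W q t vs" by (simp add: W_def)
    qed
    show "(\<lambda>q. W q t (replicate q h)) sums F h t" if "h \<in> cball 0 r" for h t
    proof -
      have "\<bar>h $ j\<bar> \<le> r" for j using that component_le_norm_cart[of h j] by simp
      then have "(\<lambda>q. Z j q t (replicate q h)) sums (F h t $ j)" for j by (rule Z4)
      then show ?thesis unfolding sums_def by (intro vec_tendstoI) (simp add: W_def)
    qed
    fix q and us :: "(real ^ 'm) list" assume us: "length us = q"
    let ?P = "prod_list (map norm us)"
    have P0: "0 \<le> ?P" by (rule prod_list_nonneg) auto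
    have b: "H (\<lambda>t. of_real (W q t us $ j)) (M / r ^ q * ?P)" for j using Z3[OF us] by (simp add: W_def)
    show "(\<lambda>t. W q t us) \<in> sobolev T l" by (rule sobolev_of_sob_le[OF b])
    have "sobolev_norm T l (\<lambda>t. W q t us) \<le> (\<Sum>j\<in>(UNIV::'m set). M / r ^ q * ?P)" by (rule sobolev_of_sob_le[OF b])
    also have "\<dots> = (real CARD('m) * M) / r ^ q * ?P" by simp
    also have "\<dots> \<le> (real CARD('m) * M + 1) / r ^ q * ?P"
      using P0 r by (intro mult_right_mono divide_right_mono) auto
    finally show "sobolev_norm T l (\<lambda>t. W q t us) \<le> (real CARD('m) * M + 1) / r ^ q * ?P" .
  qed
qed

end

section \<open>Polynomials in eigenforms\<close>

lemma linear_axis_expansion: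
  fixes f :: "real ^ 'm \<Rightarrow> 'b::real_vector"
  assumes "linear f" shows "f v = (\<Sum>j\<in>UNIV. v $ j *\<^sub>R f (axis j 1))"
proof -
  have "v = (\<Sum>j\<in>UNIV. v $ j *\<^sub>R axis j 1)" by (simp add: basis_expansion flip: scalar_mult_eq_scaleR)
  then have "f v = f (\<Sum>j\<in>UNIV. v $ j *\<^sub>R axis j 1)" by simp
  then show ?thesis using assms by (simp add: linear_sum linear_scale)
qed

context periodic
begin

lemma smooth_le_cmult: "smooth_le l a M \<Longrightarrow> smooth_le l (\<lambda>t. c * a t) (cmod c * M)"
proof -
  assume a: "smooth_le l a M"
  then obtain a' where "\<And>t. (a has_vector_derivative a' t) (at t)" unfolding smooth_le_def by blast
  then have "\<exists>b. \<forall>t. ((\<lambda>t. c * a t) has_vector_derivative b t) (at t)"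
    by (intro exI[of _ "\<lambda>t. c * a' t"] allI has_vector_derivative_mult_right)
  then show ?thesis using a sob_le_cmult[of "Suc l" a M c] unfolding smooth_le_def by simp
qed

lemma smooth_le_cnj: "smooth_le l a M \<Longrightarrow> smooth_le l (\<lambda>t. cnj (a t)) M"
proof -
  assume a: "smooth_le l a M"
  then obtain a' where "\<And>t. (a has_vector_derivative a' t) (at t)" unfolding smooth_le_def by blast
  then have "\<exists>b. \<forall>t. ((\<lambda>t. cnj (a t)) has_vector_derivative b t) (at t)"
    by (intro exI[of _ "\<lambda>t. cnj (a' t)"] allI bounded_linear.has_vector_derivative[OF bounded_linear_cnj])
  then show ?thesis using a sob_le_cnj[of "Suc l" a M] unfolding smooth_le_def by simp
qed

lemma smooth_le_const: "smooth_le l (\<lambda>_. c) (cmod c)"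
proof -
  have "sob_le (Suc l) (\<lambda>_. c) (cmod c)" using sob_le_cmult[OF sob_le_1, of "Suc l" c] by simp
  moreover have "\<forall>t. ((\<lambda>_. c) has_vector_derivative 0) (at t)" by simp
  ultimately show ?thesis unfolding smooth_le_def by (intro conjI exI[of _ "\<lambda>_. 0"])
qed

end

text \<open>A family of complex linear forms closed under conjugation, so that the real part of a polynomial in these
forms is again such a polynomial.\<close>

locale linear_forms = sobolev_multipliers +
  fixes \<zeta> :: "'x \<Rightarrow> real ^ 'm \<Rightarrow> complex" and bar :: "'x \<Rightarrow> 'x"
  assumes linear_\<zeta>: "linear (\<zeta> x)" and \<zeta>_bar: "\<zeta> (bar x) y = cnj (\<zeta> x y)"
begin

definition zmono :: "'x list \<Rightarrow> real ^ 'm \<Rightarrow> complex" where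
  "zmono w y = (\<Prod>x\<leftarrow>w. \<zeta> x y)"

lemma zmono_simps [simp]: "zmono [] y = 1" "zmono (x # w) y = \<zeta> x y * zmono w y"
  "zmono (u @ w) y = zmono u y * zmono w y"
  by (simp_all add: zmono_def)

lemma zmono_bar: "zmono (map bar w) y = cnj (zmono w y)"
  by (induction w) (simp_all add: \<zeta>_bar)

text \<open>A homogeneous polynomial of degree \<open>n\<close> in the forms \<open>\<zeta>\<close> together with a bound of the sum of the norms of
its coefficients. The forms may be linearly dependent, so a polynomial has several representations;
an inductive relation spares a choice between them and gives proofs by induction on the terms.\<close>

inductive pol :: "((real \<Rightarrow> complex) \<Rightarrow> real \<Rightarrow> bool) \<Rightarrow> nat \<Rightarrow> (real ^ 'm \<Rightarrow> real \<Rightarrow> complex) \<Rightarrow> real \<Rightarrow> bool"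
  for nb n where
  zero: "pol nb n (\<lambda>y t. 0) 0"
| add: "nb v M \<Longrightarrow> length w = n \<Longrightarrow> pol nb n f N \<Longrightarrow> pol nb n (\<lambda>y t. v t * zmono w y + f y t) (M + N)"
| weaken: "pol nb n f M \<Longrightarrow> M \<le> M' \<Longrightarrow> pol nb n f M'"

lemma pol_term: "nb v M \<Longrightarrow> length w = n \<Longrightarrow> pol nb n (\<lambda>y t. v t * zmono w y) M"
  using pol.add[OF _ _ pol.zero, of nb v M w n] by simp

lemma pol_add:
  assumes "pol nb n f M" "pol nb n g N" shows "pol nb n (\<lambda>y t. f y t + g y t) (M + N)"
  using assms(1)
proof (induction rule: pol.induct)
  case zero then show ?case using assms(2) by simp
next
  case (add v M w f N') then show ?case using pol.add[OF add(1,2) add(4)] by (simp add: add.assoc)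
next
  case (weaken f M M') then show ?case using pol.weaken by fastforce
qed

lemma pol_sum:
  assumes "finite I" "\<And>i. i \<in> I \<Longrightarrow> pol nb n (f i) (M i)"
  shows "pol nb n (\<lambda>y t. \<Sum>i\<in>I. f i y t) (\<Sum>i\<in>I. M i)"
  using assms by (induction I rule: finite_induct) (simp_all add: pol.zero pol_add)

lemma pol_map:
  assumes nb: "\<And>v M. nb v M \<Longrightarrow> nb' (\<lambda>t. c * v t) (K * M)" and K: "0 \<le> K" and f: "pol nb n f M"
  shows "pol nb' n (\<lambda>y t. c * f y t) (K * M)"
  using f
proof (induction rule: pol.induct)
  case zero then show ?case by (simp add: pol.zero)
next
  case (add v M w f N)
  have "pol nb' n (\<lambda>y t. (c * v t) * zmono w y + c * f y t) (K * M + K * N)"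
    by (rule pol.add[OF nb[OF add(1)] add(2) add(4)])
  then show ?case by (simp add: distrib_left mult.assoc)
next
  case (weaken f M M') then show ?case using pol.weaken[OF weaken(3)] K by (simp add: mult_left_mono)
qed

lemma pol_cnj:
  assumes nb: "\<And>v M. nb v M \<Longrightarrow> nb (\<lambda>t. cnj (v t)) M" and f: "pol nb n f M"
  shows "pol nb n (\<lambda>y t. cnj (f y t)) M"
  using f
proof (induction rule: pol.induct)
  case zero then show ?case by (simp add: pol.zero)
next
  case (add v M w f N)
  have "pol nb n (\<lambda>y t. cnj (v t) * zmono (map bar w) y + cnj (f y t)) (M + N)"
    using add by (intro pol.add nb) auto
  then show ?case by (simp add: zmono_bar)
next
  case (weaken f M M') then show ?case by (blast intro: pol.weaken)
qed

lemma pol_nonneg: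
  assumes nb: "\<And>v M. nb v M \<Longrightarrow> 0 \<le> M" and f: "pol nb n f M" shows "0 \<le> M"
  using f by (induction rule: pol.induct) (use nb in force)+

lemma pol_mult:
  assumes nb: "\<And>a v M N. A a M \<Longrightarrow> nb v N \<Longrightarrow> nb (\<lambda>t. a t * v t) (M * N)" and nn: "\<And>v M. nb v M \<Longrightarrow> 0 \<le> M"
    and f: "pol A n f M" and g: "pol nb k g N"
  shows "pol nb (n + k) (\<lambda>y t. f y t * g y t) (M * N)"
  using f
proof (induction rule: pol.induct)
  case zero then show ?case by (simp add: pol.zero)
next
  case (add a P u f M)
  have P0: "0 \<le> P" by (rule A.nb_nonneg[OF add(1)])
  have "pol nb (n + k) (\<lambda>y t. (a t * zmono u y) * g y t) (P * N)"
    using g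
  proof (induction rule: pol.induct)
    case zero then show ?case by (simp add: pol.zero)
  next
    case (add v Q w g N)
    have "pol nb (n + k) (\<lambda>y t. (a t * v t) * zmono (u @ w) y + (a t * zmono u y) * g y t) (P * Q + P * N)"
      using add \<open>length u = n\<close> by (intro pol.add nb[OF \<open>A a P\<close>]) auto
    then show ?case by (simp add: algebra_simps)
  next
    case (weaken g N N') then show ?case using pol.weaken[OF weaken(3)] P0 by (simp add: mult_left_mono)
  qed
  from pol_add[OF this add(4)] show ?case by (simp add: distrib_right)
next
  case (weaken f M M')
  have "0 \<le> N" using pol_nonneg[OF nn g] .
  then show ?case using pol.weaken[OF weaken(3)] weaken(2) by (simp add: mult_right_mono)
qed

lemma pol_const_A: "pol A 0 (\<lambda>y t. 1) 1"
  using pol_term[of A "\<lambda>_. 1" 1 "[]" 0] mult_le_const[of l 1] by simp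

lemma smooth_le_imp_A: "smooth_le l a M \<Longrightarrow> A a ((sqrt 2 ^ l * sob_const) * M)"
  unfolding smooth_le_def using sob_le_mult_le[OF _ l_pos] by blast

text \<open>The constant with which \<open>H\<^sup>l\<^sup>+\<^sup>1\<close> embeds into the multipliers of \<open>H\<^sup>l\<close>.\<close>

abbreviation "cmult \<equiv> sqrt 2 ^ l * sob_const"

lemma cmult_pos: "cmult > 0" using sob_const_ge_1 by simp

lemma pol_smooth_imp_A:
  assumes "pol (smooth_le l) n f M" shows "pol A n f (cmult * M)"
proof -
  have "pol A n (\<lambda>y t. 1 * f y t) (cmult * M)"
    by (rule pol_map[OF _ _ assms]) (use smooth_le_imp_A cmult_pos in auto)
  then show ?thesis by simp
qed

lemma pol_Re_smooth:
  assumes "pol (smooth_le l) n f M" shows "pol (smooth_le l) n (\<lambda>y t. of_real (Re (f y t))) M"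
proof -
  have "pol (smooth_le l) n (\<lambda>y t. f y t + cnj (f y t)) (M + M)"
    by (intro pol_add pol_cnj assms smooth_le_cnj)
  then have "pol (smooth_le l) n (\<lambda>y t. (1/2) * (f y t + cnj (f y t))) (cmod (1/2) * (M + M))"
  proof (rule pol_map[rotated 2])
    show "smooth_le l (\<lambda>t. (1/2) * v t) (cmod (1/2) * M)" if "smooth_le l v M" for v M
      using that by (rule smooth_le_cmult)
  qed simp
  moreover have "(1/2) * (f y t + cnj (f y t)) = of_real (Re (f y t))" for y t by (simp add: complex_eq_iff)
  ultimately show ?thesis by simp
qed

text \<open>Substituting \<open>y = y\<^sub>0 + h\<close> expands a polynomial around \<open>y\<^sub>0\<close>. The expansion of each form is bounded by
\<open>\<sigma>\<close>, hence a monomial of degree \<open>n\<close> is bounded by \<open>\<sigma>\<^sup>n\<close>.\<close>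

lemma pol_series:
  assumes r: "0 \<le> r" and z: "\<And>x. series_le A r (\<lambda>h t. \<zeta> x (y0 + h)) \<sigma>"
    and cb: "coeff_bound nb C" and mult: "\<And>a v M N. A a M \<Longrightarrow> nb v N \<Longrightarrow> nb (\<lambda>t. a t * v t) (M * N)"
    and f: "pol nb n f M"
  shows "series_le nb r (\<lambda>h t. f (y0 + h) t) (M * \<sigma> ^ n)"
proof -
  interpret B: coeff_bound nb C by fact
  have \<sigma>0: "0 \<le> \<sigma>" by (rule A.series_le_nonneg[OF r z])
  have zm: "series_le A r (\<lambda>h t. zmono w (y0 + h)) (\<sigma> ^ length w)" for w
  proof (induction w)
    case Nil show ?case using A.series_le_const[OF mult_le_const[of l 1]] by simp
  next
    case (Cons x w) show ?case using series_le_mult_A[OF r z[of x] Cons] by simp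
  qed
  show ?thesis using f
  proof (induction rule: pol.induct)
    case zero then show ?case using B.series_le_const[OF B.nb_zero] by simp
  next
    case (add v M w f N)
    have "series_le nb r (\<lambda>h t. zmono w (y0 + h) * v t) (\<sigma> ^ n * M)"
      using series_le_product[OF r cb mult zm[of w] B.series_le_const[OF add(1)]] add(2) by simp
    from B.series_le_add[OF r this add(4)] show ?case by (simp add: mult.commute distrib_right)
  next
    case (weaken f M M')
    show ?case by (rule B.series_le_mono[OF weaken(3)]) (use weaken(2) \<sigma>0 in \<open>simp add: mult_right_mono\<close>)
  qed
qed

subsection \<open>Derivatives\<close>

fun dzmono :: "'x list \<Rightarrow> real ^ 'm \<Rightarrow> real ^ 'm \<Rightarrow> complex" where
  "dzmono [] y k = 0"
| "dzmono (x # w) y k = \<zeta> x k * zmono w y + \<zeta> x y * dzmono w y k"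

lemma has_derivative_\<zeta>: "(\<zeta> x has_derivative \<zeta> x) (at y within S)"
  using linear_\<zeta> by (intro bounded_linear_imp_has_derivative linear_conv_bounded_linear[THEN iffD1])

lemma has_derivative_zmono: "(zmono w has_derivative dzmono w y) (at y)"
proof (induction w)
  case Nil
  have "zmono [] = (\<lambda>_. 1)" "dzmono [] y = (\<lambda>_. 0)" by auto
  then show ?case by simp
next
  case (Cons x w)
  have "((\<lambda>y. \<zeta> x y * zmono w y) has_derivative (\<lambda>k. \<zeta> x y * dzmono w y k + \<zeta> x k * zmono w y)) (at y)"
    by (intro has_derivative_mult has_derivative_\<zeta> Cons)
  moreover have "zmono (x # w) = (\<lambda>y. \<zeta> x y * zmono w y)" by (rule ext) simp
  moreover have "dzmono (x # w) y = (\<lambda>k. \<zeta> x y * dzmono w y k + \<zeta> x k * zmono w y)" by (rule ext) simp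
  ultimately show ?case by simp
qed

text \<open>The derivative in \<open>(y, t)\<close> jointly; in the direction \<open>(L y, 1)\<close> it is the derivative along the solutions of
\<open>y' = L y\<close>.\<close>

definition jderiv :: "(real ^ 'm \<Rightarrow> real \<Rightarrow> complex) \<Rightarrow> real ^ 'm \<Rightarrow> real \<Rightarrow> (real ^ 'm) \<times> real \<Rightarrow> complex" where
  "jderiv f y t = frechet_derivative (\<lambda>p. f (fst p) (snd p)) (at (y, t))"

lemma jderivI:
  assumes "((\<lambda>p. f (fst p) (snd p)) has_derivative D) (at (y, t))"
  shows "jderiv f y t = D"
  unfolding jderiv_def using frechet_derivative_at[OF assms] by simp

lemma has_jderiv_term:
  assumes v: "(v has_vector_derivative v') (at t)"
  shows "((\<lambda>p. v (snd p) * zmono w (fst p)) has_derivative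
     (\<lambda>q. v t * dzmono w y (fst q) + snd q *\<^sub>R v' * zmono w y)) (at (y, t))"
proof -
  have 1: "((\<lambda>p. v (snd p)) has_derivative (\<lambda>q. snd q *\<^sub>R v')) (at (y, t))"
    using v unfolding has_vector_derivative_def
    by (intro has_derivative_compose[of snd snd "(y, t)" UNIV v "\<lambda>s. s *\<^sub>R v'"] has_derivative_snd has_derivative_ident) auto
  have 2: "((\<lambda>p. zmono w (fst p)) has_derivative (\<lambda>q. dzmono w y (fst q))) (at (y, t))"
    by (intro has_derivative_compose[of fst fst "(y, t)" UNIV "zmono w" "dzmono w y"] has_derivative_fst has_derivative_ident)
      (simp add: has_derivative_zmono)
  show ?thesis using has_derivative_mult[OF 1 2] by simp
qed

lemma pol_smooth_has_jderiv:
  assumes "pol (smooth_le l) n f M"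
  shows "((\<lambda>p. f (fst p) (snd p)) has_derivative jderiv f y t) (at (y, t))"
  using assms
proof (induction rule: pol.induct)
  case zero
  have "((\<lambda>p. 0) has_derivative (\<lambda>_. 0)) (at (y, t))" by simp
  from jderivI[of "\<lambda>_ _. 0", OF this] this show ?case by simp
next
  case (add v M w f N)
  then obtain v' where "(v has_vector_derivative v' t) (at t)" unfolding smooth_le_def by blast
  from has_derivative_add[OF has_jderiv_term[OF this, of w y] add(4)]
  have d: "((\<lambda>p. v (snd p) * zmono w (fst p) + f (fst p) (snd p)) has_derivative
    (\<lambda>q. v t * dzmono w y (fst q) + snd q *\<^sub>R v' t * zmono w y + jderiv f y t q)) (at (y, t))" .
  from jderivI[of "\<lambda>y t. v t * zmono w y + f y t", OF this] d show ?case by simp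
qed

lemma jderiv_add_term:
  assumes "(v has_vector_derivative v') (at t)" "pol (smooth_le l) n f M"
  shows "jderiv (\<lambda>y t. v t * zmono w y + f y t) y t q
    = v t * dzmono w y (fst q) + snd q *\<^sub>R v' * zmono w y + jderiv f y t q"
proof -
  have "((\<lambda>p. v (snd p) * zmono w (fst p) + f (fst p) (snd p)) has_derivative
    (\<lambda>q. v t * dzmono w y (fst q) + snd q *\<^sub>R v' * zmono w y + jderiv f y t q)) (at (y, t))"
    by (rule has_derivative_add[OF has_jderiv_term[OF assms(1)] pol_smooth_has_jderiv[OF assms(2)]])
  from jderivI[of "\<lambda>y t. v t * zmono w y + f y t", OF this] show ?thesis by simp
qed

text \<open>Differentiating a monomial of degree \<open>n\<close> in \<open>y\<close> replaces each of its \<open>n\<close> factors in turn by a constant.\<close>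

lemma pol_jderiv_series:
  assumes r: "0 \<le> r" and z: "\<And>x. series_le A r (\<lambda>h t. \<zeta> x (y0 + h)) \<sigma>"
    and B: "\<And>x. cmod (\<zeta> x e) \<le> B" and f: "pol (smooth_le l) n f M"
  shows "series_le A r (\<lambda>h t. jderiv f (y0 + h) t (e, 0)) (real n * (cmult * M) * \<sigma> ^ (n - 1) * B)"
proof -
  have \<sigma>0: "0 \<le> \<sigma>" by (rule A.series_le_nonneg[OF r z])
  have B0: "0 \<le> B" using B norm_ge_zero order_trans by blast
  have zm: "series_le A r (\<lambda>h t. zmono w (y0 + h)) (\<sigma> ^ length w)" for w
  proof (induction w)
    case Nil show ?case using A.series_le_const[OF mult_le_const[of l 1]] by simp
  next
    case (Cons x w) show ?case using series_le_mult_A[OF r z[of x] Cons] by simp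
  qed
  have dz: "series_le A r (\<lambda>h t. dzmono w (y0 + h) e) (real (length w) * \<sigma> ^ (length w - 1) * B)" for w
  proof (induction w)
    case Nil show ?case using A.series_le_const[OF A.nb_zero] by simp
  next
    case (Cons x w)
    have 1: "series_le A r (\<lambda>h t. \<zeta> x e * zmono w (y0 + h) + \<zeta> x (y0 + h) * dzmono w (y0 + h) e)
       (B * \<sigma> ^ length w + \<sigma> * (real (length w) * \<sigma> ^ (length w - 1) * B))"
      by (intro A.series_le_add[OF r] series_le_mult_A[OF r] zm z Cons
            A.series_le_const[OF mult_le_mono[OF mult_le_const B]])
    have 2: "B * \<sigma> ^ length w + \<sigma> * (real (length w) * \<sigma> ^ (length w - 1) * B)
        = real (length (x # w)) * \<sigma> ^ (length (x # w) - 1) * B"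
      by (cases w) (auto simp: algebra_simps)
    show ?case using 1 unfolding dzmono.simps 2 .
  qed
  show ?thesis using f
  proof (induction rule: pol.induct)
    case zero
    have "((\<lambda>p. 0) has_derivative (\<lambda>_. 0)) (at (y, t))" for y t by simp
    from jderivI[of "\<lambda>_ _. 0", OF this] show ?case using A.series_le_const[OF A.nb_zero] by simp
  next
    case (add v M w f N)
    then obtain v' where v': "\<And>t. (v has_vector_derivative v' t) (at t)" unfolding smooth_le_def by blast
    have eq: "jderiv (\<lambda>y t. v t * zmono w y + f y t) (y0 + h) t (e, 0)
        = dzmono w (y0 + h) e * v t + jderiv f (y0 + h) t (e, 0)" for h t
      using jderiv_add_term[OF v' add(3), of w "y0 + h" t "(e, 0)"] by simp
    have "series_le A r (\<lambda>h t. dzmono w (y0 + h) e * v t + jderiv f (y0 + h) t (e, 0))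
       ((real n * \<sigma> ^ (n - 1) * B) * (cmult * M) + real n * (cmult * N) * \<sigma> ^ (n - 1) * B)"
      using add(2) by (intro A.series_le_add[OF r] series_le_mult_A[OF r] add(4)
         A.series_le_const smooth_le_imp_A add(1)) (use dz[of w] in simp)
    then show ?case unfolding eq by (simp add: algebra_simps)
  next
    case (weaken f M M')
    show ?case
      by (rule A.series_le_mono[OF weaken(3)])
        (use weaken(2) \<sigma>0 B0 cmult_pos in \<open>intro mult_right_mono mult_left_mono, auto\<close>)
  qed
qed

end

section \<open>Polynomials with Sobolev coefficients\<close>

lemma finite_multi_indices: "finite {\<alpha> :: 'm::finite \<Rightarrow> nat. (\<Sum>i\<in>UNIV. \<alpha> i) \<le> p}"
proof (rule finite_subset)
  show "{\<alpha> :: 'm \<Rightarrow> nat. (\<Sum>i\<in>UNIV. \<alpha> i) \<le> p} \<subseteq> Pi\<^sub>E UNIV (\<lambda>_. {..p})"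
  proof
    fix \<alpha> :: "'m \<Rightarrow> nat" assume "\<alpha> \<in> {\<alpha>. (\<Sum>i\<in>UNIV. \<alpha> i) \<le> p}"
    then have "\<alpha> i \<le> p" for i using member_le_sum[of i UNIV \<alpha>] by simp
    then show "\<alpha> \<in> Pi\<^sub>E UNIV (\<lambda>_. {..p})" by auto
  qed
qed (intro finite_PiE, auto)

context periodic
begin

lemma sobolevI:
  fixes f :: "real \<Rightarrow> real ^ 'm"
  assumes "\<And>j. \<exists>M. sob_le l (\<lambda>t. of_real (f t $ j)) M" shows "f \<in> sobolev T l"
proof -
  obtain M where "\<And>j. sob_le l (\<lambda>t. of_real (f t $ j)) (M j)" using assms by metis
  then show ?thesis by (rule sobolev_of_sob_le)
qed

lemma sobolev_bound: 
  assumes "f \<in> sobolev T l" shows "\<exists>M. sob_le l (\<lambda>t. of_real (f t $ j)) M"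
  using sob_le_of_sobolev[OF assms order_refl] by blast

lemma sobolev_0: "(\<lambda>_. 0) \<in> sobolev T l"
  by (rule sobolevI) (use sob_le_0 in auto)

lemma sobolev_add: 
  assumes "f \<in> sobolev T l" "g \<in> sobolev T l" shows "(\<lambda>t. f t + g t) \<in> sobolev T l"
proof (rule sobolevI)
  fix j
  obtain M N where "sob_le l (\<lambda>t. of_real (f t $ j)) M" "sob_le l (\<lambda>t. of_real (g t $ j)) N"
    using sobolev_bound assms by metis
  from sob_le_add[OF this] show "\<exists>M. sob_le l (\<lambda>t. of_real ((f t + g t) $ j)) M" by auto
qed

lemma sobolev_polys_0: "(\<lambda>y t. 0) \<in> sobolev_polys p T l"
  unfolding sobolev_polys_def by (auto intro!: exI[of _ "\<lambda>_ _. 0"] sobolev_0)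

lemma sobolev_polys_add:
  assumes "P \<in> sobolev_polys p T l" "Q \<in> sobolev_polys p T l"
  shows "(\<lambda>y t. P y t + Q y t) \<in> sobolev_polys p T l"
proof -
  obtain C D where "\<forall>\<alpha>. C \<alpha> \<in> sobolev T l" "\<forall>\<alpha>. D \<alpha> \<in> sobolev T l"
    "\<forall>x t. P x t = (\<Sum>\<alpha> | (\<Sum>i\<in>UNIV. \<alpha> i) \<le> p. (\<Prod>i\<in>UNIV. (x $ i) ^ \<alpha> i) *\<^sub>R C \<alpha> t)"
    "\<forall>x t. Q x t = (\<Sum>\<alpha> | (\<Sum>i\<in>UNIV. \<alpha> i) \<le> p. (\<Prod>i\<in>UNIV. (x $ i) ^ \<alpha> i) *\<^sub>R D \<alpha> t)"
    using assms unfolding sobolev_polys_def by blast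
  then show ?thesis unfolding sobolev_polys_def
    by (auto intro!: exI[of _ "\<lambda>\<alpha> t. C \<alpha> t + D \<alpha> t"] sobolev_add simp: scaleR_add_right sum.distrib)
qed

lemma sobolev_polys_sum:
  assumes "finite I" "\<And>i. i \<in> I \<Longrightarrow> P i \<in> sobolev_polys p T l"
  shows "(\<lambda>y t. \<Sum>i\<in>I. P i y t) \<in> sobolev_polys p T l"
  using assms by (induction I rule: finite_induct) (auto intro: sobolev_polys_0 sobolev_polys_add)

lemma sobolev_polys_mono:
  assumes "P \<in> sobolev_polys p T l" "p \<le> q" shows "P \<in> sobolev_polys q T l"
proof -
  obtain C where C: "\<And>\<alpha>. C \<alpha> \<in> sobolev T l"
    "\<And>x t. P x t = (\<Sum>\<alpha> | (\<Sum>i\<in>UNIV. \<alpha> i) \<le> p. (\<Prod>i\<in>UNIV. (x $ i) ^ \<alpha> i) *\<^sub>R C \<alpha> t)"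
    using assms unfolding sobolev_polys_def by blast
  define D where "D \<alpha> = (if (\<Sum>i\<in>UNIV. \<alpha> i) \<le> p then C \<alpha> else (\<lambda>_. 0))" for \<alpha>
  have "P x t = (\<Sum>\<alpha> | (\<Sum>i\<in>UNIV. \<alpha> i) \<le> q. (\<Prod>i\<in>UNIV. (x $ i) ^ \<alpha> i) *\<^sub>R D \<alpha> t)" for x t
    unfolding C(2) using assms(2)
    by (intro sum.mono_neutral_cong_left finite_multi_indices) (auto simp: D_def)
  moreover have "D \<alpha> \<in> sobolev T l" for \<alpha> using C(1) by (simp add: D_def sobolev_0)
  ultimately show ?thesis unfolding sobolev_polys_def by blast
qed

lemma sobolev_polys_const:
  assumes "f \<in> sobolev T l" shows "(\<lambda>y t. f t) \<in> sobolev_polys p T l"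
proof -
  define D where "D \<alpha> = (if \<alpha> = (\<lambda>_. 0) then f else (\<lambda>_. 0))" for \<alpha> :: "'a \<Rightarrow> nat"
  have "f t = (\<Sum>\<alpha> | (\<Sum>i\<in>UNIV. \<alpha> i) \<le> p. (\<Prod>i\<in>UNIV. (x $ i) ^ \<alpha> i) *\<^sub>R D \<alpha> t)" for x :: "real ^ 'a" and t
  proof -
    have "(\<Sum>\<alpha> | (\<Sum>i\<in>UNIV. \<alpha> i) \<le> p. (\<Prod>i\<in>UNIV. (x $ i) ^ \<alpha> i) *\<^sub>R D \<alpha> t)
        = (\<Sum>\<alpha>\<in>{\<lambda>_. 0}. (\<Prod>i\<in>UNIV. (x $ i) ^ \<alpha> i) *\<^sub>R D \<alpha> t)"
      by (intro sum.mono_neutral_right finite_multi_indices) (auto simp: D_def)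
    then show ?thesis by (simp add: D_def)
  qed
  moreover have "D \<alpha> \<in> sobolev T l" for \<alpha> using assms by (simp add: D_def sobolev_0)
  ultimately show ?thesis unfolding sobolev_polys_def by blast
qed

text \<open>Multiplication by a coordinate raises one exponent; in the coefficient family this is the pullback along the
decrement of that exponent.\<close>

lemma sobolev_polys_coord_mult:
  assumes "P \<in> sobolev_polys p T l" shows "(\<lambda>y t. (y $ k) *\<^sub>R P y t) \<in> sobolev_polys (Suc p) T l"
proof -
  obtain C where C: "\<And>\<alpha>. C \<alpha> \<in> sobolev T l"
    "\<And>x t. P x t = (\<Sum>\<alpha> | (\<Sum>i\<in>UNIV. \<alpha> i) \<le> p. (\<Prod>i\<in>UNIV. (x $ i) ^ \<alpha> i) *\<^sub>R C \<alpha> t)"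
    using assms unfolding sobolev_polys_def by blast
  define up where "up \<alpha> = \<alpha>(k := Suc (\<alpha> k))" for \<alpha> :: "'a \<Rightarrow> nat"
  define dn where "dn \<alpha> = \<alpha>(k := \<alpha> k - 1)" for \<alpha> :: "'a \<Rightarrow> nat"
  define D where "D \<alpha> = (if \<alpha> k = 0 then (\<lambda>_. 0) else C (dn \<alpha>))" for \<alpha>
  have du: "dn (up \<alpha>) = \<alpha>" for \<alpha> by (simp add: up_def dn_def)
  have upk: "up \<alpha> k = Suc (\<alpha> k)" for \<alpha> by (simp add: up_def)
  have inj: "inj up" using du by (metis injI)
  have su: "(\<Sum>i\<in>UNIV. up \<alpha> i) = Suc (\<Sum>i\<in>UNIV. \<alpha> i)" for \<alpha>
    by (simp add: up_def sum.remove[of UNIV k])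
  have pu: "(\<Prod>i\<in>UNIV. (x $ i) ^ up \<alpha> i) = x $ k * (\<Prod>i\<in>UNIV. (x $ i) ^ \<alpha> i)" for x :: "real ^ 'a" and \<alpha>
    by (simp add: up_def prod.remove[of UNIV k])
  have "(x $ k) *\<^sub>R P x t = (\<Sum>\<alpha> | (\<Sum>i\<in>UNIV. \<alpha> i) \<le> Suc p. (\<Prod>i\<in>UNIV. (x $ i) ^ \<alpha> i) *\<^sub>R D \<alpha> t)" for x t
  proof -
    have "(x $ k) *\<^sub>R P x t = (\<Sum>\<alpha> | (\<Sum>i\<in>UNIV. \<alpha> i) \<le> p. (\<Prod>i\<in>UNIV. (x $ i) ^ up \<alpha> i) *\<^sub>R D (up \<alpha>) t)"
      unfolding C(2) pu by (simp add: scaleR_sum_right D_def du upk)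
    also have "\<dots> = (\<Sum>\<alpha>\<in>up ` {\<alpha>. (\<Sum>i\<in>UNIV. \<alpha> i) \<le> p}. (\<Prod>i\<in>UNIV. (x $ i) ^ \<alpha> i) *\<^sub>R D \<alpha> t)"
      by (subst sum.reindex) (auto intro: inj_on_subset[OF inj])
    also have "\<dots> = (\<Sum>\<alpha> | (\<Sum>i\<in>UNIV. \<alpha> i) \<le> Suc p. (\<Prod>i\<in>UNIV. (x $ i) ^ \<alpha> i) *\<^sub>R D \<alpha> t)"
    proof (rule sum.mono_neutral_left[OF finite_multi_indices])
      show "up ` {\<alpha>. (\<Sum>i\<in>UNIV. \<alpha> i) \<le> p} \<subseteq> {\<alpha>. (\<Sum>i\<in>UNIV. \<alpha> i) \<le> Suc p}" using su by auto
      show "\<forall>\<alpha>\<in>{\<alpha>. (\<Sum>i\<in>UNIV. \<alpha> i) \<le> Suc p} - up ` {\<alpha>. (\<Sum>i\<in>UNIV. \<alpha> i) \<le> p}. (\<Prod>i\<in>UNIV. (x $ i) ^ \<alpha> i) *\<^sub>R D \<alpha> t = 0"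
      proof
        fix \<alpha> assume a: "\<alpha> \<in> {\<alpha>. (\<Sum>i\<in>UNIV. \<alpha> i) \<le> Suc p} - up ` {\<alpha>. (\<Sum>i\<in>UNIV. \<alpha> i) \<le> p}"
        have "\<alpha> k = 0"
        proof (rule ccontr)
          assume "\<alpha> k \<noteq> 0"
          then have "up (dn \<alpha>) = \<alpha>" by (simp add: up_def dn_def)
          moreover have "(\<Sum>i\<in>UNIV. dn \<alpha> i) \<le> p" using a su[of "dn \<alpha>"] calculation by simp
          ultimately show False using a by (metis (mono_tags, lifting) DiffD2 image_eqI mem_Collect_eq)
        qed
        then show "(\<Prod>i\<in>UNIV. (x $ i) ^ \<alpha> i) *\<^sub>R D \<alpha> t = 0" by (simp add: D_def)
      qed
    qed
    finally show ?thesis .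
  qed
  moreover have "D \<alpha> \<in> sobolev T l" for \<alpha> using C(1) by (simp add: D_def sobolev_0)
  ultimately show ?thesis unfolding sobolev_polys_def by blast
qed

end

context linear_forms
begin

lemma \<zeta>_expand: "\<zeta> x y = (\<Sum>k\<in>UNIV. of_real (y $ k) * \<zeta> x (axis k 1))"
proof -
  have "y = (\<Sum>k\<in>UNIV. y $ k *\<^sub>R axis k 1)" by (simp add: basis_expansion flip: scalar_mult_eq_scaleR)
  then have "\<zeta> x y = \<zeta> x (\<Sum>k\<in>UNIV. y $ k *\<^sub>R axis k 1)" by simp
  also have "\<dots> = (\<Sum>k\<in>UNIV. y $ k *\<^sub>R \<zeta> x (axis k 1))" using linear_\<zeta>[of x] by (simp add: linear_sum linear_scale)
  finally show ?thesis by (simp add: scaleR_conv_of_real)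
qed

lemma zmono_in_sobolev_polys:
  fixes c :: "real ^ 'm"
  assumes "sob_le q v M" shows "(\<lambda>y t. Re (v t * zmono w y) *\<^sub>R c) \<in> sobolev_polys (length w) T q"
  using assms
proof (induction w arbitrary: v M)
  case Nil
  have "(\<lambda>t. Re (v t) *\<^sub>R c) \<in> sobolev T q"
  proof (rule sobolevI)
    fix j
    have "sob_le q (\<lambda>t. of_real (c $ j) * of_real (Re (v t))) (cmod (of_real (c $ j)) * M)"
      by (intro sob_le_cmult sob_le_Re Nil)
    then show "\<exists>M. sob_le q (\<lambda>t. of_real ((Re (v t) *\<^sub>R c) $ j)) M" by (auto simp: mult.commute)
  qed
  then show ?case by (simp add: sobolev_polys_const)
next
  case (Cons x w)
  have "Re (v t * zmono (x # w) y) *\<^sub>R c = (\<Sum>k\<in>UNIV. (y $ k) *\<^sub>R (Re ((\<zeta> x (axis k 1) * v t) * zmono w y) *\<^sub>R c))" for y t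
  proof -
    have "v t * zmono (x # w) y = (\<Sum>k\<in>UNIV. of_real (y $ k) * ((\<zeta> x (axis k 1) * v t) * zmono w y))"
      unfolding zmono_simps by (subst \<zeta>_expand) (simp add: sum_distrib_left sum_distrib_right mult_ac)
    then show ?thesis by (simp add: scaleR_sum_left)
  qed
  moreover have "(\<lambda>y t. (y $ k) *\<^sub>R (Re ((\<zeta> x (axis k 1) * v t) * zmono w y) *\<^sub>R c)) \<in> sobolev_polys (length (x # w)) T q" for k
    using sobolev_polys_coord_mult[OF Cons.IH[OF sob_le_cmult[OF Cons.prems, of "\<zeta> x (axis k 1)"]], of k] by simp
  ultimately show ?case
    using sobolev_polys_sum[of UNIV "\<lambda>k y t. (y $ k) *\<^sub>R (Re ((\<zeta> x (axis k 1) * v t) * zmono w y) *\<^sub>R c)" "length (x # w)"] by simp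
qed

lemma pol_in_sobolev_polys:
  fixes c :: "real ^ 'm"
  assumes "pol (smooth_le l) n f M" "n \<le> p"
  shows "(\<lambda>y t. Re (f y t) *\<^sub>R c) \<in> sobolev_polys p T (Suc l)"
  using assms(1)
proof (induction rule: pol.induct)
  case zero then show ?case by (simp add: sobolev_polys_0)
next
  case (add v M w f N)
  have "(\<lambda>y t. Re (v t * zmono w y) *\<^sub>R c) \<in> sobolev_polys p T (Suc l)"
    using zmono_in_sobolev_polys[of "Suc l" v M w c] add(1,2) assms(2) sobolev_polys_mono
    unfolding smooth_le_def by blast
  from sobolev_polys_add[OF this add(4)] show ?case by (simp add: scaleR_add_left)
qed

end

section \<open>The homological equation\<close>

text \<open>The spectral data of a diagonalizable real operator \<open>L\<close>. Each \<open>\<zeta> x\<close> is an eigenform with eigenvalue \<open>\<mu> x\<close>;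
the columns of \<open>Q\<close> are eigenvectors with eigenvalues \<open>d\<close>, and \<open>\<zeta> (e j)\<close> is the \<open>j\<close>-th coordinate in this
eigenbasis. The number \<open>D n\<close> measures the small divisors of degree \<open>n\<close>; the factor \<open>1 + \<bar>\<kappa>\<bar>\<close>, with \<open>\<kappa>\<close> the
frequency, expresses that dividing by them gains a derivative in time.\<close>

locale eigenforms = linear_forms T l \<zeta> bar
  for T :: real and l :: nat and \<zeta> :: "'x \<Rightarrow> real ^ 'm \<Rightarrow> complex" and bar :: "'x \<Rightarrow> 'x" +
  fixes L :: "real ^ 'm \<Rightarrow> real ^ 'm" and \<mu> :: "'x \<Rightarrow> complex" and d :: "'m \<Rightarrow> complex"
    and Q Qi :: "'m \<Rightarrow> 'm \<Rightarrow> complex" and e :: "'m \<Rightarrow> 'x" and D :: "nat \<Rightarrow> real"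
  assumes linear_L: "linear L"
    and \<zeta>_L: "\<zeta> x (L y) = \<mu> x * \<zeta> x y"
    and Q_inverse: "(\<Sum>j\<in>UNIV. Q i j * Qi j k) = (if i = k then 1 else 0)"
    and L_Q: "(\<Sum>k\<in>UNIV. of_real (L (axis k 1) $ i) * Q k j) = Q i j * d j"
    and coordinate_\<zeta>: "of_real (y $ i) = (\<Sum>j\<in>UNIV. Q i j * \<zeta> (e j) y)"
    and D_pos: "D n > 0"
    and small_divisors: "2 \<le> length w \<Longrightarrow> D (length w) * (1 + \<bar>real_of_int \<kappa>\<bar>) \<le>
       cmod ((\<Sum>x\<leftarrow>w. \<mu> x) - d j + \<i> * of_int \<kappa> * of_real (2 * pi / T))"
begin

text \<open>A monomial in eigenforms is an eigenvector of the derivative along \<open>L\<close>; its eigenvalue is the sum of the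
eigenvalues of its factors.\<close>

lemma dzmono_L: "dzmono w y (L y) = (\<Sum>x\<leftarrow>w. \<mu> x) * zmono w y"
  by (induction w) (simp_all add: \<zeta>_L algebra_simps)

text \<open>Since monomials are eigenvectors of the derivative along \<open>L\<close>, each of them contributes one scalar periodic
equation, solved with the loss \<open>1 / D n\<close>.\<close>

lemma pol_homological:
  assumes n: "2 \<le> n" and F: "pol H n F M"
  shows "\<exists>f. pol (smooth_le l) n f (M / D n) \<and> (\<forall>y t. jderiv f y t (L y, 1) - d j * f y t = F y t)"
  using F
proof (induction rule: pol.induct)
  case zero
  have "((\<lambda>p. 0) has_derivative (\<lambda>_. 0)) (at (y, t))" for y :: "real ^ 'm" and t :: real by simp
  from jderivI[of "\<lambda>_ _. 0", OF this]
  show ?case by (intro exI[of _ "\<lambda>_ _. 0"]) (simp add: pol.zero)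
next
  case (add v M w F N)
  then obtain f where f: "pol (smooth_le l) n f (N / D n)" "\<And>y t. jderiv f y t (L y, 1) - d j * f y t = F y t"
    by blast
  let ?m = "(\<Sum>x\<leftarrow>w. \<mu> x)"
  obtain a a' where a: "sob_le (Suc l) a (M / D n)" "\<And>t. (a has_vector_derivative a' t) (at t)"
    "\<And>t. a' t + (?m - d j) * a t = v t"
    using periodic_solution[OF add(1) D_pos[of n], of "?m - d j"] small_divisors[of w _ j] add(2) n by auto
  have sa: "smooth_le l a (M / D n)" using a unfolding smooth_le_def by blast
  have p: "pol (smooth_le l) n (\<lambda>y t. a t * zmono w y + f y t) (M / D n + N / D n)"
    by (rule pol.add[OF sa add(2) f(1)])
  moreover have "jderiv (\<lambda>y t. a t * zmono w y + f y t) y t (L y, 1) - d j * (a t * zmono w y + f y t)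
      = v t * zmono w y + F y t" for y t
    unfolding jderiv_add_term[OF a(2) f(1)] f(2)[symmetric] a(3)[symmetric]
    by (simp add: dzmono_L algebra_simps)
  ultimately show ?case by (intro exI[of _ "\<lambda>y t. a t * zmono w y + f y t"]) (simp add: add_divide_distrib)
next
  case (weaken F M M')
  then obtain f where f: "pol (smooth_le l) n f (M / D n)" "\<forall>y t. jderiv f y t (L y, 1) - d j * f y t = F y t" by blast
  have "pol (smooth_le l) n f (M' / D n)"
    by (rule pol.weaken[OF f(1)]) (use weaken(2) D_pos[of n] in \<open>simp add: divide_right_mono\<close>)
  then show ?case using f(2) by blast
qed

text \<open>The real part undoes the embedding of the real components of \<open>\<Phi>\<close> into the complex numbers.\<close>

definition vderiv :: "(real ^ 'm \<Rightarrow> real \<Rightarrow> real ^ 'm) \<Rightarrow> real ^ 'm \<Rightarrow> real \<Rightarrow> (real ^ 'm) \<times> real \<Rightarrow> real ^ 'm" where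
  "vderiv \<Phi> y t q = (\<chi> i. Re (jderiv (\<lambda>y t. of_real (\<Phi> y t $ i)) y t q))"

text \<open>The division by \<open>cmult\<close> normalizes \<open>M\<close> as a bound for the multiplier norm.\<close>

definition homog :: "nat \<Rightarrow> (real ^ 'm \<Rightarrow> real \<Rightarrow> real ^ 'm) \<Rightarrow> real \<Rightarrow> bool" where
  "homog n \<Phi> M \<longleftrightarrow> (\<forall>i. pol (smooth_le l) n (\<lambda>y t. of_real (\<Phi> y t $ i)) (M / cmult))"

lemma homog_A: "homog n \<Phi> M \<Longrightarrow> pol A n (\<lambda>y t. of_real (\<Phi> y t $ i)) M"
  using pol_smooth_imp_A[of n "\<lambda>y t. of_real (\<Phi> y t $ i)" "M / cmult"] cmult_pos sob_const_ge_1
  unfolding homog_def by simp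

lemma homog_has_derivative:
  assumes "homog n \<Phi> M"
  shows "((\<lambda>p. \<Phi> (fst p) (snd p)) has_derivative vderiv \<Phi> y t) (at (y, t))"
proof -
  have "((\<lambda>p. \<Phi> (fst p) (snd p) $ i) has_derivative (\<lambda>q. vderiv \<Phi> y t q $ i)) (at (y, t))" for i
  proof -
    have "((\<lambda>p. complex_of_real (\<Phi> (fst p) (snd p) $ i)) has_derivative jderiv (\<lambda>y t. of_real (\<Phi> y t $ i)) y t) (at (y, t))"
      by (rule pol_smooth_has_jderiv) (use assms in \<open>auto simp: homog_def\<close>)
    from bounded_linear.has_derivative[OF bounded_linear_Re this]
    show ?thesis by (simp add: vderiv_def)
  qed
  then show ?thesis
    by (subst has_derivative_componentwise_within) (auto simp: Basis_vec_def inner_axis)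
qed

definition homological_const :: real where
  "homological_const = cmult * (\<Sum>i\<in>UNIV. \<Sum>j\<in>UNIV. cmod (Q i j)) * (\<Sum>j\<in>UNIV. \<Sum>i\<in>UNIV. cmod (Qi j i))"

lemma homological_const_nonneg: "0 \<le> homological_const"
  using sob_const_ge_1 unfolding homological_const_def by (intro mult_nonneg_nonneg sum_nonneg) auto

text \<open>In the eigenbasis of \<open>L\<close> the equation decouples into the scalar equations of \<open>pol_homological\<close>. The real
part of the complex solution still solves it, because \<open>L\<close> and \<open>F\<close> are real.\<close>

lemma homological_equation:
  assumes n: "2 \<le> n" and F: "\<And>i. pol H n (\<lambda>y t. of_real (F y t $ i)) M"
  shows "\<exists>\<Phi>. homog n \<Phi> (homological_const / D n * M) \<and> (\<forall>y t. vderiv \<Phi> y t (L y, 1) - L (\<Phi> y t) = F y t)"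
proof -
  have M0: "0 \<le> M" using pol_nonneg[OF H.nb_nonneg F] .
  let ?Kq = "\<Sum>i\<in>UNIV. \<Sum>j\<in>UNIV. cmod (Q i j)" and ?Ki = "\<Sum>j\<in>UNIV. \<Sum>i\<in>UNIV. cmod (Qi j i)"
  have rowQ: "(\<Sum>j\<in>UNIV. cmod (Q i j)) \<le> ?Kq" for i
    by (rule member_le_sum[of i UNIV "\<lambda>i. \<Sum>j\<in>UNIV. cmod (Q i j)"]) (auto intro: sum_nonneg)
  have rowQi: "(\<Sum>i\<in>UNIV. cmod (Qi j i)) \<le> ?Ki" for j
    by (rule member_le_sum[of j UNIV "\<lambda>j. \<Sum>i\<in>UNIV. cmod (Qi j i)"]) (auto intro: sum_nonneg)
  define G where "G j y t = (\<Sum>i\<in>UNIV. Qi j i * of_real (F y t $ i))" for j y t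
  have G: "pol H n (G j) (?Ki * M)" for j
  proof -
    have "pol H n (\<lambda>y t. \<Sum>i\<in>UNIV. Qi j i * of_real (F y t $ i)) (\<Sum>i\<in>UNIV. cmod (Qi j i) * M)"
      by (intro pol_sum pol_map[OF _ _ F]) (auto intro: sob_le_cmult)
    then have "pol H n (G j) (\<Sum>i\<in>UNIV. cmod (Qi j i) * M)" by (simp add: G_def[abs_def])
    then show ?thesis
      by (rule pol.weaken) (use mult_right_mono[OF rowQi M0, of j] in \<open>simp add: sum_distrib_right\<close>)
  qed
  have "\<exists>f. pol (smooth_le l) n f (?Ki * M / D n) \<and> (\<forall>y t. jderiv f y t (L y, 1) - d j * f y t = G j y t)" for j
    by (rule pol_homological[OF n G])
  then obtain f where f: "\<And>j. pol (smooth_le l) n (f j) (?Ki * M / D n)"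
    and eq: "\<And>j y t. jderiv (f j) y t (L y, 1) - d j * f j y t = G j y t" by metis
  define \<Phi> where "\<Phi> y t = (\<chi> i. Re (\<Sum>j\<in>UNIV. Q i j * f j y t))" for y t
  have hom: "homog n \<Phi> (homological_const / D n * M)"
    unfolding homog_def
  proof
    fix i
    have "pol (smooth_le l) n (\<lambda>y t. \<Sum>j\<in>UNIV. Q i j * f j y t) (\<Sum>j\<in>UNIV. cmod (Q i j) * (?Ki * M / D n))"
      by (intro pol_sum pol_map[OF _ _ f]) (auto intro: smooth_le_cmult)
    then have "pol (smooth_le l) n (\<lambda>y t. of_real (Re (\<Sum>j\<in>UNIV. Q i j * f j y t))) (\<Sum>j\<in>UNIV. cmod (Q i j) * (?Ki * M / D n))"
      by (rule pol_Re_smooth)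
    then have "pol (smooth_le l) n (\<lambda>y t. of_real (\<Phi> y t $ i)) (\<Sum>j\<in>UNIV. cmod (Q i j) * (?Ki * M / D n))"
      by (simp add: \<Phi>_def)
    then show "pol (smooth_le l) n (\<lambda>y t. of_real (\<Phi> y t $ i)) (homological_const / D n * M / cmult)"
    proof (rule pol.weaken)
      have "(\<Sum>j\<in>UNIV. cmod (Q i j) * (?Ki * M / D n)) = (\<Sum>j\<in>UNIV. cmod (Q i j)) * (?Ki * M / D n)"
        by (rule sum_distrib_right[symmetric])
      also have "\<dots> \<le> ?Kq * (?Ki * M / D n)"
        using M0 D_pos[of n] by (intro mult_right_mono rowQ) (auto intro!: divide_nonneg_pos mult_nonneg_nonneg sum_nonneg)
      also have "\<dots> = homological_const / D n * M / cmult"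
        using sob_const_ge_1 by (simp add: homological_const_def)
      finally show "(\<Sum>j\<in>UNIV. cmod (Q i j) * (?Ki * M / D n)) \<le> homological_const / D n * M / cmult" .
    qed
  qed
  have jd: "jderiv (\<lambda>y t. of_real (\<Phi> y t $ i)) y t q = of_real (Re (\<Sum>j\<in>UNIV. Q i j * jderiv (f j) y t q))" for i y t q
  proof -
    have "((\<lambda>p. \<Sum>j\<in>UNIV. Q i j * f j (fst p) (snd p)) has_derivative (\<lambda>q. \<Sum>j\<in>UNIV. Q i j * jderiv (f j) y t q)) (at (y, t))"
      by (intro has_derivative_sum has_derivative_mult_right pol_smooth_has_jderiv[OF f])
    from bounded_linear.has_derivative[OF bounded_linear_of_real bounded_linear.has_derivative[OF bounded_linear_Re this]]
    have "((\<lambda>p. complex_of_real (\<Phi> (fst p) (snd p) $ i)) has_derivative (\<lambda>q. of_real (Re (\<Sum>j\<in>UNIV. Q i j * jderiv (f j) y t q)))) (at (y, t))"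
      by (simp add: \<Phi>_def)
    from jderivI[of "\<lambda>y t. complex_of_real (\<Phi> y t $ i)", OF this] show ?thesis by simp
  qed
  have "vderiv \<Phi> y t (L y, 1) - L (\<Phi> y t) = F y t" for y t
  proof -
    have "vderiv \<Phi> y t (L y, 1) $ i - L (\<Phi> y t) $ i = F y t $ i" for i
    proof -
      have "L (\<Phi> y t) = (\<Sum>k\<in>UNIV. \<Phi> y t $ k *\<^sub>R L (axis k 1))"
        by (rule linear_axis_expansion[OF linear_L])
      then have "L (\<Phi> y t) $ i = (\<Sum>k\<in>UNIV. L (axis k 1) $ i * \<Phi> y t $ k)" by (simp add: mult.commute)
      also have "\<dots> = Re (\<Sum>k\<in>UNIV. of_real (L (axis k 1) $ i) * (\<Sum>j\<in>UNIV. Q k j * f j y t))"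
        by (simp add: \<Phi>_def)
      also have "(\<Sum>k\<in>UNIV. of_real (L (axis k 1) $ i) * (\<Sum>j\<in>UNIV. Q k j * f j y t))
          = (\<Sum>j\<in>UNIV. (\<Sum>k\<in>UNIV. of_real (L (axis k 1) $ i) * Q k j) * f j y t)"
        unfolding sum_distrib_left sum_distrib_right mult.assoc[symmetric] by (rule sum.swap)
      also have "\<dots> = (\<Sum>j\<in>UNIV. Q i j * (d j * f j y t))" by (simp add: L_Q mult.assoc)
      finally have "vderiv \<Phi> y t (L y, 1) $ i - L (\<Phi> y t) $ i
          = Re (\<Sum>j\<in>UNIV. Q i j * (jderiv (f j) y t (L y, 1) - d j * f j y t))"
        unfolding vderiv_def jd by (simp add: sum_subtractf right_diff_distrib)
      also have "(\<Sum>j\<in>UNIV. Q i j * (jderiv (f j) y t (L y, 1) - d j * f j y t)) = (\<Sum>j\<in>UNIV. \<Sum>k\<in>UNIV. Q i j * Qi j k * of_real (F y t $ k))"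
        by (simp add: eq G_def sum_distrib_left mult.assoc)
      also have "\<dots> = (\<Sum>k\<in>UNIV. (\<Sum>j\<in>UNIV. Q i j * Qi j k) * of_real (F y t $ k))"
        unfolding sum_distrib_right by (rule sum.swap)
      also have "\<dots> = (\<Sum>k\<in>UNIV. if k = i then of_real (F y t $ k) else 0)"
        unfolding Q_inverse by (intro sum.cong) auto
      also have "\<dots> = of_real (F y t $ i)" by simp
      finally show ?thesis by simp
    qed
    then show ?thesis by (simp add: vec_eq_iff)
  qed
  then show ?thesis using hom by blast
qed

text \<open>A bound of the identity map, written as a polynomial of degree one in the eigenforms. Adding one keeps it
away from zero.\<close>

definition coord_norm :: real where
  "coord_norm = cmult * (\<Sum>i\<in>UNIV. \<Sum>j\<in>UNIV. cmod (Q i j)) + 1"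

lemma coord_norm_ge_1: "coord_norm \<ge> 1"
  using sob_const_ge_1 unfolding coord_norm_def by (auto intro!: mult_nonneg_nonneg sum_nonneg)

lemma homog_id: "homog 1 (\<lambda>y t. y) coord_norm"
  unfolding homog_def
proof
  fix i
  have "pol (smooth_le l) 1 (\<lambda>y t. \<Sum>j\<in>UNIV. Q i j * zmono [e j] y) (\<Sum>j\<in>UNIV. cmod (Q i j))"
    by (intro pol_sum pol_term smooth_le_const) auto
  moreover have "(\<Sum>j\<in>UNIV. cmod (Q i j)) \<le> (\<Sum>i\<in>UNIV. \<Sum>j\<in>UNIV. cmod (Q i j))"
    by (rule member_le_sum[of i UNIV "\<lambda>i. \<Sum>j\<in>UNIV. cmod (Q i j)"]) (auto intro: sum_nonneg)
  moreover have "\<dots> \<le> coord_norm / cmult"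
    using sob_const_ge_1 cmult_pos by (simp add: coord_norm_def add_divide_distrib)
  ultimately have "pol (smooth_le l) 1 (\<lambda>y t. \<Sum>j\<in>UNIV. Q i j * zmono [e j] y) (coord_norm / cmult)"
    by (meson order_trans pol.weaken)
  then show "pol (smooth_le l) 1 (\<lambda>y t. complex_of_real (y $ i)) (coord_norm / cmult)"
    by (simp add: coordinate_\<zeta>)
qed

end

section \<open>Substituting a sum into a power series\<close>

definition deg :: "('m \<times> nat) list \<Rightarrow> nat" where
  "deg xs = sum_list (map snd xs)"

text \<open>The contribution of a list \<open>[(i\<^sub>1, n\<^sub>1), \<dots>, (i\<^sub>q, n\<^sub>q)]\<close> to the \<open>q\<close>-linear term of \<open>V(\<Sum>\<^sub>n U\<^sub>n)\<close>: in the \<open>k\<close>-th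
argument the \<open>i\<^sub>k\<close>-th component of the summand \<open>U\<close> with index \<open>n\<^sub>k\<close> is taken, and \<open>W\<close> holds the values of the multilinear form on
basis vectors. If \<open>U\<^sub>n\<close> is homogeneous of degree \<open>n\<close>, the degree of the contribution is \<open>deg\<close>.\<close>

definition subst_term ::
  "('m list \<Rightarrow> real \<Rightarrow> real ^ 'm) \<Rightarrow> (nat \<Rightarrow> real ^ 'm \<Rightarrow> real \<Rightarrow> real ^ 'm) \<Rightarrow> ('m \<times> nat) list \<Rightarrow> real ^ 'm \<Rightarrow> real \<Rightarrow> real ^ 'm" where
  "subst_term W U xs y t = (\<Prod>x\<leftarrow>xs. U (snd x) y t $ fst x) *\<^sub>R W (map fst xs) t"

text \<open>The lists that contribute to degree \<open>n\<close>. As they have at least two entries, all their indices are below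
\<open>n\<close>, which makes the equation of degree \<open>n\<close> a recursion.\<close>

definition graded_lists :: "nat \<Rightarrow> ('m \<times> nat) list set" where
  "graded_lists n = {xs. 2 \<le> length xs \<and> deg xs = n \<and> (\<forall>x\<in>set xs. 1 \<le> snd x)}"

lemma graded_lists_less:
  assumes "xs \<in> graded_lists n" "x \<in> set xs" shows "snd x < n"
proof -
  have pos: "\<forall>x\<in>set xs. 1 \<le> snd x" using assms by (simp add: graded_lists_def)
  obtain ys zs where xs: "xs = ys @ x # zs" using assms(2) split_list by metis
  have "length us \<le> sum_list (map snd us)" if "\<forall>x\<in>set us. 1 \<le> snd x" for us :: "('a \<times> nat) list"
    using that by (induction us) auto
  then have "length ys \<le> sum_list (map snd ys)" "length zs \<le> sum_list (map snd zs)" using pos xs by auto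
  then show ?thesis using assms(1) xs by (simp add: graded_lists_def deg_def)
qed

lemma length_le_deg: "\<forall>x\<in>set xs. 1 \<le> snd x \<Longrightarrow> length xs \<le> deg xs"
  unfolding deg_def by (induction xs) auto

lemma finite_graded_lists: "finite (graded_lists n :: ('m::finite \<times> nat) list set)"
proof (rule finite_subset)
  show "graded_lists n \<subseteq> {xs :: ('m \<times> nat) list. set xs \<subseteq> UNIV \<times> {..n} \<and> length xs \<le> n}"
  proof
    fix xs :: "('m \<times> nat) list" assume xs: "xs \<in> graded_lists n"
    then have "length xs \<le> n" using length_le_deg[of xs] by (simp add: graded_lists_def)
    then show "xs \<in> {xs. set xs \<subseteq> UNIV \<times> {..n} \<and> length xs \<le> n}"
      using graded_lists_less[OF xs] by force
  qed
qed (intro finite_lists_length_le, auto)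

text \<open>The majorant of \<open>subst_term\<close> when the form of degree \<open>q\<close> is bounded by \<open>c / \<rho>\<^sup>q\<close> and \<open>U\<^sub>n\<close> by \<open>b n\<close>.\<close>

definition maj_term :: "real \<Rightarrow> real \<Rightarrow> (nat \<Rightarrow> real) \<Rightarrow> ('m \<times> nat) list \<Rightarrow> real" where
  "maj_term c \<rho> b xs = c / \<rho> ^ length xs * (\<Prod>x\<leftarrow>xs. b (snd x))"

lemma sum_lists_prod:
  fixes g :: "'a \<Rightarrow> real"
  assumes "finite I"
  shows "(\<Sum>xs | set xs \<subseteq> I \<and> length xs = q. \<Prod>x\<leftarrow>xs. g x) = (\<Sum>x\<in>I. g x) ^ q"
proof (induction q)
  case 0
  have "{xs. set xs \<subseteq> I \<and> length xs = 0} = {[]}" by auto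
  then show ?case by simp
next
  case (Suc q)
  have eq: "{xs. set xs \<subseteq> I \<and> length xs = Suc q} = (\<lambda>(x, xs). x # xs) ` (I \<times> {xs. set xs \<subseteq> I \<and> length xs = q})"
    by (auto simp: length_Suc_conv image_iff)
  have "(\<Sum>xs | set xs \<subseteq> I \<and> length xs = Suc q. \<Prod>x\<leftarrow>xs. g x)
      = (\<Sum>(x, xs)\<in>I \<times> {xs. set xs \<subseteq> I \<and> length xs = q}. g x * (\<Prod>x\<leftarrow>xs. g x))"
    unfolding eq by (subst sum.reindex) (auto simp: inj_on_def case_prod_unfold)
  also have "\<dots> = (\<Sum>x\<in>I. g x) * (\<Sum>xs | set xs \<subseteq> I \<and> length xs = q. \<Prod>x\<leftarrow>xs. g x)"
    by (simp add: sum_product sum.cartesian_product)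
  finally show ?case using Suc by simp
qed

lemma sum_maj_term:
  fixes b :: "nat \<Rightarrow> real"
  shows "(\<Sum>xs | set xs \<subseteq> (UNIV :: 'm::finite set) \<times> {1..p} \<and> length xs = q. maj_term c \<rho> b xs)
    = c * (real CARD('m) * (\<Sum>n=1..p. b n) / \<rho>) ^ q"
proof -
  have "(\<Sum>xs | set xs \<subseteq> (UNIV :: 'm set) \<times> {1..p} \<and> length xs = q. maj_term c \<rho> b xs)
      = c / \<rho> ^ q * (\<Sum>xs | set xs \<subseteq> (UNIV :: 'm set) \<times> {1..p} \<and> length xs = q. \<Prod>x\<leftarrow>xs. b (snd x))"
    by (simp add: maj_term_def sum_distrib_left)
  also have "\<dots> = c / \<rho> ^ q * (\<Sum>x\<in>(UNIV :: 'm set) \<times> {1..p}. b (snd x)) ^ q"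
    by (subst sum_lists_prod) auto
  also have "(\<Sum>x\<in>(UNIV :: 'm set) \<times> {1..p}. b (snd x)) = real CARD('m) * (\<Sum>n=1..p. b n)"
  proof -
    have "(\<Sum>x\<in>(UNIV :: 'm set) \<times> {1..p}. b (snd x)) = (\<Sum>i\<in>(UNIV :: 'm set). \<Sum>n=1..p. b n)"
      by (subst sum.cartesian_product) (simp add: case_prod_unfold)
    then show ?thesis by simp
  qed
  finally show ?thesis by (simp add: power_divide power_mult_distrib)
qed

lemma sum_powers_from_2:
  fixes x :: real
  assumes "0 \<le> x" "x \<le> 1 / 2" shows "((\<lambda>q. x ^ q) has_sum x\<^sup>2 / (1 - x)) {2..}" "x\<^sup>2 / (1 - x) \<le> 2 * x\<^sup>2"
proof -
  have "(\<lambda>q. x\<^sup>2 * x ^ q) sums (x\<^sup>2 * (1 / (1 - x)))"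
    using assms by (intro sums_mult geometric_sums) auto
  then have "((\<lambda>q. x\<^sup>2 * x ^ q) has_sum x\<^sup>2 / (1 - x)) UNIV"
    using assms by (intro sums_nonneg_imp_has_sum) auto
  moreover have "bij_betw (\<lambda>q. q + 2) (UNIV :: nat set) {2..}"
    by (rule bij_betw_byWitness[where f' = "\<lambda>q. q - 2"]) auto
  from has_sum_reindex_bij_betw[OF this, of "\<lambda>q. x ^ q"]
  have "((\<lambda>q. x ^ (q + 2)) has_sum S) UNIV \<longleftrightarrow> ((\<lambda>q. x ^ q) has_sum S) {2..}" for S .
  moreover have "(\<lambda>q. x ^ (q + 2)) = (\<lambda>q. x\<^sup>2 * x ^ q)" by (simp add: power2_eq_square mult_ac)
  ultimately show "((\<lambda>q. x ^ q) has_sum x\<^sup>2 / (1 - x)) {2..}"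
    by metis
  have "x\<^sup>2 / (1 - x) \<le> x\<^sup>2 / (1 / 2)" using assms by (intro divide_left_mono) auto
  then show "x\<^sup>2 / (1 - x) \<le> 2 * x\<^sup>2" by simp
qed

definition subst_lists :: "nat \<Rightarrow> ('m \<times> nat) list set" where
  "subst_lists p = {xs. 2 \<le> length xs \<and> set xs \<subseteq> UNIV \<times> {1..p}}"

lemma maj_term_nonneg:
  assumes "0 \<le> c" "0 < \<rho>" "\<And>n. 0 \<le> b n" shows "0 \<le> maj_term c \<rho> b xs"
  unfolding maj_term_def using assms by (intro mult_nonneg_nonneg prod_list_nonneg) auto

lemma finite_lists_eq: "finite {xs. set xs \<subseteq> (UNIV :: 'm::finite set) \<times> {1..p::nat} \<and> length xs = q}"
  by (intro finite_lists_length_eq) auto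

text \<open>Summing over all lists of length \<open>q\<close> gives \<open>c x\<^sup>q\<close> with \<open>x = m (\<Sum>\<^sub>n b n) / \<rho>\<close>; a geometric series without its
first two terms remains.\<close>

lemma has_sum_maj_term:
  fixes b :: "nat \<Rightarrow> real"
  assumes c: "0 \<le> c" and \<rho>: "0 < \<rho>" and b: "\<And>n. 0 \<le> b n"
    and small: "real CARD('m) * (\<Sum>n=1..p. b n) / \<rho> \<le> 1 / 2"
  obtains S where "(maj_term c \<rho> b has_sum S) (subst_lists p :: ('m::finite \<times> nat) list set)"
    "S \<le> 2 * c * (real CARD('m) * (\<Sum>n=1..p. b n) / \<rho>)\<^sup>2"
proof -
  define x where "x = real CARD('m) * (\<Sum>n=1..p. b n) / \<rho>"
  have x: "0 \<le> x" "x \<le> 1 / 2" using small \<rho> b by (auto simp: x_def intro!: divide_nonneg_pos mult_nonneg_nonneg sum_nonneg)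
  let ?X = "\<lambda>q. {xs. set xs \<subseteq> (UNIV :: 'm set) \<times> {1..p} \<and> length xs = q}"
  have "((\<lambda>(q, xs). maj_term c \<rho> b xs) has_sum infsum (\<lambda>q. c * x ^ q) {2..}) (Sigma {2..} ?X)"
  proof (rule has_sum_Sigma_nonneg)
    show "((\<lambda>y. case (q, y) of (q, xs) \<Rightarrow> maj_term c \<rho> b xs) has_sum c * x ^ q) (?X q)" for q
      using sum_maj_term[where p=p and q=q and c=c and \<rho>=\<rho> and b=b and 'm='m] by (intro has_sum_finiteI finite_lists_eq) (simp add: x_def)
    show "(\<lambda>q. c * x ^ q) summable_on {2..}"
      using sum_powers_from_2(1)[OF x] by (intro summable_on_cmult_right) (rule has_sum_imp_summable)
  qed (use maj_term_nonneg[OF c \<rho> b] in auto)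
  moreover have "infsum (\<lambda>q. c * x ^ q) {2..} = c * (x\<^sup>2 / (1 - x))"
    by (intro infsumI has_sum_cmult_right sum_powers_from_2 x)
  ultimately have "((\<lambda>z. maj_term c \<rho> b (snd z)) has_sum c * (x\<^sup>2 / (1 - x))) (Sigma {2..} ?X)"
    by (simp add: case_prod_unfold)
  moreover have bij: "bij_betw snd (Sigma {2..} ?X) (subst_lists p)"
    by (rule bij_betw_byWitness[where f' = "\<lambda>xs. (length xs, xs)"]) (auto simp: subst_lists_def)
  ultimately have "(maj_term c \<rho> b has_sum c * (x\<^sup>2 / (1 - x))) (subst_lists p :: ('m \<times> nat) list set)"
    by (rule has_sum_reindex_bij_betw[THEN iffD1, rotated])
  moreover have "c * (x\<^sup>2 / (1 - x)) \<le> 2 * c * x\<^sup>2"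
    using mult_left_mono[OF sum_powers_from_2(2)[OF x] c] by simp
  ultimately show thesis using that unfolding x_def by blast
qed

section \<open>The formal solution and its majorant\<close>

context eigenforms
begin

lemma pol_subst_term:
  assumes U: "\<And>x i. x \<in> set xs \<Longrightarrow> pol A (snd x) (\<lambda>y t. of_real (U (snd x) y t $ i)) (b (snd x))"
    and W: "\<And>w j. H (\<lambda>t. of_real (W w t $ j)) (c / \<rho> ^ length w)"
  shows "pol H (deg xs) (\<lambda>y t. of_real (subst_term W U xs y t $ j)) (maj_term c \<rho> b xs)"
proof -
  have "pol A (deg xs) (\<lambda>y t. of_real (\<Prod>x\<leftarrow>xs. U (snd x) y t $ fst x)) (\<Prod>x\<leftarrow>xs. b (snd x))"
    using U
  proof (induction xs)
    case Nil then show ?case using pol_const_A by (simp add: deg_def)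
  next
    case (Cons x xs)
    have "pol A (snd x + deg xs) (\<lambda>y t. of_real (U (snd x) y t $ fst x) * of_real (\<Prod>x\<leftarrow>xs. U (snd x) y t $ fst x))
       (b (snd x) * (\<Prod>x\<leftarrow>xs. b (snd x)))"
      using Cons by (intro pol_mult mult_le_mult A.nb_nonneg) auto
    then show ?case by (simp add: deg_def)
  qed
  moreover have "pol H 0 (\<lambda>y t. of_real (W (map fst xs) t $ j)) (c / \<rho> ^ length xs)"
    using pol_term[of H _ _ "[]" 0, OF W[of "map fst xs" j]] by simp
  ultimately have "pol H (deg xs + 0) (\<lambda>y t. of_real (\<Prod>x\<leftarrow>xs. U (snd x) y t $ fst x) * of_real (W (map fst xs) t $ j))
     ((\<Prod>x\<leftarrow>xs. b (snd x)) * (c / \<rho> ^ length xs))"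
    by (intro pol_mult mult_le_sob_le H.nb_nonneg) auto
  then show ?thesis by (simp add: subst_term_def maj_term_def mult.commute)
qed

text \<open>The polynomials and their bounds are defined simultaneously by well-founded recursion on the degree, with
\<open>homological_equation\<close> as the choice in each step.\<close>

lemma formal_solution:
  assumes W: "\<And>w j. H (\<lambda>t. of_real (W w t $ j)) (c / \<rho> ^ length w)"
  obtains \<Phi> \<phi> where "\<Phi> 1 = (\<lambda>y t. y)" "\<phi> 1 = coord_norm"
    "\<And>n. 1 \<le> n \<Longrightarrow> homog n (\<Phi> n) (\<phi> n)"
    "\<And>n y t. 2 \<le> n \<Longrightarrow> vderiv (\<Phi> n) y t (L y, 1) - L (\<Phi> n y t) = (\<Sum>xs\<in>graded_lists n. subst_term W \<Phi> xs y t)"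
    "\<And>n. 2 \<le> n \<Longrightarrow> \<phi> n = homological_const / D n * (\<Sum>xs\<in>graded_lists n. maj_term c \<rho> \<phi> (xs :: ('m \<times> nat) list))"
proof -
  \<comment> \<open>\<open>P f n r\<close>: the pair \<open>r\<close> of a polynomial and a bound is admissible in degree \<open>n\<close> if \<open>f\<close> provides the lower degrees.\<close>
  define P where "P f n r \<longleftrightarrow>
     (n = 1 \<longrightarrow> r = ((\<lambda>y t. y), coord_norm)) \<and>
     (1 \<le> n \<longrightarrow> homog n (fst r) (snd r)) \<and>
     (2 \<le> n \<longrightarrow> (\<forall>y t. vderiv (fst r) y t (L y, 1) - L (fst r y t) = (\<Sum>xs\<in>graded_lists n. subst_term W (fst \<circ> f) xs y t)) \<and>
       snd r = homological_const / D n * (\<Sum>xs\<in>graded_lists n. maj_term c \<rho> (snd \<circ> f) (xs :: ('m \<times> nat) list)))"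
    for f :: "nat \<Rightarrow> (real ^ 'm \<Rightarrow> real \<Rightarrow> real ^ 'm) \<times> real" and n r
  have "\<exists>f. \<forall>n. P f n (f n)"
  proof (rule dependent_wf_choice[OF wf_less])
    fix f g :: "nat \<Rightarrow> (real ^ 'm \<Rightarrow> real \<Rightarrow> real ^ 'm) \<times> real" and n r
    assume eq: "\<And>z. (z, n) \<in> {(x, y). x < y} \<Longrightarrow> f z = g z"
    have 1: "subst_term W (fst \<circ> f) xs y t = subst_term W (fst \<circ> g) xs y t"
      if "xs \<in> graded_lists n" for xs y t
    proof -
      have "map (\<lambda>x. (fst \<circ> f) (snd x) y t $ fst x) xs = map (\<lambda>x. (fst \<circ> g) (snd x) y t $ fst x) xs"
        using graded_lists_less[OF that] eq by simp
      then show ?thesis unfolding subst_term_def by presburger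
    qed
    have 2: "maj_term c \<rho> (snd \<circ> f) xs = maj_term c \<rho> (snd \<circ> g) xs"
      if "xs \<in> graded_lists n" for xs :: "('m \<times> nat) list"
    proof -
      have "map (\<lambda>x. (snd \<circ> f) (snd x)) xs = map (\<lambda>x. (snd \<circ> g) (snd x)) xs"
        using graded_lists_less[OF that] eq by simp
      then show ?thesis unfolding maj_term_def by presburger
    qed
    show "P f n r = P g n r" unfolding P_def using 1 2 by (simp cong: sum.cong)
  next
    fix n :: nat and f assume IH: "\<And>y. (y, n) \<in> {(x, y). x < y} \<Longrightarrow> P f y (f y)"
    consider "n = 0" | "n = 1" | "2 \<le> n" by linarith
    then show "\<exists>r. P f n r"
    proof cases
      case 1 then show ?thesis by (auto simp: P_def)
    next
      case 2 then show ?thesis using homog_id by (auto simp: P_def)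
    next
      case 3
      define F where "F y t = (\<Sum>xs\<in>graded_lists n. subst_term W (fst \<circ> f) xs y t)" for y t
      define M where "M = (\<Sum>xs\<in>graded_lists n. maj_term c \<rho> (snd \<circ> f) (xs :: ('m \<times> nat) list))"
      have F: "pol H n (\<lambda>y t. of_real (F y t $ j)) M" for j
      proof -
        have "pol H n (\<lambda>y t. \<Sum>xs\<in>graded_lists n. of_real (subst_term W (fst \<circ> f) xs y t $ j)) M"
          unfolding M_def
        proof (rule pol_sum[OF finite_graded_lists])
          fix xs :: "('m \<times> nat) list" assume xs: "xs \<in> graded_lists n"
          have "pol H (deg xs) (\<lambda>y t. of_real (subst_term W (fst \<circ> f) xs y t $ j)) (maj_term c \<rho> (snd \<circ> f) xs)"
          proof (rule pol_subst_term[OF _ W])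
            fix x i assume x: "x \<in> set xs"
            have "snd x < n" "1 \<le> snd x" using graded_lists_less[OF xs x] xs x by (auto simp: graded_lists_def)
            then have "homog (snd x) (fst (f (snd x))) (snd (f (snd x)))" using IH[of "snd x"] by (simp add: P_def)
            then show "pol A (snd x) (\<lambda>y t. of_real ((fst \<circ> f) (snd x) y t $ i)) ((snd \<circ> f) (snd x))"
              using homog_A by simp
          qed
          then show "pol H n (\<lambda>y t. of_real (subst_term W (fst \<circ> f) xs y t $ j)) (maj_term c \<rho> (snd \<circ> f) xs)"
            using xs by (simp add: graded_lists_def)
        qed
        then show ?thesis by (simp add: F_def)
      qed
      obtain \<Phi> where "homog n \<Phi> (homological_const / D n * M)" "\<And>y t. vderiv \<Phi> y t (L y, 1) - L (\<Phi> y t) = F y t"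
        using homological_equation[OF 3 F] by blast
      then have "P f n (\<Phi>, homological_const / D n * M)" using 3 by (simp add: P_def F_def M_def)
      then show ?thesis by blast
    qed
  qed
  then obtain f where f: "\<And>n. P f n (f n)" by blast
  show thesis
  proof (rule that[of "fst \<circ> f" "snd \<circ> f"])
    show "(fst \<circ> f) 1 = (\<lambda>y t. y)" "(snd \<circ> f) 1 = coord_norm" using f[of 1] by (simp_all add: P_def)
    show "homog n ((fst \<circ> f) n) ((snd \<circ> f) n)" if "1 \<le> n" for n using f[of n] that by (simp add: P_def)
    show "vderiv ((fst \<circ> f) n) y t (L y, 1) - L ((fst \<circ> f) n y t) = (\<Sum>xs\<in>graded_lists n. subst_term W (fst \<circ> f) xs y t)"
      if "2 \<le> n" for n y t using f[of n] that by (simp add: P_def)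
    show "(snd \<circ> f) n = homological_const / D n * (\<Sum>xs\<in>graded_lists n. maj_term c \<rho> (snd \<circ> f) (xs :: ('m \<times> nat) list))"
      if "2 \<le> n" for n using f[of n] that by (simp add: P_def)
  qed
qed

text \<open>The bound of the partial sum up to \<open>N\<close> reproduces itself: a list with at least two entries and degree at most
\<open>N + 1\<close> has only indices up to \<open>N\<close>, so the sum over \<open>n \<le> N + 1\<close> of the right-hand sides of the recursion is at most the full geometric majorant
evaluated at the partial sum up to \<open>N\<close>. Its value is quadratic in \<open>s\<close>, and \<open>small2\<close> says that \<open>s\<close> is small enough
compared to \<open>1 / \<kappa>\<close>.\<close>

lemma majorant_bound:
  fixes \<phi> :: "nat \<Rightarrow> real"
  assumes c: "0 < c" and \<rho>: "0 < \<rho>" and \<phi>0: "\<And>n. 0 \<le> \<phi> n" and s: "0 < s"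
    and rec: "\<And>n. 2 \<le> n \<Longrightarrow> n \<le> p \<Longrightarrow> \<phi> n \<le> \<kappa> * (\<Sum>xs\<in>graded_lists n. maj_term c \<rho> \<phi> (xs :: ('m \<times> nat) list))"
    and \<kappa>: "0 \<le> \<kappa>"
    and small1: "real CARD('m) * (2 * (\<phi> 1 * s)) / \<rho> \<le> 1 / 2"
    and small2: "\<kappa> * (2 * c * (real CARD('m) * (2 * (\<phi> 1 * s)) / \<rho>)\<^sup>2) \<le> \<phi> 1 * s"
  shows "N \<le> p \<Longrightarrow> (\<Sum>n=1..N. \<phi> n * s ^ n) \<le> 2 * (\<phi> 1 * s)"
proof (induction N)
  case 0 show ?case using \<phi>0 s by simp
next
  case (Suc N)
  define b where "b n = \<phi> n * s ^ n" for n
  have b0: "0 \<le> b n" for n using \<phi>0 s by (simp add: b_def)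
  have IH: "(\<Sum>n=1..N. b n) \<le> 2 * (\<phi> 1 * s)" using Suc by (simp add: b_def)
  have xle: "real CARD('m) * (\<Sum>n=1..N. b n) / \<rho> \<le> real CARD('m) * (2 * (\<phi> 1 * s)) / \<rho>"
    using IH \<rho> by (intro divide_right_mono mult_left_mono) auto
  have x0: "0 \<le> real CARD('m) * (\<Sum>n=1..N. b n) / \<rho>"
    using \<rho> b0 by (intro divide_nonneg_pos mult_nonneg_nonneg sum_nonneg) auto
  obtain S where S: "(maj_term c \<rho> b has_sum S) (subst_lists N :: ('m \<times> nat) list set)"
    "S \<le> 2 * c * (real CARD('m) * (\<Sum>n=1..N. b n) / \<rho>)\<^sup>2"
    using has_sum_maj_term[where 'm='m, OF less_imp_le[OF c] \<rho> b0 order_trans[OF xle small1]] by blast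
  have tm: "s ^ deg xs * maj_term c \<rho> \<phi> xs = maj_term c \<rho> b xs" for xs :: "('m \<times> nat) list"
  proof -
    have "s ^ deg xs * (\<Prod>x\<leftarrow>xs. \<phi> (snd x)) = (\<Prod>x\<leftarrow>xs. b (snd x))"
      by (induction xs) (auto simp: deg_def b_def power_add)
    then show ?thesis by (simp add: maj_term_def mult_ac)
  qed
  have mnn: "0 \<le> maj_term c \<rho> b xs" for xs :: "('m \<times> nat) list"
    using maj_term_nonneg[of c \<rho> b] c \<rho> b0 by simp
  have "(\<Sum>n=2..Suc N. b n) \<le> (\<Sum>n=2..Suc N. \<kappa> * (\<Sum>xs\<in>graded_lists n. maj_term c \<rho> b (xs :: ('m \<times> nat) list)))"
  proof (rule sum_mono)
    fix n assume n: "n \<in> {2..Suc N}"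
    have "b n \<le> (\<kappa> * (\<Sum>xs\<in>graded_lists n. maj_term c \<rho> \<phi> (xs :: ('m \<times> nat) list))) * s ^ n"
      unfolding b_def using rec[of n] n Suc(2) s by (intro mult_right_mono) auto
    also have "\<dots> = \<kappa> * (\<Sum>xs\<in>graded_lists n. s ^ n * maj_term c \<rho> \<phi> (xs :: ('m \<times> nat) list))"
      by (simp add: sum_distrib_left mult_ac)
    also have "(\<Sum>xs\<in>graded_lists n. s ^ n * maj_term c \<rho> \<phi> (xs :: ('m \<times> nat) list)) = (\<Sum>xs\<in>graded_lists n. maj_term c \<rho> b (xs :: ('m \<times> nat) list))"
      by (intro sum.cong refl) (simp add: tm[symmetric] graded_lists_def)
    finally show "b n \<le> \<kappa> * (\<Sum>xs\<in>graded_lists n. maj_term c \<rho> b (xs :: ('m \<times> nat) list))" .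
  qed
  also have "\<dots> = \<kappa> * (\<Sum>xs\<in>(\<Union>n\<in>{2..Suc N}. graded_lists n). maj_term c \<rho> b (xs :: ('m \<times> nat) list))"
  proof -
    have "(\<Sum>xs\<in>(\<Union>n\<in>{2..Suc N}. graded_lists n). maj_term c \<rho> b (xs :: ('m \<times> nat) list))
        = (\<Sum>n=2..Suc N. \<Sum>xs\<in>graded_lists n. maj_term c \<rho> b (xs :: ('m \<times> nat) list))"
      by (rule sum.UNION_disjoint) (simp_all only: finite_graded_lists finite_atLeastAtMost ball_simps, auto simp: graded_lists_def)
    then show ?thesis by (simp only: sum_distrib_left[symmetric])
  qed
  also have "\<dots> \<le> \<kappa> * S"
  proof (intro mult_left_mono \<kappa>)
    have sub: "(\<Union>n\<in>{2..Suc N}. graded_lists n) \<subseteq> (subst_lists N :: ('m \<times> nat) list set)"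
    proof
      fix xs :: "('m \<times> nat) list" assume "xs \<in> (\<Union>n\<in>{2..Suc N}. graded_lists n)"
      then obtain n where n: "n \<le> Suc N" "xs \<in> graded_lists n" by auto
      then have "1 \<le> snd x \<and> snd x \<le> N" if "x \<in> set xs" for x
        using graded_lists_less[OF n(2) that] that by (auto simp: graded_lists_def)
      then show "xs \<in> subst_lists N" using n(2) by (force simp: subst_lists_def graded_lists_def)
    qed
    show "(\<Sum>xs\<in>(\<Union>n\<in>{2..Suc N}. graded_lists n). maj_term c \<rho> b (xs :: ('m \<times> nat) list)) \<le> S"
      by (rule finite_sum_le_has_sum[OF S(1)]) (use sub mnn finite_graded_lists in auto)
  qed
  also have "\<dots> \<le> \<kappa> * (2 * c * (real CARD('m) * (2 * (\<phi> 1 * s)) / \<rho>)\<^sup>2)"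
  proof (intro mult_left_mono \<kappa>)
    have "(real CARD('m) * (\<Sum>n=1..N. b n) / \<rho>)\<^sup>2 \<le> (real CARD('m) * (2 * (\<phi> 1 * s)) / \<rho>)\<^sup>2"
      using x0 xle by (intro power_mono)
    then have "2 * c * (real CARD('m) * (\<Sum>n=1..N. b n) / \<rho>)\<^sup>2 \<le> 2 * c * (real CARD('m) * (2 * (\<phi> 1 * s)) / \<rho>)\<^sup>2"
      using c by (intro mult_left_mono) auto
    with S(2) show "S \<le> 2 * c * (real CARD('m) * (2 * (\<phi> 1 * s)) / \<rho>)\<^sup>2" by (rule order_trans)
  qed
  also have "\<dots> \<le> \<phi> 1 * s" by (rule small2)
  finally have "(\<Sum>n=2..Suc N. b n) \<le> \<phi> 1 * s" .
  moreover have "(\<Sum>n=1..Suc N. b n) = b 1 + (\<Sum>n=2..Suc N. b n)"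
    by (simp add: sum.atLeast_Suc_atMost numeral_2_eq_2)
  moreover have "b 1 = \<phi> 1 * s" by (simp add: b_def)
  ultimately show ?case unfolding b_def[symmetric] by linarith
qed

end

section \<open>The substituted series\<close>

context sobolev_multipliers
begin

lemma series_le_subst_term:
  assumes r: "0 \<le> r" and U: "\<And>x i. x \<in> set xs \<Longrightarrow> series_le A r (\<lambda>h t. of_real (U (snd x) (y0 + h) t $ i)) (b (snd x))"
    and W: "\<And>w j. H (\<lambda>t. of_real (W w t $ j)) (c / \<rho> ^ length w)"
  shows "series_le H r (\<lambda>h t. of_real (subst_term W U xs (y0 + h) t $ j)) (maj_term c \<rho> b xs)"
proof -
  have "series_le A r (\<lambda>h t. of_real (\<Prod>x\<leftarrow>xs. U (snd x) (y0 + h) t $ fst x)) (\<Prod>x\<leftarrow>xs. b (snd x))"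
    using U
  proof (induction xs)
    case Nil then show ?case using A.series_le_const[OF mult_le_const[of l 1]] by simp
  next
    case (Cons x xs)
    have "series_le A r (\<lambda>h t. of_real (U (snd x) (y0 + h) t $ fst x) * of_real (\<Prod>x\<leftarrow>xs. U (snd x) (y0 + h) t $ fst x))
       (b (snd x) * (\<Prod>x\<leftarrow>xs. b (snd x)))"
      using Cons by (intro series_le_mult_A r) auto
    then show ?case by simp
  qed
  from series_le_mult_H[OF r this H.series_le_const[OF W[of "map fst xs" j]]]
  show ?thesis by (simp add: subst_term_def maj_term_def mult.commute)
qed

text \<open>The substituted series is a sum of normally convergent series over the lists in \<open>Y\<close>, with the majorant terms
as bounds. Allowing a subset \<open>Y\<close> of the lists gives the estimate of the terms of high degree alone.\<close>

lemma series_le_subst: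
  fixes U :: "nat \<Rightarrow> real ^ 'm \<Rightarrow> real \<Rightarrow> real ^ 'm"
  assumes r: "0 \<le> r" and c: "0 < c" and \<rho>: "0 < \<rho>"
    and b: "\<And>n. 0 \<le> b n" and small: "real CARD('m) * (\<Sum>n=1..p. b n) / \<rho> \<le> 1 / 2"
    and U: "\<And>n i. n \<in> {1..p} \<Longrightarrow> series_le A r (\<lambda>h t. of_real (U n (y0 + h) t $ i)) (b n)"
    and W: "\<And>w j. H (\<lambda>t. of_real (W w t $ j)) (c / \<rho> ^ length w)"
    and Y: "Y \<subseteq> subst_lists p"
    and M: "\<And>S. (maj_term c \<rho> b has_sum S) Y \<Longrightarrow> S \<le> M"
  shows "\<And>h t. (\<And>j. \<bar>h $ j\<bar> \<le> r) \<Longrightarrow> (\<lambda>xs. subst_term W U xs (y0 + h) t) summable_on Y"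
    and "series_le H r (\<lambda>h t. of_real ((\<Sum>\<^sub>\<infinity>xs\<in>Y. subst_term W U xs (y0 + h) t) $ j)) M"
proof -
  obtain S where S: "(maj_term c \<rho> b has_sum S) (subst_lists p :: ('m \<times> nat) list set)"
    using has_sum_maj_term[of c \<rho> b p, where 'm='m] c \<rho> b small by auto
  then have sY: "maj_term c \<rho> b summable_on Y"
    using Y has_sum_imp_summable summable_on_subset by blast
  have ser: "series_le H r (\<lambda>h t. of_real (subst_term W U xs (y0 + h) t $ j)) (maj_term c \<rho> b xs)" if "xs \<in> Y" for xs j
  proof (rule series_le_subst_term[OF r U W])
    fix x assume "x \<in> set xs"
    moreover have "xs \<in> subst_lists p" using that Y by blast
    ultimately show "snd x \<in> {1..p}" by (force simp: subst_lists_def)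
  qed
  have sums: "((\<lambda>xs. subst_term W U xs (y0 + h) t) summable_on Y)" if h: "\<And>j. \<bar>h $ j\<bar> \<le> r" for h t
  proof -
    have "norm (subst_term W U xs (y0 + h) t) \<le> (sob_const * real CARD('m)) * maj_term c \<rho> b xs" if "xs \<in> Y" for xs
    proof -
      have "\<bar>subst_term W U xs (y0 + h) t $ j\<bar> \<le> sob_const * maj_term c \<rho> b xs" for j
        using H.series_le_sup[OF r ser[OF that, where j=j] h, where t=t] by simp
      then have "(\<Sum>j\<in>UNIV. \<bar>subst_term W U xs (y0 + h) t $ j\<bar>) \<le> (\<Sum>j\<in>(UNIV :: 'm set). sob_const * maj_term c \<rho> b xs)"
        by (rule sum_mono)
      with norm_le_l1_cart[of "subst_term W U xs (y0 + h) t"] show ?thesis by (simp add: mult_ac)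
    qed
    then have "(\<lambda>xs. norm (subst_term W U xs (y0 + h) t)) summable_on Y"
      by (intro summable_on_comparison_test[OF summable_on_cmult_right[OF sY]]) auto
    then show ?thesis by (rule Infinite_Sum.abs_summable_summable)
  qed
  then show "\<And>h t. (\<And>j. \<bar>h $ j\<bar> \<le> r) \<Longrightarrow> (\<lambda>xs. subst_term W U xs (y0 + h) t) summable_on Y" .
  have "series_le H r (\<lambda>h t. of_real ((\<Sum>\<^sub>\<infinity>xs\<in>Y. subst_term W U xs (y0 + h) t) $ j)) (infsum (maj_term c \<rho> b) Y)"
  proof (rule H.series_le_has_sum[OF r _ ser sY])
    show "countable Y" by simp
    fix h :: "real ^ 'm" and t assume h: "\<And>j. \<bar>h $ j\<bar> \<le> r"
    have "((\<lambda>xs. subst_term W U xs (y0 + h) t) has_sum (\<Sum>\<^sub>\<infinity>xs\<in>Y. subst_term W U xs (y0 + h) t)) Y"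
      using sums[OF h] by (rule has_sum_infsum)
    from has_sum_bounded_linear[OF bounded_linear_vec_nth this, of j]
    show "((\<lambda>xs. complex_of_real (subst_term W U xs (y0 + h) t $ j)) has_sum
        of_real ((\<Sum>\<^sub>\<infinity>xs\<in>Y. subst_term W U xs (y0 + h) t) $ j)) Y"
      by (intro has_sum_of_real) (simp add: o_def)
  qed
  moreover have "infsum (maj_term c \<rho> b) Y \<le> M" using sY by (intro M has_sum_infsum)
  ultimately show "series_le H r (\<lambda>h t. of_real ((\<Sum>\<^sub>\<infinity>xs\<in>Y. subst_term W U xs (y0 + h) t) $ j)) M"
    by (rule H.series_le_mono)
qed

end

lemma multilinear_expansion:
  fixes F :: "(real ^ 'm) list \<Rightarrow> real ^ 'm"
  assumes lin: "\<And>us i. length us = q \<Longrightarrow> i < q \<Longrightarrow> linear (\<lambda>x. F (us[i := x]))" and I: "finite I"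
  shows "length pre + k = q \<Longrightarrow> F (pre @ replicate k (\<Sum>x\<in>I. s x *\<^sub>R v x))
     = (\<Sum>xs | set xs \<subseteq> I \<and> length xs = k. (\<Prod>x\<leftarrow>xs. s x) *\<^sub>R F (pre @ map v xs))"
proof (induction k arbitrary: pre)
  case 0
  have "{xs. set xs \<subseteq> I \<and> length xs = 0} = {[]}" by auto
  then show ?case by simp
next
  case (Suc k)
  let ?u = "\<Sum>x\<in>I. s x *\<^sub>R v x"
  have eq: "{xs. set xs \<subseteq> I \<and> length xs = Suc k} = (\<lambda>(x, xs). x # xs) ` (I \<times> {xs. set xs \<subseteq> I \<and> length xs = k})"
    by (auto simp: length_Suc_conv image_iff)
  have lin': "linear (\<lambda>z. F (pre @ z # replicate k ?u))"
    using lin[of "pre @ 0 # replicate k ?u" "length pre"] Suc.prems by (simp add: list_update_append)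
  have "F (pre @ replicate (Suc k) ?u) = (\<Sum>x\<in>I. s x *\<^sub>R F (pre @ v x # replicate k ?u))"
    using linear_sum[OF lin', of "\<lambda>x. s x *\<^sub>R v x" I] linear_scale[OF lin'] by simp
  also have "\<dots> = (\<Sum>x\<in>I. \<Sum>xs | set xs \<subseteq> I \<and> length xs = k. (s x * (\<Prod>x\<leftarrow>xs. s x)) *\<^sub>R F (pre @ v x # map v xs))"
    using Suc.IH[of "pre @ [v _]"] Suc.prems by (simp add: scaleR_sum_right)
  also have "\<dots> = (\<Sum>xs | set xs \<subseteq> I \<and> length xs = Suc k. (\<Prod>x\<leftarrow>xs. s x) *\<^sub>R F (pre @ map v xs))"
    unfolding eq by (subst sum.reindex) (auto simp: inj_on_def case_prod_unfold sum.cartesian_product)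
  finally show ?case .
qed

section \<open>The transformed equation\<close>

context sobolev_multipliers
begin

text \<open>If \<open>V(y + \<Phi>)\<close> is \<open>D\<Phi> (L y, 1) - L \<Phi>\<close> up to \<open>Q\<close>, then the new equation is \<open>y' = L y + R\<close> with
\<open>(1 + D\<^sub>y\<Phi>) R = Q\<close>. Near each \<open>y\<^sub>0\<close> a fixed linear map \<open>S\<close> serves as an approximate inverse of \<open>1 + D\<^sub>y\<Phi>\<close>. The
defect \<open>1 - S (1 + D\<^sub>y\<Phi>)\<close> is a contraction, so \<open>1 + D\<^sub>y\<Phi>\<close> is injective, which makes the two equations equivalent,
and \<open>R\<close> is the Neumann series applied to \<open>S Q\<close>, which makes it analytic.\<close>

lemma normal_form_by_inversion:
  fixes \<Phi> Q :: "real ^ 'm \<Rightarrow> real \<Rightarrow> real ^ 'm" and V :: "real ^ 'm \<Rightarrow> real \<Rightarrow> real ^ 'm"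
  assumes L: "linear L"
    and d\<Phi>: "\<And>y t. ((\<lambda>p. \<Phi> (fst p) (snd p)) has_derivative d\<Phi> y t) (at (y, t))"
    and Q: "\<And>y t. y \<in> cball 0 \<delta> \<Longrightarrow> y + \<Phi> y t \<in> \<Omega> \<Longrightarrow> V (y + \<Phi> y t) t = Q y t + (d\<Phi> y t (L y, 1) - L (\<Phi> y t))"
    and loc: "\<And>y0. y0 \<in> cball 0 \<delta> \<Longrightarrow> \<exists>r>0. \<exists>S :: real ^ 'm \<Rightarrow> real ^ 'm. linear S \<and>
       (\<forall>i j. series_le A r (\<lambda>h t. of_real ((axis j 1 - S (axis j 1 + d\<Phi> (y0 + h) t (axis j 1, 0))) $ i)) \<theta>) \<and>
       (\<forall>i. series_le H r (\<lambda>h t. of_real (S (Q (y0 + h) t) $ i)) B)"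
    and \<theta>: "sob_const * real CARD('m) * \<theta> \<le> 1 / 2"
  obtains R where "transforms_into (\<lambda>u t. L u + V u t) \<Omega> \<Phi> (\<lambda>y t. L y + R y t) (cball 0 \<delta>)"
    "sobolev_analytic_on T l R (cball 0 \<delta>)"
    "\<And>y. y \<in> cball 0 \<delta> \<Longrightarrow> R y \<in> sobolev T l \<and> sobolev_norm T l (R y) \<le> real CARD('m) * (2 * B)"
proof -
  define E where "E y t v = v + d\<Phi> y t (v, 0)" for y t v
  have lind: "linear (d\<Phi> y t)" for y t using d\<Phi>[of y t] by (simp add: has_derivative_linear)
  have linE: "linear (E y t)" for y t
  proof (rule linearI)
    fix a b :: "real ^ 'm" and s :: real
    have 1: "d\<Phi> y t (a + b, 0) = d\<Phi> y t (a, 0) + d\<Phi> y t (b, 0)"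
      using linear_add[OF lind, of y t "(a, 0)" "(b, 0)"] by simp
    have 2: "d\<Phi> y t (s *\<^sub>R a, 0) = s *\<^sub>R d\<Phi> y t (a, 0)"
      using linear_scale[OF lind, of y t s "(a, 0)"] by simp
    show "E y t (a + b) = E y t a + E y t b" by (simp add: E_def 1)
    show "E y t (s *\<^sub>R a) = s *\<^sub>R E y t a" by (simp add: E_def 2 scaleR_add_right)
  qed
  \<comment> \<open>The solution of \<open>E R = Q\<close>, unique wherever \<open>E\<close> is injective.\<close>
  define R where "R y t = (SOME v. E y t v = Q y t)" for y t
  define Good where "Good y0 r S \<longleftrightarrow> r > 0 \<and> linear S \<and>
      (\<forall>i j. series_le A r (\<lambda>h t. of_real ((axis j 1 - S (E (y0 + h) t (axis j 1))) $ i)) \<theta>) \<and>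
      (\<forall>i. series_le H r (\<lambda>h t. of_real (S (Q (y0 + h) t) $ i)) B)" for y0 r S
  have GoodD: "r > 0" "linear S"
      "series_le A r (\<lambda>h t. of_real ((axis j 1 - S (E (y0 + h) t (axis j 1))) $ i)) \<theta>"
      "series_le H r (\<lambda>h t. of_real (S (Q (y0 + h) t) $ i)) B"
    if "Good y0 r S" for y0 r S i j
    using that unfolding Good_def by simp_all
  have ex_good: "\<exists>r S. Good y0 r S" if "y0 \<in> cball 0 \<delta>" for y0
    using loc[OF that] unfolding Good_def E_def by blast
  have injE: "inj (E (y0 + h) t)" if good: "Good y0 r S" and h: "\<And>j. \<bar>h $ j\<bar> \<le> r" for y0 r S h t
  proof -
    note r = GoodD(1)[OF good] and S = GoodD(2)[OF good] and K = GoodD(3)[OF good]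
    show ?thesis
      unfolding linear_injective_0[OF linE]
    proof (intro allI impI)
      fix v assume v: "E (y0 + h) t v = 0"
      let ?K = "\<lambda>v. v - S (E (y0 + h) t v)"
      have linK: "linear ?K"
        using linear_compose[OF linE S] by (intro linear_compose_sub linear_id[unfolded id_def]) (simp add: o_def)
      have entry: "\<bar>?K (axis j 1) $ i\<bar> \<le> sob_const * \<theta>" for i j
        using A.series_le_sup[OF less_imp_le[OF r] K[where i=i and j=j] h, where t=t] by (simp only: norm_of_real)
      have veq: "v = ?K v" using v S by (simp add: linear_0)
      have "\<bar>v $ i\<bar> \<le> (\<Sum>j\<in>UNIV. \<bar>v $ j\<bar>) * (sob_const * \<theta>)" for i
      proof -
        have lax: "?K v = (\<Sum>j\<in>UNIV. v $ j *\<^sub>R ?K (axis j 1))" by (rule linear_axis_expansion[OF linK])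
        then have "v $ i = (\<Sum>j\<in>UNIV. v $ j * (?K (axis j 1) $ i))"
          using arg_cong[OF trans[OF veq lax], of "\<lambda>z. z $ i"]
          by (simp only: sum_component vector_scaleR_component real_scaleR_def)
        then have "\<bar>v $ i\<bar> \<le> (\<Sum>j\<in>UNIV. \<bar>v $ j * (?K (axis j 1) $ i)\<bar>)" by (simp only: sum_abs)
        also have "\<dots> \<le> (\<Sum>j\<in>UNIV. \<bar>v $ j\<bar> * (sob_const * \<theta>))"
          unfolding abs_mult using entry by (intro sum_mono mult_left_mono) auto
        finally show ?thesis by (simp add: sum_distrib_right)
      qed
      then have "(\<Sum>i\<in>UNIV. \<bar>v $ i\<bar>) \<le> (\<Sum>i\<in>(UNIV::'m set). (\<Sum>j\<in>UNIV. \<bar>v $ j\<bar>) * (sob_const * \<theta>))"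
        by (rule sum_mono)
      also have "\<dots> = (\<Sum>j\<in>UNIV. \<bar>v $ j\<bar>) * (sob_const * real CARD('m) * \<theta>)" by (simp add: mult_ac)
      also have "\<dots> \<le> (\<Sum>j\<in>UNIV. \<bar>v $ j\<bar>) * (1 / 2)" by (intro mult_left_mono \<theta> sum_nonneg) auto
      finally have "(\<Sum>i\<in>UNIV. \<bar>v $ i\<bar>) \<le> 0" by simp
      then have "norm v \<le> 0" using norm_le_l1_cart[of v] by linarith
      then show "v = 0" by simp
    qed
  qed
  have inj0: "inj (E y t)" if y: "y \<in> cball 0 \<delta>" for y t
  proof -
    obtain r S where "Good y r S" using ex_good[OF y] by blast
    from injE[OF this, of 0 t] GoodD(1)[OF this] show ?thesis by simp
  qed
  have solve: "E y t (R y t) = Q y t" if "inj (E y t)" for y t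
  proof -
    have "surj (E y t)" using linear_injective_imp_surjective[OF linE that] by simp
    then have "\<exists>v. E y t v = Q y t" by (metis surjD)
    then show ?thesis unfolding R_def by (rule someI_ex)
  qed
  have ser: "\<exists>r>0. \<forall>i. series_le H r (\<lambda>h t. of_real (R (y0 + h) t $ i)) (2 * B)" if y0: "y0 \<in> cball 0 \<delta>" for y0
  proof -
    obtain r S where good: "Good y0 r S" using ex_good[OF y0] by blast
    note r = GoodD(1)[OF good] and S = GoodD(2)[OF good] and K = GoodD(3)[OF good] and g = GoodD(4)[OF good]
      and inj = injE[OF good]
    have "series_le H r (\<lambda>h t. of_real (R (y0 + h) t $ i)) (2 * B)" for i
    proof (rule series_le_fixed_point[where R = "\<lambda>i h t. complex_of_real (R (y0 + h) t $ i)", OF less_imp_le[OF r] K \<theta> g])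
      fix i :: 'm and h :: "real ^ 'm" and t assume h: "\<And>j. \<bar>h $ j\<bar> \<le> r"
      let ?v = "R (y0 + h) t" and ?K = "\<lambda>v. v - S (E (y0 + h) t v)"
      have linK: "linear ?K"
        using linear_compose[OF linE S] by (intro linear_compose_sub linear_id[unfolded id_def]) (simp add: o_def)
      have "?K ?v = (\<Sum>j\<in>UNIV. ?v $ j *\<^sub>R ?K (axis j 1))" by (rule linear_axis_expansion[OF linK])
      then have "?v = S (Q (y0 + h) t) + (\<Sum>j\<in>UNIV. ?v $ j *\<^sub>R ?K (axis j 1))"
        using solve[OF inj[OF h], of t] by (simp add: algebra_simps)
      from arg_cong[OF this, of "\<lambda>z. z $ i"] have "?v $ i = S (Q (y0 + h) t) $ i + (\<Sum>j\<in>UNIV. ?v $ j * (?K (axis j 1) $ i))"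
        by (simp only: sum_component vector_scaleR_component vector_add_component real_scaleR_def)
      then have "complex_of_real (?v $ i) = of_real (S (Q (y0 + h) t) $ i + (\<Sum>j\<in>UNIV. ?v $ j * (?K (axis j 1) $ i)))"
        by presburger
      then show "complex_of_real (?v $ i) = of_real (S (Q (y0 + h) t) $ i) +
          (\<Sum>j\<in>UNIV. of_real (?K (axis j 1) $ i) * complex_of_real (?v $ j))"
        by (simp add: mult.commute)
    qed
    then show ?thesis using r by blast
  qed
  show thesis
  proof (rule that)
    show "sobolev_analytic_on T l R (cball 0 \<delta>)"
      unfolding sobolev_analytic_on_def
    proof
      fix y0 :: "real ^ 'm" assume "y0 \<in> cball 0 \<delta>"
      then obtain r where r: "r > 0" "\<And>i. series_le H r (\<lambda>h t. of_real (R (y0 + h) t $ i)) (2 * B)"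
        using ser by blast
      from analytic_class_of_series[of r "\<lambda>h. R (y0 + h)", OF this]
      show "\<exists>U c \<rho>. 0 \<in> interior U \<and> analytic_class U T l c \<rho> (\<lambda>h. R (y0 + h))"
        using r(1) by (intro exI conjI) (auto simp: interior_cball)
    qed
    show "R y \<in> sobolev T l \<and> sobolev_norm T l (R y) \<le> real CARD('m) * (2 * B)" if y: "y \<in> cball 0 \<delta>" for y
    proof -
      obtain r where r: "r > 0" "\<And>i. series_le H r (\<lambda>h t. of_real (R (y + h) t $ i)) (2 * B)"
        using ser[OF y] by blast
      have "H (\<lambda>t. of_real (R y t $ i)) (2 * B)" for i
        using series_le_eval[OF _ r(2), of 0 i] r(1) by simp
      from sobolev_of_sob_le[OF this] show ?thesis by simp
    qed
    show "transforms_into (\<lambda>u t. L u + V u t) \<Omega> \<Phi> (\<lambda>y t. L y + R y t) (cball 0 \<delta>)"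
      unfolding transforms_into_def
    proof (intro allI impI)
      fix J :: "real set" and y :: "real \<Rightarrow> real ^ 'm"
      assume asm: "is_interval J \<and> y differentiable_on J \<and> (\<forall>t\<in>J. y t \<in> cball 0 \<delta> \<and> y t + \<Phi> (y t) t \<in> \<Omega>)"
      have "((\<lambda>t. y t + \<Phi> (y t) t) has_vector_derivative L (y t + \<Phi> (y t) t) + V (y t + \<Phi> (y t) t) t) (at t within J)
          \<longleftrightarrow> (y has_vector_derivative L (y t) + R (y t) t) (at t within J)" if t: "t \<in> J" for t
      \<comment> \<open>At an isolated point of \<open>J\<close>, that is, if \<open>J\<close> is a single point, derivatives within \<open>J\<close> are arbitrary.\<close>
      proof (cases "at t within J = bot")
        case True
        have "(f has_vector_derivative f') (at t within J)" for f :: "real \<Rightarrow> real ^ 'm" and f'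
          unfolding has_vector_derivative_def has_derivative_def True
          by (simp add: bounded_linear_scaleR_left)
        then show ?thesis by simp
      next
        case False
        have yS: "y t \<in> cball 0 \<delta>" and y\<Omega>: "y t + \<Phi> (y t) t \<in> \<Omega>" using asm t by auto
        obtain y' where y': "(y has_vector_derivative y') (at t within J)"
          using asm t unfolding differentiable_on_def by (meson vector_derivative_works)
        have "((\<lambda>s. (y s, s)) has_derivative (\<lambda>h. (h *\<^sub>R y', h))) (at t within J)"
          using y' unfolding has_vector_derivative_def by (intro has_derivative_Pair has_derivative_ident)
        from has_derivative_compose[OF this, of "\<lambda>p. \<Phi> (fst p) (snd p)" "d\<Phi> (y t) t"] d\<Phi>
        have "((\<lambda>s. \<Phi> (y s) s) has_derivative (\<lambda>h. d\<Phi> (y t) t (h *\<^sub>R y', h))) (at t within J)" by simp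
        moreover have "d\<Phi> (y t) t (h *\<^sub>R y', h) = h *\<^sub>R d\<Phi> (y t) t (y', 1)" for h
          using linear_scale[OF lind, of "y t" t h "(y', 1)"] by simp
        ultimately have "((\<lambda>s. \<Phi> (y s) s) has_vector_derivative d\<Phi> (y t) t (y', 1)) (at t within J)"
          by (simp add: has_vector_derivative_def)
        then have u': "((\<lambda>t. y t + \<Phi> (y t) t) has_vector_derivative y' + d\<Phi> (y t) t (y', 1)) (at t within J)"
          by (rule has_vector_derivative_add[OF y'])
        have split: "d\<Phi> (y t) t (v, 1) = d\<Phi> (y t) t (v, 0) + d\<Phi> (y t) t (0, 1)" for v
          using linear_add[OF lind, of "y t" t "(v, 0)" "(0, 1)"] by simp
        define w where "w = L (y t) + R (y t) t"
        have "L (y t + \<Phi> (y t) t) + V (y t + \<Phi> (y t) t) t = L (y t) + d\<Phi> (y t) t (L (y t), 1) + E (y t) t (R (y t) t)"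
          unfolding Q[OF yS y\<Omega>] solve[OF inj0[OF yS]] using L by (simp add: linear_add)
        also have "\<dots> = E (y t) t w + d\<Phi> (y t) t (0, 1)"
          using linear_add[OF linE, of "y t" t "L (y t)" "R (y t) t"] split[of "L (y t)"]
          by (simp add: E_def w_def)
        finally have rhs: "L (y t + \<Phi> (y t) t) + V (y t + \<Phi> (y t) t) t = E (y t) t w + d\<Phi> (y t) t (0, 1)" .
        have lhs: "y' + d\<Phi> (y t) t (y', 1) = E (y t) t y' + d\<Phi> (y t) t (0, 1)"
          using split[of y'] by (simp add: E_def)
        have eqv: "(f has_vector_derivative b) (at t within J) \<longleftrightarrow> a = b"
          if "(f has_vector_derivative a) (at t within J)" for f :: "real \<Rightarrow> real ^ 'm" and a b
          using vector_derivative_unique_within[OF False that] that by blast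
        have "((\<lambda>t. y t + \<Phi> (y t) t) has_vector_derivative L (y t + \<Phi> (y t) t) + V (y t + \<Phi> (y t) t) t) (at t within J)
            \<longleftrightarrow> E (y t) t y' = E (y t) t w"
          unfolding eqv[OF u'] rhs lhs by (rule add_right_cancel)
        also have "\<dots> \<longleftrightarrow> y' = w" by (rule inj_eq[OF inj0[OF yS]])
        also have "\<dots> \<longleftrightarrow> (y has_vector_derivative w) (at t within J)" by (rule eqv[OF y', symmetric])
        finally show ?thesis by (simp add: w_def)
      qed
      then show "solves_on (\<lambda>u t. L u + V u t) J (\<lambda>t. y t + \<Phi> (y t) t) \<longleftrightarrow> solves_on (\<lambda>y t. L y + R y t) J y"
        unfolding solves_on_def by simp
    qed
  qed
qed

text \<open>The expansion of \<open>V\<close> at a finite sum, by multilinearity. The forms of degree zero and one vanish because \<open>V\<close>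
vanishes to second order, so only lists of length at least two remain. The expansion is required at points of \<open>\<Omega>\<close> only,
where the series of \<open>V\<close> is known to represent \<open>V\<close>.\<close>

lemma expansion_of_vector_field:
  fixes V :: "real ^ 'm \<Rightarrow> real \<Rightarrow> real ^ 'm"
  assumes \<Omega>: "0 \<in> interior \<Omega>" and V: "analytic_class \<Omega> T l c \<rho> V" and V0: "vanishes_to_second_order V"
  obtains W where "\<And>w j. H (\<lambda>t. of_real (W w t $ j)) (c / \<rho> ^ length w)"
    "\<And>p (U :: nat \<Rightarrow> real ^ 'm \<Rightarrow> real \<Rightarrow> real ^ 'm) y t. (\<Sum>n=1..p. U n y t) \<in> \<Omega> \<Longrightarrow>
        (\<lambda>xs. subst_term W U xs y t) summable_on subst_lists p \<Longrightarrow>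
        V (\<Sum>n=1..p. U n y t) t = (\<Sum>\<^sub>\<infinity>xs\<in>subst_lists p. subst_term W U xs y t)"
proof -
  obtain X where X: "\<forall>q t. sym_multilinear q (X q t)"
      "\<forall>u\<in>\<Omega>. \<forall>t. (\<lambda>q. X q t (replicate q u)) sums V u t"
      "\<forall>q us. length us = q \<longrightarrow> (\<lambda>t. X q t us) \<in> sobolev T l \<and>
         sobolev_norm T l (\<lambda>t. X q t us) \<le> c / \<rho> ^ q * prod_list (map norm us)"
    using V unfolding analytic_class_def by blast
  note X1 = X(1)[rule_format] and X2 = X(2)[rule_format]
    and X3 = X(3)[rule_format, THEN conjunct1] and X4 = X(3)[rule_format, THEN conjunct2]
  have lin: "linear (\<lambda>x. X q t (us[i := x]))" if "length us = q" "i < q" for q t us i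
    using X1[of q t] that unfolding sym_multilinear_def by blast
  define W where "W w t = X (length w) t (map (\<lambda>i. axis i 1) w)" for w t
  have Wb: "H (\<lambda>t. of_real (W w t $ j)) (c / \<rho> ^ length w)" for w j
    unfolding W_def
  proof (rule sob_le_of_sobolev)
    let ?us = "map (\<lambda>i. axis i 1) w :: (real ^ 'm) list"
    show "(\<lambda>t. X (length w) t ?us) \<in> sobolev T l" by (rule X3) simp
    have "prod_list (map norm ?us) = 1" by (induction w) auto
    then show "sobolev_norm T l (\<lambda>t. X (length w) t ?us) \<le> c / \<rho> ^ length w"
      using X4[of ?us "length w"] by simp
  qed
  have z0: "0 \<in> \<Omega>" using \<Omega> interior_subset by blast
  have zero0: "X 0 t [] = 0" for t
  proof -
    have "X q t (replicate q 0) = 0" if "q \<noteq> 0" for q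
    proof -
      have "replicate q (0 :: real ^ 'm) = (replicate q 0)[0 := 0]" using that by (cases q) auto
      then show ?thesis using linear_0[OF lin[of "replicate q 0" q 0 t]] that by simp
    qed
    then have "(\<lambda>q. X q t (replicate q 0)) sums X 0 t (replicate 0 0)"
      using sums_finite[of "{0::nat}" "\<lambda>q. X q t (replicate q 0)"] by simp
    moreover have "V 0 t = 0" using V0 unfolding vanishes_to_second_order_def by simp
    ultimately show ?thesis using X2[OF z0, of t] sums_unique2 by fastforce
  qed
  have scale: "X q t (replicate q (s *\<^sub>R x)) = s ^ q *\<^sub>R X q t (replicate q x)" for q t s x
  proof -
    have "{xs :: unit list. set xs \<subseteq> {()} \<and> length xs = q} = {replicate q ()}"
      by (auto simp: list_eq_iff_nth_eq)
    then show ?thesis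
      using multilinear_expansion[of q "X q t" "{()}" "[]" q "\<lambda>_. s" "\<lambda>_. x", OF lin] by (simp add: map_replicate_const)
  qed
  \<comment> \<open>The linear form is the derivative of \<open>V\<close> at the origin, computed along the line through \<open>x\<close>.\<close>
  have zero1: "X 1 t [x] = 0" for t x
  proof -
    have "X 1 t [x] $ j = 0" for j
    proof -
      define a where "a q = X q t (replicate q x) $ j" for q
      obtain e0 where e0: "e0 > 0" "ball 0 e0 \<subseteq> \<Omega>" using \<Omega> by (auto simp: mem_interior)
      define \<epsilon> where "\<epsilon> = e0 / (norm x + 1)"
      have \<epsilon>: "\<epsilon> > 0" using e0 by (simp add: \<epsilon>_def add_nonneg_pos)
      have in\<Omega>: "s *\<^sub>R x \<in> \<Omega>" if "\<bar>s\<bar> < \<epsilon>" for s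
      proof -
        have "norm (s *\<^sub>R x) \<le> \<bar>s\<bar> * (norm x + 1)" by (simp add: mult_left_mono)
        also have "\<dots> < e0" using that by (simp add: \<epsilon>_def pos_less_divide_eq add_nonneg_pos)
        finally show ?thesis using e0(2) by auto
      qed
      have sums: "(\<lambda>q. a q * s ^ q) sums (V (s *\<^sub>R x) t $ j)" if "\<bar>s\<bar> < \<epsilon>" for s
      proof -
        have "(\<lambda>q. X q t (replicate q (s *\<^sub>R x)) $ j) sums (V (s *\<^sub>R x) t $ j)"
          using bounded_linear.sums[OF bounded_linear_vec_nth X2[OF in\<Omega>[OF that], of t]] .
        then show ?thesis by (simp add: scale a_def mult.commute)
      qed
      have "summable (\<lambda>q. a q * (\<epsilon> / 2) ^ q)" using sums[of "\<epsilon> / 2"] \<epsilon> by (auto simp: sums_iff)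
      then have "((\<lambda>s. \<Sum>q. a q * s ^ q) has_field_derivative (\<Sum>q. diffs a q * 0 ^ q)) (at 0)"
        by (rule termdiffs_strong) (use \<epsilon> in auto)
      moreover have "(\<Sum>q. diffs a q * 0 ^ q) = a 1" using powser_zero[of "diffs a"] by (simp add: diffs_def)
      ultimately have "((\<lambda>s. \<Sum>q. a q * s ^ q) has_field_derivative a 1) (at 0)" by simp
      then have d1: "((\<lambda>s. V (s *\<^sub>R x) t $ j) has_field_derivative a 1) (at 0)"
      proof (rule has_field_derivative_transform_within[OF _ \<epsilon>])
        show "(\<Sum>q. a q * s ^ q) = V (s *\<^sub>R x) t $ j" if "dist s 0 < \<epsilon>" for s
          using sums[of s] that by (simp add: sums_iff)
      qed simp
      have "((\<lambda>s. V (s *\<^sub>R x) t) has_derivative (\<lambda>_. 0)) (at 0)"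
      proof (rule has_derivative_compose[where f = "\<lambda>s. s *\<^sub>R x" and f' = "\<lambda>s. s *\<^sub>R x" and g = "\<lambda>u. V u t" and g' = "\<lambda>_. 0"])
        show "((\<lambda>s. s *\<^sub>R x) has_derivative (\<lambda>s. s *\<^sub>R x)) (at 0)"
          by (intro bounded_linear_imp_has_derivative bounded_linear_scaleR_left)
        show "((\<lambda>u. V u t) has_derivative (\<lambda>_. 0)) (at (0 *\<^sub>R x))"
          using V0 unfolding vanishes_to_second_order_def by simp
      qed
      from bounded_linear.has_derivative[OF bounded_linear_vec_nth this, of j]
      have d2: "((\<lambda>s. V (s *\<^sub>R x) t $ j) has_field_derivative 0) (at 0)"
        by (rule has_derivative_imp_has_field_derivative) simp
      have "a 1 = 0" using DERIV_unique[OF d1 d2] .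
      then show ?thesis by (simp add: a_def)
    qed
    then show ?thesis by (simp add: vec_eq_iff)
  qed
  show thesis
  proof (rule that[of W, OF Wb])
    fix p and U :: "nat \<Rightarrow> real ^ 'm \<Rightarrow> real \<Rightarrow> real ^ 'm" and y t
    assume u\<Omega>: "(\<Sum>n=1..p. U n y t) \<in> \<Omega>" and sm: "(\<lambda>xs. subst_term W U xs y t) summable_on subst_lists p"
    let ?u = "\<Sum>n=1..p. U n y t" and ?I = "(UNIV :: 'm set) \<times> {1..p}"
    let ?Y = "\<lambda>q. {xs. set xs \<subseteq> ?I \<and> length xs = q}"
    let ?S = "\<Sum>\<^sub>\<infinity>xs\<in>subst_lists p. subst_term W U xs y t"
    have ueq: "?u = (\<Sum>x\<in>?I. (U (snd x) y t $ fst x) *\<^sub>R axis (fst x) 1)"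
    proof -
      have "U n y t = (\<Sum>i\<in>UNIV. U n y t $ i *\<^sub>R axis i 1)" for n
        by (simp add: basis_expansion flip: scalar_mult_eq_scaleR)
      then have "?u = (\<Sum>n=1..p. \<Sum>i\<in>UNIV. U n y t $ i *\<^sub>R axis i 1)" by simp
      also have "\<dots> = (\<Sum>i\<in>UNIV. \<Sum>n=1..p. U n y t $ i *\<^sub>R axis i 1)" by (rule sum.swap)
      also have "\<dots> = (\<Sum>x\<in>?I. (U (snd x) y t $ fst x) *\<^sub>R axis (fst x) 1)"
        by (subst sum.cartesian_product) (simp add: case_prod_unfold)
      finally show ?thesis .
    qed
    have exp: "X q t (replicate q ?u) = (\<Sum>xs\<in>?Y q. subst_term W U xs y t)" for q
    proof -
      have "X q t ([] @ replicate q (\<Sum>x\<in>?I. (U (snd x) y t $ fst x) *\<^sub>R axis (fst x) 1))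
        = (\<Sum>xs\<in>?Y q. (\<Prod>x\<leftarrow>xs. U (snd x) y t $ fst x) *\<^sub>R X q t ([] @ map (\<lambda>x. axis (fst x) 1) xs))"
        by (rule multilinear_expansion[OF lin]) auto
      also have "\<dots> = (\<Sum>xs\<in>?Y q. subst_term W U xs y t)"
        by (intro sum.cong refl) (auto simp: subst_term_def W_def o_def)
      finally show ?thesis unfolding ueq by simp
    qed
    have bij: "bij_betw snd (Sigma {2..} ?Y) (subst_lists p)"
      by (rule bij_betw_byWitness[where f' = "\<lambda>xs. (length xs, xs)"]) (auto simp: subst_lists_def)
    have "((\<lambda>z. subst_term W U (snd z) y t) has_sum ?S) (Sigma {2..} ?Y)"
      using has_sum_reindex_bij_betw[OF bij, of "\<lambda>xs. subst_term W U xs y t" ?S] sm by simp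
    then have "((\<lambda>q. X q t (replicate q ?u)) has_sum ?S) {2..}"
    proof (rule has_sum_SigmaD)
      show "((\<lambda>xs. subst_term W U (snd (q, xs)) y t) has_sum X q t (replicate q ?u)) (?Y q)" for q
        unfolding exp by (intro has_sum_finiteI finite_lists_eq) simp
    qed
    then have "((\<lambda>q. X q t (replicate q ?u)) has_sum ?S) UNIV"
    proof (rule has_sum_cong_neutral[THEN iffD1, rotated -1])
      fix q :: nat assume "q \<in> UNIV - {2..}"
      then have "q = 0 \<or> q = 1" by auto
      then show "X q t (replicate q ?u) = 0" using zero0[of t] zero1[of t ?u] by auto
    qed auto
    then have "(\<lambda>q. X q t (replicate q ?u)) sums ?S" by (rule has_sum_imp_sums)
    then show "V ?u t = ?S" using X2[OF u\<Omega>, of t] sums_unique2 by blast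
  qed
qed

end

section \<open>The truncated normal form\<close>

lemma of_nat_le_two_power: "n \<ge> 1 \<Longrightarrow> real n \<le> 2 ^ (n - 1)"
proof (induction n)
  case (Suc n)
  show ?case
  proof (cases "n = 0")
    case False
    then have "real (Suc n) \<le> 2 * real n" by simp
    also have "\<dots> \<le> 2 * 2 ^ (n - 1)" using Suc False by simp
    also have "\<dots> = 2 ^ (Suc n - 1)" using False by (cases n) auto
    finally show ?thesis .
  qed simp
qed simp

context eigenforms
begin

lemma \<zeta>_le:
  assumes Z: "\<And>x. (\<Sum>k\<in>UNIV. cmod (\<zeta> x (axis k 1))) \<le> Z"
  shows "cmod (\<zeta> x y) \<le> Z * norm y"
proof -
  have "cmod (\<zeta> x y) \<le> (\<Sum>k\<in>UNIV. cmod (of_real (y $ k) * \<zeta> x (axis k 1)))"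
    by (subst \<zeta>_expand) (rule norm_sum)
  also have "\<dots> \<le> (\<Sum>k\<in>UNIV. norm y * cmod (\<zeta> x (axis k 1)))"
    by (intro sum_mono) (simp add: norm_mult component_le_norm_cart mult_right_mono)
  also have "\<dots> \<le> norm y * Z" unfolding sum_distrib_left[symmetric] using Z by (intro mult_left_mono) auto
  finally show ?thesis by (simp add: mult.commute)
qed

lemma series_le_\<zeta>:
  assumes Z: "\<And>x. (\<Sum>k\<in>UNIV. cmod (\<zeta> x (axis k 1))) \<le> Z" and r: "0 \<le> r"
  shows "series_le A r (\<lambda>h t. \<zeta> x (y0 + h)) (Z * norm y0 + Z * r)"
proof -
  have "series_le A r (\<lambda>h t. \<Sum>k\<in>UNIV. \<zeta> x (axis k 1) * of_real (h $ k)) (\<Sum>k\<in>UNIV. cmod (\<zeta> x (axis k 1)) * r)"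
    by (intro A.series_le_sum r series_le_cmult_A series_le_coord) auto
  then have "series_le A r (\<lambda>h t. \<Sum>k\<in>UNIV. \<zeta> x (axis k 1) * of_real (h $ k)) (Z * r)"
    by (rule A.series_le_mono) (use mult_right_mono[OF Z r] in \<open>simp add: sum_distrib_right\<close>)
  moreover have "(\<Sum>k\<in>UNIV. \<zeta> x (axis k 1) * of_real (h $ k)) = \<zeta> x h" for h
    by (subst \<zeta>_expand) (simp add: mult.commute)
  ultimately have 1: "series_le A r (\<lambda>h t. \<zeta> x h) (Z * r)" by simp
  have "A (\<lambda>_. \<zeta> x y0) (Z * norm y0)"
    by (rule mult_le_mono[OF mult_le_const \<zeta>_le[OF Z]])
  from A.series_le_add[OF r A.series_le_const[OF this] 1]
  show ?thesis using linear_\<zeta>[of x] by (simp add: linear_add)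
qed

lemma homog_vanishes:
  assumes Z: "\<And>x. (\<Sum>k\<in>UNIV. cmod (\<zeta> x (axis k 1))) \<le> Z" and n: "2 \<le> n" and hom: "homog n \<Phi> M"
  shows "\<Phi> 0 t = 0" "vderiv \<Phi> 0 t (v, 0) = 0"
proof -
  have z: "series_le A 0 (\<lambda>h t. \<zeta> x (0 + h)) 0" for x
  proof -
    have "series_le A 0 (\<lambda>(h :: real ^ 'm) t. 0) 0" by (rule A.series_le_const[OF A.nb_zero])
    then show ?thesis
    proof (rule A.series_le_cong)
      fix h :: "real ^ 'm" assume "\<And>j. \<bar>h $ j\<bar> \<le> 0"
      then have "h = 0" by (simp add: vec_eq_iff)
      then show "0 = \<zeta> x (0 + h)" using linear_\<zeta>[of x] by (simp add: linear_0)
    qed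
  qed
  have pol: "pol (smooth_le l) n (\<lambda>y t. of_real (\<Phi> y t $ i)) (M / cmult)" for i
    using hom by (simp add: homog_def)
  have "\<Phi> 0 t $ i = 0" for i
  proof -
    have "series_le A 0 (\<lambda>h t. of_real (\<Phi> (0 + h) t $ i)) (M * 0 ^ n)"
      by (rule pol_series[OF order_refl z A.coeff_bound_axioms mult_le_mult homog_A[OF hom]])
    from A.series_le_sup[OF order_refl this, of 0 t] n show ?thesis by (simp add: zero_power)
  qed
  then show "\<Phi> 0 t = 0" by (simp add: vec_eq_iff)
  have "jderiv (\<lambda>y t. of_real (\<Phi> y t $ i)) 0 t (v, 0) = 0" for i
  proof -
    have "series_le A 0 (\<lambda>h t. jderiv (\<lambda>y t. of_real (\<Phi> y t $ i)) (0 + h) t (v, 0))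
        (real n * (cmult * (M / cmult)) * 0 ^ (n - 1) * (Z * norm v))"
      by (rule pol_jderiv_series[OF order_refl z \<zeta>_le[OF Z] pol])
    from A.series_le_sup[OF order_refl this, of 0 t] n show ?thesis by (simp add: zero_power)
  qed
  then show "vderiv \<Phi> 0 t (v, 0) = 0" by (simp add: vderiv_def vec_eq_iff)
qed

lemma homog_in_sobolev_polys:
  assumes "homog n \<Phi> M" "n \<le> p" shows "\<Phi> \<in> sobolev_polys p T (Suc l)"
proof -
  have "(\<lambda>y t. \<Sum>i\<in>UNIV. Re (complex_of_real (\<Phi> y t $ i)) *\<^sub>R (axis i 1 :: real ^ 'm)) \<in> sobolev_polys p T (Suc l)"
    using assms by (intro sobolev_polys_sum pol_in_sobolev_polys) (auto simp: homog_def)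
  moreover have "(\<Sum>i\<in>UNIV. Re (complex_of_real (\<Phi> y t $ i)) *\<^sub>R (axis i 1 :: real ^ 'm)) = \<Phi> y t" for y t
    using linear_axis_expansion[OF linear_id, of "\<Phi> y t"] by simp
  ultimately show ?thesis by simp
qed

text \<open>Every list of degree at most \<open>p\<close> is cancelled by a homological equation, so the right-hand side for the
remainder is the sum over the lists of degree above \<open>p\<close>. On the ball of radius \<open>\<delta>\<close> the forms are bounded by
\<open>2 Z \<delta> = q s\<close>, whereas the majorant series converges at \<open>s\<close>; a term of degree \<open>n\<close> thus gains \<open>q\<^sup>n \<le> q\<^sup>p\<^sup>+\<^sup>1\<close>.
The derivative of \<open>\<Phi>\<close> is of order \<open>q\<close>, and \<open>1 + D\<^sub>y\<Phi>\<close> is inverted with \<open>S = 1\<close>.\<close>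

lemma normal_form_near_zero:
  assumes c: "0 < c" and \<rho>: "0 < \<rho>" and Z: "\<And>x. (\<Sum>k\<in>UNIV. cmod (\<zeta> x (axis k 1))) \<le> Z" and Z0: "0 < Z"
    and V: "0 \<in> interior \<Omega>" "analytic_class \<Omega> T l c \<rho> V" "vanishes_to_second_order V"
    and p: "2 \<le> p" and s: "0 < s" and \<delta>: "0 < \<delta>"
    and \<kappa>: "0 \<le> \<kappa>" "\<And>n. 2 \<le> n \<Longrightarrow> n \<le> p \<Longrightarrow> homological_const / D n \<le> \<kappa>"
    and small1: "real CARD('m) * (2 * (coord_norm * s)) / \<rho> \<le> 1 / 2"
    and small2: "\<kappa> * (2 * c * (real CARD('m) * (2 * (coord_norm * s)) / \<rho>)\<^sup>2) \<le> coord_norm * s"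
    and q: "2 * Z * \<delta> = q * s" "q \<le> 1 / 2" "sob_const * real CARD('m) * (4 * q * Z * coord_norm) \<le> 1 / 2"
  obtains \<Phi> R where "\<Phi> \<in> sobolev_polys p T (Suc l)" "vanishes_to_second_order \<Phi>"
    "transforms_into (\<lambda>u t. L u + V u t) \<Omega> \<Phi> (\<lambda>y t. L y + R y t) (cball 0 \<delta>)"
    "sobolev_analytic_on T l R (cball 0 \<delta>)"
    "\<And>y. y \<in> cball 0 \<delta> \<Longrightarrow> R y \<in> sobolev T l \<and> sobolev_norm T l (R y) \<le>
        real CARD('m) * (2 * (q ^ (p + 1) * (2 * c * (real CARD('m) * (2 * (coord_norm * s)) / \<rho>)\<^sup>2)))"
proof -
  have q0: "0 \<le> q" using q(1) s Z0 \<delta> by (metis mult_nonneg_nonneg less_imp_le zero_le_mult_iff mult_pos_pos not_less zero_less_numeral)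
  have phi1: "0 < coord_norm" using coord_norm_ge_1 by simp
  obtain W where Wb: "\<And>w j. H (\<lambda>t. of_real (W w t $ j)) (c / \<rho> ^ length w)"
    and WV: "\<And>p (U :: nat \<Rightarrow> real ^ 'm \<Rightarrow> real \<Rightarrow> real ^ 'm) y t. (\<Sum>n=1..p. U n y t) \<in> \<Omega> \<Longrightarrow>
        (\<lambda>xs. subst_term W U xs y t) summable_on subst_lists p \<Longrightarrow>
        V (\<Sum>n=1..p. U n y t) t = (\<Sum>\<^sub>\<infinity>xs\<in>subst_lists p. subst_term W U xs y t)"
    using expansion_of_vector_field[OF V] by blast
  obtain F \<phi> where F1: "F 1 = (\<lambda>y t. y)" and \<phi>1: "\<phi> 1 = coord_norm"
    and hom: "\<And>n. 1 \<le> n \<Longrightarrow> homog n (F n) (\<phi> n)"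
    and Feq: "\<And>n y t. 2 \<le> n \<Longrightarrow> vderiv (F n) y t (L y, 1) - L (F n y t) = (\<Sum>xs\<in>graded_lists n. subst_term W F xs y t)"
    and \<phi>rec: "\<And>n. 2 \<le> n \<Longrightarrow> \<phi> n = homological_const / D n * (\<Sum>xs\<in>graded_lists n. maj_term c \<rho> \<phi> (xs :: ('m \<times> nat) list))"
    by (rule formal_solution[OF Wb]) blast
  \<comment> \<open>Lists in \<open>graded_lists n\<close> contain no index zero; the value zero there makes \<open>\<psi>\<close> nonnegative.\<close>
  define \<psi> where "\<psi> n = (if n = 0 then 0 else \<phi> n)" for n
  have \<psi>0: "0 \<le> \<psi> n" for n
  proof (cases "n = 0")
    case False
    then have "pol A n (\<lambda>y t. of_real (F n y t $ undefined)) (\<phi> n)" by (intro homog_A hom) simp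
    then show ?thesis using pol_nonneg[OF A.nb_nonneg] False by (simp add: \<psi>_def)
  qed (simp add: \<psi>_def)
  have \<psi>1: "\<psi> 1 = coord_norm" using \<phi>1 by (simp add: \<psi>_def)
  have maj_eq: "maj_term c \<rho> \<phi> xs = maj_term c \<rho> \<psi> xs" if "\<forall>x\<in>set xs. 1 \<le> snd x" for xs :: "('m \<times> nat) list"
  proof -
    have "map (\<lambda>x. \<phi> (snd x)) xs = map (\<lambda>x. \<psi> (snd x)) xs"
    proof (rule map_cong[OF refl])
      fix x assume "x \<in> set xs"
      with that have "snd x \<noteq> 0" by force
      then show "\<phi> (snd x) = \<psi> (snd x)" by (simp add: \<psi>_def)
    qed
    then show ?thesis unfolding maj_term_def by presburger
  qed
  have \<psi>rec: "\<psi> n \<le> \<kappa> * (\<Sum>xs\<in>graded_lists n. maj_term c \<rho> \<psi> (xs :: ('m \<times> nat) list))" if "2 \<le> n" "n \<le> p" for n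
  proof -
    have "\<psi> n = homological_const / D n * (\<Sum>xs\<in>graded_lists n. maj_term c \<rho> \<phi> (xs :: ('m \<times> nat) list))"
      using \<phi>rec[OF that(1)] that(1) by (simp add: \<psi>_def)
    also have "(\<Sum>xs\<in>graded_lists n. maj_term c \<rho> \<phi> (xs :: ('m \<times> nat) list)) = (\<Sum>xs\<in>graded_lists n. maj_term c \<rho> \<psi> (xs :: ('m \<times> nat) list))"
      by (intro sum.cong refl maj_eq) (simp add: graded_lists_def)
    also have "homological_const / D n * \<dots> \<le> \<kappa> * \<dots>"
      using maj_term_nonneg[OF less_imp_le[OF c] \<rho> \<psi>0] by (intro mult_right_mono \<kappa> that sum_nonneg)
    finally show ?thesis .
  qed
  have Sbound: "(\<Sum>n=1..p. \<psi> n * s ^ n) \<le> 2 * (coord_norm * s)"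
    using majorant_bound[OF c \<rho> \<psi>0 s \<psi>rec \<kappa>(1), of p p] small1 small2 unfolding \<psi>1 by simp
  define \<sigma> where "\<sigma> = q * s"
  have \<sigma>0: "0 \<le> \<sigma>" using q0 s by (simp add: \<sigma>_def)
  have z: "series_le A \<delta> (\<lambda>h t. \<zeta> x (y0 + h)) \<sigma>" if "y0 \<in> cball 0 \<delta>" for y0 x
  proof (rule A.series_le_mono[OF series_le_\<zeta>[OF Z less_imp_le[OF \<delta>]]])
    have "Z * norm y0 + Z * \<delta> \<le> Z * \<delta> + Z * \<delta>" using that Z0 by (simp add: mult_left_mono)
    also have "\<dots> = \<sigma>" using q(1) by (simp add: \<sigma>_def)
    finally show "Z * norm y0 + Z * \<delta> \<le> \<sigma>" .
  qed
  have Fser: "series_le A \<delta> (\<lambda>h t. of_real (F n (y0 + h) t $ i)) (\<psi> n * \<sigma> ^ n)" if "y0 \<in> cball 0 \<delta>" "1 \<le> n" for y0 n i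
  proof -
    have "series_le A \<delta> (\<lambda>h t. of_real (F n (y0 + h) t $ i)) (\<phi> n * \<sigma> ^ n)"
      by (rule pol_series[where f = "\<lambda>y t. of_real (F n y t $ i)",
            OF less_imp_le[OF \<delta>] z[OF that(1)] A.coeff_bound_axioms mult_le_mult homog_A[OF hom[OF that(2)]]])
    moreover have "\<phi> n = \<psi> n" using that(2) by (simp add: \<psi>_def)
    ultimately show ?thesis by simp
  qed
  define \<Phi> where "\<Phi> y t = (\<Sum>n=2..p. F n y t)" for y t
  define d\<Phi> where "d\<Phi> y t v = (\<Sum>n=2..p. vderiv (F n) y t v)" for y t v
  have sumF: "(\<Sum>n=1..p. F n y t) = y + \<Phi> y t" for y t
  proof -
    have "(\<Sum>n=1..p. F n y t) = F 1 y t + (\<Sum>n=2..p. F n y t)"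
      using p by (simp add: sum.atLeast_Suc_atMost numeral_2_eq_2)
    then show ?thesis using F1 by (simp add: \<Phi>_def)
  qed
  have dPhi: "((\<lambda>x. \<Phi> (fst x) (snd x)) has_derivative d\<Phi> y t) (at (y, t))" for y t
    unfolding \<Phi>_def d\<Phi>_def by (intro has_derivative_sum homog_has_derivative[OF hom]) auto
  \<comment> \<open>The lists that are not cancelled by the homological equations.\<close>
  define Y where "Y = {xs \<in> (subst_lists p :: ('m \<times> nat) list set). p < deg xs}"
  define Q where "Q y t = (\<Sum>\<^sub>\<infinity>xs\<in>Y. subst_term W F xs y t)" for y t
  define b where "b n = \<psi> n * \<sigma> ^ n" for n
  define bs where "bs n = \<psi> n * s ^ n" for n
  have b0: "0 \<le> b n" and bs0: "0 \<le> bs n" for n using \<psi>0 \<sigma>0 s by (auto simp: b_def bs_def)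
  have bbs: "b n = q ^ n * bs n" for n by (simp add: b_def bs_def \<sigma>_def power_mult_distrib)
  have bs_small: "real CARD('m) * (\<Sum>n=1..p. bs n) / \<rho> \<le> real CARD('m) * (2 * (coord_norm * s)) / \<rho>"
    using Sbound \<rho> by (intro divide_right_mono mult_left_mono) (auto simp: bs_def)
  have qle: "q ^ n \<le> 1" for n using q0 q(2) by (intro power_le_one) auto
  have b_small: "real CARD('m) * (\<Sum>n=1..p. b n) / \<rho> \<le> 1 / 2"
  proof -
    have "(\<Sum>n=1..p. b n) \<le> (\<Sum>n=1..p. bs n)"
      unfolding bbs using bs0 qle q0 by (intro sum_mono mult_left_le_one_le) auto
    then have "real CARD('m) * (\<Sum>n=1..p. b n) / \<rho> \<le> real CARD('m) * (\<Sum>n=1..p. bs n) / \<rho>"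
      using \<rho> by (intro divide_right_mono mult_left_mono) auto
    then show ?thesis using bs_small small1 by linarith
  qed
  \<comment> \<open>Passing from the scale \<open>s\<close> to the scale \<open>\<sigma> = q s\<close> gains a factor \<open>q\<close> per degree.\<close>
  have maj_b: "maj_term c \<rho> b xs = q ^ deg xs * maj_term c \<rho> bs xs" for xs :: "('m \<times> nat) list"
  proof -
    have "(\<Prod>x\<leftarrow>xs. b (snd x)) = q ^ deg xs * (\<Prod>x\<leftarrow>xs. bs (snd x))"
      by (induction xs) (auto simp: deg_def bbs power_add)
    then show ?thesis by (simp add: maj_term_def mult_ac)
  qed
  define B where "B = q ^ (p + 1) * (2 * c * (real CARD('m) * (2 * (coord_norm * s)) / \<rho>)\<^sup>2)"
  obtain S0 where S0: "(maj_term c \<rho> bs has_sum S0) (subst_lists p :: ('m \<times> nat) list set)"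
    "S0 \<le> 2 * c * (real CARD('m) * (\<Sum>n=1..p. bs n) / \<rho>)\<^sup>2"
    using has_sum_maj_term[where 'm='m, OF less_imp_le[OF c] \<rho> bs0 order_trans[OF bs_small small1]] by blast
  have S0B: "q ^ (p + 1) * S0 \<le> B"
  proof -
    have x0: "0 \<le> real CARD('m) * (\<Sum>n=1..p. bs n) / \<rho>"
      using \<rho> bs0 by (intro divide_nonneg_pos mult_nonneg_nonneg sum_nonneg) auto
    have "2 * c * (real CARD('m) * (\<Sum>n=1..p. bs n) / \<rho>)\<^sup>2 \<le> 2 * c * (real CARD('m) * (2 * (coord_norm * s)) / \<rho>)\<^sup>2"
      using c x0 bs_small by (intro mult_left_mono power_mono) auto
    with S0(2) have "S0 \<le> 2 * c * (real CARD('m) * (2 * (coord_norm * s)) / \<rho>)\<^sup>2" by (rule order_trans)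
    then show ?thesis unfolding B_def using q0 by (intro mult_left_mono) auto
  qed
  have majY: "S \<le> B" if S: "(maj_term c \<rho> b has_sum S) Y" for S
  proof -
    have "S \<le> q ^ (p + 1) * S0"
    proof (rule has_sum_mono_neutral[OF S has_sum_cmult_right[OF S0(1)]])
      fix xs assume "xs \<in> Y \<inter> subst_lists p"
      then have "q ^ deg xs \<le> q ^ (p + 1)" using q0 q(2) by (intro power_decreasing) (auto simp: Y_def)
      then show "maj_term c \<rho> b xs \<le> q ^ (p + 1) * maj_term c \<rho> bs xs"
        unfolding maj_b using maj_term_nonneg[OF less_imp_le[OF c] \<rho> bs0] by (intro mult_right_mono)
    next
      fix xs :: "('m \<times> nat) list"
      show "0 \<le> q ^ (p + 1) * maj_term c \<rho> bs xs"
        using maj_term_nonneg[OF less_imp_le[OF c] \<rho> bs0] q0 by (intro mult_nonneg_nonneg) auto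
    qed (auto simp: Y_def)
    with S0B show ?thesis by linarith
  qed
  have Fser': "series_le A \<delta> (\<lambda>h t. of_real (F n (y0 + h) t $ i)) (b n)" if "y0 \<in> cball 0 \<delta>" "n \<in> {1..p}" for y0 n i
    using Fser[of y0 n i] that by (simp add: b_def)
  have Qser: "series_le H \<delta> (\<lambda>h t. of_real (Q (y0 + h) t $ j)) B" if "y0 \<in> cball 0 \<delta>" for y0 j
    unfolding Q_def
    by (rule series_le_subst(2)[OF less_imp_le[OF \<delta>] c \<rho> b0 b_small Fser'[OF that] Wb _ majY]) (auto simp: Y_def)
  have summ: "(\<lambda>xs. subst_term W F xs y t) summable_on subst_lists p" if "y \<in> cball 0 \<delta>" for y t
  proof -
    have "(\<lambda>xs. subst_term W F xs (y + 0) t) summable_on subst_lists p"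
      by (rule series_le_subst(1)[OF less_imp_le[OF \<delta>] c \<rho> b0 b_small Fser'[OF that] Wb order_refl,
            where M = "infsum (maj_term c \<rho> b) (subst_lists p)"])
        (use \<delta> in \<open>auto dest!: infsumI\<close>)
    then show ?thesis by simp
  qed
  have Veq: "V (y + \<Phi> y t) t = Q y t + (d\<Phi> y t (L y, 1) - L (\<Phi> y t))"
    if y: "y \<in> cball 0 \<delta>" and y\<Omega>: "y + \<Phi> y t \<in> \<Omega>" for y t
  proof -
    have "V (y + \<Phi> y t) t = (\<Sum>\<^sub>\<infinity>xs\<in>subst_lists p. subst_term W F xs y t)"
      using WV[where p=p and U=F and y=y and t=t] y\<Omega> summ[OF y] unfolding sumF by simp
    also have "subst_lists p = Y \<union> (\<Union>n\<in>{2..p}. graded_lists n)"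
    proof
      show "subst_lists p \<subseteq> Y \<union> (\<Union>n\<in>{2..p}. graded_lists n)"
      proof
        fix xs :: "('m \<times> nat) list" assume xs: "xs \<in> subst_lists p"
        then have pos: "\<forall>x\<in>set xs. 1 \<le> snd x" and len: "2 \<le> length xs" by (auto simp: subst_lists_def)
        have "2 \<le> deg xs" using length_le_deg[OF pos] len by simp
        then show "xs \<in> Y \<union> (\<Union>n\<in>{2..p}. graded_lists n)"
          using xs pos len by (cases "deg xs \<le> p") (auto simp: Y_def graded_lists_def)
      qed
      show "Y \<union> (\<Union>n\<in>{2..p}. graded_lists n) \<subseteq> subst_lists p"
      proof
        fix xs :: "('m \<times> nat) list" assume "xs \<in> Y \<union> (\<Union>n\<in>{2..p}. graded_lists n)"
        then consider "xs \<in> Y" | n where "n \<le> p" "xs \<in> graded_lists n" by auto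
        then show "xs \<in> subst_lists p"
        proof cases
          case 2
          then have "1 \<le> snd x \<and> snd x \<le> p" if "x \<in> set xs" for x
            using graded_lists_less[OF 2(2) that] that by (auto simp: graded_lists_def)
          then show ?thesis using 2(2) by (force simp: subst_lists_def graded_lists_def)
        qed (simp add: Y_def)
      qed
    qed
    also have "(\<Sum>\<^sub>\<infinity>xs\<in>Y \<union> (\<Union>n\<in>{2..p}. graded_lists n). subst_term W F xs y t)
        = Q y t + (\<Sum>xs\<in>(\<Union>n\<in>{2..p}. graded_lists n). subst_term W F xs y t)"
    proof (subst infsum_Un_disjoint)
      show "(\<lambda>xs. subst_term W F xs y t) summable_on Y"
        by (rule summable_on_subset_banach[OF summ[OF y]]) (auto simp: Y_def)
      show "(\<lambda>xs. subst_term W F xs y t) summable_on (\<Union>n\<in>{2..p}. graded_lists n)"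
        by (intro summable_on_finite finite_UN_I finite_graded_lists) auto
      show "Y \<inter> (\<Union>n\<in>{2..p}. graded_lists n) = {}" by (auto simp: Y_def graded_lists_def)
      have "finite (\<Union>n\<in>{2..p}. graded_lists n :: ('m \<times> nat) list set)" by (intro finite_UN_I finite_graded_lists) auto
      then show "(\<Sum>\<^sub>\<infinity>xs\<in>Y. subst_term W F xs y t) + (\<Sum>\<^sub>\<infinity>xs\<in>(\<Union>n\<in>{2..p}. graded_lists n). subst_term W F xs y t)
        = Q y t + (\<Sum>xs\<in>(\<Union>n\<in>{2..p}. graded_lists n). subst_term W F xs y t)"
        by (simp add: Q_def)
    qed
    also have "(\<Sum>xs\<in>(\<Union>n\<in>{2..p}. graded_lists n). subst_term W F xs y t) = (\<Sum>n=2..p. \<Sum>xs\<in>graded_lists n. subst_term W F xs y t)"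
      by (rule sum.UNION_disjoint) (simp_all only: finite_graded_lists finite_atLeastAtMost ball_simps, auto simp: graded_lists_def)
    also have "\<dots> = (\<Sum>n=2..p. vderiv (F n) y t (L y, 1) - L (F n y t))"
      by (intro sum.cong refl Feq[symmetric]) auto
    also have "\<dots> = d\<Phi> y t (L y, 1) - L (\<Phi> y t)"
      using linear_L by (simp add: sum_subtractf d\<Phi>_def \<Phi>_def linear_sum)
    finally show ?thesis .
  qed
  \<comment> \<open>The factor \<open>n\<close> produced by differentiation is absorbed by \<open>q\<^sup>n\<^sup>-\<^sup>2 \<le> 2\<^sup>2\<^sup>-\<^sup>n\<close>; one factor \<open>q\<close> remains.\<close>
  define \<theta> where "\<theta> = 4 * q * Z * coord_norm"
  have dser: "series_le A \<delta> (\<lambda>h t. of_real (d\<Phi> (y0 + h) t (axis j 1, 0) $ i)) \<theta>" if y0: "y0 \<in> cball 0 \<delta>" for y0 i j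
  proof -
    have Zj: "cmod (\<zeta> x (axis j 1)) \<le> Z" for x
      using \<zeta>_le[OF Z, of x "axis j 1"] by simp
    have one: "series_le A \<delta> (\<lambda>h t. of_real (vderiv (F n) (y0 + h) t (axis j 1, 0) $ i)) (real n * \<psi> n * \<sigma> ^ (n - 1) * Z)"
      if n: "2 \<le> n" for n
    proof -
      let ?f = "\<lambda>y t. complex_of_real (F n y t $ i)"
      have pf: "pol (smooth_le l) n ?f (\<psi> n / cmult)" using hom[of n] n by (simp add: homog_def \<psi>_def)
      have ser: "series_le A \<delta> (\<lambda>h t. jderiv ?f (y0 + h) t (axis j 1, 0)) (real n * \<psi> n * \<sigma> ^ (n - 1) * Z)"
        using pol_jderiv_series[OF less_imp_le[OF \<delta>] z[OF y0] Zj pf] cmult_pos sob_const_ge_1 by simp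
      have re: "of_real (Re (jderiv ?f y t v)) = jderiv ?f y t v" for y t v
      proof -
        have d1: "((\<lambda>x. ?f (fst x) (snd x)) has_derivative jderiv ?f y t) (at (y, t))" by (rule pol_smooth_has_jderiv[OF pf])
        from bounded_linear.has_derivative[OF bounded_linear_of_real bounded_linear.has_derivative[OF bounded_linear_Re d1]]
        have "((\<lambda>x. ?f (fst x) (snd x)) has_derivative (\<lambda>v. of_real (Re (jderiv ?f y t v)))) (at (y, t))" by simp
        from has_derivative_unique[OF this d1] show ?thesis by metis
      qed
      show ?thesis using ser unfolding vderiv_def by (simp add: re)
    qed
    have "series_le A \<delta> (\<lambda>h t. \<Sum>n=2..p. of_real (vderiv (F n) (y0 + h) t (axis j 1, 0) $ i)) (\<Sum>n=2..p. real n * \<psi> n * \<sigma> ^ (n - 1) * Z)"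
      using \<delta> by (intro A.series_le_sum one) auto
    then have "series_le A \<delta> (\<lambda>h t. of_real (d\<Phi> (y0 + h) t (axis j 1, 0) $ i)) (\<Sum>n=2..p. real n * \<psi> n * \<sigma> ^ (n - 1) * Z)"
      by (simp add: d\<Phi>_def)
    then show ?thesis
    proof (rule A.series_le_mono)
      have "(\<Sum>n=2..p. real n * \<psi> n * \<sigma> ^ (n - 1) * Z) \<le> (\<Sum>n=2..p. 2 * q * Z / s * bs n)"
      proof (rule sum_mono)
        fix n assume n: "n \<in> {2..p}"
        then obtain k where k: "n = Suc (Suc k)" by (metis atLeastAtMost_iff add_2_eq_Suc le_Suc_ex)
        have "real n * q ^ (n - 1) = real n * q ^ k * q" by (simp add: k)
        also have "\<dots> \<le> 2 * q"
        proof -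
          have "real n * q ^ k \<le> 2 ^ (n - 1) * (1 / 2) ^ k"
            using of_nat_le_two_power[of n] k q0 q(2) by (intro mult_mono power_mono) auto
          also have "\<dots> = 2" by (simp add: k power_one_over)
          finally show ?thesis using q0 by (intro mult_right_mono)
        qed
        finally have nq: "real n * q ^ (n - 1) \<le> 2 * q" .
        have "real n * \<psi> n * \<sigma> ^ (n - 1) * Z = (real n * q ^ (n - 1)) * (\<psi> n * s ^ (n - 1) * Z)"
          by (simp add: \<sigma>_def power_mult_distrib mult_ac)
        also have "\<dots> \<le> 2 * q * (\<psi> n * s ^ (n - 1) * Z)"
          using nq \<psi>0[of n] s Z0 by (intro mult_right_mono) auto
        also have "\<dots> = 2 * q * Z / s * bs n" using s by (simp add: bs_def k)
        finally show "real n * \<psi> n * \<sigma> ^ (n - 1) * Z \<le> 2 * q * Z / s * bs n" .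
      qed
      also have "\<dots> = 2 * q * Z / s * (\<Sum>n=2..p. bs n)" by (simp add: sum_distrib_left)
      also have "\<dots> \<le> 2 * q * Z / s * (2 * (coord_norm * s))"
      proof (rule mult_left_mono)
        have "(\<Sum>n=2..p. bs n) \<le> (\<Sum>n=1..p. bs n)" using bs0 by (intro sum_mono2) auto
        then show "(\<Sum>n=2..p. bs n) \<le> 2 * (coord_norm * s)" using Sbound by (simp add: bs_def)
      qed (use q0 Z0 s in auto)
      also have "\<dots> = \<theta>" using s by (simp add: \<theta>_def)
      finally show "(\<Sum>n=2..p. real n * \<psi> n * \<sigma> ^ (n - 1) * Z) \<le> \<theta>" .
    qed
  qed
  have loc: "\<exists>r>0. \<exists>S :: real ^ 'm \<Rightarrow> real ^ 'm. linear S \<and>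
       (\<forall>i j. series_le A r (\<lambda>h t. of_real ((axis j 1 - S (axis j 1 + d\<Phi> (y0 + h) t (axis j 1, 0))) $ i)) \<theta>) \<and>
       (\<forall>i. series_le H r (\<lambda>h t. of_real (S (Q (y0 + h) t) $ i)) B)" if y0: "y0 \<in> cball 0 \<delta>" for y0
  proof (intro exI[of _ \<delta>] exI[of _ id] conjI allI \<delta> linear_id)
    show "series_le A \<delta> (\<lambda>h t. of_real ((axis j 1 - id (axis j 1 + d\<Phi> (y0 + h) t (axis j 1, 0))) $ i)) \<theta>" for i j
      using series_le_cmult_A[OF less_imp_le[OF \<delta>] dser[OF y0, where j=j and i=i], of "-1"] by simp
    show "series_le H \<delta> (\<lambda>h t. of_real (id (Q (y0 + h) t) $ i)) B" for i using Qser[OF y0] by simp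
  qed
  obtain R where R: "transforms_into (\<lambda>u t. L u + V u t) \<Omega> \<Phi> (\<lambda>y t. L y + R y t) (cball 0 \<delta>)"
    "sobolev_analytic_on T l R (cball 0 \<delta>)"
    "\<And>y. y \<in> cball 0 \<delta> \<Longrightarrow> R y \<in> sobolev T l \<and> sobolev_norm T l (R y) \<le> real CARD('m) * (2 * B)"
    using normal_form_by_inversion[OF linear_L dPhi Veq loc] q(3) unfolding \<theta>_def by blast
  show thesis
  proof (rule that[of \<Phi> R, OF _ _ R(1,2)])
    show "\<Phi> \<in> sobolev_polys p T (Suc l)"
      unfolding \<Phi>_def[abs_def] by (intro sobolev_polys_sum homog_in_sobolev_polys[OF hom]) auto
    show "vanishes_to_second_order \<Phi>"
      unfolding vanishes_to_second_order_def
    proof (intro allI conjI)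
      fix t
      show "\<Phi> 0 t = 0" using homog_vanishes(1)[OF Z _ hom] by (simp add: \<Phi>_def)
      have "((\<lambda>u. (u, t)) has_derivative (\<lambda>v. (v, 0))) (at 0)"
        by (intro has_derivative_Pair has_derivative_ident has_derivative_const)
      from has_derivative_compose[OF this, of "\<lambda>x. \<Phi> (fst x) (snd x)" "d\<Phi> 0 t"] dPhi
      have "((\<lambda>u. \<Phi> u t) has_derivative (\<lambda>v. d\<Phi> 0 t (v, 0))) (at 0)" by simp
      moreover have "d\<Phi> 0 t (v, 0) = 0" for v using homog_vanishes(2)[OF Z _ hom] by (simp add: d\<Phi>_def)
      ultimately show "((\<lambda>u. \<Phi> u t) has_derivative (\<lambda>_. 0)) (at 0)" by simp
    qed
    show "R y \<in> sobolev T l \<and> sobolev_norm T l (R y) \<le>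
        real CARD('m) * (2 * (q ^ (p + 1) * (2 * c * (real CARD('m) * (2 * (coord_norm * s)) / \<rho>)\<^sup>2)))" if "y \<in> cball 0 \<delta>" for y
      using R(3)[OF that] unfolding B_def .
  qed
qed

end

section \<open>Squashing a large ball\<close>

lemma poly_antiderivative:
  fixes g :: "real poly"
  obtains f where "pderiv f = g" "poly f 0 = 0"
proof -
  define f where "f = (\<Sum>k\<le>degree g. monom (coeff g k / real (Suc k)) (Suc k))"
  have pderiv_sum: "pderiv (sum h I) = (\<Sum>i\<in>I. pderiv (h i))" for h :: "nat \<Rightarrow> real poly" and I
    by (induction I rule: infinite_finite_induct) (auto simp: pderiv_add)
  have "pderiv f = (\<Sum>k\<le>degree g. monom (coeff g k) k)"
    unfolding f_def pderiv_sum by (intro sum.cong) (auto simp: pderiv_monom simp del: of_nat_Suc)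
  also have "\<dots> = g" by (rule poly_as_sum_of_monoms)
  finally have "pderiv f = g" .
  moreover have "poly f 0 = 0" by (simp add: f_def poly_sum poly_monom)
  ultimately show thesis using that by blast
qed

text \<open>The derivative is \<open>\<eta> + (1 - \<eta>) (1 - s\<^sup>2/\<delta>\<^sup>2)\<^sup>n\<close> with \<open>\<eta> = a / (8 \<delta>)\<close>: one at the origin, and for large \<open>n\<close> close to its lower bound
\<open>\<eta>\<close> outside a small neighbourhood of the origin. The part near the origin and the part with slope of order \<open>\<eta>\<close> contribute at
most \<open>a / 4\<close> each to the value.\<close>

lemma squashing_polynomial:
  fixes \<delta> a :: real
  assumes a: "0 < a" "a \<le> \<delta>"
  obtains f :: "real poly" where "poly f 0 = 0" "poly (pderiv f) 0 = 1"
    "\<And>s. \<bar>s\<bar> \<le> \<delta> \<Longrightarrow> a / (8 * \<delta>) \<le> poly (pderiv f) s" "\<And>s. \<bar>s\<bar> \<le> \<delta> \<Longrightarrow> \<bar>poly f s\<bar> \<le> a"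
proof -
  define \<eta> where "\<eta> = a / (8 * \<delta>)"
  have \<delta>: "0 < \<delta>" using a by linarith
  have \<eta>: "0 < \<eta>" "\<eta> \<le> 1" using a \<delta> by (auto simp: \<eta>_def field_simps)
  \<comment> \<open>The largest value of \<open>1 - s\<^sup>2/\<delta>\<^sup>2\<close> for \<open>\<bar>s\<bar> \<ge> a / 4\<close>.\<close>
  define x0 where "x0 = 1 - (a / 4)\<^sup>2 / \<delta>\<^sup>2"
  have a4: "0 < (a / 4)\<^sup>2 / \<delta>\<^sup>2" "(a / 4)\<^sup>2 / \<delta>\<^sup>2 \<le> 1"
    using a \<delta> by (auto simp: divide_le_eq_1 intro!: power_mono)
  have x0: "0 \<le> x0" "x0 < 1" using a4 by (auto simp: x0_def)
  obtain n where n: "x0 ^ n < \<eta>" using real_arch_pow_inv[OF \<eta>(1) x0(2)] by blast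
  define g where "g = [:\<eta>:] + smult (1 - \<eta>) ([:1, 0, - (1 / \<delta>\<^sup>2):] ^ n)"
  obtain f where f: "pderiv f = g" "poly f 0 = 0" using poly_antiderivative by blast
  have pg: "poly g s = \<eta> + (1 - \<eta>) * (1 - s\<^sup>2 / \<delta>\<^sup>2) ^ n" for s
    by (simp add: g_def poly_power power2_eq_square algebra_simps)
  have in01: "0 \<le> 1 - s\<^sup>2 / \<delta>\<^sup>2 \<and> 1 - s\<^sup>2 / \<delta>\<^sup>2 \<le> 1" if "\<bar>s\<bar> \<le> \<delta>" for s
  proof -
    have "s\<^sup>2 \<le> \<delta>\<^sup>2" using power_mono[OF that, of 2] by simp
    then show ?thesis using \<delta> by (simp add: divide_le_eq_1)
  qed
  have lower: "\<eta> \<le> poly g s" if "\<bar>s\<bar> \<le> \<delta>" for s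
    using in01[OF that] \<eta> by (simp add: pg)
  have upper: "poly g s \<le> 1" if "\<bar>s\<bar> \<le> \<delta>" for s
  proof -
    have "(1 - s\<^sup>2 / \<delta>\<^sup>2) ^ n \<le> 1" using in01[OF that] by (intro power_le_one) auto
    then have "(1 - \<eta>) * (1 - s\<^sup>2 / \<delta>\<^sup>2) ^ n \<le> (1 - \<eta>) * 1" using \<eta> by (intro mult_left_mono) auto
    then show ?thesis by (simp add: pg)
  qed
  have outer: "poly g s \<le> 2 * \<eta>" if s: "\<bar>s\<bar> \<le> \<delta>" "a / 4 \<le> \<bar>s\<bar>" for s
  proof -
    have "(a / 4)\<^sup>2 \<le> s\<^sup>2" using power_mono[OF s(2), of 2] a by simp
    then have "1 - s\<^sup>2 / \<delta>\<^sup>2 \<le> x0" using \<delta> by (simp add: x0_def divide_right_mono)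
    then have "(1 - s\<^sup>2 / \<delta>\<^sup>2) ^ n \<le> x0 ^ n" using in01[OF s(1)] by (intro power_mono) auto
    then have "(1 - s\<^sup>2 / \<delta>\<^sup>2) ^ n \<le> \<eta>" using n by linarith
    then have "(1 - \<eta>) * (1 - s\<^sup>2 / \<delta>\<^sup>2) ^ n \<le> 1 * \<eta>"
      using \<eta> in01[OF s(1)] by (intro mult_mono) auto
    then show ?thesis by (simp add: pg)
  qed
  have mvt: "\<bar>poly f y - poly f x\<bar> \<le> B * (y - x)" if xy: "x \<le> y" and B: "\<And>s. x \<le> s \<Longrightarrow> s \<le> y \<Longrightarrow> \<bar>poly g s\<bar> \<le> B" for x y B
  proof (cases "x = y")
    case False
    then obtain \<xi> where \<xi>: "\<xi> > x" "\<xi> < y" "poly f y - poly f x = (y - x) * poly (pderiv f) \<xi>"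
      using poly_MVT[of x y f] xy by auto
    then have "\<bar>poly f y - poly f x\<bar> = (y - x) * \<bar>poly g \<xi>\<bar>" using f(1) xy by (simp add: abs_mult)
    also have "\<dots> \<le> (y - x) * B" using B[of \<xi>] \<xi> xy by (intro mult_left_mono) auto
    finally show ?thesis by (simp add: mult.commute)
  qed simp
  have gabs: "\<bar>poly g s\<bar> \<le> 1" if "\<bar>s\<bar> \<le> \<delta>" for s using lower[OF that] upper[OF that] \<eta> by linarith
  have gabs': "\<bar>poly g s\<bar> \<le> 2 * \<eta>" if "\<bar>s\<bar> \<le> \<delta>" "a / 4 \<le> \<bar>s\<bar>" for s
    using lower[OF that(1)] outer[OF that] \<eta> by linarith
  have \<eta>8: "2 * \<eta> * \<delta> = a / 4" using \<delta> by (simp add: \<eta>_def)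
  have bound: "\<bar>poly f s\<bar> \<le> a" if s: "\<bar>s\<bar> \<le> \<delta>" for s
  proof -
    consider "\<bar>s\<bar> \<le> a / 4" | "a / 4 < s" | "s < - (a / 4)" by linarith
    then show ?thesis
    proof cases
      case 1
      have "\<bar>poly f s\<bar> \<le> \<bar>s\<bar>"
      proof (cases "0 \<le> s")
        case True
        then show ?thesis using mvt[of 0 s 1] gabs s f(2) by simp
      next
        case False
        then show ?thesis using mvt[of s 0 1] gabs s f(2) by simp
      qed
      then show ?thesis using 1 a by linarith
    next
      case 2
      have "\<bar>poly f (a / 4) - poly f 0\<bar> \<le> 1 * (a / 4 - 0)" using a s 2 by (intro mvt gabs) auto
      moreover have "\<bar>poly f s - poly f (a / 4)\<bar> \<le> 2 * \<eta> * (s - a / 4)" using a s 2 by (intro mvt gabs') auto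
      moreover have "2 * \<eta> * (s - a / 4) \<le> 2 * \<eta> * \<delta>" using s a \<eta> by (intro mult_left_mono) auto
      ultimately have "\<bar>poly f s - poly f (a / 4)\<bar> \<le> a / 4" "\<bar>poly f (a / 4) - poly f 0\<bar> \<le> a / 4"
        unfolding \<eta>8 by (linarith, simp)
      then show ?thesis using f(2) a by linarith
    next
      case 3
      have "\<bar>poly f 0 - poly f (- (a / 4))\<bar> \<le> 1 * (0 - (- (a / 4)))" using a s 3 by (intro mvt gabs) auto
      moreover have "\<bar>poly f (- (a / 4)) - poly f s\<bar> \<le> 2 * \<eta> * (- (a / 4) - s)" using a s 3 by (intro mvt gabs') auto
      moreover have "2 * \<eta> * (- (a / 4) - s) \<le> 2 * \<eta> * \<delta>" using s a \<eta> by (intro mult_left_mono) auto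
      ultimately have "\<bar>poly f (- (a / 4)) - poly f s\<bar> \<le> a / 4" "\<bar>poly f 0 - poly f (- (a / 4))\<bar> \<le> a / 4"
        unfolding \<eta>8 by (linarith, simp)
      then show ?thesis using f(2) a by linarith
    qed
  qed
  show thesis
    by (rule that[of f]) (use f lower bound in \<open>auto simp: \<eta>_def pg\<close>)
qed

context sobolev_multipliers
begin

lemma series_le_poly:
  fixes f :: "real poly"
  assumes r: "0 \<le> r"
  shows "\<exists>M. series_le A r (\<lambda>(h :: real ^ 'm) t. of_real (poly f (s + h $ i))) M"
proof (induction f)
  case 0
  have "series_le A r (\<lambda>(h :: real ^ 'm) t. 0) 0" by (rule A.series_le_const[OF A.nb_zero])
  then show ?case by auto
next
  case (pCons a f)
  then obtain M where M: "series_le A r (\<lambda>(h :: real ^ 'm) t. of_real (poly f (s + h $ i))) M" by blast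
  have "series_le A r (\<lambda>(h :: real ^ 'm) t. of_real s + of_real (h $ i)) (cmod (of_real s) + r)"
    by (intro A.series_le_add r A.series_le_const mult_le_const series_le_coord)
  from A.series_le_add[OF r A.series_le_const[OF mult_le_const[of l "of_real a"]] series_le_mult_A[OF r this M]]
  show ?case by auto
qed

lemma poly_in_sobolev_polys:
  fixes f :: "real poly" and c :: "real ^ 'm"
  shows "(\<lambda>y t. poly f (y $ i) *\<^sub>R c) \<in> sobolev_polys (length (coeffs f)) T q"
proof (induction f)
  case 0 then show ?case by (simp add: sobolev_polys_0)
next
  case (pCons a f)
  have const: "(\<lambda>y t. a *\<^sub>R c) \<in> sobolev_polys p T q" for p
  proof (rule sobolev_polys_const[of "\<lambda>_. a *\<^sub>R c"])
    show "(\<lambda>_. a *\<^sub>R c) \<in> sobolev T q"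
      by (rule sobolevI) (use sob_le_cmult[OF sob_le_1] in fastforce)
  qed
  have "length (coeffs (pCons a f)) = Suc (length (coeffs f))" using pCons(1) by (auto simp: cCons_def)
  moreover have "(\<lambda>y t. a *\<^sub>R c + (y $ i) *\<^sub>R (poly f (y $ i) *\<^sub>R c)) \<in> sobolev_polys (Suc (length (coeffs f))) T q"
    by (intro sobolev_polys_add const sobolev_polys_coord_mult pCons)
  ultimately show ?case by (simp add: scaleR_add_left)
qed

text \<open>The map \<open>y\<^sub>i \<mapsto> f(y\<^sub>i)\<close> in each coordinate sends the ball of radius \<open>\<delta>\<close> into the cube of size \<open>a\<close>, where
the series of \<open>V\<close> converges. No term of \<open>V\<close> is cancelled; the point is only that the transformed equation exists
on the whole ball and is analytic there. Its remainder is of order \<open>\<delta>\<close>, because the Jacobian, a diagonal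
matrix, is bounded below by \<open>a / (8 \<delta>)\<close>.\<close>

lemma normal_form_by_squashing:
  fixes L :: "real ^ 'm \<Rightarrow> real ^ 'm"
  assumes c: "0 < c" and \<rho>: "0 < \<rho>" and L: "linear L"
    and V: "0 \<in> interior \<Omega>" "analytic_class \<Omega> T l c \<rho> V" "vanishes_to_second_order V"
    and a: "0 < a" "a \<le> \<delta>" "real CARD('m) * (2 * a) / \<rho> \<le> 1 / 2"
  obtains p \<Phi> R where "\<Phi> \<in> sobolev_polys p T (Suc l)" "vanishes_to_second_order \<Phi>"
    "transforms_into (\<lambda>u t. L u + V u t) \<Omega> \<Phi> (\<lambda>y t. L y + R y t) (cball 0 \<delta>)"
    "sobolev_analytic_on T l R (cball 0 \<delta>)"
    "\<And>y. y \<in> cball 0 \<delta> \<Longrightarrow> R y \<in> sobolev T l \<and> sobolev_norm T l (R y) \<le>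
      real CARD('m) * (2 * (8 * \<delta> / a * (2 * c + (\<Sum>i\<in>UNIV. \<Sum>j\<in>UNIV. \<bar>L (axis j 1) $ i\<bar>) * (2 * a))
        + 2 * ((\<Sum>i\<in>UNIV. \<Sum>j\<in>UNIV. \<bar>L (axis j 1) $ i\<bar>) * (2 * \<delta>))))"
proof -
  have \<delta>: "0 < \<delta>" using a by linarith
  define \<Lambda> where "\<Lambda> = (\<Sum>i\<in>UNIV. \<Sum>j\<in>UNIV. \<bar>L (axis j 1) $ i\<bar>)"
  have rowL: "(\<Sum>j\<in>UNIV. \<bar>L (axis j 1) $ i\<bar>) \<le> \<Lambda>" for i
    unfolding \<Lambda>_def by (rule member_le_sum[of i UNIV "\<lambda>i. \<Sum>j\<in>UNIV. \<bar>L (axis j 1) $ i\<bar>"]) (auto intro: sum_nonneg)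
  have Lsum: "L v $ i = (\<Sum>j\<in>UNIV. L (axis j 1) $ i * v $ j)" for v i
    using arg_cong[OF linear_axis_expansion[OF L, of v], of "\<lambda>z. z $ i"] by (simp add: mult.commute)
  have Lser: "series_le A r (\<lambda>h t. of_real (L (u h) $ i)) (\<Lambda> * M)"
    if r: "0 \<le> r" and u: "\<And>j. series_le A r (\<lambda>h t. of_real (u h $ j)) M" for r M i and u :: "real ^ 'm \<Rightarrow> real ^ 'm"
  proof -
    have Leq: "complex_of_real (L (u h) $ i) = (\<Sum>j\<in>UNIV. of_real (L (axis j 1) $ i) * of_real (u h $ j))" for h
      by (subst Lsum) simp
    have "series_le A r (\<lambda>h t. \<Sum>j\<in>UNIV. of_real (L (axis j 1) $ i) * of_real (u h $ j)) (\<Sum>j\<in>UNIV. cmod (of_real (L (axis j 1) $ i)) * M)"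
      by (intro A.series_le_sum r series_le_cmult_A u) auto
    then have "series_le A r (\<lambda>h t. of_real (L (u h) $ i)) (\<Sum>j\<in>UNIV. cmod (of_real (L (axis j 1) $ i)) * M)"
      by (simp only: Leq)
    then show ?thesis
      by (rule A.series_le_mono)
        (use mult_right_mono[OF rowL A.series_le_nonneg[OF r u]] in \<open>simp add: sum_distrib_right\<close>)
  qed
  obtain f where f0: "poly f 0 = 0" and f1: "poly (pderiv f) 0 = 1"
    and fl: "\<And>s. \<bar>s\<bar> \<le> \<delta> \<Longrightarrow> a / (8 * \<delta>) \<le> poly (pderiv f) s" and fb: "\<And>s. \<bar>s\<bar> \<le> \<delta> \<Longrightarrow> \<bar>poly f s\<bar> \<le> a"
    using squashing_polynomial[OF a(1,2)] by blast
  define g where "g = pderiv f"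
  define \<psi> where "\<psi> y = (\<chi> i. poly f (y $ i))" for y :: "real ^ 'm"
  define \<Phi> where "\<Phi> y t = \<psi> y - y" for y and t :: real
  define d\<Phi> where "d\<Phi> y t q = (\<chi> i. (poly g (y $ i) - 1) * fst q $ i)" for y :: "real ^ 'm" and t :: real and q :: "(real ^ 'm) \<times> real"
  have dPhi: "((\<lambda>x. \<Phi> (fst x) (snd x)) has_derivative d\<Phi> y t) (at (y, t))" for y t
  proof -
    have "((\<lambda>x. \<Phi> (fst x) (snd x) $ i) has_derivative (\<lambda>q. d\<Phi> y t q $ i)) (at (y, t))" for i
    proof -
      have "((\<lambda>x. fst x $ i) has_derivative (\<lambda>q. fst q $ i)) (at (y, t))"
        by (intro bounded_linear.has_derivative[OF bounded_linear_vec_nth] has_derivative_fst has_derivative_ident)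
      moreover have "(poly f has_derivative (\<lambda>z. poly g (y $ i) * z)) (at (y $ i))"
        using poly_DERIV[of f "y $ i"] by (simp add: has_field_derivative_def g_def)
      ultimately have "((\<lambda>x. poly f (fst x $ i)) has_derivative (\<lambda>q. poly g (y $ i) * (fst q $ i))) (at (y, t))"
        using has_derivative_compose[of "\<lambda>x. fst x $ i" "\<lambda>q. fst q $ i" "(y, t)" UNIV "poly f" "\<lambda>z. poly g (y $ i) * z"] by simp
      from has_derivative_diff[OF this \<open>((\<lambda>x. fst x $ i) has_derivative (\<lambda>q. fst q $ i)) (at (y, t))\<close>]
      show ?thesis by (simp add: \<Phi>_def \<psi>_def d\<Phi>_def left_diff_distrib)
    qed
    then show ?thesis
      by (subst has_derivative_componentwise_within) (auto simp: Basis_vec_def inner_axis)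
  qed
  obtain W where Wb: "\<And>w j. H (\<lambda>t. of_real (W w t $ j)) (c / \<rho> ^ length w)"
    and WV: "\<And>p (U :: nat \<Rightarrow> real ^ 'm \<Rightarrow> real \<Rightarrow> real ^ 'm) y t. (\<Sum>n=1..p. U n y t) \<in> \<Omega> \<Longrightarrow>
        (\<lambda>xs. subst_term W U xs y t) summable_on subst_lists p \<Longrightarrow>
        V (\<Sum>n=1..p. U n y t) t = (\<Sum>\<^sub>\<infinity>xs\<in>subst_lists p. subst_term W U xs y t)"
    using expansion_of_vector_field[OF V] by blast
  \<comment> \<open>The sum in the expansion consists of the single summand \<open>\<psi> y\<close>.\<close>
  define U where "U = (\<lambda>(n::nat) (y :: real ^ 'm) (t :: real). \<psi> y)"
  define G where "G y t = (\<Sum>\<^sub>\<infinity>xs\<in>subst_lists 1. subst_term W U xs y t)" for y t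
  define Q where "Q y t = G y t - (d\<Phi> y t (L y, 1) - L (\<Phi> y t))" for y t
  have comp: "\<bar>y $ i\<bar> \<le> \<delta>" if "y \<in> cball 0 \<delta>" for y :: "real ^ 'm" and i
    using that component_le_norm_cart[of y i] by simp
  have bsmall: "real CARD('m) * (\<Sum>n=1..1::nat. 2 * a) / \<rho> \<le> 1 / 2" using a(3) by simp
  define B where "B = 8 * \<delta> / a * (2 * c + \<Lambda> * (2 * a)) + 2 * (\<Lambda> * (2 * \<delta>))"
  define \<theta> where "\<theta> = 1 / (2 * sob_const * real CARD('m))"
  have \<theta>: "0 < \<theta>" "sob_const * real CARD('m) * \<theta> \<le> 1 / 2" using sob_const_ge_1 by (auto simp: \<theta>_def field_simps)
  have local: "\<exists>r>0. r \<le> \<delta> \<and> (\<forall>i. series_le A r (\<lambda>(h :: real ^ 'm) t. of_real (\<psi> (y0 + h) $ i)) (2 * a)) \<and>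
      (\<forall>i. series_le A r (\<lambda>(h :: real ^ 'm) t. of_real (poly g ((y0 + h) $ i) / poly g (y0 $ i))) 2) \<and>
      (\<forall>i. series_le A r (\<lambda>(h :: real ^ 'm) t. of_real (1 - poly g ((y0 + h) $ i) / poly g (y0 $ i))) \<theta>)"
    if y0: "y0 \<in> cball 0 \<delta>" for y0
  proof -
    have gpos: "poly g (y0 $ i) > 0" for i
      using fl[OF comp[OF y0, of i]] a \<delta> by (smt (verit) divide_pos_pos g_def mult_pos_pos)
    have 1: "\<exists>r>0. r \<le> \<delta> \<and> (\<forall>r'>0. r' \<le> r \<longrightarrow> series_le A r' (\<lambda>(h :: real ^ 'm) t. of_real (\<psi> (y0 + h) $ i)) (a + a))" for i
    proof -
      obtain M where M: "series_le A \<delta> (\<lambda>(h :: real ^ 'm) t. of_real (poly f (y0 $ i + h $ i))) M"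
        using series_le_poly[OF less_imp_le[OF \<delta>]] by blast
      have "A (\<lambda>t. of_real (poly f (y0 $ i + (0 :: real ^ 'm) $ i))) a"
        by (rule mult_le_mono[OF mult_le_const]) (use fb[OF comp[OF y0, of i]] in simp)
      from A.series_le_shrink[OF \<delta> M this a(1)] show ?thesis by (simp add: \<psi>_def)
    qed
    have 2: "\<exists>r>0. r \<le> \<delta> \<and> (\<forall>r'>0. r' \<le> r \<longrightarrow> series_le A r' (\<lambda>(h :: real ^ 'm) t. of_real (poly g ((y0 + h) $ i) / poly g (y0 $ i))) (1 + 1))"
      "\<exists>r>0. r \<le> \<delta> \<and> (\<forall>r'>0. r' \<le> r \<longrightarrow> series_le A r' (\<lambda>(h :: real ^ 'm) t. of_real (1 - poly g ((y0 + h) $ i) / poly g (y0 $ i))) (0 + \<theta>))" for i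
    proof -
      obtain M where M: "series_le A \<delta> (\<lambda>(h :: real ^ 'm) t. of_real (poly g (y0 $ i + h $ i))) M"
        using series_le_poly[OF less_imp_le[OF \<delta>]] by blast
      from series_le_cmult_A[OF less_imp_le[OF \<delta>] M, of "of_real (1 / poly g (y0 $ i))"]
      obtain M' where M': "series_le A \<delta> (\<lambda>(h :: real ^ 'm) t. of_real (poly g ((y0 + h) $ i) / poly g (y0 $ i))) M'"
        by (auto simp: mult.commute divide_inverse)
      have "A (\<lambda>t. of_real (poly g ((y0 + (0 :: real ^ 'm)) $ i) / poly g (y0 $ i))) 1"
        by (rule mult_le_mono[OF mult_le_const]) (use gpos[of i] in simp)
      from A.series_le_shrink[OF \<delta> M' this zero_less_one]
      show "\<exists>r>0. r \<le> \<delta> \<and> (\<forall>r'>0. r' \<le> r \<longrightarrow> series_le A r' (\<lambda>(h :: real ^ 'm) t. of_real (poly g ((y0 + h) $ i) / poly g (y0 $ i))) (1 + 1))" .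
      from A.series_le_add[OF less_imp_le[OF \<delta>] A.series_le_const[OF mult_le_const[of l 1]] series_le_cmult_A[OF less_imp_le[OF \<delta>] M', of "-1"]]
      have "series_le A \<delta> (\<lambda>(h :: real ^ 'm) t. of_real (1 - poly g ((y0 + h) $ i) / poly g (y0 $ i))) (1 + M')"
        by simp
      moreover have "A (\<lambda>t. of_real (1 - poly g ((y0 + (0 :: real ^ 'm)) $ i) / poly g (y0 $ i))) 0"
        by (rule mult_le_mono[OF mult_le_const]) (use gpos[of i] in simp)
      ultimately show "\<exists>r>0. r \<le> \<delta> \<and> (\<forall>r'>0. r' \<le> r \<longrightarrow> series_le A r' (\<lambda>(h :: real ^ 'm) t. of_real (1 - poly g ((y0 + h) $ i) / poly g (y0 $ i))) (0 + \<theta>))"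
        by (rule A.series_le_shrink[OF \<delta> _ _ \<theta>(1)])
    qed
    obtain r1 where r1: "\<And>i. 0 < r1 i" "\<And>i. r1 i \<le> \<delta>"
      "\<And>i r. 0 < r \<Longrightarrow> r \<le> r1 i \<Longrightarrow> series_le A r (\<lambda>(h :: real ^ 'm) t. of_real (\<psi> (y0 + h) $ i)) (a + a)"
      using 1 by metis
    obtain r2 where r2: "\<And>i. 0 < r2 i"
      "\<And>i r. 0 < r \<Longrightarrow> r \<le> r2 i \<Longrightarrow> series_le A r (\<lambda>(h :: real ^ 'm) t. of_real (poly g ((y0 + h) $ i) / poly g (y0 $ i))) (1 + 1)"
      using 2(1) by metis
    obtain r3 where r3: "\<And>i. 0 < r3 i"
      "\<And>i r. 0 < r \<Longrightarrow> r \<le> r3 i \<Longrightarrow> series_le A r (\<lambda>(h :: real ^ 'm) t. of_real (1 - poly g ((y0 + h) $ i) / poly g (y0 $ i))) (0 + \<theta>)"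
      using 2(2) by metis
    define r where "r = Min (range r1 \<union> range r2 \<union> range r3)"
    have rle: "r \<le> r1 i" "r \<le> r2 i" "r \<le> r3 i" for i unfolding r_def by (auto intro!: Min_le)
    have rpos: "0 < r" unfolding r_def using r1(1) r2(1) r3(1) by (subst Min_gr_iff) auto
    have "r \<le> \<delta>" using rle(1)[of undefined] r1(2)[of undefined] by linarith
    then show ?thesis
      using rpos r1(3)[OF rpos rle(1)] r2(2)[OF rpos rle(2)] r3(2)[OF rpos rle(3)]
      by (intro exI[of _ r]) simp
  qed
  have Gser: "series_le H r (\<lambda>h t. of_real (G (y0 + h) t $ i)) (2 * c)"
    and Gsum: "(\<lambda>xs. subst_term W U xs y0 t) summable_on subst_lists 1"
    if r: "0 < r" and \<psi>: "\<And>i. series_le A r (\<lambda>(h :: real ^ 'm) t. of_real (\<psi> (y0 + h) $ i)) (2 * a)" for r y0 i t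
  proof -
    have us: "series_le A r (\<lambda>h t. of_real (U n (y0 + h) t $ i)) (2 * a)" for n i
      unfolding U_def by (rule \<psi>)
    have a0: "0 \<le> 2 * a" using a by simp
    obtain S0 where S0: "(maj_term c \<rho> (\<lambda>_. 2 * a) has_sum S0) (subst_lists 1 :: ('m \<times> nat) list set)"
      "S0 \<le> 2 * c * (real CARD('m) * (\<Sum>n=1..1::nat. 2 * a) / \<rho>)\<^sup>2"
      using has_sum_maj_term[where 'm='m, OF less_imp_le[OF c] \<rho> a0 bsmall] by blast
    have "(real CARD('m) * (\<Sum>n=1..1::nat. 2 * a) / \<rho>)\<^sup>2 \<le> 1\<^sup>2"
      using bsmall a \<rho> by (intro power_mono) auto
    then have "2 * c * (real CARD('m) * (\<Sum>n=1..1::nat. 2 * a) / \<rho>)\<^sup>2 \<le> 2 * c * 1"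
      using c by (intro mult_left_mono) auto
    then have M: "S \<le> 2 * c" if "(maj_term c \<rho> (\<lambda>_. 2 * a) has_sum S) (subst_lists 1 :: ('m \<times> nat) list set)" for S
      using S0 has_sum_unique[OF that S0(1)] by linarith
    show "series_le H r (\<lambda>h t. of_real (G (y0 + h) t $ i)) (2 * c)"
      unfolding G_def by (rule series_le_subst(2)[OF less_imp_le[OF r] c \<rho> a0 bsmall us Wb order_refl M])
    have "(\<lambda>xs. subst_term W U xs (y0 + 0) t) summable_on subst_lists 1"
      by (rule series_le_subst(1)[OF less_imp_le[OF r] c \<rho> a0 bsmall us Wb order_refl M]) (use r in auto)
    then show "(\<lambda>xs. subst_term W U xs y0 t) summable_on subst_lists 1" by simp
  qed
  have Veq: "V (y + \<Phi> y t) t = Q y t + (d\<Phi> y t (L y, 1) - L (\<Phi> y t))" if y: "y \<in> cball 0 \<delta>" and y\<Omega>: "y + \<Phi> y t \<in> \<Omega>" for y t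
  proof -
    obtain r where "r > 0" "\<And>i. series_le A r (\<lambda>(h :: real ^ 'm) t. of_real (\<psi> (y + h) $ i)) (2 * a)" using local[OF y] by blast
    from Gsum[OF this] have "V (\<Sum>n=1..1. U n y t) t = G y t"
      unfolding G_def by (intro WV) (use y\<Omega> in \<open>simp_all add: U_def \<Phi>_def\<close>)
    then show ?thesis by (simp add: U_def \<Phi>_def Q_def)
  qed
  have loc: "\<exists>r>0. \<exists>S :: real ^ 'm \<Rightarrow> real ^ 'm. linear S \<and>
       (\<forall>i j. series_le A r (\<lambda>h t. of_real ((axis j 1 - S (axis j 1 + d\<Phi> (y0 + h) t (axis j 1, 0))) $ i)) \<theta>) \<and>
       (\<forall>i. series_le H r (\<lambda>h t. of_real (S (Q (y0 + h) t) $ i)) B)" if y0: "y0 \<in> cball 0 \<delta>" for y0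
  proof -
    obtain r where r: "r > 0" "r \<le> \<delta>"
      and s\<psi>: "\<And>i. series_le A r (\<lambda>(h :: real ^ 'm) t. of_real (\<psi> (y0 + h) $ i)) (2 * a)"
      and sg: "\<And>i. series_le A r (\<lambda>(h :: real ^ 'm) t. of_real (poly g ((y0 + h) $ i) / poly g (y0 $ i))) 2"
      and s\<theta>: "\<And>i. series_le A r (\<lambda>(h :: real ^ 'm) t. of_real (1 - poly g ((y0 + h) $ i) / poly g (y0 $ i))) \<theta>"
      using local[OF y0] by blast
    note r0 = less_imp_le[OF r(1)]
    \<comment> \<open>The inverse of the Jacobian at \<open>y0\<close>.\<close>
    define S where "S v = (\<chi> i. v $ i / poly g (y0 $ i))" for v :: "real ^ 'm"
    have linS: "linear S" by (simp add: S_def linear_iff vec_eq_iff add_divide_distrib)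
    have gl: "a / (8 * \<delta>) \<le> poly g (y0 $ i)" for i using fl[OF comp[OF y0, of i]] by (simp add: g_def)
    have ginv: "\<bar>1 / poly g (y0 $ i)\<bar> \<le> 8 * \<delta> / a" for i
    proof -
      have "0 < a / (8 * \<delta>)" using a \<delta> by simp
      from le_imp_inverse_le[OF gl[of i] this] less_le_trans[OF this gl[of i]]
      show ?thesis by (simp add: inverse_eq_divide)
    qed
    have 1: "series_le A r (\<lambda>h t. of_real ((axis j 1 - S (axis j 1 + d\<Phi> (y0 + h) t (axis j 1, 0))) $ i)) \<theta>" for i j
    proof (cases "i = j")
      case True
      then show ?thesis using s\<theta>[of j] by (simp add: S_def d\<Phi>_def)
    next
      case False
      have "series_le A r (\<lambda>(h :: real ^ 'm) t. 0) 0" by (rule A.series_le_const[OF A.nb_zero])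
      from A.series_le_mono[OF this less_imp_le[OF \<theta>(1)]] show ?thesis
        using False by (simp add: S_def d\<Phi>_def axis_def)
    qed
    have 2: "series_le H r (\<lambda>h t. of_real (S (Q (y0 + h) t) $ i)) B" for i
    proof -
      have "series_le A r (\<lambda>h t. of_real ((y0 + h) $ j)) (2 * \<delta>)" for j
      proof -
        have "series_le A r (\<lambda>h t. of_real (y0 $ j) + of_real (h $ j)) (cmod (of_real (y0 $ j)) + r)"
          by (intro A.series_le_add r0 A.series_le_const mult_le_const series_le_coord)
        then have "series_le A r (\<lambda>h t. of_real ((y0 + h) $ j)) (cmod (of_real (y0 $ j)) + r)" by simp
        then show ?thesis by (rule A.series_le_mono) (use comp[OF y0, of j] r(2) in simp)
      qed
      then have sL: "series_le A r (\<lambda>h t. of_real (L (y0 + h) $ i)) (\<Lambda> * (2 * \<delta>))" by (rule Lser[OF r0])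
      have sL\<psi>: "series_le A r (\<lambda>h t. of_real (L (\<psi> (y0 + h)) $ i)) (\<Lambda> * (2 * a))" by (rule Lser[OF r0 s\<psi>])
      have 3: "series_le H r (\<lambda>h t. of_real (1 / poly g (y0 $ i)) * (of_real (G (y0 + h) t $ i) + of_real (L (\<psi> (y0 + h)) $ i)))
          (8 * \<delta> / a * (2 * c + \<Lambda> * (2 * a)))"
        by (rule H.series_le_mono[OF series_le_cmult_H[OF r0 H.series_le_add[OF r0 Gser[OF r(1) s\<psi>] series_le_A_imp_H[OF sL\<psi>]]]])
          (use ginv[of i] H.series_le_nonneg[OF r0 H.series_le_add[OF r0 Gser[OF r(1) s\<psi>] series_le_A_imp_H[OF sL\<psi>]]]
            in \<open>simp only: norm_of_real, intro mult_right_mono\<close>)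
      have 4: "series_le H r (\<lambda>h t. (-1) * (of_real (poly g ((y0 + h) $ i) / poly g (y0 $ i)) * of_real (L (y0 + h) $ i))) (cmod (-1) * (2 * (\<Lambda> * (2 * \<delta>))))"
        by (intro series_le_cmult_H r0 series_le_A_imp_H series_le_mult_A sg sL)
      have eq: "of_real (S (Q (y0 + h) t) $ i) = complex_of_real (1 / poly g (y0 $ i)) * (of_real (G (y0 + h) t $ i) + of_real (L (\<psi> (y0 + h)) $ i))
          + (-1) * (of_real (poly g ((y0 + h) $ i) / poly g (y0 $ i)) * of_real (L (y0 + h) $ i))" for h t
      proof -
        have "Q (y0 + h) t $ i = G (y0 + h) t $ i + L (\<psi> (y0 + h)) $ i - poly g ((y0 + h) $ i) * L (y0 + h) $ i"
        proof -
          have "L (\<psi> (y0 + h) - (y0 + h)) $ i = L (\<psi> (y0 + h)) $ i - L (y0 + h) $ i"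
            by (simp only: linear_diff[OF L] vector_minus_component)
          then show ?thesis unfolding Q_def d\<Phi>_def \<Phi>_def by (simp add: left_diff_distrib)
        qed
        then have "S (Q (y0 + h) t) $ i = 1 / poly g (y0 $ i) * (G (y0 + h) t $ i + L (\<psi> (y0 + h)) $ i)
            + (-1) * (poly g ((y0 + h) $ i) / poly g (y0 $ i) * L (y0 + h) $ i)"
          unfolding S_def by (simp add: diff_divide_distrib)
        from arg_cong[OF this, of complex_of_real] show ?thesis by simp
      qed
      from H.series_le_add[OF r0 3 4] show ?thesis unfolding eq B_def by simp
    qed
    show ?thesis using r(1) linS 1 2 by blast
  qed
  obtain R where R: "transforms_into (\<lambda>u t. L u + V u t) \<Omega> \<Phi> (\<lambda>y t. L y + R y t) (cball 0 \<delta>)"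
    "sobolev_analytic_on T l R (cball 0 \<delta>)"
    "\<And>y. y \<in> cball 0 \<delta> \<Longrightarrow> R y \<in> sobolev T l \<and> sobolev_norm T l (R y) \<le> real CARD('m) * (2 * B)"
    using normal_form_by_inversion[OF L dPhi Veq loc \<theta>(2)] by blast
  show thesis
  proof (rule that[of \<Phi> "Suc (Suc (length (coeffs f)))" R, OF _ _ R(1,2)])
    have part: "(\<lambda>(y :: real ^ 'm) t. \<Sum>i\<in>UNIV. poly h (y $ i) *\<^sub>R (axis i 1 :: real ^ 'm))
        \<in> sobolev_polys (Suc (Suc (length (coeffs f)))) T (Suc l)"
      if "length (coeffs h) \<le> Suc (Suc (length (coeffs f)))" for h :: "real poly"
      by (rule sobolev_polys_sum[OF finite]) (rule sobolev_polys_mono[OF poly_in_sobolev_polys that])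
    have "(\<lambda>(y :: real ^ 'm) t. (\<Sum>i\<in>UNIV. poly f (y $ i) *\<^sub>R axis i 1) + (\<Sum>i\<in>UNIV. poly [:0, -1:] (y $ i) *\<^sub>R axis i 1))
        \<in> sobolev_polys (Suc (Suc (length (coeffs f)))) T (Suc l)"
      by (rule sobolev_polys_add[OF part part]) auto
    moreover have "(\<Sum>i\<in>UNIV. poly f (y $ i) *\<^sub>R axis i 1) + (\<Sum>i\<in>UNIV. poly [:0, -1:] (y $ i) *\<^sub>R axis i 1) = \<psi> y - y" for y :: "real ^ 'm"
      using linear_axis_expansion[OF linear_id, of "\<psi> y"] linear_axis_expansion[OF linear_id, of y]
      by (simp add: \<psi>_def sum_negf)
    moreover have "\<Phi> = (\<lambda>y t. \<psi> y - y)" by (intro ext) (simp add: \<Phi>_def)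
    ultimately have "\<Phi> \<in> sobolev_polys (Suc (Suc (length (coeffs f)))) T (Suc l)" by simp
    then show "\<Phi> \<in> sobolev_polys (Suc (Suc (length (coeffs f)))) T (Suc l)" .
    show "vanishes_to_second_order \<Phi>"
      unfolding vanishes_to_second_order_def
    proof (intro allI conjI)
      fix t
      show "\<Phi> 0 t = 0" by (simp add: \<Phi>_def \<psi>_def f0 vec_eq_iff)
      have "((\<lambda>u. (u, t)) has_derivative (\<lambda>v. (v, 0))) (at 0)"
        by (intro has_derivative_Pair has_derivative_ident has_derivative_const)
      from has_derivative_compose[OF this, of "\<lambda>x. \<Phi> (fst x) (snd x)" "d\<Phi> 0 t"] dPhi
      have "((\<lambda>u. \<Phi> u t) has_derivative (\<lambda>v. d\<Phi> 0 t (v, 0))) (at 0)" by simp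
      moreover have "d\<Phi> 0 t (v, 0) = 0" for v using f1 by (simp add: d\<Phi>_def g_def vec_eq_iff)
      ultimately show "((\<lambda>u. \<Phi> u t) has_derivative (\<lambda>_. 0)) (at 0)" by simp
    qed
    show "R y \<in> sobolev T l \<and> sobolev_norm T l (R y) \<le>
      real CARD('m) * (2 * (8 * \<delta> / a * (2 * c + (\<Sum>i\<in>UNIV. \<Sum>j\<in>UNIV. \<bar>L (axis j 1) $ i\<bar>) * (2 * a))
        + 2 * ((\<Sum>i\<in>UNIV. \<Sum>j\<in>UNIV. \<bar>L (axis j 1) $ i\<bar>) * (2 * \<delta>))))" if "y \<in> cball 0 \<delta>" for y
      using R(3)[OF that] unfolding B_def \<Lambda>_def .
  qed
qed

end

section \<open>The truncation order\<close>

lemma power_exp_bound: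
  fixes q :: real
  assumes "0 \<le> q" "q \<le> exp (-1)" "x \<le> real n" shows "q ^ n \<le> exp (- x)"
proof -
  have "q ^ n \<le> exp (-1) ^ n" using assms by (intro power_mono)
  also have "\<dots> = exp (- real n)" by (simp add: exp_of_nat_mult[symmetric])
  also have "\<dots> \<le> exp (- x)" using assms by simp
  finally show ?thesis .
qed

context eigenforms
begin

text \<open>The order \<open>p\<close> is chosen proportional to \<open>\<delta>\<^sup>-\<^sup>b\<close>, the radius \<open>s\<close> of the majorant proportional to
\<open>(p + 1)\<^sup>-\<^sup>\<tau>\<^sup>-\<^sup>1\<close>. Then \<open>\<delta> / s\<close> is of order \<open>\<delta>\<^sup>1\<^sup>-\<^sup>b\<^sup>(\<^sup>\<tau>\<^sup>+\<^sup>1\<^sup>)\<close> and stays bounded, with a bound that is made small by the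
constant of proportionality in \<open>p\<close>; it suffices that \<open>q \<le> 1/e\<close>, for which \<open>q\<^sup>p \<le> e\<^sup>-\<^sup>p\<close>.\<close>

lemma exponentially_small_remainder:
  assumes c: "0 < c" and \<rho>: "0 < \<rho>" and fin: "finite (UNIV :: 'x set)"
    and \<kappa>0: "0 < \<kappa>0" and D: "\<And>n. D n = \<kappa>0 / (real n + 1) powr (\<tau> + 1)" and \<tau>: "0 < \<tau>" and b: "0 < b" "b * (\<tau> + 1) \<le> 1"
  obtains c1 \<delta>0 M where "0 < c1" "0 < \<delta>0" "\<delta>0 \<le> 1" "0 \<le> M"
    "\<And>\<Omega> V \<delta>. 0 \<in> interior \<Omega> \<Longrightarrow> analytic_class \<Omega> T l c \<rho> V \<Longrightarrow> vanishes_to_second_order V \<Longrightarrow> 0 < \<delta> \<Longrightarrow> \<delta> \<le> \<delta>0 \<Longrightarrow>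
      \<exists>p \<Phi> R. real p \<le> c1 * \<delta> powr (- b) \<and> \<Phi> \<in> sobolev_polys p T (Suc l) \<and> vanishes_to_second_order \<Phi> \<and>
        transforms_into (\<lambda>u t. L u + V u t) \<Omega> \<Phi> (\<lambda>y t. L y + R y t) (cball 0 \<delta>) \<and>
        sobolev_analytic_on T l R (cball 0 \<delta>) \<and>
        (\<forall>y\<in>cball 0 \<delta>. R y \<in> sobolev T l \<and> sobolev_norm T l (R y) \<le> M * \<delta>\<^sup>2 * exp (- c1 / \<delta> powr b))"
proof -
  define m where "m = real CARD('m)"
  have m: "m > 0" by (simp add: m_def)
  have phi: "coord_norm \<ge> 1" by (rule coord_norm_ge_1)
  define Z where "Z = (\<Sum>x\<in>UNIV. \<Sum>k\<in>UNIV. cmod (\<zeta> x (axis k 1))) + 1"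
  have Z: "(\<Sum>k\<in>UNIV. cmod (\<zeta> x (axis k 1))) \<le> Z" for x
    using member_le_sum[of x UNIV "\<lambda>x. \<Sum>k\<in>UNIV. cmod (\<zeta> x (axis k 1))"] fin by (simp add: Z_def sum_nonneg)
  have Z0: "0 < Z" by (simp add: Z_def add_nonneg_pos sum_nonneg)
  define K1 where "K1 = homological_const / \<kappa>0 + 1"
  have K1: "0 < K1" using homological_const_nonneg \<kappa>0 by (simp add: K1_def add_nonneg_pos)
  \<comment> \<open>The two bounds make the majorant series converge and close the majorant recursion.\<close>
  define \<epsilon> where "\<epsilon> = min (\<rho> / (4 * m * coord_norm)) (\<rho>\<^sup>2 / (8 * c * m\<^sup>2 * coord_norm * K1))"
  have \<epsilon>: "0 < \<epsilon>" using \<rho> m phi c K1 by (simp add: \<epsilon>_def)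
  \<comment> \<open>The first bound yields the exponential, the second one the invertibility of the Jacobian.\<close>
  define q0 where "q0 = min (exp (-1)) (1 / (8 * sob_const * m * Z * coord_norm))"
  have q0: "0 < q0" using sob_const_ge_1 m Z0 phi by (simp add: q0_def)
  \<comment> \<open>Chosen such that \<open>(2 x)\<^sup>\<tau>\<^sup>+\<^sup>1 \<delta> \<le> q0 \<epsilon> / (2 Z)\<close> for \<open>x = c1 \<delta>\<^sup>-\<^sup>b\<close> and \<open>\<delta> \<le> 1\<close>.\<close>
  define c1 where "c1 = (q0 * \<epsilon> / (2 * Z)) powr (1 / (\<tau> + 1)) / 2"
  have c1: "0 < c1" using q0 \<epsilon> Z0 by (simp add: c1_def)
  have c1pow: "(2 * c1) powr (\<tau> + 1) = q0 * \<epsilon> / (2 * Z)"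
    using q0 \<epsilon> Z0 \<tau> by (simp add: c1_def powr_powr)
  \<comment> \<open>For \<open>\<delta> \<le> \<delta>0\<close> the order \<open>p\<close> is at least two.\<close>
  define \<delta>0 where "\<delta>0 = min 1 ((c1 / 2) powr (1 / b))"
  have \<delta>0: "0 < \<delta>0" "\<delta>0 \<le> 1" using c1 by (auto simp: \<delta>0_def)
  define M where "M = 64 * c * m ^ 3 * coord_norm\<^sup>2 * Z\<^sup>2 / \<rho>\<^sup>2 * exp 2"
  have M: "0 \<le> M" using c m by (simp add: M_def)
  show thesis
  proof (rule that[OF c1 \<delta>0 M])
    fix \<Omega> :: "(real ^ 'm) set" and V :: "real ^ 'm \<Rightarrow> real \<Rightarrow> real ^ 'm" and \<delta> :: real
    assume V: "0 \<in> interior \<Omega>" "analytic_class \<Omega> T l c \<rho> V" "vanishes_to_second_order V" and \<delta>: "0 < \<delta>" "\<delta> \<le> \<delta>0"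
    define x where "x = c1 * \<delta> powr (- b)"
    have x2: "2 \<le> x"
    proof -
      have "\<delta> powr b \<le> ((c1 / 2) powr (1 / b)) powr b" using \<delta> b by (intro powr_mono2) (auto simp: \<delta>0_def)
      also have "\<dots> = c1 / 2" using b c1 by (simp add: powr_powr)
      finally show ?thesis using \<delta> by (simp add: x_def powr_minus field_simps)
    qed
    define p where "p = nat \<lfloor>x\<rfloor>"
    have p: "real p \<le> x" "x < real p + 1" "2 \<le> p" using x2 by (auto simp: p_def le_nat_floor) 
    define P where "P = (real p + 1) powr (\<tau> + 1)"
    have P: "1 \<le> P" using \<tau> by (auto simp: P_def intro!: ge_one_powr_ge_zero)
    define s where "s = \<epsilon> / P"
    have s: "0 < s" "s \<le> \<epsilon>" using \<epsilon> P by (auto simp: s_def divide_le_eq)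
    define q where "q = 2 * Z * \<delta> / s"
    have q_pos: "0 \<le> q" using Z0 \<delta> s by (simp add: q_def)
    have P_le: "\<delta> * P \<le> q0 * \<epsilon> / (2 * Z)"
    proof -
      have "P \<le> (2 * x) powr (\<tau> + 1)" unfolding P_def using p(1) x2 \<tau> by (intro powr_mono2) auto
      also have "\<dots> = (2 * c1) powr (\<tau> + 1) * (\<delta> powr (- b)) powr (\<tau> + 1)"
        using c1 by (simp add: x_def powr_mult flip: mult.assoc)
      also have "\<dots> = q0 * \<epsilon> / (2 * Z) * \<delta> powr (- (b * (\<tau> + 1)))" by (simp only: c1pow powr_powr mult_minus_left)
      finally have "\<delta> * P \<le> \<delta> * (q0 * \<epsilon> / (2 * Z) * \<delta> powr (- (b * (\<tau> + 1))))" using \<delta> by (intro mult_left_mono) auto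
      also have "\<dots> = q0 * \<epsilon> / (2 * Z) * \<delta> powr (1 - b * (\<tau> + 1))"
        using \<delta> powr_add[of \<delta> 1 "- (b * (\<tau> + 1))"] by simp
      also have "\<dots> \<le> q0 * \<epsilon> / (2 * Z) * 1"
        using q0 \<epsilon> Z0 b(2) \<delta> \<delta>0 by (intro mult_left_mono powr_le1) auto
      finally show ?thesis by simp
    qed
    have q_le: "q \<le> q0"
    proof -
      have "q = 2 * Z / \<epsilon> * (\<delta> * P)" using P \<epsilon> by (simp add: q_def s_def)
      also have "\<dots> \<le> 2 * Z / \<epsilon> * (q0 * \<epsilon> / (2 * Z))" using Z0 \<epsilon> P_le by (intro mult_left_mono) auto
      also have "\<dots> = q0" using Z0 \<epsilon> by simp
      finally show ?thesis .
    qed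
    have e2: "exp (-1) \<le> (1 / 2 :: real)" using exp_ge_add_one_self[of 1] by (simp add: exp_minus inverse_eq_divide divide_le_eq)
    have eq1: "2 * Z * \<delta> = q * s" using s by (simp add: q_def)
    have eq2: "q \<le> 1 / 2" using q_le e2 by (simp add: q0_def)
    have eq3: "sob_const * real CARD('m) * (4 * q * Z * coord_norm) \<le> 1 / 2"
    proof -
      have pos: "0 < sob_const * m * Z * coord_norm" using sob_const_ge_1 m Z0 phi by simp
      have "sob_const * m * (4 * q * Z * coord_norm) = 4 * q * (sob_const * m * Z * coord_norm)" by simp
      also have "\<dots> \<le> 4 * (1 / (8 * sob_const * m * Z * coord_norm)) * (sob_const * m * Z * coord_norm)"
        using q_le pos by (intro mult_right_mono mult_left_mono) (auto simp: q0_def)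
      also have "\<dots> = 1 / 2" using sob_const_ge_1 m Z0 phi by simp
      finally show ?thesis by (simp add: m_def)
    qed
    have small1: "real CARD('m) * (2 * (coord_norm * s)) / \<rho> \<le> 1 / 2"
    proof -
      have "m * (2 * (coord_norm * s)) / \<rho> \<le> m * (2 * (coord_norm * (\<rho> / (4 * m * coord_norm)))) / \<rho>"
        using s(2) m phi \<rho> by (intro divide_right_mono mult_left_mono) (auto simp: \<epsilon>_def)
      also have "\<dots> = 1 / 2" using m phi \<rho> by simp
      finally show ?thesis by (simp add: m_def)
    qed
    have \<kappa>: "0 \<le> K1 * P" "\<And>n. 2 \<le> n \<Longrightarrow> n \<le> p \<Longrightarrow> homological_const / D n \<le> K1 * P"
    proof -
      show "0 \<le> K1 * P" using K1 P by simp
      fix n assume "2 \<le> n" "n \<le> p"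
      then have "(real n + 1) powr (\<tau> + 1) \<le> P" unfolding P_def using \<tau> by (intro powr_mono2) auto
      then have "homological_const / \<kappa>0 * (real n + 1) powr (\<tau> + 1) \<le> K1 * P"
        using homological_const_nonneg \<kappa>0 K1 by (intro mult_mono) (auto simp: K1_def)
      then show "homological_const / D n \<le> K1 * P" using \<kappa>0 by (simp add: D)
    qed
    have small2: "K1 * P * (2 * c * (real CARD('m) * (2 * (coord_norm * s)) / \<rho>)\<^sup>2) \<le> coord_norm * s"
    proof -
      have "K1 * P * (2 * c * (m * (2 * (coord_norm * s)) / \<rho>)\<^sup>2) = (P * s) * (8 * c * m\<^sup>2 * coord_norm * K1 / \<rho>\<^sup>2) * (coord_norm * s)"
        by (simp add: power2_eq_square)
      also have "P * s = \<epsilon>" using P by (simp add: s_def)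
      also have "\<epsilon> * (8 * c * m\<^sup>2 * coord_norm * K1 / \<rho>\<^sup>2) * (coord_norm * s) \<le> 1 * (coord_norm * s)"
      proof (rule mult_right_mono)
        have "\<epsilon> * (8 * c * m\<^sup>2 * coord_norm * K1 / \<rho>\<^sup>2) \<le> \<rho>\<^sup>2 / (8 * c * m\<^sup>2 * coord_norm * K1) * (8 * c * m\<^sup>2 * coord_norm * K1 / \<rho>\<^sup>2)"
          using c m phi K1 \<rho> by (intro mult_right_mono) (auto simp: \<epsilon>_def)
        also have "\<dots> = 1" using c m phi K1 \<rho> by simp
        finally show "\<epsilon> * (8 * c * m\<^sup>2 * coord_norm * K1 / \<rho>\<^sup>2) \<le> 1" .
      qed (use phi s in simp)
      finally show ?thesis by (simp add: m_def)
    qed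
    obtain \<Phi> R where R: "\<Phi> \<in> sobolev_polys p T (Suc l)" "vanishes_to_second_order \<Phi>"
      "transforms_into (\<lambda>u t. L u + V u t) \<Omega> \<Phi> (\<lambda>y t. L y + R y t) (cball 0 \<delta>)"
      "sobolev_analytic_on T l R (cball 0 \<delta>)"
      "\<And>y. y \<in> cball 0 \<delta> \<Longrightarrow> R y \<in> sobolev T l \<and> sobolev_norm T l (R y) \<le>
          real CARD('m) * (2 * (q ^ (p + 1) * (2 * c * (real CARD('m) * (2 * (coord_norm * s)) / \<rho>)\<^sup>2)))"
      by (rule normal_form_near_zero[OF c \<rho> Z Z0 V p(3) s(1) \<delta>(1) \<kappa> small1 small2 eq1 eq2 eq3]) blast+
    have bound: "real CARD('m) * (2 * (q ^ (p + 1) * (2 * c * (real CARD('m) * (2 * (coord_norm * s)) / \<rho>)\<^sup>2))) \<le> M * \<delta>\<^sup>2 * exp (- c1 / \<delta> powr b)"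
    proof -
      obtain k where k: "p = Suc k" using p(3) by (cases p) auto
      have "q ^ (p + 1) * s\<^sup>2 = q ^ k * (q * s)\<^sup>2" by (simp add: k power2_eq_square)
      also have "\<dots> = q ^ k * (2 * Z * \<delta>)\<^sup>2" by (simp only: eq1)
      also have "\<dots> \<le> exp (- (x - 2)) * (2 * Z * \<delta>)\<^sup>2"
        using p(2) q_pos q_le by (intro mult_right_mono power_exp_bound) (auto simp: k q0_def)
      also have "exp (- (x - 2)) = exp 2 * exp (- c1 / \<delta> powr b)"
        by (simp add: x_def powr_minus divide_inverse flip: exp_add)
      finally have key: "q ^ (p + 1) * s\<^sup>2 \<le> exp 2 * exp (- c1 / \<delta> powr b) * (2 * Z * \<delta>)\<^sup>2" .
      have "m * (2 * (q ^ (p + 1) * (2 * c * (m * (2 * (coord_norm * s)) / \<rho>)\<^sup>2))) = 16 * c * m ^ 3 * coord_norm\<^sup>2 / \<rho>\<^sup>2 * (q ^ (p + 1) * s\<^sup>2)"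
        by (simp add: power2_eq_square power3_eq_cube)
      also have "\<dots> \<le> 16 * c * m ^ 3 * coord_norm\<^sup>2 / \<rho>\<^sup>2 * (exp 2 * exp (- c1 / \<delta> powr b) * (2 * Z * \<delta>)\<^sup>2)"
        using c m by (intro mult_left_mono key) auto
      also have "\<dots> = M * \<delta>\<^sup>2 * exp (- c1 / \<delta> powr b)" by (simp add: M_def power2_eq_square)
      finally show ?thesis by (simp add: m_def)
    qed
    show "\<exists>p \<Phi> R. real p \<le> c1 * \<delta> powr (- b) \<and> \<Phi> \<in> sobolev_polys p T (Suc l) \<and> vanishes_to_second_order \<Phi> \<and>
        transforms_into (\<lambda>u t. L u + V u t) \<Omega> \<Phi> (\<lambda>y t. L y + R y t) (cball 0 \<delta>) \<and>
        sobolev_analytic_on T l R (cball 0 \<delta>) \<and>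
        (\<forall>y\<in>cball 0 \<delta>. R y \<in> sobolev T l \<and> sobolev_norm T l (R y) \<le> M * \<delta>\<^sup>2 * exp (- c1 / \<delta> powr b))"
      using R p(1) order_trans[OF _ bound] unfolding x_def
      by (intro exI[of _ p] exI[of _ \<Phi>] exI[of _ R] conjI ballI) blast+
  qed
qed

end

section \<open>Eigenvalues and small divisors\<close>

text \<open>For \<open>\<bar>k\<bar> \<le> C n\<close> the given inequality is used, and the additional factor \<open>1 + \<bar>k\<bar>\<close> is absorbed by one more power of
\<open>n + 1\<close>. For larger \<open>\<bar>k\<bar>\<close> the term \<open>2 \<pi> i k / T\<close> dominates the others.\<close>

lemma small_divisor_bound:
  fixes ev :: "'m::finite \<Rightarrow> complex"
  assumes T: "0 < T" and \<gamma>: "0 < \<gamma>" and \<tau>: "0 < \<tau>"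
    and dio: "\<And>(a :: 'm \<Rightarrow> nat) (k :: int) j. (\<Sum>i\<in>UNIV. a i) \<ge> 2 \<Longrightarrow>
           cmod ((\<Sum>i\<in>UNIV. of_nat (a i) * ev i) + \<i> * of_int k * complex_of_real (2 * pi / T) - ev j)
             \<ge> \<gamma> / (real (\<Sum>i\<in>UNIV. a i) + \<bar>real_of_int k\<bar>) powr \<tau>"
  obtains \<kappa> where "0 < \<kappa>" "\<And>(a :: 'm \<Rightarrow> nat) (k :: int) j. (\<Sum>i\<in>UNIV. a i) \<ge> 2 \<Longrightarrow>
     \<kappa> / (real (\<Sum>i\<in>UNIV. a i) + 1) powr (\<tau> + 1) * (1 + \<bar>real_of_int k\<bar>) \<le>
     cmod ((\<Sum>i\<in>UNIV. of_nat (a i) * ev i) - ev j + \<i> * of_int k * complex_of_real (2 * pi / T))"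
proof -
  define \<omega> where "\<omega> = 2 * pi / T"
  have \<omega>: "0 < \<omega>" using T by (simp add: \<omega>_def)
  define \<Lambda> where "\<Lambda> = (\<Sum>i\<in>UNIV. cmod (ev i))"
  have \<Lambda>: "cmod (ev i) \<le> \<Lambda>" "0 \<le> \<Lambda>" for i
    unfolding \<Lambda>_def by (auto intro!: member_le_sum sum_nonneg)
  define C where "C = max 1 (4 * \<Lambda> / \<omega>)"
  have C: "1 \<le> C" "4 * \<Lambda> \<le> C * \<omega>" using \<omega> by (auto simp: C_def field_simps max_def)
  define \<kappa> where "\<kappa> = min (\<gamma> / (1 + C) powr (\<tau> + 1)) (\<omega> / 4)"
  have \<kappa>: "0 < \<kappa>" "\<kappa> \<le> \<gamma> / (1 + C) powr (\<tau> + 1)" "\<kappa> \<le> \<omega> / 4"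
  proof -
    show "0 < \<kappa>" using \<gamma> \<omega> C by (simp add: \<kappa>_def)
    show "\<kappa> \<le> \<gamma> / (1 + C) powr (\<tau> + 1)" unfolding \<kappa>_def by (rule min.cobounded1)
    show "\<kappa> \<le> \<omega> / 4" unfolding \<kappa>_def by (rule min.cobounded2)
  qed
  show thesis
  proof (rule that[OF \<kappa>(1)])
    fix a :: "'m \<Rightarrow> nat" and k :: int and j
    assume a: "(\<Sum>i\<in>UNIV. a i) \<ge> 2"
    define n where "n = real (\<Sum>i\<in>UNIV. a i)"
    have n: "2 \<le> n" using a unfolding n_def by linarith
    define S where "S = (\<Sum>i\<in>UNIV. of_nat (a i) * ev i) - ev j + \<i> * of_int k * complex_of_real \<omega>"
    have n1: "1 \<le> (n + 1) powr (\<tau> + 1)" using n \<tau> by (intro ge_one_powr_ge_zero) auto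
    have "\<kappa> / (n + 1) powr (\<tau> + 1) * (1 + \<bar>real_of_int k\<bar>) \<le> cmod S"
    proof (cases "\<bar>real_of_int k\<bar> \<le> C * n")
      case True
      have "\<gamma> / (n + \<bar>real_of_int k\<bar>) powr \<tau> \<le> cmod S"
        using dio[OF a, of k j] unfolding n_def[symmetric] S_def \<omega>_def by (simp add: algebra_simps)
      moreover have "\<kappa> / (n + 1) powr (\<tau> + 1) * (1 + \<bar>real_of_int k\<bar>) \<le> \<gamma> / (n + \<bar>real_of_int k\<bar>) powr \<tau>"
      proof -
        have k1: "1 + \<bar>real_of_int k\<bar> \<le> (1 + C) * (n + 1)" using True C n by (simp add: algebra_simps)
        have k2: "n + \<bar>real_of_int k\<bar> \<le> (1 + C) * (n + 1)" using True C n by (simp add: algebra_simps)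
        have "\<kappa> / (n + 1) powr (\<tau> + 1) * (1 + \<bar>real_of_int k\<bar>) \<le> \<gamma> / (1 + C) powr (\<tau> + 1) / (n + 1) powr (\<tau> + 1) * ((1 + C) * (n + 1))"
          using \<kappa> k1 \<gamma> by (intro mult_mono divide_right_mono) auto
        also have "\<dots> = \<gamma> / ((1 + C) * (n + 1)) powr \<tau>"
          using C n by (simp add: powr_add powr_mult)
        also have "\<dots> \<le> \<gamma> / (n + \<bar>real_of_int k\<bar>) powr \<tau>"
          using \<gamma> \<tau> k2 n C by (intro divide_left_mono powr_mono2 mult_pos_pos) auto
        finally show ?thesis .
      qed
      ultimately show ?thesis by linarith
    next
      case False
      have "cmod (\<Sum>i\<in>UNIV. of_nat (a i) * ev i) \<le> n * \<Lambda>"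
      proof -
        have "cmod (\<Sum>i\<in>UNIV. of_nat (a i) * ev i) \<le> (\<Sum>i\<in>UNIV. real (a i) * \<Lambda>)"
          using \<Lambda> by (intro order_trans[OF norm_sum] sum_mono) (auto simp: norm_mult intro!: mult_left_mono)
        then show ?thesis by (simp add: n_def sum_distrib_right)
      qed
      moreover have "\<Lambda> \<le> n * \<Lambda>" using n \<Lambda>(2) mult_right_mono[of 1 n \<Lambda>] by simp
      moreover have "cmod (\<i> * of_int k * complex_of_real \<omega>) = \<omega> * \<bar>real_of_int k\<bar>" using \<omega> by (simp add: norm_mult)
      moreover have "cmod (\<i> * of_int k * complex_of_real \<omega>) \<le> cmod S + cmod (\<Sum>i\<in>UNIV. of_nat (a i) * ev i) + cmod (ev j)"
      proof -
        have eq: "\<i> * of_int k * complex_of_real \<omega> = S - (\<Sum>i\<in>UNIV. of_nat (a i) * ev i) + ev j" by (simp add: S_def)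
        show ?thesis unfolding eq
          using norm_triangle_ineq[of "S - (\<Sum>i\<in>UNIV. of_nat (a i) * ev i)" "ev j"]
            norm_triangle_ineq4[of S "\<Sum>i\<in>UNIV. of_nat (a i) * ev i"] by linarith
      qed
      moreover have "4 * (n * \<Lambda>) \<le> \<omega> * \<bar>real_of_int k\<bar>"
      proof -
        have "4 * (n * \<Lambda>) = n * (4 * \<Lambda>)" by simp
        also have "\<dots> \<le> n * (C * \<omega>)" using C n by (intro mult_left_mono) auto
        also have "\<dots> = \<omega> * (C * n)" by simp
        also have "\<dots> \<le> \<omega> * \<bar>real_of_int k\<bar>" using False \<omega> by (intro mult_left_mono) auto
        finally show ?thesis .
      qed
      ultimately have half: "\<omega> * \<bar>real_of_int k\<bar> / 2 \<le> cmod S" using \<Lambda>(1)[of j] by linarith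
      have "1 * 1 \<le> C * n" using C n by (intro mult_mono) auto
      then have k1: "1 \<le> \<bar>real_of_int k\<bar>" using False by linarith
      have "\<kappa> / (n + 1) powr (\<tau> + 1) * (1 + \<bar>real_of_int k\<bar>) \<le> \<kappa> * (1 + \<bar>real_of_int k\<bar>)"
        using \<kappa>(1) n1 by (intro mult_right_mono) (auto simp: divide_le_eq)
      also have "\<dots> \<le> \<omega> / 4 * (2 * \<bar>real_of_int k\<bar>)" using \<kappa> k1 by (intro mult_mono) auto
      also have "\<dots> \<le> cmod S" using half by simp
      finally show ?thesis .
    qed
    then show "\<kappa> / (real (\<Sum>i\<in>UNIV. a i) + 1) powr (\<tau> + 1) * (1 + \<bar>real_of_int k\<bar>) \<le>
     cmod ((\<Sum>i\<in>UNIV. of_nat (a i) * ev i) - ev j + \<i> * of_int k * complex_of_real (2 * pi / T))"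
      unfolding S_def n_def \<omega>_def .
  qed
qed

text \<open>Translates sums over words into the sums over multi-indices that occur in the Diophantine inequality.\<close>

lemma sum_list_counts:
  fixes ev :: "'m::finite \<Rightarrow> complex"
  shows "(\<Sum>x\<leftarrow>w. ev (\<pi> x)) = (\<Sum>i\<in>UNIV. of_nat (length (filter (\<lambda>x. \<pi> x = i) w)) * ev i)"
    and "(\<Sum>i\<in>UNIV. length (filter (\<lambda>x. \<pi> x = i) w)) = length w"
proof (induction w)
  case (Cons x w)
  have "(\<Sum>i\<in>UNIV. of_nat (length (filter (\<lambda>x. \<pi> x = i) (x # w))) * ev i)
     = (\<Sum>i\<in>UNIV. (if i = \<pi> x then ev i else 0) + of_nat (length (filter (\<lambda>x. \<pi> x = i) w)) * ev i)"
    by (intro sum.cong) (auto simp: algebra_simps)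
  then show "(\<Sum>x\<leftarrow>x # w. ev (\<pi> x)) = (\<Sum>i\<in>UNIV. of_nat (length (filter (\<lambda>x. \<pi> x = i) (x # w))) * ev i)"
    using Cons(1) by (simp add: sum.distrib)
  have "(\<Sum>i\<in>UNIV. length (filter (\<lambda>x. \<pi> x = i) (x # w))) = (\<Sum>i\<in>UNIV. (if i = \<pi> x then 1 else 0) + length (filter (\<lambda>x. \<pi> x = i) w))"
    by (intro sum.cong) auto
  then show "(\<Sum>i\<in>UNIV. length (filter (\<lambda>x. \<pi> x = i) (x # w))) = length (x # w)"
    using Cons(2) by (simp add: sum.distrib)
qed auto

lemma det_cnj: "det (\<chi> i j. cnj (X $ i $ j)) = cnj (det (X :: complex ^ 'n ^ 'n))"
  by (simp add: det_def)

lemma matrix_inv_inverse: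
  fixes A :: "'a::semiring_1 ^ 'n ^ 'm"
  assumes "invertible A" shows "A ** matrix_inv A = mat 1" "matrix_inv A ** A = mat 1"
  using someI_ex[OF assms[unfolded invertible_def]] by (auto simp: matrix_inv_def)

lemma characteristic_polynomial_diagonal:
  fixes P :: "complex ^ 'm ^ 'm" and d :: "'m \<Rightarrow> complex"
  assumes P: "invertible P" and X: "X = P ** (\<chi> i j. if i = j then d i else 0) ** matrix_inv P"
  shows "det (mat z - X) = (\<Prod>j\<in>UNIV. z - d j)"
proof -
  let ?D = "\<chi> i j. if i = j then d i else 0"
  have PP: "P ** matrix_inv P = mat 1" by (rule matrix_inv_inverse(1)[OF P])
  have "mat z - X = P ** (mat z - ?D) ** matrix_inv P"
  proof -
    have "P ** mat z = mat z ** P"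
      by (simp add: matrix_matrix_mult_def mat_def vec_eq_iff if_distrib if_distribR sum.delta' sum.delta mult.commute cong: if_cong)
    then have "P ** mat z ** matrix_inv P = mat z"
      using PP by (metis matrix_mul_assoc matrix_mul_rid)
    moreover have "P ** (mat z - ?D) ** matrix_inv P + P ** ?D ** matrix_inv P = P ** mat z ** matrix_inv P"
      by (simp add: matrix_matrix_mult_def vec_eq_iff flip: distrib_right distrib_left sum.distrib)
    ultimately show ?thesis unfolding X by (simp add: algebra_simps)
  qed
  then have "det (mat z - X) = det P * det (mat z - ?D) * det (matrix_inv P)" by (simp add: det_mul)
  also have "\<dots> = det (mat z - ?D) * det (P ** matrix_inv P)" by (simp add: det_mul)
  also have "\<dots> = det (mat z - ?D)" by (simp add: PP)
  also have "\<dots> = (\<Prod>j\<in>UNIV. (mat z - ?D) $ j $ j)" by (rule det_diagonal) (simp add: mat_def)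
  finally show ?thesis by (simp add: mat_def)
qed

theorem theorem2p2:
  fixes T c \<rho> \<gamma> \<tau> b :: real and l :: nat
    and L :: "real ^ 'm \<Rightarrow> real ^ 'm" and ev :: "'m \<Rightarrow> complex"
  assumes "T > 0" and "linear L" and "c > 0" and "\<rho> > 0" and "l \<ge> 1"
    and "diagonalizable L"
    and "\<gamma> > 0" and "\<tau> > 0" and "eigenvalues_of L ev"
    and "\<And>(a :: 'm \<Rightarrow> nat) (k :: int) j. (\<Sum>i\<in>UNIV. a i) \<ge> 2 \<Longrightarrow>
           cmod ((\<Sum>i\<in>UNIV. of_nat (a i) * ev i) + \<i> * of_int k * complex_of_real (2 * pi / T) - ev j)
             \<ge> \<gamma> / (real (\<Sum>i\<in>UNIV. a i) + \<bar>real_of_int k\<bar>) powr \<tau>"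
    and "\<tau> \<le> real l"
    and "b = 1 / (real l + \<tau> + 1)"
  shows "\<exists>M' > 0. \<exists>\<omega> > 0. \<forall>(\<Omega> :: (real ^ 'm) set) V.
    0 \<in> interior \<Omega> \<and>
    analytic_class \<Omega> T l c \<rho> V \<and>
    (\<forall>u\<in>\<Omega>. \<forall>t. V u (t + T) = V u t) \<and>
    vanishes_to_second_order V \<longrightarrow>
    (\<exists>(p :: real \<Rightarrow> nat) (\<Phi> :: real \<Rightarrow> real ^ 'm \<Rightarrow> real \<Rightarrow> real ^ 'm)
      (N :: real \<Rightarrow> real ^ 'm \<Rightarrow> real \<Rightarrow> real ^ 'm) (R :: real \<Rightarrow> real ^ 'm \<Rightarrow> real \<Rightarrow> real ^ 'm).
      (\<lambda>\<delta>. real (p \<delta>)) \<in> O[at_right 0](\<lambda>\<delta>. \<delta> powr (- b)) \<and>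
      (\<forall>\<delta> > 0.
        \<Phi> \<delta> \<in> sobolev_polys (p \<delta>) T (l + 1) \<and> vanishes_to_second_order (\<Phi> \<delta>) \<and>
        transforms_into (\<lambda>u t. L u + V u t) \<Omega> (\<Phi> \<delta>)
          (\<lambda>y t. L y + N \<delta> y t + R \<delta> y t) (cball 0 \<delta>) \<and>
        N \<delta> \<in> sobolev_polys (p \<delta>) T l \<and> vanishes_to_second_order (N \<delta>) \<and>
        (\<forall>y t. op_exp (\<lambda>x. (- t) *\<^sub>R adjoint L x)
                 (N \<delta> (op_exp (\<lambda>x. t *\<^sub>R adjoint L x) y) t) = N \<delta> y 0) \<and>
        sobolev_analytic_on T l (R \<delta>) (cball 0 \<delta>) \<and>
        (\<forall>y\<in>cball 0 \<delta>. R \<delta> y \<in> sobolev T l \<and>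
           sobolev_norm T l (R \<delta> y) \<le> M' * \<delta>\<^sup>2 * exp (- \<omega> / \<delta> powr b))))"
proof -
  obtain P :: "complex ^ 'm ^ 'm" and d :: "'m \<Rightarrow> complex" where P: "invertible P" and LP: "complex_matrix L = P ** (\<chi> i j. if i = j then d i else 0) ** matrix_inv P"
    using \<open>diagonalizable L\<close> unfolding diagonalizable_def by blast
  let ?Dg = "\<chi> i j. if i = j then d i else 0"
  let ?Pi = "matrix_inv P"
  have PP: "P ** ?Pi = mat 1" "?Pi ** P = mat 1" by (rule matrix_inv_inverse[OF P])+
  have char: "(\<Prod>j\<in>UNIV. z - ev j) = (\<Prod>j\<in>UNIV. z - d j)" for z
    using characteristic_polynomial_diagonal[OF P LP, of z] \<open>eigenvalues_of L ev\<close> unfolding eigenvalues_of_def by metis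
  have char_cnj: "(\<Prod>j\<in>UNIV. cnj z - ev j) = cnj (\<Prod>j\<in>UNIV. z - ev j)" for z
  proof -
    have "(\<chi> i j. cnj ((mat z - complex_matrix L) $ i $ j)) = mat (cnj z) - complex_matrix L"
      by (simp add: vec_eq_iff mat_def complex_matrix_def)
    then show ?thesis using \<open>eigenvalues_of L ev\<close> det_cnj[of "mat z - complex_matrix L"] unfolding eigenvalues_of_def by metis
  qed
  \<comment> \<open>The eigenforms are the coordinates in the eigenbasis and their conjugates. The eigenvalue of a conjugate form is
     again an eigenvalue of the real operator \<open>L\<close>, so the Diophantine inequality covers all monomials.\<close>
  define \<mu> where "\<mu> = (\<lambda>(j, s). if s then cnj (d j) else d j)"
  have "\<exists>i. \<mu> x = ev i" for x
  proof -
    obtain j s where x: "x = (j, s)" by (cases x)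
    have z: "(\<Prod>i\<in>UNIV. d j - d i) = 0" by (intro prod_zero) auto
    have "(\<Prod>i\<in>UNIV. d j - ev i) = 0" unfolding char by (rule z)
    moreover have "(\<Prod>i\<in>UNIV. cnj (d j) - ev i) = 0" unfolding char_cnj char z by simp
    ultimately have "(\<Prod>i\<in>UNIV. \<mu> x - ev i) = 0" by (simp add: \<mu>_def x del: prod_zero_iff)
    then obtain i where "\<mu> x - ev i = 0" unfolding prod_zero_iff[OF finite] by blast
    then show ?thesis by auto
  qed
  then obtain \<pi> where \<pi>: "\<And>x. \<mu> x = ev (\<pi> x)" by metis
  obtain \<kappa>0 where \<kappa>0: "0 < \<kappa>0" and div: "\<And>(a :: 'm \<Rightarrow> nat) (k :: int) j. (\<Sum>i\<in>UNIV. a i) \<ge> 2 \<Longrightarrow>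
     \<kappa>0 / (real (\<Sum>i\<in>UNIV. a i) + 1) powr (\<tau> + 1) * (1 + \<bar>real_of_int k\<bar>) \<le>
     cmod ((\<Sum>i\<in>UNIV. of_nat (a i) * ev i) - ev j + \<i> * of_int k * complex_of_real (2 * pi / T))"
    using small_divisor_bound[OF \<open>T > 0\<close> \<open>\<gamma> > 0\<close> \<open>\<tau> > 0\<close> assms(10)] by blast
  define \<zeta>0 where "\<zeta>0 j y = (\<Sum>k\<in>UNIV. ?Pi $ j $ k * of_real (y $ k))" for j and y :: "real ^ 'm"
  define \<zeta> where "\<zeta> = (\<lambda>(j, s) y. if s then cnj (\<zeta>0 j y) else \<zeta>0 j y)"
  define bar where "bar = (\<lambda>(j :: 'm, s). (j, \<not> s))"
  define Dn where "Dn n = \<kappa>0 / (real n + 1) powr (\<tau> + 1)" for n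
  have matL: "L (axis k 1) $ i = matrix L $ i $ k" for i k by (simp add: matrix_def)
  have Lcomp: "L y $ i = (\<Sum>k\<in>UNIV. L (axis k 1) $ i * y $ k)" for y i
    using arg_cong[OF linear_axis_expansion[OF \<open>linear L\<close>, of y], of "\<lambda>z. z $ i"] by (simp add: mult.commute)
  have lin\<zeta>0: "linear (\<zeta>0 j)" for j
    by (simp add: \<zeta>0_def linear_iff distrib_left sum.distrib scaleR_conv_of_real[where 'a = complex] sum_distrib_left mult_ac)
  have LP1: "complex_matrix L ** P = P ** ?Dg"
    unfolding LP by (simp add: PP flip: matrix_mul_assoc)
  have LP2: "?Pi ** complex_matrix L = ?Dg ** ?Pi"
    unfolding LP by (simp add: PP matrix_mul_assoc)
  have \<zeta>0L: "\<zeta>0 j (L y) = d j * \<zeta>0 j y" for j y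
  proof -
    have row: "(\<Sum>i\<in>UNIV. ?Pi $ j $ i * of_real (L (axis k 1) $ i)) = d j * ?Pi $ j $ k" for k
    proof -
      have "(?Pi ** complex_matrix L) $ j $ k = (?Dg ** ?Pi) $ j $ k" by (simp only: LP2)
      then show ?thesis
        by (simp add: matrix_matrix_mult_def complex_matrix_def matL if_distrib if_distribR sum.delta sum.delta' cong: if_cong)
    qed
    have "\<zeta>0 j (L y) = (\<Sum>i\<in>UNIV. \<Sum>k\<in>UNIV. ?Pi $ j $ i * of_real (L (axis k 1) $ i) * of_real (y $ k))"
      unfolding \<zeta>0_def by (subst Lcomp) (simp add: sum_distrib_left mult_ac)
    also have "\<dots> = (\<Sum>k\<in>UNIV. (\<Sum>i\<in>UNIV. ?Pi $ j $ i * of_real (L (axis k 1) $ i)) * of_real (y $ k))"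
      unfolding sum_distrib_right by (rule sum.swap)
    also have "\<dots> = d j * \<zeta>0 j y" by (simp add: row \<zeta>0_def sum_distrib_left mult_ac)
    finally show ?thesis .
  qed
  have Qinv: "(\<Sum>j\<in>UNIV. P $ i $ j * ?Pi $ j $ k) = (if i = k then 1 else 0)" for i k
  proof -
    have "(P ** ?Pi) $ i $ k = mat 1 $ i $ k" by (simp only: PP)
    then show ?thesis by (simp add: matrix_matrix_mult_def mat_def)
  qed
  interpret E: eigenforms T l \<zeta> bar L \<mu> d "\<lambda>i j. P $ i $ j" "\<lambda>i j. ?Pi $ i $ j" "\<lambda>j. (j, False)" Dn
  proof
    show "0 < T" by fact
    show "l \<ge> 1" by fact
    show "L (u + v) = L u + L v" "L (r *\<^sub>R u) = r *\<^sub>R L u" for r u v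
      using \<open>linear L\<close> by (simp_all add: linear_iff)
    show "\<zeta> x (u + v) = \<zeta> x u + \<zeta> x v" "\<zeta> x (r *\<^sub>R u) = r *\<^sub>R \<zeta> x u" for x r u v
      using lin\<zeta>0 by (cases x; simp add: \<zeta>_def linear_iff)+
    show "\<zeta> (bar x) y = cnj (\<zeta> x y)" for x y by (cases x) (auto simp: \<zeta>_def bar_def)
    show "\<zeta> x (L y) = \<mu> x * \<zeta> x y" for x y by (cases x) (auto simp: \<zeta>_def \<mu>_def \<zeta>0L)
    show "(\<Sum>j\<in>UNIV. P $ i $ j * ?Pi $ j $ k) = (if i = k then 1 else 0)" for i k by (rule Qinv)
    show "(\<Sum>k\<in>UNIV. of_real (L (axis k 1) $ i) * P $ k $ j) = P $ i $ j * d j" for i j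
    proof -
      have "(complex_matrix L ** P) $ i $ j = (P ** ?Dg) $ i $ j" by (simp only: LP1)
      then show ?thesis
        by (simp add: matrix_matrix_mult_def complex_matrix_def matL if_distrib if_distribR sum.delta sum.delta' cong: if_cong)
    qed
    show "complex_of_real (y $ i) = (\<Sum>j\<in>UNIV. P $ i $ j * \<zeta> (j, False) y)" for y i
    proof -
      have "(\<Sum>j\<in>UNIV. P $ i $ j * \<zeta> (j, False) y) = (\<Sum>j\<in>UNIV. \<Sum>k\<in>UNIV. P $ i $ j * ?Pi $ j $ k * of_real (y $ k))"
        by (simp add: \<zeta>_def \<zeta>0_def sum_distrib_left mult.assoc)
      also have "\<dots> = (\<Sum>k\<in>UNIV. (\<Sum>j\<in>UNIV. P $ i $ j * ?Pi $ j $ k) * of_real (y $ k))"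
        unfolding sum_distrib_right by (rule sum.swap)
      also have "\<dots> = of_real (y $ i)"
        unfolding Qinv by (simp add: if_distrib if_distribR sum.delta sum.delta' cong: if_cong)
      finally show ?thesis by simp
    qed
    show "0 < Dn n" for n using \<kappa>0 by (simp add: Dn_def)
    show "Dn (length w) * (1 + \<bar>real_of_int k\<bar>) \<le> cmod ((\<Sum>x\<leftarrow>w. \<mu> x) - d j + \<i> * of_int k * of_real (2 * pi / T))"
      if w: "2 \<le> length w" for w k j
    proof -
      let ?a = "\<lambda>i. length (filter (\<lambda>x. \<pi> x = i) w)"
      have "d j = ev (\<pi> (j, False))" using \<pi>[of "(j, False)"] by (simp add: \<mu>_def)
      moreover have "(\<Sum>x\<leftarrow>w. \<mu> x) = (\<Sum>i\<in>UNIV. of_nat (?a i) * ev i)"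
        unfolding \<pi> by (rule sum_list_counts)
      moreover have "(\<Sum>i\<in>UNIV. ?a i) = length w" by (rule sum_list_counts)
      ultimately show ?thesis using div[of ?a k "\<pi> (j, False)"] w by (simp add: Dn_def)
    qed
  qed
  have b: "0 < b" "b * (\<tau> + 1) \<le> 1" unfolding \<open>b = _\<close> using \<open>\<tau> > 0\<close> by (simp_all add: add_pos_pos divide_le_eq)
  obtain c1 \<delta>0 M where c1: "0 < c1" and \<delta>0: "0 < \<delta>0" "\<delta>0 \<le> 1" and M: "0 \<le> M"
    and near: "\<And>\<Omega> V \<delta>. 0 \<in> interior \<Omega> \<Longrightarrow> analytic_class \<Omega> T l c \<rho> V \<Longrightarrow> vanishes_to_second_order V \<Longrightarrow> 0 < \<delta> \<Longrightarrow> \<delta> \<le> \<delta>0 \<Longrightarrow>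
      \<exists>p \<Phi> R. real p \<le> c1 * \<delta> powr (- b) \<and> \<Phi> \<in> sobolev_polys p T (Suc l) \<and> vanishes_to_second_order \<Phi> \<and>
        transforms_into (\<lambda>u t. L u + V u t) \<Omega> \<Phi> (\<lambda>y t. L y + R y t) (cball 0 \<delta>) \<and>
        sobolev_analytic_on T l R (cball 0 \<delta>) \<and>
        (\<forall>y\<in>cball 0 \<delta>. R y \<in> sobolev T l \<and> sobolev_norm T l (R y) \<le> M * \<delta>\<^sup>2 * exp (- c1 / \<delta> powr b))"
    by (rule E.exponentially_small_remainder[OF \<open>c > 0\<close> \<open>\<rho> > 0\<close> finite \<kappa>0 Dn_def \<open>\<tau> > 0\<close> b]) blast
  define a where "a = min \<delta>0 (\<rho> / (4 * real CARD('m)))"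
  have a: "0 < a" "a \<le> \<delta>0" using \<delta>0 \<open>\<rho> > 0\<close> by (auto simp: a_def)
  have a_small: "real CARD('m) * (2 * a) / \<rho> \<le> 1 / 2"
  proof -
    have "real CARD('m) * (2 * a) / \<rho> \<le> real CARD('m) * (2 * (\<rho> / (4 * real CARD('m)))) / \<rho>"
      using \<open>\<rho> > 0\<close> by (intro divide_right_mono mult_left_mono) (auto simp: a_def)
    then show ?thesis using \<open>\<rho> > 0\<close> by simp
  qed
  define \<Lambda> where "\<Lambda> = (\<Sum>i\<in>UNIV. \<Sum>j\<in>UNIV. \<bar>L (axis j 1) $ i\<bar>)"
  have \<Lambda>: "0 \<le> \<Lambda>" unfolding \<Lambda>_def by (intro sum_nonneg) auto
  define C3 where "C3 = real CARD('m) * (2 * (8 / a * (2 * c + \<Lambda> * (2 * a)) + 4 * \<Lambda>))"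
  have C3: "0 \<le> C3" using a \<Lambda> \<open>c > 0\<close> by (simp add: C3_def)
  \<comment> \<open>The second summand is needed for \<open>\<delta> > \<delta>0\<close>: there \<open>\<delta> \<le> \<delta>\<^sup>2 / \<delta>0\<close>, and the exponential is at least
     \<open>exp (- c1 / \<delta>0 powr b)\<close>.\<close>
  define M' where "M' = M + C3 / \<delta>0 * exp (c1 / \<delta>0 powr b) + 1"
  have M': "0 < M'" using M C3 \<delta>0 by (simp add: M'_def add_nonneg_pos)
  have all: "\<exists>p \<Phi> R. (\<delta> \<le> \<delta>0 \<longrightarrow> real p \<le> c1 * \<delta> powr (- b)) \<and> \<Phi> \<in> sobolev_polys p T (l + 1) \<and> vanishes_to_second_order \<Phi> \<and>
        transforms_into (\<lambda>u t. L u + V u t) \<Omega> \<Phi> (\<lambda>y t. L y + 0 + R y t) (cball 0 \<delta>) \<and>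
        sobolev_analytic_on T l R (cball 0 \<delta>) \<and>
        (\<forall>y\<in>cball 0 \<delta>. R y \<in> sobolev T l \<and> sobolev_norm T l (R y) \<le> M' * \<delta>\<^sup>2 * exp (- c1 / \<delta> powr b))"
    if V: "0 \<in> interior \<Omega>" "analytic_class \<Omega> T l c \<rho> V" "vanishes_to_second_order V" and \<delta>: "0 < \<delta>" for \<Omega> V \<delta>
  proof (cases "\<delta> \<le> \<delta>0")
    case True
    have le: "M * \<delta>\<^sup>2 * exp (- c1 / \<delta> powr b) \<le> M' * \<delta>\<^sup>2 * exp (- c1 / \<delta> powr b)"
      using C3 \<delta>0 by (intro mult_right_mono) (auto simp: M'_def)
    obtain p \<Phi> R where R: "real p \<le> c1 * \<delta> powr (- b)" "\<Phi> \<in> sobolev_polys p T (Suc l)" "vanishes_to_second_order \<Phi>"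
      "transforms_into (\<lambda>u t. L u + V u t) \<Omega> \<Phi> (\<lambda>y t. L y + R y t) (cball 0 \<delta>)"
      "sobolev_analytic_on T l R (cball 0 \<delta>)"
      "\<forall>y\<in>cball 0 \<delta>. R y \<in> sobolev T l \<and> sobolev_norm T l (R y) \<le> M * \<delta>\<^sup>2 * exp (- c1 / \<delta> powr b)"
      using near[OF V \<delta> True] by blast
    show ?thesis
      by (rule exI[of _ p], rule exI[of _ \<Phi>], rule exI[of _ R]) (use R order_trans[OF _ le] in \<open>simp del: mem_cball\<close>)
  next
    case False
    then have \<delta>': "\<delta>0 \<le> \<delta>" by simp
    obtain p \<Phi> R where R: "\<Phi> \<in> sobolev_polys p T (Suc l)" "vanishes_to_second_order \<Phi>"
      "transforms_into (\<lambda>u t. L u + V u t) \<Omega> \<Phi> (\<lambda>y t. L y + R y t) (cball 0 \<delta>)"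
      "sobolev_analytic_on T l R (cball 0 \<delta>)"
      "\<And>y. y \<in> cball 0 \<delta> \<Longrightarrow> R y \<in> sobolev T l \<and> sobolev_norm T l (R y) \<le>
      real CARD('m) * (2 * (8 * \<delta> / a * (2 * c + \<Lambda> * (2 * a)) + 2 * (\<Lambda> * (2 * \<delta>))))"
      unfolding \<Lambda>_def
      by (rule E.normal_form_by_squashing[OF \<open>c > 0\<close> \<open>\<rho> > 0\<close> \<open>linear L\<close> V a(1) order_trans[OF a(2) \<delta>'] a_small]) blast
    have "real CARD('m) * (2 * (8 * \<delta> / a * (2 * c + \<Lambda> * (2 * a)) + 2 * (\<Lambda> * (2 * \<delta>)))) = C3 * \<delta>"
      by (simp add: C3_def algebra_simps)
    also have "\<dots> \<le> M' * \<delta>\<^sup>2 * exp (- c1 / \<delta> powr b)"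
    proof -
      have "\<delta>0 powr b \<le> \<delta> powr b" using \<delta>' \<delta>0 b by (intro powr_mono2) auto
      then have "c1 / \<delta> powr b \<le> c1 / \<delta>0 powr b" using c1 \<delta>0 \<delta> by (intro divide_left_mono) auto
      then have e: "1 \<le> exp (c1 / \<delta>0 powr b) * exp (- c1 / \<delta> powr b)" by (simp flip: exp_add)
      have "C3 * \<delta> \<le> C3 * \<delta> * (\<delta> / \<delta>0)" using mult_left_mono[of 1 "\<delta> / \<delta>0" "C3 * \<delta>"] C3 \<delta>' \<delta>0 \<delta> by (simp add: le_divide_eq)
      also have "\<dots> = C3 / \<delta>0 * \<delta>\<^sup>2 * 1" by (simp add: power2_eq_square)
      also have "\<dots> \<le> C3 / \<delta>0 * \<delta>\<^sup>2 * (exp (c1 / \<delta>0 powr b) * exp (- c1 / \<delta> powr b))"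
        using C3 \<delta>0 by (intro mult_left_mono e) auto
      also have "\<dots> = (C3 / \<delta>0 * exp (c1 / \<delta>0 powr b)) * \<delta>\<^sup>2 * exp (- c1 / \<delta> powr b)" by simp
      also have "\<dots> \<le> M' * \<delta>\<^sup>2 * exp (- c1 / \<delta> powr b)"
        using M by (intro mult_right_mono) (auto simp: M'_def)
      finally show ?thesis .
    qed
    finally have le: "real CARD('m) * (2 * (8 * \<delta> / a * (2 * c + \<Lambda> * (2 * a)) + 2 * (\<Lambda> * (2 * \<delta>)))) \<le> M' * \<delta>\<^sup>2 * exp (- c1 / \<delta> powr b)" .
    show ?thesis
      by (rule exI[of _ p], rule exI[of _ \<Phi>], rule exI[of _ R])
        (use R order_trans[OF _ le] False in \<open>simp del: mem_cball\<close>)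
  qed
  have op0: "op_exp (\<lambda>x. s *\<^sub>R adjoint L x) 0 = 0" for s
  proof -
    have "linear (adjoint L)" using \<open>linear L\<close> by (simp add: adjoint_linear)
    then have "((\<lambda>x. s *\<^sub>R adjoint L x) ^^ n) 0 = 0" for n by (induction n) (auto simp: linear_0)
    then show ?thesis by (simp add: op_exp_def)
  qed
  show ?thesis
  proof (rule exI[of _ M'], rule conjI[OF M'], rule exI[of _ c1], rule conjI[OF c1], intro allI impI)
    fix \<Omega> :: "(real ^ 'm) set" and V
    assume "0 \<in> interior \<Omega> \<and> analytic_class \<Omega> T l c \<rho> V \<and>
      (\<forall>u\<in>\<Omega>. \<forall>t. V u (t + T) = V u t) \<and> vanishes_to_second_order V"
    then have V: "0 \<in> interior \<Omega>" "analytic_class \<Omega> T l c \<rho> V" "vanishes_to_second_order V" by auto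
    define ok where "ok \<delta> p \<Phi> R \<longleftrightarrow> (\<delta> \<le> \<delta>0 \<longrightarrow> real p \<le> c1 * \<delta> powr (- b)) \<and> \<Phi> \<in> sobolev_polys p T (l + 1) \<and> vanishes_to_second_order \<Phi> \<and>
        transforms_into (\<lambda>u t. L u + V u t) \<Omega> \<Phi> (\<lambda>y t. L y + 0 + R y t) (cball 0 \<delta>) \<and>
        sobolev_analytic_on T l R (cball 0 \<delta>) \<and>
        (\<forall>y\<in>cball 0 \<delta>. R y \<in> sobolev T l \<and> sobolev_norm T l (R y) \<le> M' * \<delta>\<^sup>2 * exp (- c1 / \<delta> powr b))"
      for \<delta> p \<Phi> R
    have "\<exists>p \<Phi> R. ok \<delta> p \<Phi> R" if "0 < \<delta>" for \<delta> unfolding ok_def by (rule all[OF V that])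
    then obtain p \<Phi> R where ok: "\<And>\<delta>. 0 < \<delta> \<Longrightarrow> ok \<delta> (p \<delta>) (\<Phi> \<delta>) (R \<delta>)" by metis
    have O: "(\<lambda>\<delta>. real (p \<delta>)) \<in> O[at_right 0](\<lambda>\<delta>. \<delta> powr (- b))"
    proof (rule bigoI[of _ c1])
      show "\<forall>\<^sub>F \<delta> in at_right 0. norm (real (p \<delta>)) \<le> c1 * norm (\<delta> powr (- b))"
        unfolding eventually_at_right_field
        by (rule exI[of _ \<delta>0]) (use ok \<delta>0 in \<open>auto simp: ok_def\<close>)
    qed
    have N1: "(\<lambda>y t. 0 :: real ^ 'm) \<in> sobolev_polys q T l" for q by (rule E.sobolev_polys_0)
    have N2: "vanishes_to_second_order (\<lambda>(y :: real ^ 'm) t. 0)" by (simp add: vanishes_to_second_order_def)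
    show "\<exists>(p :: real \<Rightarrow> nat) (\<Phi> :: real \<Rightarrow> real ^ 'm \<Rightarrow> real \<Rightarrow> real ^ 'm)
      (N :: real \<Rightarrow> real ^ 'm \<Rightarrow> real \<Rightarrow> real ^ 'm) (R :: real \<Rightarrow> real ^ 'm \<Rightarrow> real \<Rightarrow> real ^ 'm).
      (\<lambda>\<delta>. real (p \<delta>)) \<in> O[at_right 0](\<lambda>\<delta>. \<delta> powr (- b)) \<and>
      (\<forall>\<delta> > 0.
        \<Phi> \<delta> \<in> sobolev_polys (p \<delta>) T (l + 1) \<and> vanishes_to_second_order (\<Phi> \<delta>) \<and>
        transforms_into (\<lambda>u t. L u + V u t) \<Omega> (\<Phi> \<delta>)
          (\<lambda>y t. L y + N \<delta> y t + R \<delta> y t) (cball 0 \<delta>) \<and>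
        N \<delta> \<in> sobolev_polys (p \<delta>) T l \<and> vanishes_to_second_order (N \<delta>) \<and>
        (\<forall>y t. op_exp (\<lambda>x. (- t) *\<^sub>R adjoint L x)
                 (N \<delta> (op_exp (\<lambda>x. t *\<^sub>R adjoint L x) y) t) = N \<delta> y 0) \<and>
        sobolev_analytic_on T l (R \<delta>) (cball 0 \<delta>) \<and>
        (\<forall>y\<in>cball 0 \<delta>. R \<delta> y \<in> sobolev T l \<and>
           sobolev_norm T l (R \<delta> y) \<le> M' * \<delta>\<^sup>2 * exp (- c1 / \<delta> powr b)))"
    proof (rule exI[of _ p], rule exI[of _ \<Phi>], rule exI[of _ "\<lambda>_ _ _. 0"], rule exI[of _ R], rule conjI[OF O], intro allI impI)
      fix \<delta> :: real assume "0 < \<delta>"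
      from ok[OF this, unfolded ok_def] show "\<Phi> \<delta> \<in> sobolev_polys (p \<delta>) T (l + 1) \<and> vanishes_to_second_order (\<Phi> \<delta>) \<and>
        transforms_into (\<lambda>u t. L u + V u t) \<Omega> (\<Phi> \<delta>) (\<lambda>y t. L y + 0 + R \<delta> y t) (cball 0 \<delta>) \<and>
        (\<lambda>y t. 0 :: real ^ 'm) \<in> sobolev_polys (p \<delta>) T l \<and> vanishes_to_second_order (\<lambda>(y :: real ^ 'm) t. 0) \<and>
        (\<forall>(y :: real ^ 'm) t. op_exp (\<lambda>x. (- t) *\<^sub>R adjoint L x) 0 = 0) \<and>
        sobolev_analytic_on T l (R \<delta>) (cball 0 \<delta>) \<and>
        (\<forall>y\<in>cball 0 \<delta>. R \<delta> y \<in> sobolev T l \<and>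
           sobolev_norm T l (R \<delta> y) \<le> M' * \<delta>\<^sup>2 * exp (- c1 / \<delta> powr b))"
        using N1 N2 op0 by blast
    qed
  qed
qed

end
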